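(* For every $n\in\mathbb{Z}$ the reflection coefficients $R_n^\nu$ can be represented as $$R^1_n=\frac{V_0(\psi_n)V_1(\theta_{\rm in})+V_1(\psi_n)V_0(\theta_{\rm in})\,e^{ikb(\psi_n^2-\theta_{\rm in}^2)/2}}{ika\,\psi_n(\psi_n+\theta_{\rm in})},\qquad R^2_n=-R^1_n .$$
   Context: Let $0<b<a$ and let $k\in\mathbb{C}$ with $\operatorname{Re}k>0$ and (small) $\operatorname{Im}k>0$. Put $x_{2n}=an$, $x_{2n+1}=an+b$ for $n\in\mathbb{Z}$. Let $\mathcal{R}$ be the two-sheeted branched surface over the $(x,y)$-plane with branch points of order 2 at $(x_n,0)$, $n\in\mathbb{Z}$. Cut $\mathcal{R}$ along the half-lines $x=x_n$, $y<0$, into two sheets denoted $1_*$ and $2_*$; a function on $\mathcal{R}$ is then written $f(x,y,\nu_* )$, $\nu=1,2$. Crossing a cut exchanges the sheets: continuity on $\mathcal{R}$ means $f(x_n+0,y,\nu_* )=f(x_n-0,y,(3-\nu)_* )$ for $y<0$, while $f(\cdot,\cdot,\nu_* )$ is continuous across $x=x_n$, $y>0$. Alternatively $\mathcal{R}$ is cut along the segments $y=0$, $x_{2m}<x<x_{2m+1}$, into sheets $1,2$, and the function is written $f(x,y,\nu)$; the two notations are related by $f(x,y,\nu)=f(x,y,\nu_* )$ for $y>0$ and for $y<0$, $x_{2m+1}<x<x_{2m+2}$, and $f(x,y,\nu)=f(x,y,(3-\nu)_* )$ for $y<0$, $x_{2m}<x<x_{2m+1}$. The parabolic operator is $L=\partial_x+(2ik)^{-1}\partial_y^2$,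 and its Green's function on the plane is $G(x,y)=\sqrt{\frac{k}{2\pi i x}}\,e^{iky^2/(2x)}$ for $x>0$ (principal root), $G=0$ for $x<0$. Diffraction problem. Let $\theta_{\rm in}\in\mathbb{C}$, $\operatorname{Re}\theta_{\rm in}>0$, be such that $k\theta_{\rm in}^2$ is real and positive (so $\operatorname{Im}(k\theta_{\rm in})>0$). Put $\psi_n=\sqrt{\theta_{\rm in}^2+4\pi n/(ka)}$ with the branch for which $\operatorname{Im}(k\psi_n)>0$ (it is assumed that no $\psi_n$ vanishes); $\psi_0=\theta_{\rm in}$. The incident wave, present only in the upper half-plane $y>0$ of sheet $1$, is $u_{\rm in}=e^{-ikx\theta_{\rm in}^2/2-ik\theta_{\rm in}y}$. The total field $u$ is the solution of $L[u]=0$ on $\mathcal{R}$ which is continuous on $\mathcal{R}$ (except at the branch points), bounded near the branch points, satisfies the Floquet property $u(x+a,y,\nu)=e^{-ika\theta_{\rm in}^2/2}u(x,y,\nu)$, and is such that the scattered field $u_{\rm sc}$ (equal to $u-u_{\rm in}$ in the upper half-plane of sheet $1$ and to $u$ elsewhere) tends to $0$ as $|y|\to\infty$. The reflection coefficients $R_n^\nu$ are defined by the Floquet expansion $$u_{\rm sc}(x,y,\nu)=\sum_{n=-\infty}^\infty R_n^\nu\,e^{-ikx\psi_n^2/2+ik\psi_n y}\quad (y>0).$$ Edge Green's functions. $w_n(x,y,\nu_* )$, $n\in\mathbb{Z}$, is the field on $\mathcal{R}$ satisfying $L[w_n](x,y,\nu_* )=(-1)^{\nu-1}\delta(x-(x_n+0))\delta(y)$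 and vanishing for $x<x_n$. Explicitly: $w_n(x,y,2_* )=-w_n(x,y,1_* )$; $w_n(x,y,1_* )=0$ for $x<x_n$; $w_n(x,y,1_* )=G(x-x_n,y)$ for $x_n<x<x_{n+1}$; and for $m>n$, $x_m<x<x_{m+1}$, $w_n(x,y,1_* )=\int_{-\infty}^\infty w_n(x_m+0,y',1_* )G(x-x_m,y-y')\,dy'$, where $w_n(x_m+0,y',1_* )=\operatorname{sign}(y')\,w_n(x_m-0,y',1_* )$. Directivities. $V_n(\theta)$ is defined for $\theta>0$ by $w_n(x,y,1_* )=V_n\!\left(\frac{y}{x-x_n}\right)G(x-x_n,y)+o(G(x-x_n,y))$ in $y>0$; at complex arguments $\theta$ (with $\operatorname{Im}(k\theta)>0$) it is given by its integral representation $$V_n(\theta)=1+2\sum_{m=n+1}^{\infty}e^{ik(x_m-x_n)\theta^2/2}\int_{-\infty}^{0}w_n(x_m+0,y,1_* )e^{-ik\theta y}\,dy.$$ *)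

theory Defs
  imports "HOL-Analysis.Analysis"
begin

definition xn :: "real \<Rightarrow> real \<Rightarrow> int \<Rightarrow> real" where
  "xn a b n = (if even n then a * of_int (n div 2) else a * of_int (n div 2) + b)"

text \<open>
  A field on the two-sheeted surface is a function \<open>f x y \<nu>\<close> with \<open>\<nu> \<in> {1, 2}\<close>. Unless said
  otherwise it is given in the starred notation, i.e. on the sheets obtained by cutting along the
  half-lines \<open>x = x\<^sub>n\<close>, \<open>y < 0\<close>. On such a cut the convention is that \<open>f (x\<^sub>n) y \<nu>\<close> stands for
  the right-hand value \<open>f (x\<^sub>n + 0) y \<nu>\<close>. Values at the branch points \<open>(x\<^sub>n, 0)\<close> are irrelevant.

  The surface without its branch points is covered by two kinds of charts: the interior of a
  starred sheet, and the neighbourhoods of the cuts, in which the sheet \<open>\<nu>\<close> on the right-hand side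
  is glued to the sheet \<open>3 - \<nu>\<close> on the left-hand side.
\<close>

type_synonym field = "real \<Rightarrow> real \<Rightarrow> nat \<Rightarrow> complex"

definition sheet_interior :: "real \<Rightarrow> real \<Rightarrow> (real \<times> real) set" where
  "sheet_interior a b = {(x, y). y > 0 \<or> (\<forall>n. x \<noteq> xn a b n)}"

definition cut_nbhd :: "real \<Rightarrow> real \<Rightarrow> int \<Rightarrow> (real \<times> real) set" where
  "cut_nbhd a b n = {(x, y). xn a b (n - 1) < x \<and> x < xn a b (n + 1) \<and> y < 0}"

definition glue_cut :: "real \<Rightarrow> real \<Rightarrow> int \<Rightarrow> field \<Rightarrow> nat \<Rightarrow> real \<Rightarrow> real \<Rightarrow> complex" where
  "glue_cut a b n f \<nu> x y = (if x < xn a b n then f x y (3 - \<nu>) else f x y \<nu>)"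

text \<open>
  The unstarred notation, for the sheets cut along \<open>y = 0\<close>, \<open>x\<^sub>2\<^sub>m < x < x\<^sub>2\<^sub>m\<^sub>+\<^sub>1\<close>. The interval is closed
  on the left in accordance with the right-hand values on the starred cuts, so that the result is
  continuous across the lines \<open>x = x\<^sub>n\<close> in \<open>y < 0\<close>. Points with \<open>y = 0\<close> on the unstarred cuts
  are attributed to the upper shore.
\<close>

definition unstarred :: "real \<Rightarrow> real \<Rightarrow> field \<Rightarrow> field" where
  "unstarred a b f x y \<nu> =
     (if y < 0 \<and> (\<exists>m. xn a b (2 * m) \<le> x \<and> x < xn a b (2 * m + 1))
      then f x y (3 - \<nu>) else f x y \<nu>)"

definition dx :: "(real \<Rightarrow> real \<Rightarrow> complex) \<Rightarrow> real \<Rightarrow> real \<Rightarrow> complex" where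
  "dx f x y = vector_derivative (\<lambda>s. f s y) (at x)"

definition dy :: "(real \<Rightarrow> real \<Rightarrow> complex) \<Rightarrow> real \<Rightarrow> real \<Rightarrow> complex" where
  "dy f x y = vector_derivative (\<lambda>t. f x t) (at y)"

definition parabolic :: "complex \<Rightarrow> (real \<Rightarrow> real \<Rightarrow> complex) \<Rightarrow> real \<Rightarrow> real \<Rightarrow> complex" where
  "parabolic k f x y = dx f x y + inverse (2 * \<i> * k) * dy (dy f) x y"

text \<open>Classical (once continuously differentiable in \<open>x\<close>, twice in \<open>y\<close>) solutions on an open set.\<close>

definition classical_solution ::
    "complex \<Rightarrow> (real \<times> real) set \<Rightarrow> (real \<Rightarrow> real \<Rightarrow> complex) \<Rightarrow> bool" where
  "classical_solution k U f \<longleftrightarrow>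
     continuous_on U (\<lambda>(x, y). f x y) \<and>
     (\<forall>(x, y)\<in>U. (\<lambda>s. f s y) differentiable (at x) \<and> (\<lambda>t. f x t) differentiable (at y)
        \<and> (\<lambda>t. dy f x t) differentiable (at y)) \<and>
     continuous_on U (\<lambda>(x, y). dx f x y) \<and>
     continuous_on U (\<lambda>(x, y). dy f x y) \<and>
     continuous_on U (\<lambda>(x, y). dy (dy f) x y) \<and>
     (\<forall>(x, y)\<in>U. parabolic k f x y = 0)"

definition solution_on_surface :: "real \<Rightarrow> real \<Rightarrow> complex \<Rightarrow> field \<Rightarrow> bool" where
  "solution_on_surface a b k f \<longleftrightarrow>
     (\<forall>\<nu>\<in>{1, 2}. classical_solution k (sheet_interior a b) (\<lambda>x y. f x y \<nu>) \<and>
        (\<forall>n. classical_solution k (cut_nbhd a b n) (glue_cut a b n f \<nu>)))"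

definition bounded_near_branch_points :: "real \<Rightarrow> real \<Rightarrow> field \<Rightarrow> bool" where
  "bounded_near_branch_points a b f \<longleftrightarrow>
     (\<forall>n. \<exists>\<epsilon>>0. \<exists>M. \<forall>\<nu>\<in>{1, 2}. \<forall>x y.
        (x, y) \<in> ball (xn a b n, 0) \<epsilon> - {(xn a b n, 0)} \<longrightarrow> norm (f x y \<nu>) \<le> M)"

definition u_in :: "complex \<Rightarrow> complex \<Rightarrow> real \<Rightarrow> real \<Rightarrow> complex" where
  "u_in k \<theta> x y = exp (- \<i> * k * of_real x * \<theta>\<^sup>2 / 2 - \<i> * k * \<theta> * of_real y)"

text \<open>In the unstarred notation.\<close>

definition u_sc :: "real \<Rightarrow> real \<Rightarrow> complex \<Rightarrow> complex \<Rightarrow> field \<Rightarrow> field" where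
  "u_sc a b k \<theta> u x y \<nu> =
     (if y > 0 \<and> \<nu> = 1 then unstarred a b u x y \<nu> - u_in k \<theta> x y else unstarred a b u x y \<nu>)"

text \<open>
  Continuity of the field on the surface is part of \<^term>\<open>solution_on_surface\<close>. The scattered field
  tends to \<open>0\<close> as \<open>\<bar>y\<bar> \<rightarrow> \<infinity>\<close> uniformly in \<open>x\<close> (equivalently, uniformly over a period).
\<close>

definition diffraction_solution ::
    "real \<Rightarrow> real \<Rightarrow> complex \<Rightarrow> complex \<Rightarrow> field \<Rightarrow> bool" where
  "diffraction_solution a b k \<theta> u \<longleftrightarrow>
     solution_on_surface a b k u \<and>
     bounded_near_branch_points a b u \<and>
     (\<forall>\<nu>\<in>{1, 2}. \<forall>x y. (\<forall>n. (x, y) \<noteq> (xn a b n, 0)) \<longrightarrow>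
        unstarred a b u (x + a) y \<nu>
          = exp (- \<i> * k * of_real a * \<theta>\<^sup>2 / 2) * unstarred a b u x y \<nu>) \<and>
     (\<forall>\<nu>\<in>{1, 2}. uniform_limit UNIV (\<lambda>y x. u_sc a b k \<theta> u x y \<nu>) (\<lambda>_. 0) at_infinity)"

definition psi :: "real \<Rightarrow> complex \<Rightarrow> complex \<Rightarrow> int \<Rightarrow> complex" where
  "psi a k \<theta> n = (let r = csqrt (\<theta>\<^sup>2 + 4 * of_real pi * of_int n / (k * of_real a))
                  in if Im (k * r) > 0 then r else - r)"

definition floquet_coefficients ::
    "real \<Rightarrow> real \<Rightarrow> complex \<Rightarrow> complex \<Rightarrow> field \<Rightarrow> (nat \<Rightarrow> int \<Rightarrow> complex) \<Rightarrow> bool" where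
  "floquet_coefficients a b k \<theta> u R \<longleftrightarrow>
     (\<forall>\<nu>\<in>{1, 2}. \<forall>x y. y > 0 \<longrightarrow>
        ((\<lambda>n. R \<nu> n * exp (- \<i> * k * of_real x * (psi a k \<theta> n)\<^sup>2 / 2
                            + \<i> * k * psi a k \<theta> n * of_real y))
         has_sum u_sc a b k \<theta> u x y \<nu>) UNIV)"

definition green :: "complex \<Rightarrow> real \<Rightarrow> real \<Rightarrow> complex" where
  "green k x y = (if x > 0
     then csqrt (k / (2 * of_real pi * \<i> * of_real x))
            * exp (\<i> * k * (of_real y)\<^sup>2 / (2 * of_real x))
     else 0)"

text \<open>
  The edge Green's function \<open>w\<^sub>n\<close> on sheet \<open>1\<^sub>*\<close> in the slab \<open>x\<^sub>n\<^sub>+\<^sub>j < x < x\<^sub>n\<^sub>+\<^sub>j\<^sub>+\<^sub>1\<close>. The formula is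
  continuous up to the right end of the slab, where it gives the left-hand value
  \<open>w\<^sub>n (x\<^sub>n\<^sub>+\<^sub>j\<^sub>+\<^sub>1 - 0) y\<close> used in the next slab.
\<close>

fun edge_slab :: "real \<Rightarrow> real \<Rightarrow> complex \<Rightarrow> int \<Rightarrow> nat \<Rightarrow> real \<Rightarrow> real \<Rightarrow> complex" where
  "edge_slab a b k n 0 x y = green k (x - xn a b n) y"
| "edge_slab a b k n (Suc j) x y =
     (let p = xn a b (n + int (Suc j)) in
      LINT y'|lborel. of_real (sgn y') * edge_slab a b k n j p y' * green k (x - p) (y - y'))"

text \<open>
  At \<open>x = x\<^sub>m\<close>, \<open>m > n\<close>, this is the right-hand value \<open>w\<^sub>n (x\<^sub>m + 0) y\<close>. The value at \<open>x = x\<^sub>n\<close> itself,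
  where the source is located, is never used.
\<close>

definition edge_green :: "real \<Rightarrow> real \<Rightarrow> complex \<Rightarrow> int \<Rightarrow> field" where
  "edge_green a b k n x y \<nu> = (- 1) ^ (\<nu> - 1) *
     (let m = (THE m. xn a b m \<le> x \<and> x < xn a b (m + 1)) in
      if x \<le> xn a b n then 0
      else if x = xn a b m then of_real (sgn y) * edge_slab a b k n (nat (m - 1 - n)) x y
      else edge_slab a b k n (nat (m - n)) x y)"

text \<open>
  The directivity, by its integral representation; meant for \<open>Im (k * \<theta>) > 0\<close>.
  The summation index is \<open>m = n + 1 + j\<close>.
\<close>

definition directivity :: "real \<Rightarrow> real \<Rightarrow> complex \<Rightarrow> int \<Rightarrow> complex \<Rightarrow> complex" where
  "directivity a b k n \<theta> = 1 + 2 * (\<Sum>j::nat. let m = n + 1 + int j in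
     exp (\<i> * k * of_real (xn a b m - xn a b n) * \<theta>\<^sup>2 / 2) *
     (LINT y:{..0}|lborel. edge_green a b k n (xn a b m) y 1 * exp (- \<i> * k * \<theta> * of_real y)))"

end

theory Submission
  imports Defs "HOL-Probability.Probability" "HOL-Real_Asymp.Real_Asymp"
begin

text \<open>
  Since \<open>Im k > 0\<close>, the parabolic equation is a diffusion equation with \<open>x\<close> as time: crossing a slab between
  two consecutive edges is convolution with a complex Gaussian (\<open>slab_representation\<close>). On the two-sheeted
  surface the sum and the difference of the sheets decouple. The sum is continuous across the cuts, the
  difference changes sign across each of them.

  The reflection coefficients are fluxes. Green's identity with the adjoint plane wave of angle \<open>\<psi>\<^sub>n\<close>, over one
  period below a horizontal line, equates \<open>a \<psi>\<^sub>n\<close> times a Floquet coefficient with the jumps at the cuts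
  (\<open>flux_identity\<close>). For the sum of the sheets there is no jump, whence \<open>R\<^sup>1\<^sub>n + R\<^sup>2\<^sub>n = 0\<close>. For the difference the jumps
  are half-line Laplace transforms of the field at the two edges of a period.

  To evaluate them let \<open>d\<^sub>m\<close> be the difference field in front of the edge \<open>m\<close> minus the incident wave. From one
  edge to the next it is flipped on \<open>y < 0\<close>, receives the shadow of the incident wave as a source, and
  diffuses; this is the locale \<open>reduced_problem\<close>. Two facts about it give the formula.

  First, the value of the field at an edge is a directivity (\<open>edge_value_eq\<close>). One follows \<open>d\<^sub>m(0)\<close> back through
  all slabs upstream. The kernel of this backward evolution is the edge Green's function of the grating
  reflected by \<open>x \<rightarrow> b - x\<close>, which is the same grating with the edges \<open>m\<close> and \<open>1 - m\<close> exchanged, and its pairings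
  with the shadows of the incident wave are the terms of \<open>V\<^bsub>1-m\<^esub>(\<theta>)\<close>.

  Second, \<open>\<partial>\<^sub>y + i k \<theta>\<close> annihilates the incident wave. Applied to the difference field it therefore leaves a
  field without incoming part whose only sources sit at the edges, with the edge values as strengths
  (\<open>g_step\<close>). This field is a superposition of edge Green's functions, and pairing it with a half plane
  wave of angle \<open>\<psi>\<^sub>n\<close> produces \<open>V\<^sub>0(\<psi>\<^sub>n)\<close> and \<open>V\<^sub>1(\<psi>\<^sub>n)\<close>; integration by parts returns the Laplace transforms, with
  the factor \<open>\<psi>\<^sub>n + \<theta>\<close> (\<open>pairing_g\<close>, \<open>shadow_eq\<close>, \<open>amplitude_formula\<close>).

  Both expansions run over infinitely many edges, and no decay comes from their Floquet
  factor \<open>\<mu> = e\<^bsup>ika\<theta>\<^sup>2/2\<^esup>\<close>, which has modulus one; what helps is that it differs from one, because no \<open>\<psi>\<^sub>n\<close> vanishes. The evolution \<open>T\<close> through a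
  period dissipates energy in the strong sense that the squared \<open>L\<^sup>2\<close> norm of \<open>f - T f\<close> is at most a constant times
  the energy lost by \<open>f\<close> (\<open>period_dissipation\<close>). Hence the energy of \<open>(1 - T)\<^sup>3 T\<^sup>i f\<close> is of order \<open>i\<^bsup>-3\<^esup>\<close>, third differences
  of the pairings are absolutely summable, and three summations by parts against \<open>\<mu>\<^sup>i\<close> give convergence
  (\<open>summable_pairing_evolve\<close>). The same differences show that the infinitely remote past contributes
  nothing (\<open>pairing_evolve_remainder_0\<close>).
\<close>

section \<open>Integration on the line and Gaussian integrals\<close>

lemma has_vector_derivative_iff_difference_quotient:
  fixes f :: "real \<Rightarrow> complex"
  shows "(f has_vector_derivative D) (at x) \<longleftrightarrow> ((\<lambda>y. (f y - f x) /\<^sub>R (y - x)) \<longlongrightarrow> D) (at x)"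
proof -
  have *: "norm ((f y - f x) /\<^sub>R (y - x) - D) = norm (f y - f x - (y - x) *\<^sub>R D) / norm (y - x)"
    if "y \<noteq> x" for y
  proof -
    have "(f y - f x) /\<^sub>R (y - x) - D = (f y - f x - (y - x) *\<^sub>R D) /\<^sub>R (y - x)"
      using that by (simp add: scaleR_diff_right)
    then show ?thesis by (simp add: divide_inverse)
  qed
  have "((\<lambda>y. (f y - f x) /\<^sub>R (y - x)) \<longlongrightarrow> D) (at x)
      \<longleftrightarrow> ((\<lambda>y. norm ((f y - f x) /\<^sub>R (y - x) - D)) \<longlongrightarrow> 0) (at x)"
    by (subst Lim_null) (simp add: tendsto_norm_zero_iff)
  also have "\<dots> \<longleftrightarrow> ((\<lambda>y. norm (f y - f x - (y - x) *\<^sub>R D) / norm (y - x)) \<longlongrightarrow> 0) (at x)"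
    by (intro filterlim_cong refl) (auto simp: eventually_at_filter *)
  finally show ?thesis
    by (simp add: has_vector_derivative_def has_derivative_iff_norm bounded_linear_scaleR_left)
qed

text \<open>
  The mean value theorem bounds the difference quotients by the same integrable function as the
  derivatives, so dominated convergence applies to them.
\<close>

lemma has_vector_derivative_integral_dominated:
  fixes f f' :: "real \<Rightarrow> real \<Rightarrow> complex"
  assumes \<delta>: "\<delta> > 0"
    and int: "\<And>x. \<bar>x - x0\<bar> < \<delta> \<Longrightarrow> integrable lborel (f x)"
    and deriv: "\<And>x t. \<bar>x - x0\<bar> < \<delta> \<Longrightarrow> ((\<lambda>x. f x t) has_vector_derivative f' x t) (at x)"
    and bound: "\<And>x t. \<bar>x - x0\<bar> < \<delta> \<Longrightarrow> norm (f' x t) \<le> w t"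
    and meas [measurable]: "f' x0 \<in> borel_measurable borel"
    and w: "integrable lborel w"
  shows "((\<lambda>x. \<integral>t. f x t \<partial>lborel) has_vector_derivative (\<integral>t. f' x0 t \<partial>lborel)) (at x0)"
proof -
  have lim: "((\<lambda>x. (\<integral>t. (f x t - f x0 t) /\<^sub>R (x - x0) \<partial>lborel)) \<longlongrightarrow> (\<integral>t. f' x0 t \<partial>lborel)) (at x0)"
    unfolding tendsto_at_iff_sequentially comp_def
  proof (intro allI impI)
    fix X :: "nat \<Rightarrow> real"
    assume X: "\<forall>i. X i \<in> UNIV - {x0}" "X \<longlonglongrightarrow> x0"
    then obtain N where N: "\<And>n. n \<ge> N \<Longrightarrow> \<bar>X n - x0\<bar> < \<delta>"
      using \<delta> unfolding LIMSEQ_def dist_real_def by meson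
    let ?X = "\<lambda>n. X (n + N)"
    have XN: "\<bar>?X n - x0\<bar> < \<delta>" "?X n \<noteq> x0" for n
      using N[of "n + N"] X by auto
    have X': "?X \<longlonglongrightarrow> x0"
      using X(2) by (rule LIMSEQ_ignore_initial_segment)
    have "(\<lambda>n. (\<integral>t. (f (?X n) t - f x0 t) /\<^sub>R (?X n - x0) \<partial>lborel)) \<longlonglongrightarrow> (\<integral>t. f' x0 t \<partial>lborel)"
    proof (rule integral_dominated_convergence[where w = w])
      show "f' x0 \<in> borel_measurable lborel" by simp
      show "(\<lambda>t. (f (?X n) t - f x0 t) /\<^sub>R (?X n - x0)) \<in> borel_measurable lborel" for n
        using int[of "?X n"] int[of x0] XN[of n] \<delta>
        by (auto intro!: borel_measurable_scaleR borel_measurable_diff)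
      show "AE t in lborel. (\<lambda>n. (f (?X n) t - f x0 t) /\<^sub>R (?X n - x0)) \<longlonglongrightarrow> f' x0 t"
      proof (intro AE_I2)
        fix t
        have "((\<lambda>x. (f x t - f x0 t) /\<^sub>R (x - x0)) \<longlongrightarrow> f' x0 t) (at x0)"
          using deriv[of x0 t] \<delta> by (simp add: has_vector_derivative_iff_difference_quotient)
        then show "(\<lambda>n. (f (?X n) t - f x0 t) /\<^sub>R (?X n - x0)) \<longlonglongrightarrow> f' x0 t"
          using X' XN unfolding tendsto_at_iff_sequentially comp_def by (auto dest!: spec[of _ ?X])
      qed
      show "AE t in lborel. norm ((f (?X n) t - f x0 t) /\<^sub>R (?X n - x0)) \<le> w t" for n
      proof (intro AE_I2)
        fix t
        have "norm (f (?X n) t - f x0 t) \<le> w t * norm (?X n - x0)"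
        proof (rule differentiable_bound[where S = "{x. \<bar>x - x0\<bar> < \<delta>}" and f' = "\<lambda>x h. h *\<^sub>R f' x t"])
          have "{x. \<bar>x - x0\<bar> < \<delta>} = ball x0 \<delta>" by (auto simp: dist_real_def)
          then show "convex {x. \<bar>x - x0\<bar> < \<delta>}" by simp
          show "((\<lambda>x. f x t) has_derivative (\<lambda>h. h *\<^sub>R f' x t)) (at x within {x. \<bar>x - x0\<bar> < \<delta>})"
            if "x \<in> {x. \<bar>x - x0\<bar> < \<delta>}" for x
            using deriv[of x t] that by (auto simp: has_vector_derivative_def has_derivative_at_withinI)
          show "onorm (\<lambda>h. h *\<^sub>R f' x t) \<le> w t" if "x \<in> {x. \<bar>x - x0\<bar> < \<delta>}" for x
            using bound[of x t] that
            by (intro onorm_le) (auto simp: mult.commute intro: mult_left_mono)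
        qed (use XN \<delta> in auto)
        then show "norm ((f (?X n) t - f x0 t) /\<^sub>R (?X n - x0)) \<le> w t"
          using XN(2)[of n] by (simp add: divide_simps)
      qed
    qed (use w in simp)
    then show "(\<lambda>n. (\<integral>t. (f (X n) t - f x0 t) /\<^sub>R (X n - x0) \<partial>lborel)) \<longlonglongrightarrow> (\<integral>t. f' x0 t \<partial>lborel)"
      by (rule LIMSEQ_offset)
  qed
  have "\<forall>\<^sub>F x in at x0. (\<integral>t. (f x t - f x0 t) /\<^sub>R (x - x0) \<partial>lborel)
      = ((\<integral>t. f x t \<partial>lborel) - (\<integral>t. f x0 t \<partial>lborel)) /\<^sub>R (x - x0)"
    unfolding eventually_at
    using \<delta> by (auto simp: dist_real_def int Bochner_Integration.integral_diff intro!: exI[of _ \<delta>])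
  from tendsto_cong[OF this] lim
  show ?thesis
    unfolding has_vector_derivative_iff_difference_quotient by simp
qed

lemma integrable_exp_abs:
  assumes "\<epsilon> > 0"
  shows "integrable lborel (\<lambda>t::real. exp (- \<epsilon> * \<bar>t\<bar>))"
proof -
  have 1: "integrable lborel (\<lambda>t. indicator {0..} t *\<^sub>R exp (- \<epsilon> * t))"
  proof -
    have "set_integrable lebesgue {0..} (\<lambda>t. exp (- \<epsilon> * t))"
      using assms integrable_on_exp_minus_to_infinity[of \<epsilon> 0]
      by (intro nonnegative_absolutely_integrable_1) auto
    then show ?thesis
      unfolding set_integrable_def
      by (rule integrable_completion[THEN iffD1, rotated]) measurable
  qed
  from 1 have 2: "integrable lborel (\<lambda>t. indicator {0..} (- t) *\<^sub>R exp (- \<epsilon> * (- t)))"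
    using lborel_integrable_real_affine_iff[of "-1" "\<lambda>t. indicator {0..} t *\<^sub>R exp (- \<epsilon> * t)" 0] by simp
  have "integrable lborel (\<lambda>t. indicator {0..} t *\<^sub>R exp (- \<epsilon> * t)
      + indicator {0..} (- t) *\<^sub>R exp (- \<epsilon> * (- t)))"
    using 1 2 by (rule Bochner_Integration.integrable_add)
  then show ?thesis
    by (rule Bochner_Integration.integrable_bound) (auto simp: indicator_def)
qed

lemma integral_FTC_halfline:
  fixes F f :: "real \<Rightarrow> complex"
  assumes F: "\<And>t. t > 0 \<Longrightarrow> (F has_vector_derivative f t) (at t)"
    and f: "\<And>t. t > 0 \<Longrightarrow> isCont f t"
    and int: "set_integrable lborel {0<..} f"
    and A: "(F \<longlongrightarrow> A) (at_right 0)" and B: "(F \<longlongrightarrow> B) at_top"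
  shows "(LINT t:{0<..}|lborel. f t) = B - A"
proof -
  have e: "einterval 0 \<infinity> = {0<..}" by (auto simp: einterval_def)
  have "(LBINT t=0..\<infinity>. f t) = B - A"
    by (rule interval_integral_FTC_integrable[where F = F])
       (use assms in \<open>auto simp: e zero_ereal_def ereal_tendsto_simps\<close>)
  then show ?thesis
    by (simp add: interval_lebesgue_integral_def e)
qed

lemma integral_FTC_negative_halfline:
  fixes F f :: "real \<Rightarrow> complex"
  assumes F: "\<And>t. t < 0 \<Longrightarrow> (F has_vector_derivative f t) (at t)"
    and f: "\<And>t. t < 0 \<Longrightarrow> isCont f t"
    and int: "set_integrable lborel {..<0} f"
    and A: "(F \<longlongrightarrow> A) at_bot" and B: "(F \<longlongrightarrow> B) (at_left 0)"
  shows "(LINT t:{..<0}|lborel. f t) = B - A"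
proof -
  have e: "einterval (-\<infinity>) 0 = {..<0}" by (auto simp: einterval_def)
  have "(LBINT t=-\<infinity>..0. f t) = B - A"
    by (rule interval_integral_FTC_integrable[where F = F])
       (use assms in \<open>auto simp: e zero_ereal_def ereal_tendsto_simps\<close>)
  then show ?thesis
    by (simp add: interval_lebesgue_integral_def e)
qed

lemma integral_FTC_line:
  fixes F f :: "real \<Rightarrow> complex"
  assumes F: "\<And>t. (F has_vector_derivative f t) (at t)"
    and f: "\<And>t. isCont f t"
    and int: "integrable lborel f"
    and A: "(F \<longlongrightarrow> A) at_bot" and B: "(F \<longlongrightarrow> B) at_top"
  shows "(LINT t|lborel. f t) = B - A"
proof -
  have e: "einterval (-\<infinity>) \<infinity> = UNIV" by (auto simp: einterval_def)
  have "(LBINT t=-\<infinity>..\<infinity>. f t) = B - A"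
    by (rule interval_integral_FTC_integrable[where F = F])
       (use assms in \<open>auto simp: e set_integrable_def ereal_tendsto_simps\<close>)
  then show ?thesis
    by (simp add: interval_lebesgue_integral_def e set_lebesgue_integral_def)
qed

lemma gaussian_le_exp_abs:
  fixes A \<epsilon> t :: real
  assumes "A > 0"
  shows "exp (- A * t\<^sup>2) \<le> exp (\<epsilon>\<^sup>2 / (4 * A)) * exp (- \<epsilon> * \<bar>t\<bar>)"
proof -
  have "0 \<le> (2 * A * \<bar>t\<bar> - \<epsilon>)\<^sup>2 / (4 * A)" using assms by simp
  also have "\<dots> = A * t\<^sup>2 - \<epsilon> * \<bar>t\<bar> + \<epsilon>\<^sup>2 / (4 * A)"
    using assms by (simp add: field_simps power2_eq_square)
  finally show ?thesis by (simp add: exp_add [symmetric])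
qed

text \<open>
  A power of \<open>\<bar>t\<bar>\<close> costs one unit of exponential rate, because \<open>\<bar>t\<bar>\<^sup>n \<le> n! e\<^bsup>\<bar>t\<bar>\<^esup>\<close>.
\<close>

lemma abs_mult_gaussian_le_exp_abs:
  fixes A \<epsilon> t :: real
  assumes "A > 0"
  shows "\<bar>t\<bar> ^ n * exp (- A * t\<^sup>2) \<le> fact n * exp ((\<epsilon> + 1)\<^sup>2 / (4 * A)) * exp (- \<epsilon> * \<bar>t\<bar>)"
proof -
  have "\<bar>t\<bar> ^ n / fact n \<le> exp \<bar>t\<bar>"
    using sum_le_suminf[OF summable_exp, of "{n}" "\<bar>t\<bar>"]
    by (simp add: exp_def divide_inverse mult.commute)
  then have "\<bar>t\<bar> ^ n \<le> fact n * exp \<bar>t\<bar>" by (simp add: field_simps)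
  then have "\<bar>t\<bar> ^ n * exp (- A * t\<^sup>2)
      \<le> (fact n * exp \<bar>t\<bar>) * (exp ((\<epsilon> + 1)\<^sup>2 / (4 * A)) * exp (- (\<epsilon> + 1) * \<bar>t\<bar>))"
    using gaussian_le_exp_abs[OF assms, of t "\<epsilon> + 1"] by (intro mult_mono) auto
  also have "\<dots> = fact n * exp ((\<epsilon> + 1)\<^sup>2 / (4 * A)) * (exp \<bar>t\<bar> * exp (- (\<epsilon> + 1) * \<bar>t\<bar>))"
    by simp
  also have "exp \<bar>t\<bar> * exp (- (\<epsilon> + 1) * \<bar>t\<bar>) = exp (- \<epsilon> * \<bar>t\<bar>)"
    by (simp add: exp_add [symmetric] algebra_simps)
  finally show ?thesis .
qed

lemma integrable_mult_gaussian:
  fixes \<alpha> :: complex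
  assumes "Re \<alpha> > 0"
  shows "integrable lborel (\<lambda>t::real. of_real (t ^ n) * exp (- \<alpha> * of_real (t\<^sup>2)))"
proof (rule Bochner_Integration.integrable_bound)
  show "integrable lborel (\<lambda>t::real. fact n * exp ((1 + 1)\<^sup>2 / (4 * Re \<alpha>)) * exp (- 1 * \<bar>t\<bar>))"
    by (intro integrable_mult_right integrable_exp_abs) simp
  show "AE t in lborel. norm (of_real (t ^ n) * exp (- \<alpha> * of_real (t\<^sup>2)))
      \<le> norm (fact n * exp ((1 + 1)\<^sup>2 / (4 * Re \<alpha>)) * exp (- 1 * \<bar>t\<bar>))"
  proof (rule AE_I2)
    fix t :: real
    have "norm (complex_of_real (t ^ n)) = \<bar>t\<bar> ^ n"
      by (simp only: norm_of_real power_abs)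
    then show "norm (of_real (t ^ n) * exp (- \<alpha> * of_real (t\<^sup>2)))
        \<le> norm (fact n * exp ((1 + 1)\<^sup>2 / (4 * Re \<alpha>)) * exp (- 1 * \<bar>t\<bar>))"
      using abs_mult_gaussian_le_exp_abs[OF assms, of t n 1]
      by (simp add: norm_mult abs_mult del: of_real_power)
  qed
qed measurable

lemma tendsto_mult_gaussian:
  fixes \<alpha> :: complex
  assumes "Re \<alpha> > 0"
  shows "((\<lambda>t::real. of_real (t ^ n) * exp (- \<alpha> * of_real (t\<^sup>2))) \<longlongrightarrow> 0) at_top"
    and "((\<lambda>t::real. of_real (t ^ n) * exp (- \<alpha> * of_real (t\<^sup>2))) \<longlongrightarrow> 0) at_bot"
proof -
  define C where "C = fact n * exp ((1 + 1)\<^sup>2 / (4 * Re \<alpha>))"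
  have bound: "norm (of_real (t ^ n) * exp (- \<alpha> * of_real (t\<^sup>2))) \<le> C * exp (- \<bar>t\<bar>)" for t
  proof -
    have "norm (complex_of_real (t ^ n)) = \<bar>t\<bar> ^ n"
      by (simp only: norm_of_real power_abs)
    then show ?thesis
      using abs_mult_gaussian_le_exp_abs[OF assms, of t n 1]
      by (simp add: norm_mult abs_mult C_def del: of_real_power)
  qed
  have top: "((\<lambda>t::real. C * exp (- t)) \<longlongrightarrow> 0) at_top"
    using tendsto_mult_right_zero[OF filterlim_compose[OF exp_at_bot filterlim_uminus_at_bot_at_top]] by simp
  have bot: "((\<lambda>t::real. C * exp t) \<longlongrightarrow> 0) at_bot"
    using tendsto_mult_right_zero[OF exp_at_bot] by simp
  show "((\<lambda>t::real. of_real (t ^ n) * exp (- \<alpha> * of_real (t\<^sup>2))) \<longlongrightarrow> 0) at_top"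
    using bound by (intro Lim_null_comparison[OF _ top] eventually_mono[OF eventually_ge_at_top[of 0]]) (metis abs_of_nonneg)
  show "((\<lambda>t::real. of_real (t ^ n) * exp (- \<alpha> * of_real (t\<^sup>2))) \<longlongrightarrow> 0) at_bot"
    using bound by (intro Lim_null_comparison[OF _ bot] eventually_mono[OF eventually_le_at_bot[of 0]]) (metis abs_of_nonpos minus_minus)
qed

text \<open>
  The total derivative of \<open>t e\<^bsup>-\<alpha>t\<^sup>2\<^esup>\<close> has integral zero.
\<close>

lemma gaussian_second_moment:
  fixes \<alpha> :: complex
  assumes "Re \<alpha> > 0"
  shows "2 * \<alpha> * (\<integral>t. of_real (t ^ 2) * exp (- \<alpha> * of_real (t\<^sup>2)) \<partial>lborel)
       = (\<integral>t. exp (- \<alpha> * of_real (t\<^sup>2)) \<partial>lborel)"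
proof -
  let ?f = "\<lambda>t::real. exp (- \<alpha> * of_real (t\<^sup>2)) - 2 * \<alpha> * (of_real (t ^ 2) * exp (- \<alpha> * of_real (t\<^sup>2)))"
  let ?F = "\<lambda>t::real. of_real (t ^ 1) * exp (- \<alpha> * of_real (t\<^sup>2))"
  have i0: "integrable lborel (\<lambda>t::real. exp (- \<alpha> * of_real (t\<^sup>2)))"
    using integrable_mult_gaussian[OF assms, of 0] by simp
  have i2: "integrable lborel (\<lambda>t::real. of_real (t ^ 2) * exp (- \<alpha> * of_real (t\<^sup>2)))"
    using integrable_mult_gaussian[OF assms, of 2] by simp
  have "(\<integral>t. ?f t \<partial>lborel) = 0 - 0"
  proof (rule integral_FTC_line[where F = ?F])
    fix t :: real
    have "((\<lambda>z. z * exp (- \<alpha> * z\<^sup>2)) has_field_derivative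
        (exp (- \<alpha> * (of_real t)\<^sup>2) - 2 * \<alpha> * ((of_real t)\<^sup>2 * exp (- \<alpha> * (of_real t)\<^sup>2)))) (at (of_real t))"
      by (auto intro!: derivative_eq_intros simp: algebra_simps power2_eq_square)
    from has_vector_derivative_real_field[OF this]
    show "(?F has_vector_derivative ?f t) (at t)" by simp
    show "isCont ?f t" by (intro continuous_intros)
  qed (use i0 i2 tendsto_mult_gaussian[OF assms, of 1] in auto)
  then show ?thesis using i0 i2 by simp
qed

text \<open>
  On the positive reals this is the classical Gaussian integral. Along the segment from \<open>Re \<alpha>\<close> to
  \<open>\<alpha>\<close> the product of the integral with \<open>\<surd>\<alpha>\<close> has zero derivative, by the second moment identity.
\<close>

lemma complex_gaussian_integral:
  fixes \<alpha> :: complex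
  assumes "Re \<alpha> > 0"
  shows "csqrt \<alpha> * (\<integral>t. exp (- \<alpha> * of_real (t\<^sup>2)) \<partial>lborel) = of_real (sqrt pi)"
proof -
  define c where "c = (\<lambda>\<tau>::real. Complex (Re \<alpha>) (\<tau> * Im \<alpha>))"
  have Rec: "Re (c \<tau>) = Re \<alpha>" for \<tau> by (simp add: c_def)
  have Rec': "Re (c \<tau>) > 0" for \<tau> using assms by (simp add: c_def)
  have c_eq: "c \<tau> = of_real (Re \<alpha>) + of_real \<tau> * (\<i> * of_real (Im \<alpha>))" for \<tau>
    by (simp add: c_def complex_eq_iff)
  define J where "J = (\<lambda>\<tau>. \<integral>t. exp (- c \<tau> * of_real (t\<^sup>2)) \<partial>lborel)"
  define M where "M = (\<lambda>\<tau>. \<integral>t. of_real (t ^ 2) * exp (- c \<tau> * of_real (t\<^sup>2)) \<partial>lborel)"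
  have M: "2 * c \<tau> * M \<tau> = J \<tau>" for \<tau>
    unfolding M_def J_def by (rule gaussian_second_moment) (rule Rec')
  have dJ: "(J has_vector_derivative - (\<i> * of_real (Im \<alpha>)) * M \<tau>) (at \<tau>)" for \<tau>
  proof -
    let ?f' = "\<lambda>\<tau> t. - (\<i> * of_real (Im \<alpha>)) * (of_real (t ^ 2) * exp (- c \<tau> * of_real (t\<^sup>2)))"
    have "(J has_vector_derivative (\<integral>t. ?f' \<tau> t \<partial>lborel)) (at \<tau>)"
      unfolding J_def
    proof (rule has_vector_derivative_integral_dominated[where \<delta> = 1
          and w = "\<lambda>t. norm (Im \<alpha>) * norm (of_real (t ^ 2) * exp (- \<alpha> * of_real (t\<^sup>2)))"])
      show "integrable lborel (\<lambda>t. exp (- c x * of_real (t\<^sup>2)))" for x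
        using integrable_mult_gaussian[OF Rec', of 0 x] by simp
      show "((\<lambda>x. exp (- c x * of_real (t\<^sup>2))) has_vector_derivative ?f' x t) (at x)" for x t
      proof -
        have "((\<lambda>z. exp (- (of_real (Re \<alpha>) + z * (\<i> * of_real (Im \<alpha>))) * of_real (t\<^sup>2))) has_field_derivative
            ?f' x t) (at (of_real x))"
          unfolding c_eq by (auto intro!: derivative_eq_intros)
        from has_vector_derivative_real_field[OF this] show ?thesis
          unfolding c_eq by simp
      qed
      show "integrable lborel (\<lambda>t. norm (Im \<alpha>) * norm (of_real (t ^ 2) * exp (- \<alpha> * of_real (t\<^sup>2))))"
        using integrable_mult_gaussian[OF assms, of 2] by (intro integrable_mult_right integrable_norm)
      show "norm (?f' x t) \<le> norm (Im \<alpha>) * norm (of_real (t ^ 2) * exp (- \<alpha> * of_real (t\<^sup>2)))" for x t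
        by (simp add: norm_mult Rec)
    qed (auto simp: c_def)
    then show ?thesis unfolding M_def by simp
  qed
  have zero: "((\<lambda>\<tau>. csqrt (c \<tau>) * J \<tau>) has_vector_derivative 0) (at \<tau> within UNIV)" for \<tau>
  proof -
    have nn: "c \<tau> \<notin> \<real>\<^sub>\<le>\<^sub>0" using Rec'[of \<tau>] by (auto simp: complex_nonpos_Reals_iff)
    have "((\<lambda>z. csqrt (of_real (Re \<alpha>) + z * (\<i> * of_real (Im \<alpha>)))) has_field_derivative
       (\<i> * of_real (Im \<alpha>)) / (2 * csqrt (c \<tau>))) (at (of_real \<tau>))"
      using nn unfolding c_eq by (auto intro!: derivative_eq_intros)
    from has_vector_derivative_real_field[OF this]
    have dc: "((\<lambda>\<tau>. csqrt (c \<tau>)) has_vector_derivative (\<i> * of_real (Im \<alpha>)) / (2 * csqrt (c \<tau>))) (at \<tau>)"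
      unfolding c_eq by simp
    have s: "csqrt (c \<tau>) * csqrt (c \<tau>) = c \<tau>" "csqrt (c \<tau>) \<noteq> 0"
      using Rec'[of \<tau>] power2_csqrt[of "c \<tau>"] by (auto simp: power2_eq_square)
    have "csqrt (c \<tau>) * (- (\<i> * of_real (Im \<alpha>)) * M \<tau>)
       + (\<i> * of_real (Im \<alpha>)) / (2 * csqrt (c \<tau>)) * J \<tau> = 0"
      unfolding M[symmetric] using s by (simp add: field_simps)
    then show ?thesis
      using has_vector_derivative_mult[OF dc dJ] by simp
  qed
  obtain C where C: "\<And>\<tau>. csqrt (c \<tau>) * J \<tau> = C"
    using has_vector_derivative_zero_constant[OF convex_UNIV zero] by auto
  have "csqrt \<alpha> * (\<integral>t. exp (- \<alpha> * of_real (t\<^sup>2)) \<partial>lborel) = csqrt (c 1) * J 1"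
    by (simp add: J_def c_def)
  also have "\<dots> = csqrt (c 0) * J 0" using C by metis
  also have "\<dots> = of_real (sqrt pi)"
  proof -
    have s: "sqrt (Re \<alpha>) > 0" using assms by simp
    have "has_bochner_integral lborel (\<lambda>x. exp (- x\<^sup>2)) (sqrt pi)"
      using has_bochner_integral_even_function[OF gaussian_moment_0] by simp
    then have g: "(\<integral>x. exp (- x\<^sup>2) \<partial>lborel) = sqrt pi" by (rule has_bochner_integral_integral_eq)
    have "(\<integral>x. exp (- x\<^sup>2) \<partial>lborel) = sqrt (Re \<alpha>) * (\<integral>x. exp (- (sqrt (Re \<alpha>) * x)\<^sup>2) \<partial>lborel)"
      using s by (subst lborel_integral_real_affine[where c = "sqrt (Re \<alpha>)" and t = 0]) auto
    also have "(\<lambda>x. exp (- (sqrt (Re \<alpha>) * x)\<^sup>2)) = (\<lambda>x. exp (- Re \<alpha> * x\<^sup>2))"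
      using assms by (simp add: power_mult_distrib)
    finally have 1: "sqrt (Re \<alpha>) * (\<integral>x. exp (- Re \<alpha> * x\<^sup>2) \<partial>lborel) = sqrt pi" using g by simp
    have "J 0 = (\<integral>x. complex_of_real (exp (- Re \<alpha> * x\<^sup>2)) \<partial>lborel)"
      unfolding J_def c_eq by (intro Bochner_Integration.integral_cong) (auto simp: exp_of_real[symmetric])
    also have "\<dots> = of_real (\<integral>x. exp (- Re \<alpha> * x\<^sup>2) \<partial>lborel)" by simp
    finally have "csqrt (c 0) * J 0 = of_real (sqrt (Re \<alpha>)) * of_real (\<integral>x. exp (- Re \<alpha> * x\<^sup>2) \<partial>lborel)"
      using assms by (simp add: c_eq csqrt_of_real_nonneg)
    then show ?thesis using 1 by (metis of_real_mult)
  qed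
  finally show ?thesis .
qed

section \<open>Exponentially decaying functions\<close>

text \<open>
  The edge Green's functions and half plane waves decay exponentially in \<open>y\<close>, the scattered field is only
  bounded. The pairings below combine a function of the first kind with one of the second.
\<close>

definition decaying :: "real \<Rightarrow> (real \<Rightarrow> complex) \<Rightarrow> bool" where
  "decaying \<epsilon> f \<longleftrightarrow> f \<in> borel_measurable borel \<and> (\<exists>C. \<forall>t. norm (f t) \<le> C * exp (- \<epsilon> * \<bar>t\<bar>))"

definition bounded_measurable :: "(real \<Rightarrow> complex) \<Rightarrow> bool" where
  "bounded_measurable f \<longleftrightarrow> f \<in> borel_measurable borel \<and> (\<exists>B. \<forall>t. norm (f t) \<le> B)"

lemma decaying_measurable [measurable_dest]: "decaying \<epsilon> f \<Longrightarrow> f \<in> borel_measurable borel"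
  by (simp add: decaying_def)

lemma bounded_measurable_measurable [measurable_dest]: "bounded_measurable f \<Longrightarrow> f \<in> borel_measurable borel"
  by (simp add: bounded_measurable_def)

lemma decayingE:
  assumes "decaying \<epsilon> f"
  obtains C where "C \<ge> 0" "\<And>t. norm (f t) \<le> C * exp (- \<epsilon> * \<bar>t\<bar>)"
proof -
  from assms obtain C where C: "\<And>t. norm (f t) \<le> C * exp (- \<epsilon> * \<bar>t\<bar>)" by (auto simp: decaying_def)
  have "0 \<le> C" using C[of 0] norm_ge_zero[of "f 0"] by (simp del: norm_ge_zero)
  with C show ?thesis using that by blast
qed

lemma bounded_measurableE:
  assumes "bounded_measurable f"
  obtains B where "B \<ge> 0" "\<And>t. norm (f t) \<le> B"
  using assms unfolding bounded_measurable_def by (metis norm_ge_zero order_trans)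

lemma decaying_imp_bounded:
  assumes "decaying \<epsilon> f" "\<epsilon> > 0" shows "bounded_measurable f"
proof -
  obtain C where C: "C \<ge> 0" "\<And>t. norm (f t) \<le> C * exp (- \<epsilon> * \<bar>t\<bar>)" using assms(1) by (rule decayingE) blast
  have "C * exp (- \<epsilon> * \<bar>t\<bar>) \<le> C" for t using C(1) assms(2) by (simp add: mult_left_le)
  then show ?thesis unfolding bounded_measurable_def using assms(1) C(2)
    by (meson decaying_measurable order_trans)
qed

lemma decaying_integrable:
  assumes "decaying \<epsilon> f" "\<epsilon> > 0" shows "integrable lborel f"
proof -
  obtain C where C: "C \<ge> 0" "\<And>t. norm (f t) \<le> C * exp (- \<epsilon> * \<bar>t\<bar>)" using assms(1) by (rule decayingE) blast
  have [measurable]: "f \<in> borel_measurable borel" using assms(1) by (rule decaying_measurable)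
  show ?thesis
  proof (rule Bochner_Integration.integrable_bound)
    show "integrable lborel (\<lambda>t. C * exp (- \<epsilon> * \<bar>t\<bar>))"
      using integrable_exp_abs[OF assms(2)] by (rule integrable_mult_right)
    show "AE t in lborel. norm (f t) \<le> norm (C * exp (- \<epsilon> * \<bar>t\<bar>))" using C by simp
  qed simp
qed

lemma decaying_mult_bounded:
  assumes "decaying \<epsilon> f" "bounded_measurable h" shows "decaying \<epsilon> (\<lambda>t. f t * h t)"
proof -
  obtain C where C: "C \<ge> 0" "\<And>t. norm (f t) \<le> C * exp (- \<epsilon> * \<bar>t\<bar>)" using assms(1) by (rule decayingE) blast
  obtain B where B: "B \<ge> 0" "\<And>t. norm (h t) \<le> B" using assms(2) by (rule bounded_measurableE) blast
  note [measurable] = decaying_measurable[OF assms(1)] bounded_measurable_measurable[OF assms(2)]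
  have "norm (f t * h t) \<le> (C * B) * exp (- \<epsilon> * \<bar>t\<bar>)" for t
    using mult_mono[OF C(2)[of t] B(2)[of t]] C(1) by (simp add: norm_mult mult_ac)
  then show ?thesis unfolding decaying_def by (auto intro!: exI[of _ "C * B"])
qed

lemma decaying_add:
  assumes "decaying \<epsilon> f" "decaying \<epsilon> g" shows "decaying \<epsilon> (\<lambda>t. f t + g t)"
proof -
  obtain C where C: "\<And>t. norm (f t) \<le> C * exp (- \<epsilon> * \<bar>t\<bar>)" using assms(1) by (rule decayingE) blast
  obtain D where D: "\<And>t. norm (g t) \<le> D * exp (- \<epsilon> * \<bar>t\<bar>)" using assms(2) by (rule decayingE) blast
  have "norm (f t + g t) \<le> (C + D) * exp (- \<epsilon> * \<bar>t\<bar>)" for t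
    using norm_triangle_le[OF add_mono[OF C[of t] D[of t]]] by (simp add: distrib_right)
  then show ?thesis using assms unfolding decaying_def by (auto intro!: exI[of _ "C + D"])
qed

lemma decaying_cmult:
  assumes "decaying \<epsilon> f" shows "decaying \<epsilon> (\<lambda>t. c * f t)"
  using decaying_mult_bounded[OF assms, of "\<lambda>_. c"]
  by (auto simp: bounded_measurable_def mult.commute)

lemma decaying_diff:
  assumes "decaying \<epsilon> f" "decaying \<epsilon> g" shows "decaying \<epsilon> (\<lambda>t. f t - g t)"
  using decaying_add[OF assms(1) decaying_cmult[OF assms(2), of "-1"]] by simp

lemma measurable_cnj [measurable]: "cnj \<in> borel_measurable borel"
  by (intro borel_measurable_continuous_onI continuous_intros)

lemma decaying_cnj: "decaying \<epsilon> f \<Longrightarrow> decaying \<epsilon> (\<lambda>t. cnj (f t))"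
  unfolding decaying_def by (auto intro: measurable_compose[OF _ measurable_cnj])

lemma bounded_measurable_cnj: "bounded_measurable f \<Longrightarrow> bounded_measurable (\<lambda>t. cnj (f t))"
  unfolding bounded_measurable_def by (auto intro: measurable_compose[OF _ measurable_cnj])

lemma bounded_measurable_mult:
  assumes "bounded_measurable f" "bounded_measurable g" shows "bounded_measurable (\<lambda>t. f t * g t)"
proof -
  obtain B where B: "B \<ge> 0" "\<And>t. norm (f t) \<le> B" using assms(1) by (rule bounded_measurableE) blast
  obtain C where C: "C \<ge> 0" "\<And>t. norm (g t) \<le> C" using assms(2) by (rule bounded_measurableE) blast
  have "norm (f t * g t) \<le> B * C" for t using mult_mono[OF B(2) C(2)] B C by (simp add: norm_mult)
  then show ?thesis using assms by (auto simp: bounded_measurable_def)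
qed

lemma bounded_measurable_add:
  assumes "bounded_measurable f" "bounded_measurable g" shows "bounded_measurable (\<lambda>t. f t + g t)"
proof -
  obtain B where B: "B \<ge> 0" "\<And>t. norm (f t) \<le> B" using assms(1) by (rule bounded_measurableE) blast
  obtain C where C: "C \<ge> 0" "\<And>t. norm (g t) \<le> C" using assms(2) by (rule bounded_measurableE) blast
  have "norm (f t + g t) \<le> B + C" for t using norm_triangle_le[OF add_mono[OF B(2) C(2)]] .
  then show ?thesis using assms by (auto simp: bounded_measurable_def)
qed

lemma decaying_shift:
  assumes "decaying \<epsilon> f" "\<epsilon> > 0" shows "decaying \<epsilon> (\<lambda>t. f (t - r))"
proof -
  obtain C where C: "C \<ge> 0" "\<And>t. norm (f t) \<le> C * exp (- \<epsilon> * \<bar>t\<bar>)" using assms(1) by (rule decayingE) blast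
  note [measurable] = decaying_measurable[OF assms(1)]
  have "norm (f (t - r)) \<le> (C * exp (\<epsilon> * \<bar>r\<bar>)) * exp (- \<epsilon> * \<bar>t\<bar>)" for t
  proof -
    have "\<epsilon> * \<bar>t\<bar> \<le> \<epsilon> * (\<bar>r\<bar> + \<bar>t - r\<bar>)" using assms(2) by (intro mult_left_mono) auto
    then have "exp (- \<epsilon> * \<bar>t - r\<bar>) \<le> exp (\<epsilon> * \<bar>r\<bar>) * exp (- \<epsilon> * \<bar>t\<bar>)"
      by (simp add: exp_add[symmetric] algebra_simps)
    then have "C * exp (- \<epsilon> * \<bar>t - r\<bar>) \<le> C * (exp (\<epsilon> * \<bar>r\<bar>) * exp (- \<epsilon> * \<bar>t\<bar>))"
      using C(1) by (rule mult_left_mono)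
    then show ?thesis using C(2)[of "t - r"] by (simp add: mult.assoc)
  qed
  then show ?thesis unfolding decaying_def by (auto intro!: exI[of _ "C * exp (\<epsilon> * \<bar>r\<bar>)"])
qed

lemma exp_abs_diff_mult_le:
  fixes y t \<epsilon> :: real
  assumes "\<epsilon> > 0"
  shows "exp (- \<epsilon> * \<bar>y - t\<bar>) * exp (- \<epsilon> * \<bar>t\<bar>) \<le> exp (- (\<epsilon> / 2) * \<bar>y\<bar>) * exp (- (\<epsilon> / 2) * \<bar>t\<bar>)"
proof -
  have "\<epsilon> * (\<bar>y\<bar> / 2 + \<bar>t\<bar> / 2) \<le> \<epsilon> * (\<bar>y - t\<bar> + \<bar>t\<bar>)"
    using assms by (intro mult_left_mono) auto
  then show ?thesis by (simp add: exp_add[symmetric] algebra_simps)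
qed

lemma fubini_product_bound:
  fixes F :: "real \<Rightarrow> real \<Rightarrow> 'a::{banach, second_countable_topology}"
  assumes F [measurable]: "case_prod F \<in> borel_measurable (borel \<Otimes>\<^sub>M borel)"
    and bound: "\<And>x y. norm (F x y) \<le> a x * b y"
    and a: "integrable lborel a" and b: "integrable lborel b"
    and a0: "\<And>x. a x \<ge> 0" and b0: "\<And>y. b y \<ge> 0"
  shows "(\<integral>x. (\<integral>y. F x y \<partial>lborel) \<partial>lborel) = (\<integral>y. (\<integral>x. F x y \<partial>lborel) \<partial>lborel)"
    and "integrable lborel (\<lambda>x. \<integral>y. F x y \<partial>lborel)"
    and "integrable lborel (\<lambda>y. \<integral>x. F x y \<partial>lborel)"
proof -
  note [measurable] = borel_measurable_integrable[OF a] borel_measurable_integrable[OF b]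
  have i2: "integrable lborel (\<lambda>y. F x y)" for x
    by (rule Bochner_Integration.integrable_bound[OF integrable_mult_right[OF b, of "a x"]])
       (use bound a0 b0 in auto)
  have "integrable (lborel \<Otimes>\<^sub>M lborel) (case_prod F)"
  proof (rule lborel_pair.Fubini_integrable)
    show "integrable lborel (\<lambda>x. \<integral>y. norm (case_prod F (x, y)) \<partial>lborel)"
    proof (rule Bochner_Integration.integrable_bound[OF integrable_mult_left[OF a, of "\<integral>y. b y \<partial>lborel"]])
      show "AE x in lborel. norm (\<integral>y. norm (case_prod F (x, y)) \<partial>lborel) \<le> norm (a x * (\<integral>y. b y \<partial>lborel))"
      proof (rule AE_I2)
        fix x
        have "(\<integral>y. norm (F x y) \<partial>lborel) \<le> (\<integral>y. a x * b y \<partial>lborel)"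
          using i2[of x] b bound by (intro integral_mono) auto
        moreover have "0 \<le> (\<integral>y. norm (F x y) \<partial>lborel)" by simp
        ultimately show "norm (\<integral>y. norm (case_prod F (x, y)) \<partial>lborel) \<le> norm (a x * (\<integral>y. b y \<partial>lborel))"
          by simp
      qed
    qed simp
  qed (use i2 in auto)
  note int = this
  show "(\<integral>x. (\<integral>y. F x y \<partial>lborel) \<partial>lborel) = (\<integral>y. (\<integral>x. F x y \<partial>lborel) \<partial>lborel)"
    using lborel_pair.Fubini_integral[OF int] by simp
  show "integrable lborel (\<lambda>x. \<integral>y. F x y \<partial>lborel)"
    using lborel_pair.integrable_fst[OF int] by simp
  show "integrable lborel (\<lambda>y. \<integral>x. F x y \<partial>lborel)"
    using lborel_pair.integrable_snd[OF int] by simp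
qed

text \<open>
  Fubini for a pairing of a convolution; the decaying factors dominate the double integrand by a product.
\<close>

lemma convolution_transpose:
  assumes "\<epsilon> > 0" and A: "decaying \<epsilon> A" and f: "decaying \<epsilon> f" and h: "bounded_measurable h"
  shows "(\<integral>y. h y * (\<integral>t. A (y - t) * f t \<partial>lborel) \<partial>lborel)
       = (\<integral>t. f t * (\<integral>y. A (y - t) * h y \<partial>lborel) \<partial>lborel)"
    and "(\<integral>t. f t * (\<integral>y. A (t - y) * h y \<partial>lborel) \<partial>lborel)
       = (\<integral>y. h y * (\<integral>t. A (t - y) * f t \<partial>lborel) \<partial>lborel)"
proof -
  obtain a where a: "a \<ge> 0" "\<And>t. norm (A t) \<le> a * exp (- \<epsilon> * \<bar>t\<bar>)" using A by (rule decayingE) blast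
  obtain c where c: "c \<ge> 0" "\<And>t. norm (f t) \<le> c * exp (- \<epsilon> * \<bar>t\<bar>)" using f by (rule decayingE) blast
  obtain B where B: "B \<ge> 0" "\<And>t. norm (h t) \<le> B" using h by (rule bounded_measurableE) blast
  note [measurable] = decaying_measurable[OF A] decaying_measurable[OF f] bounded_measurable_measurable[OF h]
  have e: "\<epsilon> / 2 > 0" using assms(1) by simp
  have bound: "norm (h y * (A s * f t)) \<le> (B * a * c * exp (- (\<epsilon> / 2) * \<bar>y\<bar>)) * exp (- (\<epsilon> / 2) * \<bar>t\<bar>)"
    if "\<bar>s\<bar> = \<bar>y - t\<bar>" for y t s
  proof -
    have "norm (h y * (A s * f t)) \<le> B * ((a * exp (- \<epsilon> * \<bar>y - t\<bar>)) * (c * exp (- \<epsilon> * \<bar>t\<bar>)))"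
      unfolding norm_mult using a c B that by (intro mult_mono) (use a(2)[of s] in \<open>auto simp: that\<close>)
    also have "\<dots> = (B * a * c) * (exp (- \<epsilon> * \<bar>y - t\<bar>) * exp (- \<epsilon> * \<bar>t\<bar>))" by simp
    also have "\<dots> \<le> (B * a * c) * (exp (- (\<epsilon> / 2) * \<bar>y\<bar>) * exp (- (\<epsilon> / 2) * \<bar>t\<bar>))"
      using exp_abs_diff_mult_le[OF assms(1)] a B c by (intro mult_left_mono) auto
    finally show ?thesis by (simp add: mult_ac)
  qed
  note fub = fubini_product_bound(1)[where a = "\<lambda>y. B * a * c * exp (- (\<epsilon> / 2) * \<bar>y\<bar>)"
      and b = "\<lambda>t. exp (- (\<epsilon> / 2) * \<bar>t\<bar>)", OF _ bound integrable_mult_right[OF integrable_exp_abs[OF e]]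
      integrable_exp_abs[OF e]]
  have "(\<integral>y. (\<integral>t. h y * (A (y - t) * f t) \<partial>lborel) \<partial>lborel)
      = (\<integral>t. (\<integral>y. h y * (A (y - t) * f t) \<partial>lborel) \<partial>lborel)"
    using a B c by (intro fub) auto
  then show "(\<integral>y. h y * (\<integral>t. A (y - t) * f t \<partial>lborel) \<partial>lborel)
       = (\<integral>t. f t * (\<integral>y. A (y - t) * h y \<partial>lborel) \<partial>lborel)"
    by (simp add: mult_ac flip: integral_mult_right_zero)
  have "(\<integral>y. (\<integral>t. h y * (A (t - y) * f t) \<partial>lborel) \<partial>lborel)
      = (\<integral>t. (\<integral>y. h y * (A (t - y) * f t) \<partial>lborel) \<partial>lborel)"
    using a B c by (intro fub) auto
  then show "(\<integral>t. f t * (\<integral>y. A (t - y) * h y \<partial>lborel) \<partial>lborel)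
       = (\<integral>y. h y * (\<integral>t. A (t - y) * f t \<partial>lborel) \<partial>lborel)"
    by (simp add: mult_ac flip: integral_mult_right_zero)
qed

section \<open>The Gaussian kernel\<close>

text \<open>
  The kernel is \<open>G(l, s) = (\<gamma>/\<pi>)\<^bsup>1/2\<^esup> e\<^bsup>-\<gamma>s\<^sup>2\<^esup>\<close> with \<open>\<gamma> =\<close> \<open>gexp k l\<close>. Since \<open>Im k > 0\<close>, \<open>\<gamma>\<close> has positive
  real part, so that \<open>x\<close> acts as a time in which the field diffuses.
\<close>

definition gexp :: "complex \<Rightarrow> real \<Rightarrow> complex" where "gexp k l = - \<i> * k / (2 * of_real l)"

definition green' :: "complex \<Rightarrow> real \<Rightarrow> real \<Rightarrow> complex" where
  "green' k l s = \<i> * k * of_real s / of_real l * green k l s"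

lemma Re_gexp: "Re (gexp k l) = Im k / (2 * l)"
proof -
  have "gexp k l = (- \<i> * k) / of_real (2 * l)" by (simp add: gexp_def)
  then show ?thesis by (simp only: Re_divide_of_real) simp
qed

lemma green_eq:
  assumes "l > 0"
  shows "green k l s = csqrt (gexp k l / of_real pi) * exp (- gexp k l * of_real (s\<^sup>2))"
proof -
  have "k / (2 * of_real pi * \<i> * of_real l) = gexp k l / of_real pi"
    using assms by (simp add: gexp_def field_simps)
  then show ?thesis using assms by (simp add: green_def gexp_def)
qed

lemma green_even: "green k l (- s) = green k l s"
  by (simp add: green_def)

lemma green_swap: "green k l (s - t) = green k l (t - s)"
  using green_even[of k l "s - t"] by simp

lemma continuous_green: "continuous_on UNIV (green k l)"
  unfolding green_def by (cases "l > 0") (auto intro!: continuous_intros)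

lemma measurable_green [measurable]: "green k l \<in> borel_measurable borel"
  by (rule borel_measurable_continuous_onI[OF continuous_green])

lemma measurable_green' [measurable]: "green' k l \<in> borel_measurable borel"
  unfolding green'_def[abs_def] by measurable

lemma norm_green:
  assumes "l > 0"
  shows "norm (green k l s) = norm (csqrt (gexp k l / of_real pi)) * exp (- (Im k / (2 * l)) * s\<^sup>2)"
  using assms by (simp add: green_eq norm_mult Re_gexp del: of_real_power)

lemma decaying_green:
  assumes "Im k > 0" "l > 0"
  shows "decaying \<epsilon> (green k l)" "decaying \<epsilon> (green' k l)"
proof -
  define A where "A = Im k / (2 * l)"
  have A: "A > 0" using assms by (simp add: A_def)
  define c where "c = norm (csqrt (gexp k l / of_real pi))"
  have c: "c \<ge> 0" by (simp add: c_def)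
  have n: "norm (green k l s) = c * exp (- A * s\<^sup>2)" for s
    using norm_green[OF assms(2)] by (simp add: c_def A_def)
  have "norm (green k l s) \<le> (c * (fact 0 * exp ((\<epsilon> + 1)\<^sup>2 / (4 * A)))) * exp (- \<epsilon> * \<bar>s\<bar>)" for s
    using mult_left_mono[OF abs_mult_gaussian_le_exp_abs[OF A, of s 0 \<epsilon>] c] by (simp add: n mult_ac)
  then show "decaying \<epsilon> (green k l)" unfolding decaying_def by (metis measurable_green)
  have "norm (green' k l s) \<le> (c * norm k / l * (fact 1 * exp ((\<epsilon> + 1)\<^sup>2 / (4 * A)))) * exp (- \<epsilon> * \<bar>s\<bar>)" for s
  proof -
    have "norm (green' k l s) = (c * norm k / l) * (\<bar>s\<bar> ^ 1 * exp (- A * s\<^sup>2))"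
      using assms by (simp add: green'_def norm_mult norm_divide n)
    also have "\<dots> \<le> (c * norm k / l) * (fact 1 * exp ((\<epsilon> + 1)\<^sup>2 / (4 * A)) * exp (- \<epsilon> * \<bar>s\<bar>))"
      using abs_mult_gaussian_le_exp_abs[OF A, of s 1 \<epsilon>] c assms by (intro mult_left_mono) auto
    finally show ?thesis by (simp add: mult_ac)
  qed
  then show "decaying \<epsilon> (green' k l)" unfolding decaying_def by (metis measurable_green')
qed

lemma green_has_vector_derivative:
  "l > 0 \<Longrightarrow> ((\<lambda>s. green k l s) has_vector_derivative green' k l s) (at s)"
proof -
  assume l: "l > 0"
  have "((\<lambda>z. csqrt (k / (2 * of_real pi * \<i> * of_real l)) * exp (\<i> * k * z\<^sup>2 / (2 * of_real l)))
     has_field_derivative green' k l s) (at (of_real s))"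
    using l by (auto intro!: derivative_eq_intros simp: green'_def green_def field_simps)
  from has_vector_derivative_real_field[OF this] show ?thesis
    using l by (simp add: green_def)
qed

lemma csqrt_divide_of_real:
  assumes "r > 0" "Re z > 0"
  shows "csqrt (z / of_real r) = csqrt z / of_real (sqrt r)"
proof (rule csqrt_unique)
  show "(csqrt z / of_real (sqrt r))\<^sup>2 = z / of_real r"
    using assms by (simp add: power_divide flip: of_real_power)
  have "Re (csqrt z) > 0" using assms by (simp add: add_nonneg_pos)
  then show "0 < Re (csqrt z / of_real (sqrt r)) \<or> Re (csqrt z / of_real (sqrt r)) = 0 \<and> 0 \<le> Im (csqrt z / of_real (sqrt r))"
    using assms by (simp add: Re_divide_of_real)
qed

lemma integral_green:
  assumes "Im k > 0" "l > 0"
  shows "(\<integral>s. green k l s \<partial>lborel) = 1"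
proof -
  have R: "Re (gexp k l) > 0" using assms by (simp add: Re_gexp)
  have "(\<integral>s. green k l s \<partial>lborel) = csqrt (gexp k l / of_real pi) * (\<integral>t. exp (- gexp k l * of_real (t\<^sup>2)) \<partial>lborel)"
    using assms by (simp add: green_eq)
  also have "\<dots> = of_real (sqrt pi) / of_real (sqrt pi)"
    using complex_gaussian_integral[OF R] by (simp add: csqrt_divide_of_real R)
  finally show ?thesis by simp
qed

lemma gaussian_fourier_transform:
  fixes a b :: real
  assumes "a > 0"
  shows "(\<integral>y. exp (of_real (- a * y\<^sup>2) + \<i> * of_real (b * y)) \<partial>lborel)
       = of_real (sqrt (pi / a) * exp (- b\<^sup>2 / (4 * a)))"
proof -
  define c where "c = sqrt (2 * a)"
  have c: "c > 0" "c\<^sup>2 = 2 * a" using assms by (auto simp: c_def)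
  have "(\<integral>x. std_normal_density x *\<^sub>R iexp (b / c * x) \<partial>lborel) = of_real (exp (- ((b / c)\<^sup>2) / 2))"
    using fun_cong[OF char_std_normal_distribution, of "b / c"] unfolding char_def
    by (subst (asm) integral_density) auto
  also have "(\<integral>x. std_normal_density x *\<^sub>R iexp (b / c * x) \<partial>lborel)
     = c *\<^sub>R (\<integral>y. std_normal_density (c * y) *\<^sub>R iexp (b / c * (c * y)) \<partial>lborel)"
    using c by (subst lborel_integral_real_affine[where c = c and t = 0]) auto
  also have "\<dots> = c *\<^sub>R (\<integral>y. of_real (1 / sqrt (2 * pi)) * exp (of_real (- a * y\<^sup>2) + \<i> * of_real (b * y)) \<partial>lborel)"
  proof (intro arg_cong[of _ _ "\<lambda>x. c *\<^sub>R x"] Bochner_Integration.integral_cong refl)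
    fix y :: real
    have "std_normal_density (c * y) = 1 / sqrt (2 * pi) * exp (- a * y\<^sup>2)"
      using c by (simp add: std_normal_density_def power_mult_distrib)
    moreover have "b / c * (c * y) = b * y" using c by simp
    moreover have "exp (complex_of_real (- a * y\<^sup>2)) = of_real (exp (- a * y\<^sup>2))" by (rule exp_of_real)
    ultimately show "std_normal_density (c * y) *\<^sub>R iexp (b / c * (c * y))
        = of_real (1 / sqrt (2 * pi)) * exp (of_real (- a * y\<^sup>2) + \<i> * of_real (b * y))"
      by (simp only: exp_add scaleR_conv_of_real of_real_mult mult.assoc)
  qed
  finally have "of_real (c / sqrt (2 * pi)) * (\<integral>y. exp (of_real (- a * y\<^sup>2) + \<i> * of_real (b * y)) \<partial>lborel)
     = of_real (exp (- ((b / c)\<^sup>2) / 2))"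
    by (simp add: scaleR_conv_of_real)
  moreover have "sqrt (pi / a) * (c / sqrt (2 * pi)) = 1"
    using assms by (simp add: c_def real_sqrt_divide real_sqrt_mult)
  moreover have "(b / c)\<^sup>2 / 2 = b\<^sup>2 / (4 * a)" using c by (simp add: power_divide)
  ultimately show ?thesis
    by (metis (no_types, lifting) minus_divide_left mult.assoc mult.left_neutral of_real_1 of_real_mult)
qed

section \<open>Propagation through a slab\<close>

text \<open>
  The field at the right end of a slab of width \<open>l\<close> in terms of the field \<open>f\<close> at its left end.
\<close>

definition heat :: "complex \<Rightarrow> real \<Rightarrow> (real \<Rightarrow> complex) \<Rightarrow> real \<Rightarrow> complex" where
  "heat k l f y = (\<integral>t. green k l (y - t) * f t \<partial>lborel)"

lemma norm_integral_le:
  fixes f :: "real \<Rightarrow> 'a::{banach, second_countable_topology}"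
  assumes "integrable lborel g" "\<And>t. norm (f t) \<le> g t"
  shows "norm (\<integral>t. f t \<partial>lborel) \<le> (\<integral>t. g t \<partial>lborel)"
proof (cases "integrable lborel f")
  case True
  have "norm (\<integral>t. f t \<partial>lborel) \<le> (\<integral>t. norm (f t) \<partial>lborel)" by (rule integral_norm_bound)
  also have "\<dots> \<le> (\<integral>t. g t \<partial>lborel)" using assms True by (intro integral_mono) auto
  finally show ?thesis .
next
  case False
  have "0 \<le> (\<integral>t. g t \<partial>lborel)"
    using assms(2) by (intro Bochner_Integration.integral_nonneg) (meson norm_ge_zero order_trans)
  with False show ?thesis by (simp add: not_integrable_integral_eq)
qed

lemma measurable_heat [measurable (raw)]:
  assumes [measurable]: "f \<in> borel_measurable borel" shows "heat k l f \<in> borel_measurable borel"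
  unfolding heat_def[abs_def] by measurable

lemma integrable_convolution:
  assumes "\<epsilon> > 0" "decaying \<epsilon> A" "bounded_measurable f"
  shows "integrable lborel (\<lambda>t. A (y - t) * f t)"
proof -
  have 1: "decaying \<epsilon> (\<lambda>t. A (0 - t))"
  proof -
    obtain C where C: "\<And>t. norm (A t) \<le> C * exp (- \<epsilon> * \<bar>t\<bar>)" using assms(2) by (rule decayingE) blast
    note [measurable] = decaying_measurable[OF assms(2)]
    have "norm (A (0 - t)) \<le> C * exp (- \<epsilon> * \<bar>t\<bar>)" for t using C[of "0 - t"] by simp
    then show ?thesis unfolding decaying_def by (intro conjI exI[of _ C] allI) measurable
  qed
  have "decaying \<epsilon> (\<lambda>t. A (0 - (t - y)))" by (rule decaying_shift[OF 1 assms(1)])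
  then have "decaying \<epsilon> (\<lambda>t. A (y - t) * f t)" by (intro decaying_mult_bounded assms(3)) simp
  then show ?thesis using assms(1) by (rule decaying_integrable)
qed

text \<open>
  The constant depends on the kernel only. This matters when the operator is iterated: the bounds
  grow at most geometrically with the number of slabs.
\<close>

lemma norm_convolution_le:
  assumes \<epsilon>: "\<epsilon> > 0" and A: "decaying (2 * \<epsilon>) A"
  obtains K where "K \<ge> 1"
    "\<And>f C y. f \<in> borel_measurable borel \<Longrightarrow> (\<And>t. norm (f t) \<le> C * exp (- \<epsilon> * \<bar>t\<bar>)) \<Longrightarrow>
       norm (\<integral>t. A (y - t) * f t \<partial>lborel) \<le> K * C * exp (- \<epsilon> * \<bar>y\<bar>)"
    "\<And>f B y. f \<in> borel_measurable borel \<Longrightarrow> (\<And>t. norm (f t) \<le> B) \<Longrightarrow>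
       norm (\<integral>t. A (y - t) * f t \<partial>lborel) \<le> K * B"
proof -
  obtain a where a: "a \<ge> 0" "\<And>t. norm (A t) \<le> a * exp (- (2 * \<epsilon>) * \<bar>t\<bar>)" using A by (rule decayingE) blast
  define I where "I = (\<integral>t. exp (- \<epsilon> * \<bar>t\<bar>) \<partial>lborel)"
  have I0: "I \<ge> 0" by (simp add: I_def)
  note [measurable] = decaying_measurable[OF A]
  have int: "integrable lborel (\<lambda>t. exp (- \<epsilon> * \<bar>y - t\<bar>))" for y
    using lborel_integrable_real_affine_iff[of "-1" "\<lambda>t. exp (- \<epsilon> * \<bar>t\<bar>)" y] integrable_exp_abs[OF \<epsilon>] by simp
  have I: "(\<integral>t. exp (- \<epsilon> * \<bar>y - t\<bar>) \<partial>lborel) = I" for y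
    unfolding I_def using lborel_integral_real_affine[of "-1" "\<lambda>t. exp (- \<epsilon> * \<bar>t\<bar>)" y] by simp
  show ?thesis
  proof (rule that[of "a * I + 1"])
    show "a * I + 1 \<ge> 1" using a I0 by simp
    fix f :: "real \<Rightarrow> complex" and C y
    assume f [measurable]: "f \<in> borel_measurable borel" and C: "\<And>t. norm (f t) \<le> C * exp (- \<epsilon> * \<bar>t\<bar>)"
    have C0: "C \<ge> 0" using C[of 0] norm_ge_zero[of "f 0"] by (simp del: norm_ge_zero)
    have "norm (\<integral>t. A (y - t) * f t \<partial>lborel) \<le> (\<integral>t. (a * C * exp (- \<epsilon> * \<bar>y\<bar>)) * exp (- \<epsilon> * \<bar>y - t\<bar>) \<partial>lborel)"
    proof (rule norm_integral_le)
      show "integrable lborel (\<lambda>t. (a * C * exp (- \<epsilon> * \<bar>y\<bar>)) * exp (- \<epsilon> * \<bar>y - t\<bar>))"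
        using int by simp
      fix t
      have "norm (A (y - t) * f t) \<le> (a * exp (- (2 * \<epsilon>) * \<bar>y - t\<bar>)) * (C * exp (- \<epsilon> * \<bar>t\<bar>))"
        unfolding norm_mult using a C0 by (intro mult_mono C) auto
      also have "\<dots> = (a * C) * (exp (- (2 * \<epsilon>) * \<bar>y - t\<bar>) * exp (- \<epsilon> * \<bar>t\<bar>))" by simp
      also have "\<dots> \<le> (a * C) * (exp (- \<epsilon> * \<bar>y\<bar>) * exp (- \<epsilon> * \<bar>y - t\<bar>))"
      proof -
        have "\<epsilon> * (\<bar>y\<bar> + \<bar>y - t\<bar>) \<le> \<epsilon> * (2 * \<bar>y - t\<bar> + \<bar>t\<bar>)" using \<epsilon> by (intro mult_left_mono) auto
        then show ?thesis using a C0 by (intro mult_left_mono) (auto simp: exp_add[symmetric] algebra_simps)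
      qed
      finally show "norm (A (y - t) * f t) \<le> (a * C * exp (- \<epsilon> * \<bar>y\<bar>)) * exp (- \<epsilon> * \<bar>y - t\<bar>)" by (simp add: mult_ac)
    qed
    also have "\<dots> = (a * I) * C * exp (- \<epsilon> * \<bar>y\<bar>)" using I by simp
    also have "\<dots> \<le> (a * I + 1) * C * exp (- \<epsilon> * \<bar>y\<bar>)" using C0 by (intro mult_right_mono) auto
    finally show "norm (\<integral>t. A (y - t) * f t \<partial>lborel) \<le> (a * I + 1) * C * exp (- \<epsilon> * \<bar>y\<bar>)" .
  next
    fix f :: "real \<Rightarrow> complex" and B y
    assume f [measurable]: "f \<in> borel_measurable borel" and B: "\<And>t. norm (f t) \<le> B"
    have B0: "B \<ge> 0" using B[of 0] norm_ge_zero order_trans by blast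
    have "norm (\<integral>t. A (y - t) * f t \<partial>lborel) \<le> (\<integral>t. (a * B) * exp (- \<epsilon> * \<bar>y - t\<bar>) \<partial>lborel)"
    proof (rule norm_integral_le)
      show "integrable lborel (\<lambda>t. (a * B) * exp (- \<epsilon> * \<bar>y - t\<bar>))"
        using int by simp
      fix t
      have "norm (A (y - t) * f t) \<le> (a * exp (- (2 * \<epsilon>) * \<bar>y - t\<bar>)) * B"
        unfolding norm_mult using a B0 by (intro mult_mono B) auto
      also have "\<dots> = (a * B) * exp (- (2 * \<epsilon>) * \<bar>y - t\<bar>)" by simp
      also have "\<dots> \<le> (a * B) * exp (- \<epsilon> * \<bar>y - t\<bar>)"
        using \<epsilon> a B0 by (intro mult_left_mono) (auto simp: mult_right_mono)
      finally show "norm (A (y - t) * f t) \<le> (a * B) * exp (- \<epsilon> * \<bar>y - t\<bar>)" .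
    qed
    also have "\<dots> = (a * I) * B" using I by simp
    also have "\<dots> \<le> (a * I + 1) * B" using B0 by (intro mult_right_mono) auto
    finally show "norm (\<integral>t. A (y - t) * f t \<partial>lborel) \<le> (a * I + 1) * B" .
  qed
qed

lemma norm_heat_le:
  assumes "Im k > 0" "l > 0" "\<epsilon> > 0"
  obtains K where "K \<ge> 1"
    "\<And>f C y. f \<in> borel_measurable borel \<Longrightarrow> (\<And>t. norm (f t) \<le> C * exp (- \<epsilon> * \<bar>t\<bar>)) \<Longrightarrow>
       norm (heat k l f y) \<le> K * C * exp (- \<epsilon> * \<bar>y\<bar>)"
  by (rule norm_convolution_le[OF assms(3) decaying_green(1)[OF assms(1,2)]])
     (rule that, auto simp: heat_def)

lemma decaying_convolution:
  assumes "\<epsilon> > 0" "decaying (2 * \<epsilon>) A" "decaying \<epsilon> f"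
  shows "decaying \<epsilon> (\<lambda>y. \<integral>t. A (y - t) * f t \<partial>lborel)"
proof -
  note [measurable] = decaying_measurable[OF assms(2)] decaying_measurable[OF assms(3)]
  obtain K where K: "\<And>f C y. f \<in> borel_measurable borel \<Longrightarrow> (\<And>t. norm (f t) \<le> C * exp (- \<epsilon> * \<bar>t\<bar>)) \<Longrightarrow>
       norm (\<integral>t. A (y - t) * f t \<partial>lborel) \<le> K * C * exp (- \<epsilon> * \<bar>y\<bar>)"
    using norm_convolution_le[OF assms(1,2)] by metis
  obtain C where C: "\<And>t. norm (f t) \<le> C * exp (- \<epsilon> * \<bar>t\<bar>)" using assms(3) by (rule decayingE) blast
  show ?thesis unfolding decaying_def
    using K[OF decaying_measurable[OF assms(3)] C] by (auto intro!: exI[of _ "K * C"])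
qed

lemma decaying_heat:
  assumes "Im k > 0" "l > 0" "\<epsilon> > 0" "decaying \<epsilon> f"
  shows "decaying \<epsilon> (heat k l f)"
  using decaying_convolution[OF assms(3) decaying_green(1)[OF assms(1,2)] assms(4)]
  unfolding heat_def[abs_def] .

lemma bounded_measurable_convolution:
  assumes A: "decaying 2 A" and f: "bounded_measurable f"
  shows "bounded_measurable (\<lambda>y. \<integral>t. A (y - t) * f t \<partial>lborel)"
proof -
  have A': "decaying (2 * 1) A" using A by simp
  note [measurable] = decaying_measurable[OF A] bounded_measurable_measurable[OF f]
  obtain K where K: "\<And>f B y. f \<in> borel_measurable borel \<Longrightarrow> (\<And>t. norm (f t) \<le> B) \<Longrightarrow>
       norm (\<integral>t. A (y - t) * f t \<partial>lborel) \<le> K * B"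
    using norm_convolution_le[OF zero_less_one A'] by metis
  obtain B where B: "\<And>t. norm (f t) \<le> B" using f by (rule bounded_measurableE) blast
  show ?thesis unfolding bounded_measurable_def
    using K[OF bounded_measurable_measurable[OF f] B] by (auto intro!: exI[of _ "K * B"])
qed

lemma bounded_measurable_heat:
  assumes "Im k > 0" "l > 0" "bounded_measurable f"
  shows "bounded_measurable (heat k l f)"
  using bounded_measurable_convolution[OF decaying_green(1)[OF assms(1,2)] assms(3)]
  unfolding heat_def[abs_def] .

lemma convolution_has_vector_derivative:
  assumes A: "decaying 1 A" "\<And>s. (A has_vector_derivative A' s) (at s)" and A': "decaying 1 A'"
    and f: "bounded_measurable f"
  shows "((\<lambda>y. \<integral>t. A (y - t) * f t \<partial>lborel) has_vector_derivative (\<integral>t. A' (y - t) * f t \<partial>lborel)) (at y)"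
proof -
  obtain a where a: "a \<ge> 0" "\<And>t. norm (A' t) \<le> a * exp (- 1 * \<bar>t\<bar>)"
    using A' by (rule decayingE) blast
  obtain B where B: "B \<ge> 0" "\<And>t. norm (f t) \<le> B" using f by (rule bounded_measurableE) blast
  note [measurable] = bounded_measurable_measurable[OF f] decaying_measurable[OF A']
  show ?thesis
  proof (rule has_vector_derivative_integral_dominated[where \<delta> = 1
        and w = "\<lambda>t. (a * exp 1 * B) * exp (- 1 * \<bar>y - t\<bar>)"])
    show "integrable lborel (\<lambda>t. A (x - t) * f t)" for x
      by (rule integrable_convolution[OF zero_less_one A(1) f])
    show "((\<lambda>x. A (x - t) * f t) has_vector_derivative A' (x - t) * f t) (at x)" for x t
    proof -
      have "((A \<circ> (\<lambda>x. x - t)) has_vector_derivative 1 *\<^sub>R A' (x - t)) (at x)"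
        by (rule vector_diff_chain_at) (auto intro!: derivative_eq_intros A(2)
            simp: has_real_derivative_iff_has_vector_derivative[symmetric])
      then show ?thesis by (auto intro!: has_vector_derivative_mult_left simp: o_def)
    qed
    show "norm (A' (x - t) * f t) \<le> (a * exp 1 * B) * exp (- 1 * \<bar>y - t\<bar>)" if "\<bar>x - y\<bar> < 1" for x t
    proof -
      have "norm (A' (x - t) * f t) \<le> (a * exp (- 1 * \<bar>x - t\<bar>)) * B"
        unfolding norm_mult using a B by (intro mult_mono) auto
      also have "\<dots> \<le> (a * (exp 1 * exp (- 1 * \<bar>y - t\<bar>))) * B"
        using a B that by (intro mult_right_mono mult_left_mono) (auto simp: exp_add[symmetric])
      finally show ?thesis by (simp add: mult_ac)
    qed
    show "integrable lborel (\<lambda>t. (a * exp 1 * B) * exp (- 1 * \<bar>y - t\<bar>))"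
      using lborel_integrable_real_affine_iff[of "-1" "\<lambda>t. exp (- 1 * \<bar>t\<bar>)" y] integrable_exp_abs[of 1] by simp
  qed auto
qed

lemma heat_has_vector_derivative:
  assumes "Im k > 0" "l > 0" "bounded_measurable f"
  shows "(heat k l f has_vector_derivative (\<integral>t. green' k l (y - t) * f t \<partial>lborel)) (at y)"
  unfolding heat_def[abs_def]
  by (rule convolution_has_vector_derivative[OF decaying_green(1)[OF assms(1,2)] green_has_vector_derivative[OF assms(2)]
        decaying_green(2)[OF assms(1,2)] assms(3)])

lemma heat_transpose:
  assumes "Im k > 0" "l > 0" "\<epsilon> > 0" "decaying \<epsilon> f" "bounded_measurable h"
  shows "(\<integral>y. h y * heat k l f y \<partial>lborel) = (\<integral>y. heat k l h y * f y \<partial>lborel)"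
  unfolding heat_def
  by (subst convolution_transpose(1)[OF assms(3) decaying_green(1)[OF assms(1,2)] assms(4,5)])
     (simp add: green_swap[of k l] mult.commute)

lemma heat_diff:
  assumes "Im k > 0" "l > 0" "bounded_measurable f" "bounded_measurable g"
  shows "heat k l (\<lambda>t. f t - g t) y = heat k l f y - heat k l g y"
  using integrable_convolution[OF _ decaying_green(1)[OF assms(1,2)] assms(3), of 1 y]
    integrable_convolution[OF _ decaying_green(1)[OF assms(1,2)] assms(4), of 1 y]
  by (simp add: heat_def right_diff_distrib)

lemma heat_cmult: "heat k l (\<lambda>t. c * f t) y = c * heat k l f y"
  unfolding heat_def by (simp add: mult.left_commute)

section \<open>Energy\<close>

definition energy :: "(real \<Rightarrow> complex) \<Rightarrow> real" where
  "energy f = (\<integral>t. (norm (f t))\<^sup>2 \<partial>lborel)"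

lemma energy_nonneg: "energy f \<ge> 0"
  by (simp add: energy_def)

lemma energy_integrable:
  assumes "decaying \<epsilon> f" "\<epsilon> > 0"
  shows "integrable lborel (\<lambda>t. (norm (f t))\<^sup>2)"
proof -
  have "decaying \<epsilon> (\<lambda>t. f t * cnj (f t))"
    using decaying_imp_bounded[OF decaying_cnj[OF assms(1)] assms(2)] by (intro decaying_mult_bounded assms)
  then have "integrable lborel (\<lambda>t. f t * cnj (f t))" using assms(2) by (rule decaying_integrable)
  then have "integrable lborel (\<lambda>t. norm (f t * cnj (f t)))" by (rule integrable_norm)
  then show ?thesis by (simp add: norm_mult power2_eq_square)
qed

lemma norm_add_power2_le: "(norm (x + y))\<^sup>2 \<le> 2 * (norm x)\<^sup>2 + 2 * (norm (y::complex))\<^sup>2"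
proof -
  have "(norm (x + y))\<^sup>2 \<le> (norm x + norm y)\<^sup>2" by (intro power_mono norm_triangle_ineq) auto
  also have "\<dots> \<le> 2 * (norm x)\<^sup>2 + 2 * (norm y)\<^sup>2"
    using sum_squares_bound[of "norm x" "norm y"] by (simp add: power2_sum)
  finally show ?thesis .
qed

lemma energy_add_le:
  assumes "decaying \<epsilon> f" "decaying \<epsilon> g" "\<epsilon> > 0"
  shows "energy (\<lambda>t. f t + g t) \<le> 2 * energy f + 2 * energy g"
proof -
  have "energy (\<lambda>t. f t + g t) \<le> (\<integral>t. 2 * (norm (f t))\<^sup>2 + 2 * (norm (g t))\<^sup>2 \<partial>lborel)"
    unfolding energy_def
    using assms by (intro integral_mono norm_add_power2_le energy_integrable[OF decaying_add] Bochner_Integration.integrable_add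
        integrable_mult_right) (auto intro: energy_integrable)
  also have "\<dots> = 2 * energy f + 2 * energy g"
    using assms by (simp add: energy_def energy_integrable)
  finally show ?thesis .
qed

lemma energy_shift: "energy (\<lambda>t. f (t - r)) = energy f"
  unfolding energy_def using lborel_integral_real_affine[of 1 "\<lambda>t. (norm (f t))\<^sup>2" "- r"] by simp

text \<open>
  Cauchy--Schwarz in the additive form \<open>2xy \<le> \<tau>x\<^sup>2 + y\<^sup>2/\<tau>\<close>, where the weight \<open>\<tau>\<close> can be adapted to
  factors of different size.
\<close>

lemma pairing_le_energy:
  assumes "decaying \<epsilon> f" "decaying \<epsilon> g" "\<epsilon> > 0" "\<tau> > 0"
  shows "norm (\<integral>t. f t * g t \<partial>lborel) \<le> (\<tau> * energy f + energy g / \<tau>) / 2"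
proof -
  note [measurable] = decaying_measurable[OF assms(1)] decaying_measurable[OF assms(2)]
  have "norm (\<integral>t. f t * g t \<partial>lborel) \<le> (\<integral>t. \<tau> / 2 * (norm (f t))\<^sup>2 + 1 / (2 * \<tau>) * (norm (g t))\<^sup>2 \<partial>lborel)"
  proof (rule norm_integral_le)
    show "integrable lborel (\<lambda>t. \<tau> / 2 * (norm (f t))\<^sup>2 + 1 / (2 * \<tau>) * (norm (g t))\<^sup>2)"
      using assms by (intro Bochner_Integration.integrable_add integrable_mult_right energy_integrable) auto
    fix t
    have "0 \<le> (\<tau> * norm (f t) - norm (g t))\<^sup>2 / (2 * \<tau>)" using assms by simp
    then show "norm (f t * g t) \<le> \<tau> / 2 * (norm (f t))\<^sup>2 + 1 / (2 * \<tau>) * (norm (g t))\<^sup>2"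
      using assms(4) by (simp add: norm_mult power2_diff power2_eq_square field_simps)
  qed
  also have "\<dots> = (\<tau> * energy f + energy g / \<tau>) / 2"
    using assms by (simp add: energy_def energy_integrable field_simps)
  finally show ?thesis .
qed

section \<open>Dissipation of energy\<close>

text \<open>
  The rate of the Gaussian \<open>\<integral> cnj (G(y - s)) G(y - t) dy\<close> in \<open>t - s\<close>.
\<close>

definition spread_rate :: "complex \<Rightarrow> real \<Rightarrow> real" where
  "spread_rate k l = (norm (gexp k l))\<^sup>2 / (2 * Re (gexp k l))"

definition diff_energy :: "(real \<Rightarrow> complex) \<Rightarrow> real \<Rightarrow> real" where
  "diff_energy f r = energy (\<lambda>t. f t - f (t - r))"

text \<open>
  How much \<open>f\<close> changes, in mean square, under a random Gaussian translation. This is the quantity that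
  the propagation through a slab dissipates.
\<close>

definition gauss_diff_energy :: "real \<Rightarrow> (real \<Rightarrow> complex) \<Rightarrow> real" where
  "gauss_diff_energy c f = (\<integral>r. exp (- c * r\<^sup>2) * diff_energy f r \<partial>lborel)"

lemma spread_rate_pos:
  assumes "Im k > 0" "l > 0" shows "spread_rate k l > 0"
proof -
  have "Re (gexp k l) > 0" using assms by (simp add: Re_gexp)
  then have "gexp k l \<noteq> 0" by auto
  with \<open>Re (gexp k l) > 0\<close> show ?thesis by (simp add: spread_rate_def)
qed

lemma real_gaussian_integral:
  fixes c :: real
  assumes "c > 0"
  shows "integrable lborel (\<lambda>r. exp (- c * r\<^sup>2))" "(\<integral>r. exp (- c * r\<^sup>2) \<partial>lborel) = sqrt (pi / c)"
proof -
  show "integrable lborel (\<lambda>r. exp (- c * r\<^sup>2))"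
  proof (rule Bochner_Integration.integrable_bound[OF integrable_mult_right[OF integrable_exp_abs[of 1], of "exp (1\<^sup>2 / (4 * c))"]])
    show "AE r in lborel. norm (exp (- c * r\<^sup>2)) \<le> norm (exp (1\<^sup>2 / (4 * c)) * exp (- 1 * \<bar>r\<bar>))"
      using gaussian_le_exp_abs[OF assms, of _ 1] by (intro AE_I2) simp
  qed auto
  have "complex_of_real (\<integral>r. exp (- c * r\<^sup>2) \<partial>lborel) = (\<integral>r. complex_of_real (exp (- c * r\<^sup>2)) \<partial>lborel)"
    by simp
  also have "\<dots> = (\<integral>y. exp (of_real (- c * y\<^sup>2) + \<i> * of_real (0 * y)) \<partial>lborel)"
    by (intro Bochner_Integration.integral_cong refl) (simp only: mult_zero_left of_real_0 mult_zero_right add_0_right exp_of_real)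
  also have "\<dots> = of_real (sqrt (pi / c))"
    using gaussian_fourier_transform[OF assms, of 0] by simp
  finally show "(\<integral>r. exp (- c * r\<^sup>2) \<partial>lborel) = sqrt (pi / c)" by (simp only: of_real_eq_iff)
qed

text \<open>
  After centring at the midpoint of \<open>s\<close> and \<open>t\<close> the integrand is a real Gaussian times a pure
  oscillation, whose integral is a Fourier transform.
\<close>

lemma green_autocorrelation:
  assumes "Im k > 0" "l > 0"
  defines "c \<equiv> spread_rate k l"
  shows "(\<integral>y. cnj (green k l (y - s)) * green k l (y - t) \<partial>lborel)
    = of_real (sqrt (c / pi) * exp (- c * (t - s)\<^sup>2))"
proof -
  define A where "A = Re (gexp k l)"
  define B where "B = Im (gexp k l)"
  define r where "r = t - s"
  have A: "A > 0" using assms by (simp add: Re_gexp A_def)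
  have \<alpha>: "gexp k l = Complex A B" by (simp add: A_def B_def)
  have n: "cnj (csqrt (gexp k l / of_real pi)) * csqrt (gexp k l / of_real pi) = of_real (norm (gexp k l) / pi)"
  proof -
    have "cnj (csqrt (gexp k l / of_real pi)) * csqrt (gexp k l / of_real pi)
        = of_real ((norm (csqrt (gexp k l / of_real pi)))\<^sup>2)"
      by (subst mult.commute) (rule complex_norm_square[symmetric])
    also have "(norm (csqrt (gexp k l / of_real pi)))\<^sup>2 = norm ((csqrt (gexp k l / of_real pi))\<^sup>2)"
      by (simp only: norm_power)
    also have "\<dots> = norm (gexp k l) / pi" by (simp add: norm_divide)
    finally show ?thesis .
  qed
  have "(\<integral>y. cnj (green k l (y - s)) * green k l (y - t) \<partial>lborel)
     = (\<integral>x. cnj (green k l (x + r / 2)) * green k l (x - r / 2) \<partial>lborel)"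
    by (subst lborel_integral_real_affine[of 1 _ "(t + s) / 2"]) (auto simp: r_def field_simps)
  also have "\<dots> = (\<integral>x. of_real (norm (gexp k l) / pi * exp (- A * r\<^sup>2 / 2)) * exp (of_real (- (2 * A) * x\<^sup>2) + \<i> * of_real ((2 * B * r) * x)) \<partial>lborel)"
  proof (intro Bochner_Integration.integral_cong refl)
    fix x :: real
    have e: "cnj (- gexp k l * of_real ((x + r / 2)\<^sup>2)) + (- gexp k l * of_real ((x - r / 2)\<^sup>2))
       = of_real (- A * r\<^sup>2 / 2) + (of_real (- (2 * A) * x\<^sup>2) + \<i> * of_real ((2 * B * r) * x))"
      unfolding \<alpha> by (simp add: complex_eq_iff power2_eq_square field_simps)
    have "cnj (green k l (x + r / 2)) * green k l (x - r / 2)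
       = of_real (norm (gexp k l) / pi) * (exp (cnj (- gexp k l * of_real ((x + r / 2)\<^sup>2))) * exp (- gexp k l * of_real ((x - r / 2)\<^sup>2)))"
      unfolding green_eq[OF assms(2)] n[symmetric] by (simp only: complex_cnj_mult exp_cnj mult_ac)
    also have "\<dots> = of_real (norm (gexp k l) / pi) * (of_real (exp (- A * r\<^sup>2 / 2)) * exp (of_real (- (2 * A) * x\<^sup>2) + \<i> * of_real ((2 * B * r) * x)))"
      by (simp only: exp_add[symmetric] e) (simp only: exp_add exp_of_real)
    finally show "cnj (green k l (x + r / 2)) * green k l (x - r / 2)
       = of_real (norm (gexp k l) / pi * exp (- A * r\<^sup>2 / 2)) * exp (of_real (- (2 * A) * x\<^sup>2) + \<i> * of_real ((2 * B * r) * x))"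
      by (simp only: of_real_mult mult.assoc)
  qed
  also have "\<dots> = of_real (norm (gexp k l) / pi * exp (- A * r\<^sup>2 / 2)) * of_real (sqrt (pi / (2 * A)) * exp (- (2 * B * r)\<^sup>2 / (4 * (2 * A))))"
    using gaussian_fourier_transform[of "2 * A" "2 * B * r"] A by (subst integral_mult_right_zero) simp
  also have "\<dots> = of_real ((norm (gexp k l) / pi * sqrt (pi / (2 * A))) * (exp (- A * r\<^sup>2 / 2) * exp (- (2 * B * r)\<^sup>2 / (4 * (2 * A)))))"
    by simp
  also have "exp (- A * r\<^sup>2 / 2) * exp (- (2 * B * r)\<^sup>2 / (4 * (2 * A))) = exp (- c * r\<^sup>2)"
  proof -
    have "(norm (gexp k l))\<^sup>2 = A\<^sup>2 + B\<^sup>2" by (simp add: cmod_power2 A_def B_def)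
    then have "c = (A\<^sup>2 + B\<^sup>2) / (2 * A)" by (simp add: c_def spread_rate_def A_def)
    then have "c * r\<^sup>2 = (A\<^sup>2 + B\<^sup>2) / (2 * A) * r\<^sup>2" by simp
    also have "\<dots> = - (- A * r\<^sup>2 / 2 + - (2 * B * r)\<^sup>2 / (4 * (2 * A)))"
      using A by (simp add: field_simps power2_eq_square)
    finally show ?thesis by (simp add: exp_add[symmetric])
  qed
  also have "norm (gexp k l) / pi * sqrt (pi / (2 * A)) = sqrt (c / pi)"
  proof (rule real_sqrt_unique[symmetric])
    show "(norm (gexp k l) / pi * sqrt (pi / (2 * A)))\<^sup>2 = c / pi"
      using A by (simp add: power_mult_distrib power_divide c_def spread_rate_def A_def[symmetric]) (simp add: power2_eq_square)
  qed (use A in simp)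
  finally show ?thesis by (simp add: r_def)
qed

lemma energy_eq_integral: "complex_of_real (energy f) = (\<integral>t. f t * cnj (f t) \<partial>lborel)"
proof -
  have "complex_of_real (energy f) = (\<integral>t. complex_of_real ((norm (f t))\<^sup>2) \<partial>lborel)"
    by (simp only: energy_def integral_complex_of_real)
  then show ?thesis by (simp only: complex_norm_square)
qed

lemma diff_energy_nonneg: "diff_energy f r \<ge> 0"
  by (simp add: diff_energy_def energy_nonneg)

lemma measurable_diff_energy [measurable (raw)]:
  assumes [measurable]: "f \<in> borel_measurable borel" "g \<in> borel_measurable M"
  shows "(\<lambda>x. diff_energy f (g x)) \<in> borel_measurable M"
  unfolding diff_energy_def[abs_def] energy_def by measurable

lemma diff_energy_le:
  assumes "decaying \<epsilon> f" "\<epsilon> > 0" shows "diff_energy f r \<le> 4 * energy f"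
proof -
  have "diff_energy f r \<le> 2 * energy f + 2 * energy (\<lambda>t. - f (t - r))"
    using energy_add_le[OF assms(1) decaying_cmult[OF decaying_shift[OF assms]] assms(2), of "-1" r]
    by (simp add: diff_energy_def)
  also have "energy (\<lambda>t. - f (t - r)) = energy f" using energy_shift[of f r] by (simp add: energy_def)
  finally show ?thesis by simp
qed

lemma diff_energy_double_le:
  assumes "decaying \<epsilon> f" "\<epsilon> > 0" shows "diff_energy f (2 * r) \<le> 4 * diff_energy f r"
proof -
  have d: "decaying \<epsilon> (\<lambda>t. f t - f (t - r))" by (intro decaying_diff decaying_shift assms)
  have "diff_energy f (2 * r) = energy (\<lambda>t. (f t - f (t - r)) + (f (t - r) - f ((t - r) - r)))"
    by (simp add: diff_energy_def algebra_simps)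
  also have "\<dots> \<le> 2 * energy (\<lambda>t. f t - f (t - r)) + 2 * energy (\<lambda>t. f (t - r) - f ((t - r) - r))"
    by (rule energy_add_le[OF d decaying_shift[OF d assms(2)] assms(2)])
  also have "energy (\<lambda>t. f (t - r) - f ((t - r) - r)) = energy (\<lambda>t. f t - f (t - r))"
    by (rule energy_shift)
  finally show ?thesis by (simp add: diff_energy_def)
qed

lemma integrable_gauss_diff_energy:
  assumes "decaying \<epsilon> f" "\<epsilon> > 0" "c > 0"
  shows "integrable lborel (\<lambda>r. exp (- c * r\<^sup>2) * diff_energy f r)"
proof (rule Bochner_Integration.integrable_bound[OF integrable_mult_left[OF real_gaussian_integral(1)[OF assms(3)], of "4 * energy f"]])
  note [measurable] = decaying_measurable[OF assms(1)]
  show "(\<lambda>r. exp (- c * r\<^sup>2) * diff_energy f r) \<in> borel_measurable lborel" by measurable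
  show "AE r in lborel. norm (exp (- c * r\<^sup>2) * diff_energy f r) \<le> norm (exp (- c * r\<^sup>2) * (4 * energy f))"
    using diff_energy_le[OF assms(1,2)] by (intro AE_I2) (simp add: abs_mult diff_energy_nonneg energy_nonneg)
qed

lemma gauss_diff_energy_nonneg: "gauss_diff_energy c f \<ge> 0"
  unfolding gauss_diff_energy_def by (intro Bochner_Integration.integral_nonneg) (simp add: diff_energy_nonneg)

lemma gauss_diff_energy_mono:
  assumes "decaying \<epsilon> f" "\<epsilon> > 0" "0 < c" "c \<le> c'"
  shows "gauss_diff_energy c' f \<le> gauss_diff_energy c f"
  unfolding gauss_diff_energy_def
proof (intro integral_mono)
  show "exp (- c' * r\<^sup>2) * diff_energy f r \<le> exp (- c * r\<^sup>2) * diff_energy f r" for r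
    using assms(4) by (intro mult_right_mono) (auto simp: diff_energy_nonneg mult_right_mono)
qed (use integrable_gauss_diff_energy[OF assms(1,2)] assms in auto)

text \<open>
  A translation by \<open>2r\<close> is two translations by \<open>r\<close>, which costs a factor \<open>4\<close>; the substitution
  \<open>r \<rightarrow> 2r\<close> contributes the remaining \<open>2\<close>.
\<close>

lemma gauss_diff_energy_quarter_le:
  assumes "decaying \<epsilon> f" "\<epsilon> > 0" "c > 0"
  shows "gauss_diff_energy (c / 4) f \<le> 8 * gauss_diff_energy c f"
proof -
  note [measurable] = decaying_measurable[OF assms(1)]
  have "gauss_diff_energy (c / 4) f = 2 * (\<integral>s. exp (- (c / 4) * (2 * s)\<^sup>2) * diff_energy f (2 * s) \<partial>lborel)"
    unfolding gauss_diff_energy_def by (subst lborel_integral_real_affine[of 2 _ 0]) auto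
  also have "(\<lambda>s. exp (- (c / 4) * (2 * s)\<^sup>2) * diff_energy f (2 * s)) = (\<lambda>s. exp (- c * s\<^sup>2) * diff_energy f (2 * s))"
    by (simp add: power_mult_distrib)
  also have "(\<integral>s. exp (- c * s\<^sup>2) * diff_energy f (2 * s) \<partial>lborel) \<le> (\<integral>s. 4 * (exp (- c * s\<^sup>2) * diff_energy f s) \<partial>lborel)"
  proof (rule integral_mono)
    show i: "integrable lborel (\<lambda>s. 4 * (exp (- c * s\<^sup>2) * diff_energy f s))"
      using integrable_gauss_diff_energy[OF assms] by simp
    show le: "exp (- c * s\<^sup>2) * diff_energy f (2 * s) \<le> 4 * (exp (- c * s\<^sup>2) * diff_energy f s)" for s
      using mult_left_mono[OF diff_energy_double_le[OF assms(1,2), of s], of "exp (- c * s\<^sup>2)"] by simp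
    show "integrable lborel (\<lambda>s. exp (- c * s\<^sup>2) * diff_energy f (2 * s))"
    proof (rule Bochner_Integration.integrable_bound[OF i])
      show "AE s in lborel. norm (exp (- c * s\<^sup>2) * diff_energy f (2 * s)) \<le> norm (4 * (exp (- c * s\<^sup>2) * diff_energy f s))"
        using le by (intro AE_I2) (simp add: abs_mult diff_energy_nonneg)
    qed measurable
  qed
  also have "\<dots> = 4 * gauss_diff_energy c f" by (simp add: gauss_diff_energy_def)
  finally show ?thesis by simp
qed

lemma gauss_diff_energy_scale_le:
  assumes "decaying \<epsilon> f" "\<epsilon> > 0" "c > 0"
  shows "gauss_diff_energy (c / 4 ^ p) f \<le> 8 ^ p * gauss_diff_energy c f"
proof (induction p)
  case (Suc p)
  have "gauss_diff_energy (c / 4 ^ Suc p) f \<le> 8 * gauss_diff_energy (c / 4 ^ p) f"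
    using gauss_diff_energy_quarter_le[OF assms(1,2), of "c / 4 ^ p"] assms(3) by (simp add: mult.commute)
  with Suc show ?case by simp
qed simp

text \<open>
  Expanding the energy of the convolution gives \<open>\<integral>\<integral> f(t) cnj (f(t - r)) P(r)\<close> with the autocorrelation \<open>P\<close> of
  the kernel. Since \<open>P\<close> is a probability density and \<open>2 Re (f(t) cnj (f(t - r)))\<close> is the sum of the two
  squared moduli minus \<open>\<bar>f(t) - f(t - r)\<bar>\<^sup>2\<close>, only the translation energy is lost.
\<close>

lemma energy_heat:
  assumes "Im k > 0" "l > 0" "\<epsilon> > 0" and f: "decaying \<epsilon> f"
  defines "c \<equiv> spread_rate k l"
  shows "energy f - energy (heat k l f) = sqrt (c / pi) / 2 * gauss_diff_energy c f"
proof -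
  have c: "c > 0" using assms by (simp add: c_def spread_rate_pos)
  define P where "P = (\<lambda>r. sqrt (c / pi) * exp (- c * r\<^sup>2))"
  have P: "integrable lborel P" "(\<integral>r. P r \<partial>lborel) = 1" "\<And>r. P r \<ge> 0"
    using real_gaussian_integral[OF c] c by (auto simp: P_def real_sqrt_divide)
  have [measurable]: "P \<in> borel_measurable borel" unfolding P_def by measurable
  note [measurable] = decaying_measurable[OF f]
  obtain B where B: "B \<ge> 0" "\<And>t. norm (f t) \<le> B"
    using decaying_imp_bounded[OF f assms(3)] by (rule bounded_measurableE) blast
  let ?h = "heat k l f" and ?G = "green k l"
  have h: "decaying \<epsilon> ?h" using assms by (intro decaying_heat)
  have G: "decaying \<epsilon> ?G" "decaying \<epsilon> (\<lambda>t. cnj (?G t))" using assms by (auto intro: decaying_green decaying_cnj)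
  have Gb: "bounded_measurable (\<lambda>y. ?G (y - t))" for t
    using decaying_imp_bounded[OF decaying_shift[OF G(1) assms(3)] assms(3)] .
  have "complex_of_real (energy ?h) = (\<integral>y. cnj (?h y) * (\<integral>t. ?G (y - t) * f t \<partial>lborel) \<partial>lborel)"
    by (simp add: energy_eq_integral heat_def mult.commute)
  also have "\<dots> = (\<integral>t. f t * (\<integral>y. ?G (y - t) * cnj (?h y) \<partial>lborel) \<partial>lborel)"
    by (rule convolution_transpose(1)[OF assms(3) G(1) f bounded_measurable_cnj[OF decaying_imp_bounded[OF h assms(3)]]])
  also have "\<dots> = (\<integral>t. f t * (\<integral>r. cnj (f (t - r)) * of_real (P r) \<partial>lborel) \<partial>lborel)"
  proof (rule Bochner_Integration.integral_cong[OF refl], rule arg_cong2[of _ _ _ _ "(*)", OF refl])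
    fix t
    have "(\<integral>y. ?G (y - t) * cnj (?h y) \<partial>lborel) = (\<integral>y. ?G (y - t) * (\<integral>s. cnj (?G (y - s)) * cnj (f s) \<partial>lborel) \<partial>lborel)"
    proof -
      have "cnj (?h y) = (\<integral>s. cnj (?G (y - s)) * cnj (f s) \<partial>lborel)" for y
        unfolding heat_def by (simp flip: complex_cnj_mult)
      then show ?thesis by simp
    qed
    also have "\<dots> = (\<integral>s. cnj (f s) * (\<integral>y. cnj (?G (y - s)) * ?G (y - t) \<partial>lborel) \<partial>lborel)"
      by (rule convolution_transpose(1)[OF assms(3) G(2) decaying_cnj[OF f] Gb])
    also have "\<dots> = (\<integral>s. cnj (f s) * of_real (P (t - s)) \<partial>lborel)"
      using green_autocorrelation[OF assms(1,2)] by (simp add: P_def c_def)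
    also have "\<dots> = (\<integral>r. cnj (f (t - r)) * of_real (P r) \<partial>lborel)"
      by (subst lborel_integral_real_affine[of "-1" _ t]) auto
    finally show "(\<integral>y. ?G (y - t) * cnj (?h y) \<partial>lborel) = (\<integral>r. cnj (f (t - r)) * of_real (P r) \<partial>lborel)" .
  qed
  also have "\<dots> = (\<integral>t. (\<integral>r. f t * (cnj (f (t - r)) * of_real (P r)) \<partial>lborel) \<partial>lborel)" by simp
  finally have e1: "complex_of_real (energy ?h) = (\<integral>t. (\<integral>r. f t * (cnj (f (t - r)) * of_real (P r)) \<partial>lborel) \<partial>lborel)" .
  have bound: "norm (f t * (cnj (f (t - r)) * of_real (P r))) \<le> norm (f t) * (B * P r)" for t r
    using P(3)[of r] B(2)[of "t - r"] by (auto simp: norm_mult intro!: mult_left_mono mult_right_mono)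
  have nf: "integrable lborel (\<lambda>t. norm (f t))" using decaying_integrable[OF f assms(3)] by (rule integrable_norm)
  note fub = fubini_product_bound[where F = "\<lambda>t r. f t * (cnj (f (t - r)) * of_real (P r))",
      OF _ bound nf integrable_mult_right[OF P(1)]]
  have e2: "complex_of_real (energy ?h) = (\<integral>r. (\<integral>t. f t * (cnj (f (t - r)) * of_real (P r)) \<partial>lborel) \<partial>lborel)"
    unfolding e1 using B P by (intro fub(1)) auto
  have i2: "integrable lborel (\<lambda>r. (\<integral>t. f t * (cnj (f (t - r)) * of_real (P r)) \<partial>lborel))"
    using B P by (intro fub(3)) auto
  have R: "Re (\<integral>t. f t * (cnj (f (t - r)) * of_real (P r)) \<partial>lborel) = P r * energy f - P r * diff_energy f r / 2" for r
  proof -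
    have d: "decaying \<epsilon> (\<lambda>t. f (t - r))" by (rule decaying_shift[OF f assms(3)])
    have i: "integrable lborel (\<lambda>t. f t * cnj (f (t - r)))"
      by (intro decaying_integrable[OF _ assms(3)] decaying_mult_bounded f bounded_measurable_cnj decaying_imp_bounded[OF d assms(3)])
    have "diff_energy f r = (\<integral>t. (norm (f t))\<^sup>2 + (norm (f (t - r)))\<^sup>2 - 2 * Re (f t * cnj (f (t - r))) \<partial>lborel)"
      unfolding diff_energy_def energy_def
      by (intro Bochner_Integration.integral_cong refl) (simp only: cmod_power2, simp add: power2_eq_square algebra_simps)
    also have "\<dots> = energy f + energy (\<lambda>t. f (t - r)) - 2 * Re (\<integral>t. f t * cnj (f (t - r)) \<partial>lborel)"
    proof -
      define C where "C = (\<lambda>t. Re (f t * cnj (f (t - r))))"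
      have "integrable lborel C" "(\<integral>t. C t \<partial>lborel) = Re (\<integral>t. f t * cnj (f (t - r)) \<partial>lborel)"
        unfolding C_def by (rule integrable_Re[OF i], rule integral_Re[OF i])
      then show ?thesis
        using energy_integrable[OF f assms(3)] energy_integrable[OF d assms(3)]
        by (simp add: energy_def fun_cong[OF C_def, symmetric] del: times_complex.sel)
    qed
    finally have *: "Re (\<integral>t. f t * cnj (f (t - r)) \<partial>lborel) = energy f - diff_energy f r / 2"
      by (simp add: energy_shift field_simps)
    have "(\<integral>t. f t * (cnj (f (t - r)) * of_real (P r)) \<partial>lborel) = of_real (P r) * (\<integral>t. f t * cnj (f (t - r)) \<partial>lborel)"
      by (subst integral_mult_right_zero[symmetric]) (simp add: mult_ac)
    then show ?thesis using * by (simp add: right_diff_distrib)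
  qed
  have iP: "integrable lborel (\<lambda>r. P r * diff_energy f r / 2)"
    using integrable_gauss_diff_energy[OF f assms(3) c] by (simp add: P_def mult.assoc)
  have "energy ?h = Re (\<integral>r. (\<integral>t. f t * (cnj (f (t - r)) * of_real (P r)) \<partial>lborel) \<partial>lborel)"
    using e2 by (metis Re_complex_of_real)
  also have "\<dots> = (\<integral>r. P r * energy f - P r * diff_energy f r / 2 \<partial>lborel)"
    using integral_Re[OF i2] R by simp
  also have "\<dots> = energy f - (\<integral>r. P r * diff_energy f r / 2 \<partial>lborel)"
    using P iP by simp
  also have "(\<integral>r. P r * diff_energy f r / 2 \<partial>lborel) = sqrt (c / pi) / 2 * gauss_diff_energy c f"
    unfolding gauss_diff_energy_def P_def by (subst integral_mult_right_zero[symmetric]) (simp add: mult_ac)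
  finally show ?thesis by simp
qed

lemma energy_heat_le:
  assumes "Im k > 0" "l > 0" "\<epsilon> > 0" "decaying \<epsilon> f"
  shows "energy (heat k l f) \<le> energy f"
proof -
  have "0 \<le> sqrt (spread_rate k l / pi) / 2 * gauss_diff_energy (spread_rate k l) f"
    using spread_rate_pos[OF assms(1,2)] by (simp add: gauss_diff_energy_nonneg)
  then show ?thesis using energy_heat[OF assms] by linarith
qed

text \<open>
  Cauchy--Schwarz for the weight \<open>w\<close>, from the discriminant of a nonnegative quadratic.
\<close>

lemma weighted_square_le:
  assumes w: "integrable lborel w" "\<And>r. w r \<ge> 0"
    and d: "bounded_measurable d"
  shows "(norm (\<integral>r. of_real (w r) * d r \<partial>lborel))\<^sup>2 \<le> (\<integral>r. w r \<partial>lborel) * (\<integral>r. w r * (norm (d r))\<^sup>2 \<partial>lborel)"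
proof -
  obtain B where B: "B \<ge> 0" "\<And>t. norm (d t) \<le> B" using d by (rule bounded_measurableE) blast
  note [measurable] = bounded_measurable_measurable[OF d] borel_measurable_integrable[OF w(1)]
  define I where "I = (\<integral>r. w r \<partial>lborel)"
  define M where "M = (\<integral>r. w r * norm (d r) \<partial>lborel)"
  define Q where "Q = (\<integral>r. w r * (norm (d r))\<^sup>2 \<partial>lborel)"
  have i1: "integrable lborel (\<lambda>r. w r * norm (d r))"
    by (rule Bochner_Integration.integrable_bound[OF integrable_mult_left[OF w(1), of B]])
      (use w B in \<open>auto simp: abs_mult intro!: mult_left_mono\<close>)
  have i2: "integrable lborel (\<lambda>r. w r * (norm (d r))\<^sup>2)"
    by (rule Bochner_Integration.integrable_bound[OF integrable_mult_left[OF w(1), of "B\<^sup>2"]])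
      (use w B in \<open>auto simp: abs_mult intro!: mult_left_mono power_mono\<close>)
  have I0: "I \<ge> 0" "M \<ge> 0" "Q \<ge> 0" unfolding I_def M_def Q_def using w(2) by (auto intro!: Bochner_Integration.integral_nonneg)
  have n: "norm (\<integral>r. of_real (w r) * d r \<partial>lborel) \<le> M"
    unfolding M_def using i1 w(2) by (intro norm_integral_le) (auto simp: norm_mult)
  have quad: "0 \<le> Q - 2 * x * M + x\<^sup>2 * I" for x
  proof -
    have "0 \<le> (\<integral>r. w r * (norm (d r) - x)\<^sup>2 \<partial>lborel)"
      using w(2) by (intro Bochner_Integration.integral_nonneg) auto
    also have "\<dots> = (\<integral>r. w r * (norm (d r))\<^sup>2 - 2 * x * (w r * norm (d r)) + x\<^sup>2 * w r \<partial>lborel)"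
      by (intro Bochner_Integration.integral_cong refl) (simp add: power2_eq_square algebra_simps)
    also have "\<dots> = Q - 2 * x * M + x\<^sup>2 * I"
      using i1 i2 w(1) by (simp add: Q_def M_def I_def)
    finally show ?thesis .
  qed
  have "M\<^sup>2 \<le> I * Q"
  proof (cases "I = 0")
    case True
    have "M = 0"
    proof (rule ccontr)
      assume "M \<noteq> 0"
      then have "M > 0" using I0 by simp
      then show False using quad[of "(Q + 1) / (2 * M)"] True by (simp add: field_simps)
    qed
    then show ?thesis using True by simp
  next
    case False
    then have "I > 0" using I0 by simp
    then show ?thesis using quad[of "M / I"] by (simp add: field_simps power2_eq_square)
  qed
  moreover have "(norm (\<integral>r. of_real (w r) * d r \<partial>lborel))\<^sup>2 \<le> M\<^sup>2" using n by (intro power_mono) auto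
  ultimately show ?thesis by (simp add: I_def Q_def)
qed

text \<open>
  The kernel only enters through its absolute value, which is dominated by a sufficiently wide
  Gaussian; widening the Gaussian in \<^const>\<open>gauss_diff_energy\<close> costs no more than a constant factor.
\<close>

lemma heat_dissipation:
  assumes "Im k > 0" "l > 0"
  obtains C where "C \<ge> 0"
    "\<And>\<epsilon> f. \<epsilon> > 0 \<Longrightarrow> decaying \<epsilon> f \<Longrightarrow>
       energy (\<lambda>t. f t - heat k l f t) \<le> C * (energy f - energy (heat k l f))"
proof -
  define c where "c = spread_rate k l"
  define A where "A = Im k / (2 * l)"
  define g where "g = norm (csqrt (gexp k l / of_real pi))"
  define p where "p = sqrt (c / pi) / 2"
  have c: "c > 0" using assms by (simp add: c_def spread_rate_pos)
  have A: "A > 0" using assms by (simp add: A_def)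
  have g: "g \<ge> 0" by (simp add: g_def)
  have p: "p > 0" using c by (simp add: p_def)
  \<comment> \<open>The energy loss is measured with the Gaussian rate \<open>c\<close>, the modulus of the kernel decays with rate
    \<open>A\<close>; quartering the former \<open>m\<close> times brings it below the latter.\<close>
  obtain m where "c / A < 4 ^ m" using real_arch_pow[of 4 "c / A"] by auto
  then have m: "c / 4 ^ m \<le> A" using A by (simp add: field_simps)
  have nG: "norm (green k l r) = g * exp (- A * r\<^sup>2)" for r
    using norm_green[OF assms(2)] by (simp add: g_def A_def)
  have iG: "integrable lborel (\<lambda>r. norm (green k l r))"
    unfolding nG using real_gaussian_integral(1)[OF A] by simp
  define I where "I = (\<integral>r. norm (green k l r) \<partial>lborel)"
  have I0: "I \<ge> 0" by (simp add: I_def)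
  show ?thesis
  proof (rule that[of "I * g * 8 ^ m / p"])
    show "0 \<le> I * g * 8 ^ m / p" using I0 g p by simp
    fix \<epsilon> :: real and f assume \<epsilon>: "\<epsilon> > 0" and f: "decaying \<epsilon> f"
    note [measurable] = decaying_measurable[OF f]
    have d: "decaying \<epsilon> (\<lambda>t. f t - f (t - r))" for r by (intro decaying_diff decaying_shift f \<epsilon>)
    have point: "(norm (f y - heat k l f y))\<^sup>2 \<le> I * (\<integral>r. norm (green k l r) * (norm (f y - f (y - r)))\<^sup>2 \<partial>lborel)" for y
    proof -
      have fb: "bounded_measurable f" using decaying_imp_bounded[OF f \<epsilon>] .
      have b: "bounded_measurable (\<lambda>r. sgn (green k l r) * (f y - f (y - r)))"
      proof -
        obtain B where B: "B \<ge> 0" "\<And>t. norm (f t) \<le> B" using fb by (rule bounded_measurableE) blast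
        have "norm (sgn (green k l r) * (f y - f (y - r))) \<le> 1 * (B + B)" for r
          unfolding norm_mult using B by (intro mult_mono norm_triangle_le_diff add_mono) (auto simp: norm_sgn)
        moreover have "(\<lambda>r. sgn (green k l r) * (f y - f (y - r))) \<in> borel_measurable borel"
          unfolding sgn_div_norm by measurable
        ultimately show ?thesis unfolding bounded_measurable_def by blast
      qed
      have i1: "integrable lborel (\<lambda>t. green k l (y - t) * f t)"
        by (rule integrable_convolution[OF \<epsilon> decaying_green(1)[OF assms] fb])
      then have i1': "integrable lborel (\<lambda>r. green k l r * f (y - r))"
        using lborel_integrable_real_affine_iff[of "-1" "\<lambda>t. green k l (y - t) * f t" y] by simp
      have "heat k l f y = (\<integral>r. green k l r * f (y - r) \<partial>lborel)"
        unfolding heat_def by (subst lborel_integral_real_affine[of "-1" _ y]) auto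
      moreover have "f y = (\<integral>r. green k l r * f y \<partial>lborel)"
        using integral_green[OF assms] by simp
      moreover have "integrable lborel (green k l)"
        by (rule decaying_integrable[OF decaying_green(1)[OF assms] \<epsilon>])
      ultimately have "f y - heat k l f y = (\<integral>r. green k l r * f y - green k l r * f (y - r) \<partial>lborel)"
        using i1' by simp
      also have "\<dots> = (\<integral>r. of_real (norm (green k l r)) * (sgn (green k l r) * (f y - f (y - r))) \<partial>lborel)"
        by (intro Bochner_Integration.integral_cong refl)
           (simp add: sgn_eq right_diff_distrib)
      finally have 1: "f y - heat k l f y = \<dots>" .
      have 2: "norm (green k l r) * (norm (sgn (green k l r) * (f y - f (y - r))))\<^sup>2
          = norm (green k l r) * (norm (f y - f (y - r)))\<^sup>2" for r
        by (cases "green k l r = 0") (auto simp: norm_mult norm_sgn)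
      show ?thesis using weighted_square_le[OF iG norm_ge_zero b] unfolding 1 2 I_def .
    qed
    obtain F where F: "F \<ge> 0" "\<And>t. norm (f t) \<le> F * exp (- \<epsilon> * \<bar>t\<bar>)" using f by (rule decayingE) blast
    obtain a where a: "a \<ge> 0" "\<And>t. norm (green k l t) \<le> a * exp (- (2 * \<epsilon> + \<epsilon>) * \<bar>t\<bar>)"
      using decaying_green(1)[OF assms] by (rule decayingE) blast
    have bound: "norm (norm (green k l r) * (norm (f y - f (y - r)))\<^sup>2)
       \<le> (4 * F\<^sup>2 * a * exp (- \<epsilon> * \<bar>y\<bar>)) * exp (- \<epsilon> * \<bar>r\<bar>)" for y r
    proof -
      have e: "exp (- \<epsilon> * \<bar>y - r\<bar>) \<le> exp (- \<epsilon> * \<bar>y\<bar>) * exp (\<epsilon> * \<bar>r\<bar>)"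
      proof -
        have "\<epsilon> * \<bar>y\<bar> \<le> \<epsilon> * (\<bar>y - r\<bar> + \<bar>r\<bar>)" using \<epsilon> by (intro mult_left_mono) auto
        then show ?thesis by (simp add: exp_add[symmetric] algebra_simps)
      qed
      have "norm (f y - f (y - r)) \<le> F * exp (- \<epsilon> * \<bar>y\<bar>) + F * exp (- \<epsilon> * \<bar>y - r\<bar>)"
        using F by (intro norm_triangle_le_diff add_mono) auto
      also have "\<dots> \<le> F * exp (- \<epsilon> * \<bar>y\<bar>) * exp (\<epsilon> * \<bar>r\<bar>) + F * (exp (- \<epsilon> * \<bar>y\<bar>) * exp (\<epsilon> * \<bar>r\<bar>))"
      proof (rule add_mono)
        have "F * exp (- \<epsilon> * \<bar>y\<bar>) * 1 \<le> F * exp (- \<epsilon> * \<bar>y\<bar>) * exp (\<epsilon> * \<bar>r\<bar>)"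
          using F \<epsilon> by (intro mult_left_mono) auto
        then show "F * exp (- \<epsilon> * \<bar>y\<bar>) \<le> F * exp (- \<epsilon> * \<bar>y\<bar>) * exp (\<epsilon> * \<bar>r\<bar>)" by simp
      qed (use e F in \<open>intro mult_left_mono\<close>)
      finally have 1: "norm (f y - f (y - r)) \<le> 2 * F * exp (- \<epsilon> * \<bar>y\<bar>) * exp (\<epsilon> * \<bar>r\<bar>)" by (simp add: mult_ac)
      have "(norm (f y - f (y - r)))\<^sup>2 \<le> (2 * F * exp (- \<epsilon> * \<bar>y\<bar>) * exp (\<epsilon> * \<bar>r\<bar>))\<^sup>2"
        using 1 by (intro power_mono) auto
      also have "\<dots> = 4 * F\<^sup>2 * ((exp (- \<epsilon> * \<bar>y\<bar>) * exp (- \<epsilon> * \<bar>y\<bar>)) * (exp (\<epsilon> * \<bar>r\<bar>) * exp (\<epsilon> * \<bar>r\<bar>)))"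
        by (simp add: power2_eq_square mult_ac)
      also have "\<dots> \<le> 4 * F\<^sup>2 * ((1 * exp (- \<epsilon> * \<bar>y\<bar>)) * (exp (\<epsilon> * \<bar>r\<bar>) * exp (\<epsilon> * \<bar>r\<bar>)))"
        using F \<epsilon> by (intro mult_left_mono mult_right_mono) auto
      finally have 2: "(norm (f y - f (y - r)))\<^sup>2 \<le> 4 * F\<^sup>2 * (exp (- \<epsilon> * \<bar>y\<bar>) * exp (2 * \<epsilon> * \<bar>r\<bar>))"
        by (simp add: exp_add[symmetric] mult_ac)
      have "norm (green k l r) * (norm (f y - f (y - r)))\<^sup>2
         \<le> (a * exp (- (2 * \<epsilon> + \<epsilon>) * \<bar>r\<bar>)) * (4 * F\<^sup>2 * (exp (- \<epsilon> * \<bar>y\<bar>) * exp (2 * \<epsilon> * \<bar>r\<bar>)))"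
        using 2 a F by (intro mult_mono) auto
      also have "\<dots> = (4 * F\<^sup>2 * a * exp (- \<epsilon> * \<bar>y\<bar>)) * (exp (- (2 * \<epsilon> + \<epsilon>) * \<bar>r\<bar>) * exp (2 * \<epsilon> * \<bar>r\<bar>))"
        by simp
      also have "exp (- (2 * \<epsilon> + \<epsilon>) * \<bar>r\<bar>) * exp (2 * \<epsilon> * \<bar>r\<bar>) = exp (- \<epsilon> * \<bar>r\<bar>)"
        by (simp add: exp_add[symmetric] algebra_simps)
      finally show ?thesis by simp
    qed
    note fub = fubini_product_bound[where F = "\<lambda>y r. norm (green k l r) * (norm (f y - f (y - r)))\<^sup>2",
        OF _ bound integrable_mult_right[OF integrable_exp_abs[OF \<epsilon>]] integrable_exp_abs[OF \<epsilon>]]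
    have "energy (\<lambda>t. f t - heat k l f t)
       \<le> (\<integral>y. I * (\<integral>r. norm (green k l r) * (norm (f y - f (y - r)))\<^sup>2 \<partial>lborel) \<partial>lborel)"
      unfolding energy_def
    proof (rule integral_mono)
      show "integrable lborel (\<lambda>t. (norm (f t - heat k l f t))\<^sup>2)"
        by (rule energy_integrable[OF decaying_diff[OF f decaying_heat[OF assms \<epsilon> f]] \<epsilon>])
      show "integrable lborel (\<lambda>y. I * (\<integral>r. norm (green k l r) * (norm (f y - f (y - r)))\<^sup>2 \<partial>lborel))"
        using F a by (intro integrable_mult_right fub(2)) auto
    qed (use point in auto)
    also have "\<dots> = I * (\<integral>y. (\<integral>r. norm (green k l r) * (norm (f y - f (y - r)))\<^sup>2 \<partial>lborel) \<partial>lborel)" by simp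
    also have "(\<integral>y. (\<integral>r. norm (green k l r) * (norm (f y - f (y - r)))\<^sup>2 \<partial>lborel) \<partial>lborel)
       = (\<integral>r. (\<integral>y. norm (green k l r) * (norm (f y - f (y - r)))\<^sup>2 \<partial>lborel) \<partial>lborel)"
      using F a by (intro fub(1)) auto
    also have "\<dots> = g * gauss_diff_energy A f"
      unfolding gauss_diff_energy_def diff_energy_def energy_def nG by (simp add: mult.assoc)
    also have "gauss_diff_energy A f \<le> gauss_diff_energy (c / 4 ^ m) f"
      using c m by (intro gauss_diff_energy_mono[OF f \<epsilon>]) auto
    also have "\<dots> \<le> 8 ^ m * gauss_diff_energy c f"
      by (rule gauss_diff_energy_scale_le[OF f \<epsilon> c])
    also have "gauss_diff_energy c f = (energy f - energy (heat k l f)) / p"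
      using energy_heat[OF assms \<epsilon> f] p by (simp add: c_def p_def field_simps)
    finally show "energy (\<lambda>t. f t - heat k l f t) \<le> I * g * 8 ^ m / p * (energy f - energy (heat k l f))"
      using I0 g by (simp add: mult_left_mono mult.assoc)
  qed
qed

text \<open>
  A multiple of \<open>f(t)\<close> is the sum of \<open>\<integral> e\<^bsup>-cr\<^sup>2\<^esup> (f(t) - f(t - r)) dr\<close>, controlled by the translation energy, and
  of the smoothed value \<open>\<integral> e\<^bsup>-cr\<^sup>2\<^esup> f(t - r) dr\<close>, which is bounded by Cauchy--Schwarz. Compared with the left-hand side, the
  second contribution becomes small for wide Gaussians and a large weight \<open>\<sigma>\<close>.
\<close>

lemma pairing_le_gauss_diff_energy:
  assumes f: "decaying \<epsilon> f" and z: "decaying \<epsilon> z" and \<epsilon>: "\<epsilon> > 0" and c: "c > 0" and \<tau>: "\<tau> > 0" and \<sigma>: "\<sigma> > 0"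
  shows "norm (\<integral>t. f t * z t \<partial>lborel) * sqrt (pi / c)
    \<le> (\<tau> * gauss_diff_energy c f + sqrt (pi / c) * energy z / \<tau>) / 2
       + (\<integral>t. norm (z t) \<partial>lborel) * ((\<sigma> * energy f + sqrt (pi / c) / \<sigma>) / 2)"
proof -
  define N where "N = sqrt (pi / c)"
  define e where "e = (\<lambda>r. exp (- c * r\<^sup>2))"
  have e: "integrable lborel e" "(\<integral>r. e r \<partial>lborel) = N" "\<And>r. e r \<ge> 0"
    using real_gaussian_integral[OF c] by (auto simp: e_def N_def)
  have N: "N > 0" using c by (simp add: N_def)
  have [measurable]: "e \<in> borel_measurable borel" unfolding e_def by measurable
  note [measurable] = decaying_measurable[OF f] decaying_measurable[OF z]
  obtain B where B: "B \<ge> 0" "\<And>t. norm (f t) \<le> B"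
    using decaying_imp_bounded[OF f \<epsilon>] by (rule bounded_measurableE) blast
  have nz: "integrable lborel (\<lambda>t. norm (z t))" using decaying_integrable[OF z \<epsilon>] by (rule integrable_norm)
  have d: "decaying \<epsilon> (\<lambda>t. f t - f (t - r))" for r by (intro decaying_diff decaying_shift f \<epsilon>)
  have ee: "decaying \<epsilon> (\<lambda>r. complex_of_real (e r))"
    using gaussian_le_exp_abs[OF c, of _ \<epsilon>] unfolding decaying_def e_def
    by (auto intro!: exI[of _ "exp (\<epsilon>\<^sup>2 / (4 * c))"])
  have energy_e: "energy (\<lambda>r. complex_of_real (e r)) \<le> N"
  proof -
    have "energy (\<lambda>r. complex_of_real (e r)) \<le> (\<integral>r. e r \<partial>lborel)"
      unfolding energy_def
    proof (rule integral_mono)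
      show "integrable lborel (\<lambda>r. (norm (complex_of_real (e r)))\<^sup>2)" by (rule energy_integrable[OF ee \<epsilon>])
      fix r
      have "0 \<le> e r" "e r \<le> 1" using c by (auto simp: e_def)
      then show "(norm (complex_of_real (e r)))\<^sup>2 \<le> e r" by (simp add: power2_eq_square mult_left_le)
    qed (rule e)
    then show ?thesis using e by simp
  qed
  have sup: "norm (\<integral>r. of_real (e r) * f (t - r) \<partial>lborel) \<le> (\<sigma> * energy f + N / \<sigma>) / 2" for t
  proof -
    have f1: "decaying \<epsilon> (\<lambda>r. f (- r))"
    proof -
      obtain C where C: "\<And>t. norm (f t) \<le> C * exp (- \<epsilon> * \<bar>t\<bar>)" using f by (rule decayingE) blast
      have "norm (f (- r)) \<le> C * exp (- \<epsilon> * \<bar>r\<bar>)" for r using C[of "- r"] by simp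
      then show ?thesis unfolding decaying_def by (intro conjI exI[of _ C] allI) measurable
    qed
    have f2: "decaying \<epsilon> (\<lambda>r. f (t - r))" using decaying_shift[OF f1 \<epsilon>, of t] by simp
    have "energy (\<lambda>r. f (t - r)) = energy f"
      unfolding energy_def using lborel_integral_real_affine[of "-1" "\<lambda>t. (norm (f t))\<^sup>2" t] by simp
    then have "norm (\<integral>r. f (t - r) * of_real (e r) \<partial>lborel) \<le> (\<sigma> * energy f + energy (\<lambda>r. complex_of_real (e r)) / \<sigma>) / 2"
      using pairing_le_energy[OF f2 ee \<epsilon> \<sigma>] by simp
    also have "\<dots> \<le> (\<sigma> * energy f + N / \<sigma>) / 2"
      using energy_e \<sigma> by (simp add: divide_right_mono)
    finally show ?thesis by (simp add: mult.commute)
  qed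
  have if2: "integrable lborel (\<lambda>r. of_real (e r) * f (t - r))" for t
    by (rule Bochner_Integration.integrable_bound[OF integrable_mult_left[OF e(1), of B]])
      (use B e in \<open>auto simp: norm_mult intro!: mult_left_mono\<close>)
  have split: "of_real N * f t = (\<integral>r. of_real (e r) * (f t - f (t - r)) \<partial>lborel) + (\<integral>r. of_real (e r) * f (t - r) \<partial>lborel)" for t
  proof -
    have "(\<integral>r. of_real (e r) * (f t - f (t - r)) \<partial>lborel) = (\<integral>r. of_real (e r) * f t - of_real (e r) * f (t - r) \<partial>lborel)"
      by (simp add: right_diff_distrib)
    also have "\<dots> = of_real N * f t - (\<integral>r. of_real (e r) * f (t - r) \<partial>lborel)"
      using if2 e by (subst Bochner_Integration.integral_diff) auto
    finally show ?thesis by simp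
  qed
  have bound: "norm (z t * (of_real (e r) * (f t - f (t - r)))) \<le> (norm (z t) * (2 * B)) * e r" for t r
  proof -
    have "norm (f t - f (t - r)) \<le> B + B" by (intro norm_triangle_le_diff add_mono B)
    then have "norm (z t) * (e r * norm (f t - f (t - r))) \<le> norm (z t) * (e r * (2 * B))"
      using e(3)[of r] by (intro mult_left_mono) auto
    then show ?thesis using e(3)[of r] by (simp add: norm_mult mult_ac)
  qed
  note fub = fubini_product_bound[where F = "\<lambda>t r. z t * (of_real (e r) * (f t - f (t - r)))",
      OF _ bound integrable_mult_left[OF nz] e(1)]
  have i1: "integrable lborel (\<lambda>t. \<integral>r. z t * (of_real (e r) * (f t - f (t - r))) \<partial>lborel)"
    using B e by (intro fub(2)) auto
  have i2: "integrable lborel (\<lambda>t. z t * (\<integral>r. of_real (e r) * f (t - r) \<partial>lborel))"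
  proof (rule Bochner_Integration.integrable_bound[OF integrable_mult_left[OF nz, of "(\<sigma> * energy f + N / \<sigma>) / 2"]])
    show "AE t in lborel. norm (z t * (\<integral>r. of_real (e r) * f (t - r) \<partial>lborel)) \<le> norm (norm (z t) * ((\<sigma> * energy f + N / \<sigma>) / 2))"
    proof (rule AE_I2)
      fix t
      have "norm (z t) * norm (\<integral>r. of_real (e r) * f (t - r) \<partial>lborel) \<le> norm (z t) * ((\<sigma> * energy f + N / \<sigma>) / 2)"
        using sup by (rule mult_left_mono) simp
      then show "norm (z t * (\<integral>r. of_real (e r) * f (t - r) \<partial>lborel)) \<le> norm (norm (z t) * ((\<sigma> * energy f + N / \<sigma>) / 2))"
        by (simp only: norm_mult real_norm_def)
    qed
  qed measurable
  have "of_real N * (\<integral>t. f t * z t \<partial>lborel) = (\<integral>t. z t * (of_real N * f t) \<partial>lborel)"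
    by (subst integral_mult_right_zero[symmetric]) (simp add: mult_ac)
  also have "\<dots> = (\<integral>t. (\<integral>r. z t * (of_real (e r) * (f t - f (t - r))) \<partial>lborel) + z t * (\<integral>r. of_real (e r) * f (t - r) \<partial>lborel) \<partial>lborel)"
    by (simp only: split distrib_left integral_mult_right_zero)
  also have "\<dots> = (\<integral>t. (\<integral>r. z t * (of_real (e r) * (f t - f (t - r))) \<partial>lborel) \<partial>lborel) + (\<integral>t. z t * (\<integral>r. of_real (e r) * f (t - r) \<partial>lborel) \<partial>lborel)"
    using i1 i2 by (rule Bochner_Integration.integral_add)
  also have "(\<integral>t. (\<integral>r. z t * (of_real (e r) * (f t - f (t - r))) \<partial>lborel) \<partial>lborel)
     = (\<integral>r. (\<integral>t. z t * (of_real (e r) * (f t - f (t - r))) \<partial>lborel) \<partial>lborel)"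
    using B e by (intro fub(1)) auto
  finally have eq: "of_real N * (\<integral>t. f t * z t \<partial>lborel)
     = (\<integral>r. (\<integral>t. z t * (of_real (e r) * (f t - f (t - r))) \<partial>lborel) \<partial>lborel)
       + (\<integral>t. z t * (\<integral>r. of_real (e r) * f (t - r) \<partial>lborel) \<partial>lborel)" .
  have b1: "norm (\<integral>r. (\<integral>t. z t * (of_real (e r) * (f t - f (t - r))) \<partial>lborel) \<partial>lborel)
     \<le> (\<integral>r. \<tau> / 2 * (e r * diff_energy f r) + (energy z / (2 * \<tau>)) * e r \<partial>lborel)"
  proof (rule norm_integral_le)
    show "integrable lborel (\<lambda>r. \<tau> / 2 * (e r * diff_energy f r) + (energy z / (2 * \<tau>)) * e r)"
      using integrable_gauss_diff_energy[OF f \<epsilon> c] e by (auto simp: e_def)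
    fix r
    have "(\<integral>t. z t * (of_real (e r) * (f t - f (t - r))) \<partial>lborel) = of_real (e r) * (\<integral>t. (f t - f (t - r)) * z t \<partial>lborel)"
      by (subst integral_mult_right_zero[symmetric]) (simp add: mult_ac)
    then have "norm (\<integral>t. z t * (of_real (e r) * (f t - f (t - r))) \<partial>lborel) = e r * norm (\<integral>t. (f t - f (t - r)) * z t \<partial>lborel)"
      using e(3)[of r] by (simp add: norm_mult)
    also have "\<dots> \<le> e r * ((\<tau> * diff_energy f r + energy z / \<tau>) / 2)"
      using pairing_le_energy[OF d z \<epsilon> \<tau>] e(3)[of r] by (intro mult_left_mono) (auto simp: diff_energy_def)
    finally show "norm (\<integral>t. z t * (of_real (e r) * (f t - f (t - r))) \<partial>lborel)
       \<le> \<tau> / 2 * (e r * diff_energy f r) + (energy z / (2 * \<tau>)) * e r"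
      by (simp add: field_simps)
  qed
  also have "\<dots> = \<tau> / 2 * gauss_diff_energy c f + (energy z / (2 * \<tau>)) * N"
    using integrable_gauss_diff_energy[OF f \<epsilon> c] e by (simp add: e_def[abs_def] gauss_diff_energy_def)
  finally have b1: "norm (\<integral>r. (\<integral>t. z t * (of_real (e r) * (f t - f (t - r))) \<partial>lborel) \<partial>lborel)
     \<le> \<tau> / 2 * gauss_diff_energy c f + (energy z / (2 * \<tau>)) * N" .
  have b2: "norm (\<integral>t. z t * (\<integral>r. of_real (e r) * f (t - r) \<partial>lborel) \<partial>lborel)
     \<le> (\<integral>t. norm (z t) * ((\<sigma> * energy f + N / \<sigma>) / 2) \<partial>lborel)"
  proof (rule norm_integral_le)
    show "integrable lborel (\<lambda>t. norm (z t) * ((\<sigma> * energy f + N / \<sigma>) / 2))" using nz by (rule integrable_mult_left)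
    show "norm (z t * (\<integral>r. of_real (e r) * f (t - r) \<partial>lborel)) \<le> norm (z t) * ((\<sigma> * energy f + N / \<sigma>) / 2)" for t
      unfolding norm_mult using sup by (rule mult_left_mono) simp
  qed
  have "N * norm (\<integral>t. f t * z t \<partial>lborel) = norm (of_real N * (\<integral>t. f t * z t \<partial>lborel))"
    using N by (simp add: norm_mult)
  also have "\<dots> \<le> (\<tau> / 2 * gauss_diff_energy c f + (energy z / (2 * \<tau>)) * N) + (\<integral>t. norm (z t) \<partial>lborel) * ((\<sigma> * energy f + N / \<sigma>) / 2)"
    unfolding eq using b1 b2 by (intro norm_triangle_le add_mono) auto
  finally show ?thesis using \<tau> by (simp add: N_def[symmetric] field_simps)
qed

text \<open>
  Bounded energy and vanishing translation energy force weak convergence to zero: on the line, a function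
  that hardly changes under translations is spread out.
\<close>

lemma tendsto_pairing_zero:
  assumes f: "\<And>i. decaying \<epsilon> (f i)" and z: "decaying \<epsilon> z" and \<epsilon>: "\<epsilon> > 0" and c: "c > 0"
    and M: "\<And>i. energy (f i) \<le> M"
    and lim: "(\<lambda>i. gauss_diff_energy c (f i)) \<longlonglongrightarrow> 0"
  shows "(\<lambda>i. \<integral>t. f i t * z t \<partial>lborel) \<longlonglongrightarrow> 0"
proof (rule LIMSEQ_I)
  fix \<eta> :: real assume \<eta>: "\<eta> > 0"
  define L where "L = (\<integral>t. norm (z t) \<partial>lborel)"
  have L: "L \<ge> 0" by (simp add: L_def)
  have M0: "M \<ge> 0" using M[of 0] energy_nonneg[of "f 0"] by linarith
  \<comment> \<open>The weights make the two terms without \<open>f\<close> small, the width of the Gaussian then makes the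
    term with the energy of \<open>f\<close> small, and finally large \<open>i\<close> the one with the translation energy.\<close>
  define \<tau> where "\<tau> = 2 * energy z / \<eta> + 1"
  have \<tau>: "\<tau> > 0" "energy z / \<tau> \<le> \<eta> / 2" using \<eta> energy_nonneg[of z]
    by (auto simp: \<tau>_def field_simps add_pos_nonneg)
  define \<sigma> where "\<sigma> = 2 * L / \<eta> + 1"
  have \<sigma>: "\<sigma> > 0" "L / \<sigma> \<le> \<eta> / 2" using \<eta> L by (auto simp: \<sigma>_def field_simps add_pos_nonneg)
  define N where "N = (\<lambda>p::nat. sqrt (pi / (c / 4 ^ p)))"
  have N: "N p = sqrt (pi / c) * 2 ^ p" for p
  proof -
    have "N p = sqrt (pi / c * (2 ^ p)\<^sup>2)" unfolding N_def using c by (simp add: power_mult[symmetric] power2_eq_square power_mult_distrib[symmetric])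
    then show ?thesis by (simp only: real_sqrt_mult real_sqrt_abs) simp
  qed
  have N0: "N p > 0" for p using c by (simp add: N)
  obtain p where "2 * (L * \<sigma> * M + 1) / (\<eta> * sqrt (pi / c)) < 2 ^ p" using real_arch_pow[of 2] by auto
  then have "2 * (L * \<sigma> * M + 1) < \<eta> * N p" using \<eta> c by (simp add: N field_simps)
  then have p: "L * \<sigma> * M / N p < \<eta> / 2" using N0[of p] by (simp add: field_simps)
  have lim': "(\<lambda>i. \<tau> * (8 ^ p * gauss_diff_energy c (f i)) / N p) \<longlonglongrightarrow> 0"
    using tendsto_mult_right_zero[OF lim, of "\<tau> * 8 ^ p / N p"] by (simp add: field_simps)
  then have "\<forall>\<^sub>F i in sequentially. \<tau> * (8 ^ p * gauss_diff_energy c (f i)) / N p < \<eta> / 2"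
    using \<eta> by (intro order_tendstoD(2)) auto
  then obtain i0 where i0: "\<And>i. i \<ge> i0 \<Longrightarrow> \<tau> * (8 ^ p * gauss_diff_energy c (f i)) / N p < \<eta> / 2"
    by (auto simp: eventually_sequentially)
  have "norm (\<integral>t. f i t * z t \<partial>lborel) < \<eta>" if "i \<ge> i0" for i
  proof -
    have c': "c / 4 ^ p > 0" using c by simp
    let ?g = "gauss_diff_energy (c / 4 ^ p) (f i)"
    let ?x = "norm (\<integral>t. f i t * z t \<partial>lborel)"
    have "?x * N p \<le> (\<tau> * ?g + N p * energy z / \<tau>) / 2 + L * ((\<sigma> * energy (f i) + N p / \<sigma>) / 2)"
      using pairing_le_gauss_diff_energy[OF f z \<epsilon> c' \<tau>(1) \<sigma>(1)] by (simp add: N_def L_def)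
    then have "?x \<le> ((\<tau> * ?g + N p * energy z / \<tau>) / 2 + L * ((\<sigma> * energy (f i) + N p / \<sigma>) / 2)) / N p"
      using N0[of p] by (simp add: pos_le_divide_eq)
    also have "\<dots> = (\<tau> * ?g / N p + energy z / \<tau> + L * \<sigma> * energy (f i) / N p + L / \<sigma>) / 2"
      using N0[of p] \<sigma>(1) \<tau>(1) by (simp add: field_simps)
    also have "\<dots> < (\<eta> / 2 + \<eta> / 2 + \<eta> / 2 + \<eta> / 2) / 2"
    proof -
      have "\<tau> * ?g / N p \<le> \<tau> * (8 ^ p * gauss_diff_energy c (f i)) / N p"
        using gauss_diff_energy_scale_le[OF f \<epsilon> c, of p i] \<tau>(1) N0[of p]
        by (intro divide_right_mono mult_left_mono) auto
      moreover have "L * \<sigma> * energy (f i) / N p \<le> L * \<sigma> * M / N p"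
        using L \<sigma>(1) M[of i] N0[of p] by (intro divide_right_mono mult_left_mono) auto
      moreover have "(A + B + C + D) / 2 < (\<eta> / 2 + \<eta> / 2 + \<eta> / 2 + \<eta> / 2) / 2"
        if "A < \<eta> / 2" "B \<le> \<eta> / 2" "C < \<eta> / 2" "D \<le> \<eta> / 2" for A B C D :: real
        using that by (simp add: field_simps)
      ultimately show ?thesis using i0[OF that] \<tau>(2) \<sigma>(2) p by (meson order_le_less_trans)
    qed
    finally show ?thesis by simp
  qed
  then show "\<exists>no. \<forall>n\<ge>no. norm ((\<integral>t. f n t * z t \<partial>lborel) - 0) < \<eta>" by auto
qed

section \<open>Iterated evolution through the slabs\<close>

text \<open>
  The difference of the two sheets changes sign across the lower half of an edge and is continuous across
  the upper half.
\<close>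

definition flip :: "(real \<Rightarrow> complex) \<Rightarrow> real \<Rightarrow> complex" where
  "flip f t = of_real (sgn t) * f t"

lemma measurable_flip [measurable (raw)]:
  assumes [measurable]: "f \<in> borel_measurable borel" shows "flip f \<in> borel_measurable borel"
  unfolding flip_def[abs_def] by measurable

lemma norm_flip_le: "norm (flip f t) \<le> norm (f t)"
  by (auto simp: flip_def norm_mult sgn_real_def)

lemma decaying_flip: "decaying \<epsilon> f \<Longrightarrow> decaying \<epsilon> (flip f)"
  unfolding decaying_def using norm_flip_le[of f] order_trans measurable_flip by blast

lemma bounded_measurable_flip: "bounded_measurable f \<Longrightarrow> bounded_measurable (flip f)"
  unfolding bounded_measurable_def using norm_flip_le[of f] order_trans measurable_flip by blast

lemma AE_nonzero: "AE t in lborel. t \<noteq> (0::real)"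
  by (rule AE_lborel_singleton)

lemma integral_cong_nonzero:
  fixes f g :: "real \<Rightarrow> complex"
  assumes [measurable]: "f \<in> borel_measurable borel" "g \<in> borel_measurable borel"
    and eq: "\<And>t. t \<noteq> 0 \<Longrightarrow> f t = g t"
  shows "(\<integral>t. f t \<partial>lborel) = (\<integral>t. g t \<partial>lborel)"
  using AE_nonzero eq by (intro integral_cong_AE) (auto elim: eventually_mono)

lemma integral_flip_flip:
  assumes [measurable]: "f \<in> borel_measurable borel" "g \<in> borel_measurable borel"
  shows "(\<integral>t. flip f t * g t \<partial>lborel) = (\<integral>t. f t * flip g t \<partial>lborel)"
  by (simp add: flip_def mult_ac)

lemma energy_cong_AE:
  assumes [measurable]: "f \<in> borel_measurable borel" "g \<in> borel_measurable borel"
    and "\<And>t. t \<noteq> 0 \<Longrightarrow> norm (f t) = norm (g t)"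
  shows "energy f = energy g"
  unfolding energy_def using AE_nonzero assms(3)
  by (intro integral_cong_AE) (auto elim: eventually_mono)

lemma energy_flip: "f \<in> borel_measurable borel \<Longrightarrow> energy (flip f) = energy f"
  by (intro energy_cong_AE) (auto simp: flip_def norm_mult sgn_real_def intro: measurable_flip)

text \<open>
  Summed over the second half of the indices up to \<open>i\<close>, the differences telescope to at most
  \<open>x (i div 2)\<close>, while the decreasing \<open>y\<close> contributes at least about \<open>i/2\<close> times \<open>y i\<close>. This gains one power of \<open>i\<close>.
\<close>

lemma harmonic_decay_step:
  fixes x y :: "nat \<Rightarrow> real"
  assumes dec: "decseq y" and y0: "\<And>i. y i \<ge> 0" and x0: "\<And>i. x i \<ge> 0" and C: "C \<ge> 0"
    and le: "\<And>i. y i \<le> C * (x i - x (Suc i))" and K: "\<And>i. x i \<le> K / real (Suc i) ^ p"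
  shows "y i \<le> C * K * 2 ^ Suc p / real (Suc i) ^ Suc p"
proof -
  \<comment> \<open>The constant \<open>2 ^ Suc p\<close> comes from replacing the index \<open>i div 2\<close> and the length of the range by \<open>i\<close>.\<close>
  define J where "J = i div 2"
  have J: "J \<le> i" by (simp add: J_def)
  have "(\<Sum>m = J..<Suc i. y m) \<le> (\<Sum>m = J..<Suc i. C * (x m - x (Suc m)))"
    by (intro sum_mono le)
  also have "\<dots> = C * (x J - x (Suc i))"
    using sum_Suc_diff'[of J "Suc i" "\<lambda>m. - x m"] J
    by (simp add: sum_distrib_left[symmetric] del: sum.op_ivl_Suc)
  also have "\<dots> \<le> C * x J" using C x0[of "Suc i"] by (intro mult_left_mono) auto
  also have "\<dots> \<le> C * (K / real (Suc J) ^ p)" using C K by (intro mult_left_mono)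
  finally have 1: "(\<Sum>m = J..<Suc i. y m) \<le> C * (K / real (Suc J) ^ p)" .
  have "real (card {J..<Suc i}) * y i \<le> (\<Sum>m = J..<Suc i. y m)"
    using dec by (intro sum_bounded_below) (auto simp: decseq_def)
  then have 2: "real (Suc i - J) * y i \<le> C * (K / real (Suc J) ^ p)" using 1 by simp
  have K0: "K \<ge> 0" using K[of 0] x0[of 0] by simp
  have 3: "real (Suc i) / 2 \<le> real (Suc i - J)" "real (Suc i) / 2 \<le> real (Suc J)"
    unfolding J_def by (auto simp: of_nat_diff field_simps)
  have "real (Suc i) / 2 * y i \<le> real (Suc i - J) * y i" using 3 y0 by (intro mult_right_mono)
  also note 2
  also have "C * (K / real (Suc J) ^ p) \<le> C * (K / (real (Suc i) / 2) ^ p)"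
    using 3 C K0 by (intro mult_left_mono divide_left_mono power_mono) auto
  finally have "y i \<le> C * (K / (real (Suc i) / 2) ^ p) / (real (Suc i) / 2)"
    by (subst pos_le_divide_eq) (simp_all add: mult.commute)
  also have "\<dots> = C * K * 2 ^ Suc p / real (Suc i) ^ Suc p"
    by (simp add: power_divide field_simps)
  finally show ?thesis .
qed

text \<open>
  The partial sums of both series differ by a factor and by boundary terms that converge.
\<close>

lemma summable_by_parts:
  fixes A :: "nat \<Rightarrow> complex"
  assumes "\<mu> \<noteq> 1" "norm \<mu> = 1" "A \<longlonglongrightarrow> 0" "summable (\<lambda>i. \<mu> ^ i * (A i - A (Suc i)))"
  shows "summable (\<lambda>i. \<mu> ^ i * A i)"
proof -
  have l0: "\<mu> \<noteq> 0" using assms(2) by auto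
  have id: "(\<Sum>i<n. \<mu> ^ i * A i) = (\<mu> * (\<Sum>i<n. \<mu> ^ i * (A i - A (Suc i))) - A 0 + \<mu> ^ n * A n) / (\<mu> - 1)" for n
    using assms(1) by (induction n) (auto simp: field_simps)
  have z: "(\<lambda>n. \<mu> ^ n * A n) \<longlonglongrightarrow> 0"
  proof (rule Lim_null_comparison)
    show "(\<lambda>n. norm (A n)) \<longlonglongrightarrow> 0" using assms(3) by (rule tendsto_norm_zero)
  qed (simp add: norm_mult norm_power assms(2))
  have "(\<lambda>n. (\<mu> * (\<Sum>i<n. \<mu> ^ i * (A i - A (Suc i))) - A 0 + \<mu> ^ n * A n) / (\<mu> - 1))
     \<longlonglongrightarrow> (\<mu> * (\<Sum>i. \<mu> ^ i * (A i - A (Suc i))) - A 0 + 0) / (\<mu> - 1)"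
    using assms(1) by (intro tendsto_intros summable_LIMSEQ assms(4) z) auto
  then have "(\<lambda>i. \<mu> ^ i * A i) sums ((\<mu> * (\<Sum>i. \<mu> ^ i * (A i - A (Suc i))) - A 0 + 0) / (\<mu> - 1))"
    unfolding sums_def id .
  then show ?thesis by (rule sums_summable)
qed

locale grating =
  fixes a b :: real and k :: complex
  assumes b_pos: "0 < b" and b_less: "b < a" and Im_k: "Im k > 0"
begin

definition width :: "int \<Rightarrow> real" where "width i = (if even i then b else a - b)"

text \<open>
  One step of the evolution along the grating: pass an edge, then the slab behind it.
\<close>

definition cross :: "int \<Rightarrow> (real \<Rightarrow> complex) \<Rightarrow> real \<Rightarrow> complex" where
  "cross i f = heat k (width i) (flip f)"

primrec evolve :: "int \<Rightarrow> nat \<Rightarrow> (real \<Rightarrow> complex) \<Rightarrow> real \<Rightarrow> complex" where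
  "evolve n 0 f = f"
| "evolve n (Suc j) f = cross (n + int j) (evolve n j f)"

lemma width_pos: "width i > 0" using b_pos b_less by (simp add: width_def)

lemma width_cong: "even i = even j \<Longrightarrow> width i = width j" by (simp add: width_def)

lemma cross_cong: "even i = even j \<Longrightarrow> cross i = cross j" by (simp add: cross_def width_def fun_eq_iff)

lemma decaying_cross: "\<epsilon> > 0 \<Longrightarrow> decaying \<epsilon> f \<Longrightarrow> decaying \<epsilon> (cross i f)"
  unfolding cross_def by (intro decaying_heat Im_k width_pos decaying_flip)

lemma bounded_measurable_cross: "bounded_measurable f \<Longrightarrow> bounded_measurable (cross i f)"
  unfolding cross_def by (intro bounded_measurable_heat Im_k width_pos bounded_measurable_flip)

lemma measurable_cross [measurable (raw)]: "f \<in> borel_measurable borel \<Longrightarrow> cross i f \<in> borel_measurable borel"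
  unfolding cross_def by measurable

lemma decaying_evolve: "\<epsilon> > 0 \<Longrightarrow> decaying \<epsilon> f \<Longrightarrow> decaying \<epsilon> (evolve n j f)"
  by (induction j) (auto intro: decaying_cross)

lemma cross_diff:
  assumes "bounded_measurable f" "bounded_measurable g"
  shows "cross i (\<lambda>t. f t - g t) = (\<lambda>t. cross i f t - cross i g t)"
proof
  fix y
  have "flip (\<lambda>t. f t - g t) = (\<lambda>t. flip f t - flip g t)" by (simp add: fun_eq_iff flip_def right_diff_distrib)
  then show "cross i (\<lambda>t. f t - g t) y = cross i f y - cross i g y"
    unfolding cross_def using heat_diff[OF Im_k width_pos bounded_measurable_flip[OF assms(1)] bounded_measurable_flip[OF assms(2)]]
    by simp
qed

lemma evolve_Suc_shift: "evolve n (Suc j) f = evolve (n + 1) j (cross n f)"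
  by (induction j) (simp_all add: algebra_simps)

lemma evolve_cong_start: "even n = even m \<Longrightarrow> evolve n j f = evolve m j f"
  by (induction j) (auto intro: arg_cong2[OF cross_cong])

lemma evolve_even_Suc: "evolve n (2 * Suc i) f = cross (n + 1) (cross n (evolve n (2 * i) f))"
proof -
  have "evolve n (2 * Suc i) f = cross (n + int (Suc (2 * i))) (cross (n + int (2 * i)) (evolve n (2 * i) f))"
    by simp
  also have "cross (n + int (2 * i)) = cross n" by (intro cross_cong) simp
  also have "cross (n + int (Suc (2 * i))) = cross (n + 1)" by (intro cross_cong) simp
  finally show ?thesis .
qed

lemma energy_cross_le:
  assumes "\<epsilon> > 0" "decaying \<epsilon> f" shows "energy (cross i f) \<le> energy f"
  unfolding cross_def
  using energy_heat_le[OF Im_k width_pos assms(1) decaying_flip[OF assms(2)]] energy_flip[OF decaying_measurable[OF assms(2)]]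
  by simp

text \<open>
  If a period of the evolution dissipates little energy, then so do both of its steps, which
  therefore hardly change the function, while the two sign flips cancel.
\<close>

lemma period_dissipation:
  obtains C where "C \<ge> 0"
    "\<And>\<epsilon> f n. \<epsilon> > 0 \<Longrightarrow> decaying \<epsilon> f \<Longrightarrow>
      energy (\<lambda>t. f t - cross (n + 1) (cross n f) t) \<le> C * (energy f - energy (cross (n + 1) (cross n f)))"
proof -
  obtain C1 where C1: "C1 \<ge> 0" "\<And>\<epsilon> f. \<epsilon> > 0 \<Longrightarrow> decaying \<epsilon> f \<Longrightarrow>
       energy (\<lambda>t. f t - heat k (width 0) f t) \<le> C1 * (energy f - energy (heat k (width 0) f))"
    by (rule heat_dissipation[OF Im_k width_pos[of 0]]) (rule that; assumption)
  obtain C2 where C2: "C2 \<ge> 0" "\<And>\<epsilon> f. \<epsilon> > 0 \<Longrightarrow> decaying \<epsilon> f \<Longrightarrow>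
       energy (\<lambda>t. f t - heat k (width 1) f t) \<le> C2 * (energy f - energy (heat k (width 1) f))"
    by (rule heat_dissipation[OF Im_k width_pos[of 1]]) (rule that; assumption)
  define C where "C = max C1 C2"
  have C: "energy (\<lambda>t. f t - heat k (width i) f t) \<le> C * (energy f - energy (heat k (width i) f))"
    if "\<epsilon> > 0" "decaying \<epsilon> f" for i \<epsilon> f
  proof -
    have "energy f - energy (heat k (width j) f) \<ge> 0" for j
      using energy_heat_le[OF Im_k width_pos that] by simp
    then have "C1 * (energy f - energy (heat k (width j) f)) \<le> C * (energy f - energy (heat k (width j) f))"
      "C2 * (energy f - energy (heat k (width j) f)) \<le> C * (energy f - energy (heat k (width j) f))" for j
      unfolding C_def by (intro mult_right_mono; simp)+
    moreover have "width i = width 0 \<or> width i = width 1" by (simp add: width_def)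
    ultimately show ?thesis
      using order_trans[OF C1(2)[OF that]] order_trans[OF C2(2)[OF that]] by (elim disjE) simp_all
  qed
  show ?thesis
  proof (rule that[of "2 * C"])
    show "0 \<le> 2 * C" using C1(1) by (simp add: C_def)
    fix \<epsilon> :: real and f n assume \<epsilon>: "\<epsilon> > 0" and f: "decaying \<epsilon> f"
    define h where "h = cross n f"
    define g where "g = flip h"
    have h: "decaying \<epsilon> h" unfolding h_def by (rule decaying_cross[OF \<epsilon> f])
    have g: "decaying \<epsilon> g" unfolding g_def by (rule decaying_flip[OF h])
    have E: "cross (n + 1) h = heat k (width (n + 1)) g" by (simp add: cross_def g_def)
    have Eg: "decaying \<epsilon> (heat k (width (n + 1)) g)" by (intro decaying_heat Im_k width_pos \<epsilon> g)
    note meas = decaying_measurable[OF f] decaying_measurable[OF h] decaying_measurable[OF g]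
    have "energy (\<lambda>t. f t - cross (n + 1) h t) = energy (\<lambda>t. (f t - g t) + (g t - heat k (width (n + 1)) g t))"
      by (simp add: E)
    also have "\<dots> \<le> 2 * energy (\<lambda>t. f t - g t) + 2 * energy (\<lambda>t. g t - heat k (width (n + 1)) g t)"
      by (intro energy_add_le[OF decaying_diff[OF f g] decaying_diff[OF g Eg] \<epsilon>])
    also have "energy (\<lambda>t. f t - g t) = energy (\<lambda>t. flip f t - heat k (width n) (flip f) t)"
    proof (rule energy_cong_AE)
      show "(\<lambda>t. f t - g t) \<in> borel_measurable borel" using meas by simp
      show "(\<lambda>t. flip f t - heat k (width n) (flip f) t) \<in> borel_measurable borel" using meas by measurable
      show "norm (f t - g t) = norm (flip f t - heat k (width n) (flip f) t)" if "t \<noteq> 0" for t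
        using that norm_minus_cancel[of "f t + heat k (width n) (flip f) t"]
        by (cases "t > 0") (auto simp: g_def h_def flip_def cross_def sgn_real_def)
    qed
    also have "\<dots> \<le> C * (energy (flip f) - energy h)"
      using C[OF \<epsilon> decaying_flip[OF f], of n] by (simp add: h_def cross_def)
    also have "energy (flip f) = energy f" using energy_flip[OF meas(1)] .
    also have "energy (\<lambda>t. g t - heat k (width (n + 1)) g t) \<le> C * (energy g - energy (cross (n + 1) h))"
      using C[OF \<epsilon> g, of "n + 1"] by (simp add: E)
    also have "energy g = energy h" unfolding g_def using energy_flip[OF meas(2)] .
    finally show "energy (\<lambda>t. f t - cross (n + 1) (cross n f) t) \<le> 2 * C * (energy f - energy (cross (n + 1) (cross n f)))"
      by (simp add: h_def algebra_simps)
  qed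
qed

text \<open>
  The \<open>p\<close>-th difference \<open>(1 - T)\<^sup>p T\<^sup>i f\<close>, where \<open>T\<close> is the evolution through one period.
\<close>

primrec differ :: "int \<Rightarrow> (real \<Rightarrow> complex) \<Rightarrow> nat \<Rightarrow> nat \<Rightarrow> real \<Rightarrow> complex" where
  "differ n f 0 i = evolve n (2 * i) f"
| "differ n f (Suc p) i = (\<lambda>t. differ n f p i t - differ n f p (Suc i) t)"

lemma decaying_differ: "\<epsilon> > 0 \<Longrightarrow> decaying \<epsilon> f \<Longrightarrow> decaying \<epsilon> (differ n f p i)"
  by (induction p arbitrary: i) (auto intro: decaying_evolve decaying_diff)

lemma differ_step:
  assumes "\<epsilon> > 0" "decaying \<epsilon> f"
  shows "differ n f p (Suc i) = cross (n + 1) (cross n (differ n f p i))"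
proof (induction p arbitrary: i)
  case 0
  show ?case using evolve_even_Suc[of n i f] by simp
next
  case (Suc p)
  have b: "bounded_measurable (differ n f p i)" for i
    by (rule decaying_imp_bounded[OF decaying_differ[OF assms] assms(1)])
  have "differ n f (Suc p) (Suc i) = (\<lambda>t. cross (n + 1) (cross n (differ n f p i)) t - cross (n + 1) (cross n (differ n f p (Suc i))) t)"
    using Suc by simp
  also have "\<dots> = cross (n + 1) (\<lambda>t. cross n (differ n f p i) t - cross n (differ n f p (Suc i)) t)"
    by (rule cross_diff[symmetric]) (intro bounded_measurable_cross b)+
  also have "\<dots> = cross (n + 1) (cross n (differ n f (Suc p) i))"
    using cross_diff[OF b b, of n] by simp
  finally show ?case .
qed

text \<open>
  Each difference is bounded by the energy that the previous one loses in a period, and these losses are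
  summable; hence every difference gains one power of \<open>i\<close>.
\<close>

lemma energy_differ_decay:
  assumes \<epsilon>: "\<epsilon> > 0" and f: "decaying \<epsilon> f"
  obtains K where "\<And>i. energy (differ n f p i) \<le> K / real (Suc i) ^ p"
proof -
  obtain C where C: "C \<ge> 0" "\<And>\<epsilon> f n. \<epsilon> > 0 \<Longrightarrow> decaying \<epsilon> f \<Longrightarrow>
      energy (\<lambda>t. f t - cross (n + 1) (cross n f) t) \<le> C * (energy f - energy (cross (n + 1) (cross n f)))"
    by (rule period_dissipation) (rule that; assumption)
  have dec: "decseq (\<lambda>i. energy (differ n f p i))" for p
  proof (rule decseq_SucI)
    fix i
    have d: "decaying \<epsilon> (differ n f p i)" by (rule decaying_differ[OF assms])
    have "energy (cross (n + 1) (cross n (differ n f p i))) \<le> energy (cross n (differ n f p i))"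
      by (rule energy_cross_le[OF \<epsilon> decaying_cross[OF \<epsilon> d]])
    also have "\<dots> \<le> energy (differ n f p i)" by (rule energy_cross_le[OF \<epsilon> d])
    finally show "energy (differ n f p (Suc i)) \<le> energy (differ n f p i)"
      unfolding differ_step[OF assms] .
  qed
  have step: "energy (differ n f (Suc p) i) \<le> C * (energy (differ n f p i) - energy (differ n f p (Suc i)))" for p i
    using C(2)[OF \<epsilon> decaying_differ[OF assms], of n p i n] by (simp add: differ_step[OF assms])
  have "\<exists>K. \<forall>i. energy (differ n f p i) \<le> K / real (Suc i) ^ p"
  proof (induction p)
    case 0
    show ?case using decseqD[OF dec[of 0], of 0] by (intro exI[of _ "energy (differ n f 0 0)"]) auto
  next
    case (Suc p)
    then obtain K where K: "\<And>i. energy (differ n f p i) \<le> K / real (Suc i) ^ p" by blast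
    show ?case
      using harmonic_decay_step[where x = "\<lambda>i. energy (differ n f p i)" and y = "\<lambda>i. energy (differ n f (Suc p) i)" and p = p,
          OF dec energy_nonneg energy_nonneg C(1) step K] by blast
  qed
  then show ?thesis using that by blast
qed

text \<open>
  The energy decreases to a limit, so its losses tend to zero.
\<close>

lemma gauss_diff_energy_evolve_tendsto:
  assumes \<epsilon>: "\<epsilon> > 0" and f: "decaying \<epsilon> f"
  shows "(\<lambda>i. gauss_diff_energy (spread_rate k (width n)) (flip (evolve n (2 * i) f))) \<longlonglongrightarrow> 0"
proof -
  define c where "c = spread_rate k (width n)"
  define p where "p = sqrt (c / pi) / 2"
  have p: "p > 0" using spread_rate_pos[OF Im_k width_pos[of n]] by (simp add: p_def c_def)
  define e where "e = (\<lambda>i. energy (evolve n (2 * i) f))"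
  have d: "decaying \<epsilon> (evolve n (2 * i) f)" for i by (rule decaying_evolve[OF assms])
  have drop: "p * gauss_diff_energy c (flip (evolve n (2 * i) f)) \<le> e i - e (Suc i)" for i
  proof -
    have "p * gauss_diff_energy c (flip (evolve n (2 * i) f)) = e i - energy (cross n (evolve n (2 * i) f))"
      using energy_heat[OF Im_k width_pos[of n] \<epsilon> decaying_flip[OF d[of i]]] energy_flip[OF decaying_measurable[OF d[of i]]]
      by (simp add: c_def p_def e_def cross_def)
    also have "\<dots> \<le> e i - e (Suc i)"
      using energy_cross_le[OF \<epsilon> decaying_cross[OF \<epsilon> d[of i], of n], of "n + 1"] unfolding e_def evolve_even_Suc by simp
    finally show ?thesis .
  qed
  have "decseq e"
  proof (rule decseq_SucI)
    fix i
    have "0 \<le> p * gauss_diff_energy c (flip (evolve n (2 * i) f))" using p by (simp add: gauss_diff_energy_nonneg)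
    then show "e (Suc i) \<le> e i" using drop[of i] by linarith
  qed
  then obtain L where L: "e \<longlonglongrightarrow> L"
    by (rule decseq_convergent[of e 0]) (auto simp: e_def energy_nonneg)
  have "(\<lambda>i. (e i - e (Suc i)) / p) \<longlonglongrightarrow> (L - L) / p"
    using p by (intro tendsto_intros L LIMSEQ_Suc[OF L]) auto
  then have l: "(\<lambda>i. (e i - e (Suc i)) / p) \<longlonglongrightarrow> 0" by simp
  show ?thesis unfolding c_def[symmetric]
  proof (rule tendsto_sandwich[OF _ _ tendsto_const l])
    show "\<forall>\<^sub>F i in sequentially. 0 \<le> gauss_diff_energy c (flip (evolve n (2 * i) f))"
      by (simp add: gauss_diff_energy_nonneg)
    show "\<forall>\<^sub>F i in sequentially. gauss_diff_energy c (flip (evolve n (2 * i) f)) \<le> (e i - e (Suc i)) / p"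
      using drop p by (simp add: field_simps)
  qed
qed

lemma pairing_evolve_tendsto_0:
  assumes \<epsilon>: "\<epsilon> > 0" and f: "decaying \<epsilon> f" and z: "decaying \<epsilon> z"
  shows "(\<lambda>i. \<integral>t. evolve n (2 * i) f t * z t \<partial>lborel) \<longlonglongrightarrow> 0"
proof -
  have d: "decaying \<epsilon> (evolve n (2 * i) f)" for i by (rule decaying_evolve[OF \<epsilon> f])
  obtain K where K: "\<And>i. energy (differ n f 0 i) \<le> K / real (Suc i) ^ 0"
    using energy_differ_decay[OF \<epsilon> f, of n 0] by blast
  have "(\<lambda>i. \<integral>t. flip (evolve n (2 * i) f) t * flip z t \<partial>lborel) \<longlonglongrightarrow> 0"
  proof (rule tendsto_pairing_zero[where \<epsilon> = \<epsilon> and M = K and c = "spread_rate k (width n)"])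
    show "energy (flip (evolve n (2 * i) f)) \<le> K" for i
      using K[of i] energy_flip[OF decaying_measurable[OF d[of i]]] by simp
  qed (use assms d gauss_diff_energy_evolve_tendsto[OF \<epsilon> f] spread_rate_pos[OF Im_k width_pos[of n]] in \<open>auto intro: decaying_flip\<close>)
  moreover have "(\<integral>t. flip (evolve n (2 * i) f) t * flip z t \<partial>lborel) = (\<integral>t. evolve n (2 * i) f t * z t \<partial>lborel)" for i
  proof (rule integral_cong_AE)
    note [measurable] = decaying_measurable[OF d[of i]] decaying_measurable[OF z]
    show "(\<lambda>t. flip (evolve n (2 * i) f) t * flip z t) \<in> borel_measurable lborel" by measurable
    show "(\<lambda>t. evolve n (2 * i) f t * z t) \<in> borel_measurable lborel" by measurable
    show "AE t in lborel. flip (evolve n (2 * i) f) t * flip z t = evolve n (2 * i) f t * z t"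
      using AE_nonzero by eventually_elim (auto simp: flip_def sgn_real_def)
  qed
  ultimately show ?thesis by simp
qed

lemma pairing_differ_Suc:
  assumes \<epsilon>: "\<epsilon> > 0" and f: "decaying \<epsilon> f" and z: "bounded_measurable z"
  shows "(\<integral>t. differ n f (Suc p) i t * z t \<partial>lborel)
    = (\<integral>t. differ n f p i t * z t \<partial>lborel) - (\<integral>t. differ n f p (Suc i) t * z t \<partial>lborel)"
proof -
  have "integrable lborel (\<lambda>t. differ n f p i t * z t)" for i
    by (rule decaying_integrable[OF decaying_mult_bounded[OF decaying_differ[OF \<epsilon> f] z] \<epsilon>])
  then show ?thesis by (simp add: left_diff_distrib)
qed

text \<open>
  The terms themselves tend to zero at an unknown rate only, but the third differences decay
  like \<open>i\<^sup>-\<^sup>3\<^sup>/\<^sup>2\<close>. Three summations by parts against the oscillating factor \<open>\<mu>\<^sup>i\<close> give convergence.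
\<close>

theorem summable_pairing_evolve:
  assumes \<epsilon>: "\<epsilon> > 0" and f: "decaying \<epsilon> f" and z: "decaying \<epsilon> z" and l: "\<mu> \<noteq> 1" "norm \<mu> = 1"
  shows "summable (\<lambda>i. \<mu> ^ i * (\<integral>t. evolve n (2 * i) f t * z t \<partial>lborel))"
proof -
  define A where "A = (\<lambda>p i. \<integral>t. differ n f p i t * z t \<partial>lborel)"
  have A_Suc: "A (Suc p) i = A p i - A p (Suc i)" for p i
    unfolding A_def by (rule pairing_differ_Suc[OF \<epsilon> f decaying_imp_bounded[OF z \<epsilon>]])
  have A0: "A p \<longlonglongrightarrow> 0" for p
  proof (induction p)
    case 0
    show ?case using pairing_evolve_tendsto_0[OF \<epsilon> f z] by (simp add: A_def)
  next
    case (Suc p)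
    then have "(\<lambda>i. A p i - A p (Suc i)) \<longlonglongrightarrow> 0 - 0" by (intro tendsto_diff LIMSEQ_Suc)
    then show ?case by (simp add: A_Suc)
  qed
  obtain K where K: "\<And>i. energy (differ n f 3 i) \<le> K / real (Suc i) ^ 3"
    using energy_differ_decay[OF \<epsilon> f, of n 3] by blast
  have "summable (\<lambda>i. \<mu> ^ i * A 3 i)"
  proof (rule summable_comparison_test')
    have "summable (\<lambda>i. real i powr (- (3 / 2)))" by (subst summable_real_powr_iff) simp
    then have "summable (\<lambda>i. real (Suc i) powr (- (3 / 2)))" by (subst summable_Suc_iff)
    then show "summable (\<lambda>i. (K + energy z) / 2 * real (Suc i) powr (- (3 / 2)))" by (rule summable_mult)
    fix i :: nat
    \<comment> \<open>This weight balances an energy of order \<open>i\<^bsup>-3\<^esup>\<close> against a constant one.\<close>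
    define \<tau> where "\<tau> = real (Suc i) powr (3 / 2)"
    have \<tau>: "\<tau> > 0" "\<tau> * \<tau> = real (Suc i) ^ 3"
    proof -
      show "\<tau> > 0" by (simp add: \<tau>_def)
      have "\<tau> * \<tau> = real (Suc i) powr (3 / 2 + 3 / 2)" by (simp only: \<tau>_def powr_add)
      also have "\<dots> = real (Suc i) powr real 3" by simp
      also have "\<dots> = real (Suc i) ^ 3" by (rule powr_realpow) simp
      finally show "\<tau> * \<tau> = real (Suc i) ^ 3" .
    qed
    have "norm (A 3 i) \<le> (\<tau> * energy (differ n f 3 i) + energy z / \<tau>) / 2"
      unfolding A_def by (rule pairing_le_energy[OF decaying_differ[OF \<epsilon> f] z \<epsilon> \<tau>(1)])
    also have "\<dots> \<le> (\<tau> * (K / real (Suc i) ^ 3) + energy z / \<tau>) / 2"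
      using K[of i] \<tau> by (intro divide_right_mono add_mono mult_left_mono) auto
    also have "\<tau> * (K / real (Suc i) ^ 3) = K / \<tau>" unfolding \<tau>(2)[symmetric] using \<tau>(1) by simp
    also have "(K / \<tau> + energy z / \<tau>) / 2 = (K + energy z) / 2 * real (Suc i) powr (- (3 / 2))"
      by (simp add: \<tau>_def powr_minus field_simps)
    finally show "norm (\<mu> ^ i * A 3 i) \<le> (K + energy z) / 2 * real (Suc i) powr (- (3 / 2))"
      by (simp add: norm_mult norm_power l)
  qed
  then have "summable (\<lambda>i. \<mu> ^ i * A 2 i)"
    by (intro summable_by_parts[OF l A0]) (simp add: A_Suc[symmetric] numeral_3_eq_3 numeral_2_eq_2)
  then have "summable (\<lambda>i. \<mu> ^ i * A 1 i)"
    by (intro summable_by_parts[OF l A0]) (simp add: A_Suc[symmetric] numeral_2_eq_2)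
  then have "summable (\<lambda>i. \<mu> ^ i * A 0 i)"
    by (intro summable_by_parts[OF l A0]) (simp add: A_Suc[symmetric])
  then show ?thesis by (simp add: A_def)
qed

text \<open>
  A crude bound, which controls the localisation in \<open>y\<close> at the price of geometric growth in \<open>i\<close>.
\<close>

lemma norm_differ_le:
  assumes \<epsilon>: "\<epsilon> > 0" and f: "decaying \<epsilon> f"
  obtains C K where "C \<ge> 0" "K \<ge> 1" "\<And>i t. norm (differ n f p i t) \<le> C * K ^ i * exp (- \<epsilon> * \<bar>t\<bar>)"
proof -
  obtain K1 where K1: "K1 \<ge> 1" "\<And>f C y. f \<in> borel_measurable borel \<Longrightarrow> (\<And>t. norm (f t) \<le> C * exp (- \<epsilon> * \<bar>t\<bar>)) \<Longrightarrow>
       norm (heat k (width n) f y) \<le> K1 * C * exp (- \<epsilon> * \<bar>y\<bar>)"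
    by (rule norm_heat_le[OF Im_k width_pos[of n] \<epsilon>]) (rule that; blast)
  obtain K2 where K2: "K2 \<ge> 1" "\<And>f C y. f \<in> borel_measurable borel \<Longrightarrow> (\<And>t. norm (f t) \<le> C * exp (- \<epsilon> * \<bar>t\<bar>)) \<Longrightarrow>
       norm (heat k (width (n + 1)) f y) \<le> K2 * C * exp (- \<epsilon> * \<bar>y\<bar>)"
    by (rule norm_heat_le[OF Im_k width_pos[of "n + 1"] \<epsilon>]) (rule that; blast)
  obtain C where C: "C \<ge> 0" "\<And>t. norm (differ n f p 0 t) \<le> C * exp (- \<epsilon> * \<bar>t\<bar>)"
    using decaying_differ[OF \<epsilon> f] by (rule decayingE) blast
  have "norm (differ n f p i t) \<le> C * (K2 * K1) ^ i * exp (- \<epsilon> * \<bar>t\<bar>)" for i t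
  proof (induction i arbitrary: t)
    case 0 show ?case using C by simp
  next
    case (Suc i)
    note [measurable] = decaying_measurable[OF decaying_differ[OF \<epsilon> f, of n p i]]
    have 1: "norm (cross n (differ n f p i) t) \<le> K1 * (C * (K2 * K1) ^ i) * exp (- \<epsilon> * \<bar>t\<bar>)" for t
      unfolding cross_def by (rule K1(2)) (measurable, metis norm_flip_le Suc order_trans)
    have "norm (cross (n + 1) (cross n (differ n f p i)) t) \<le> K2 * (K1 * (C * (K2 * K1) ^ i)) * exp (- \<epsilon> * \<bar>t\<bar>)"
      unfolding cross_def[of "n + 1"] by (rule K2(2)) (measurable, metis norm_flip_le 1 order_trans)
    then show ?case unfolding differ_step[OF \<epsilon> f] by (simp add: mult_ac)
  qed
  moreover have "K2 * K1 \<ge> 1" using mult_mono[OF K2(1) K1(1)] K2(1) by simp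
  ultimately show ?thesis using that C(1) by blast
qed

text \<open>
  Against a merely bounded function the energy bound is applied on a window whose width grows
  linearly in \<open>i\<close>; outside of it the exponential localisation outweighs the at most geometric growth.
\<close>

lemma pairing_differ3_bounded_tendsto_0:
  assumes \<epsilon>: "\<epsilon> > 0" and f: "decaying \<epsilon> f" and d: "bounded_measurable d"
  shows "(\<lambda>i. \<integral>t. differ n f 3 i t * d t \<partial>lborel) \<longlonglongrightarrow> 0"
proof -
  obtain E where E: "\<And>i. energy (differ n f 3 i) \<le> E / real (Suc i) ^ 3"
    using energy_differ_decay[OF \<epsilon> f, of n 3] by blast
  obtain C K where CK: "C \<ge> 0" "K \<ge> 1" "\<And>i t. norm (differ n f 3 i t) \<le> C * K ^ i * exp (- \<epsilon> * \<bar>t\<bar>)"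
    by (rule norm_differ_le[OF \<epsilon> f, of n 3]) (rule that; assumption)
  obtain B where B: "B \<ge> 0" "\<And>t. norm (d t) \<le> B" using d by (rule bounded_measurableE) blast
  note [measurable] = bounded_measurable_measurable[OF d]
  \<comment> \<open>Outside of \<open>\<bar>t\<bar> \<le> \<rho> (i + 1)\<close> half of the exponential decay beats \<open>K\<^sup>i\<close> and leaves a factor
    \<open>e\<^bsup>-(i + 1)\<^esup>\<close>.\<close>
  define \<rho> where "\<rho> = 2 * (ln K + 1) / \<epsilon>"
  have \<rho>: "\<rho> > 0" using CK(2) \<epsilon> by (simp add: \<rho>_def add_nonneg_pos)
  define I where "I = (\<integral>t. exp (- (\<epsilon> / 2) * \<bar>t\<bar>) \<partial>lborel)"
  have \<epsilon>2: "\<epsilon> / 2 > 0" using \<epsilon> by simp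
  have I0: "I \<ge> 0" by (simp add: I_def)
  have bound: "norm (\<integral>t. differ n f 3 i t * d t \<partial>lborel)
     \<le> (E / real (Suc i) + 2 * \<rho> * B\<^sup>2 / real (Suc i)) / 2 + C * B * I * exp (- real (Suc i))" for i
  proof -
    define R where "R = \<rho> * real (Suc i)"
    have R: "R > 0" using \<rho> by (simp add: R_def)
    define d1 where "d1 = (\<lambda>t. indicator {-R..R} t * d t)"
    define d2 where "d2 = (\<lambda>t. indicator (- {-R..R}) t * d t)"
    let ?g = "differ n f 3 i"
    have g: "decaying \<epsilon> ?g" by (rule decaying_differ[OF \<epsilon> f])
    note [measurable] = decaying_measurable[OF g]
    have d1: "decaying \<epsilon> d1"
    proof -
      have "norm (d1 t) \<le> (B * exp (\<epsilon> * R)) * exp (- \<epsilon> * \<bar>t\<bar>)" for t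
      proof (cases "\<bar>t\<bar> \<le> R")
        case True
        then have "\<epsilon> * \<bar>t\<bar> \<le> \<epsilon> * R" using \<epsilon> by simp
        then have "1 \<le> exp (\<epsilon> * R) * exp (- \<epsilon> * \<bar>t\<bar>)" by (simp add: exp_add[symmetric])
        then have "B * 1 \<le> B * (exp (\<epsilon> * R) * exp (- \<epsilon> * \<bar>t\<bar>))" using B(1) by (rule mult_left_mono)
        moreover have "norm (d1 t) \<le> B" using B by (auto simp: d1_def indicator_def)
        ultimately show ?thesis by (simp add: mult.assoc)
      next
        case False
        then have "t \<notin> {-R..R}" by auto
        then show ?thesis using B by (simp add: d1_def)
      qed
      moreover have "d1 \<in> borel_measurable borel" unfolding d1_def by measurable
      ultimately show ?thesis unfolding decaying_def by blast
    qed
    have d2: "bounded_measurable d2"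
      unfolding bounded_measurable_def d2_def using B by (auto intro!: exI[of _ B] simp: indicator_def)
    have e1: "energy d1 \<le> 2 * R * B\<^sup>2"
    proof -
      have ind: "integrable lborel (indicator {-R..R} :: real \<Rightarrow> real)"
        by (rule integrable_real_indicator) (simp_all add: emeasure_lborel_Icc_eq ennreal_less_top)
      have "energy d1 \<le> (\<integral>t. B\<^sup>2 * indicator {-R..R} t \<partial>lborel)"
        unfolding energy_def using B
        by (intro integral_mono energy_integrable[OF d1 \<epsilon>] integrable_mult_right ind)
           (auto simp: d1_def indicator_def ind intro!: power_mono)
      also have "\<dots> = 2 * R * B\<^sup>2" using R by simp
      finally show ?thesis .
    qed
    have p1: "norm (\<integral>t. ?g t * d1 t \<partial>lborel) \<le> (E / real (Suc i) + 2 * \<rho> * B\<^sup>2 / real (Suc i)) / 2"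
    proof -
      have s: "real (Suc i) ^ 2 > 0" by simp
      have "norm (\<integral>t. ?g t * d1 t \<partial>lborel) \<le> (real (Suc i) ^ 2 * energy ?g + energy d1 / real (Suc i) ^ 2) / 2"
        by (rule pairing_le_energy[OF g d1 \<epsilon> s])
      also have "\<dots> \<le> (real (Suc i) ^ 2 * (E / real (Suc i) ^ 3) + (2 * R * B\<^sup>2) / real (Suc i) ^ 2) / 2"
        using E[of i] e1 by (intro divide_right_mono add_mono mult_left_mono) auto
      also have "\<dots> = (E / real (Suc i) + 2 * \<rho> * B\<^sup>2 / real (Suc i)) / 2"
        by (simp add: R_def power2_eq_square power3_eq_cube field_simps del: of_nat_Suc)
      finally show ?thesis .
    qed
    have p2: "norm (\<integral>t. ?g t * d2 t \<partial>lborel) \<le> C * B * I * exp (- real (Suc i))"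
    proof -
      have "norm (\<integral>t. ?g t * d2 t \<partial>lborel) \<le> (\<integral>t. (C * B * exp (- real (Suc i))) * exp (- (\<epsilon> / 2) * \<bar>t\<bar>) \<partial>lborel)"
      proof (rule norm_integral_le)
        show "integrable lborel (\<lambda>t. (C * B * exp (- real (Suc i))) * exp (- (\<epsilon> / 2) * \<bar>t\<bar>))"
          by (rule integrable_mult_right[OF integrable_exp_abs[OF \<epsilon>2]])
        fix t
        show "norm (?g t * d2 t) \<le> (C * B * exp (- real (Suc i))) * exp (- (\<epsilon> / 2) * \<bar>t\<bar>)"
        proof (cases "\<bar>t\<bar> \<le> R")
          case True
          then show ?thesis using CK B by (simp add: d2_def indicator_def abs_le_iff)
        next
          case False
          have "(ln K + 1) * real (Suc i) = \<epsilon> / 2 * R" using \<epsilon> by (simp add: R_def \<rho>_def)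
          also have "\<dots> \<le> \<epsilon> / 2 * \<bar>t\<bar>" using False \<epsilon> by (intro mult_left_mono) auto
          finally have r: "(ln K + 1) * real (Suc i) \<le> \<epsilon> / 2 * \<bar>t\<bar>" .
          have "K ^ i = exp (ln K * real i)" using CK(2) by (simp add: exp_of_nat_mult mult.commute)
          also have "\<dots> \<le> exp (ln K * real (Suc i))" using CK(2) by (simp add: mult_left_mono)
          finally have Ki: "K ^ i \<le> exp (ln K * real (Suc i))" .
          have "K ^ i * exp (- \<epsilon> * \<bar>t\<bar>) \<le> exp (ln K * real (Suc i)) * exp (- \<epsilon> * \<bar>t\<bar>)"
            using Ki by (rule mult_right_mono) simp
          also have "\<dots> \<le> exp (- real (Suc i)) * exp (- (\<epsilon> / 2) * \<bar>t\<bar>)"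
            using r by (simp add: exp_add[symmetric] algebra_simps)
          finally have e: "K ^ i * exp (- \<epsilon> * \<bar>t\<bar>) \<le> exp (- real (Suc i)) * exp (- (\<epsilon> / 2) * \<bar>t\<bar>)" .
          have "norm (?g t * d2 t) \<le> (C * K ^ i * exp (- \<epsilon> * \<bar>t\<bar>)) * B"
            unfolding norm_mult using CK B by (intro mult_mono) (auto simp: d2_def indicator_def)
          also have "\<dots> = (C * B) * (K ^ i * exp (- \<epsilon> * \<bar>t\<bar>))" by simp
          also have "\<dots> \<le> (C * B) * (exp (- real (Suc i)) * exp (- (\<epsilon> / 2) * \<bar>t\<bar>))"
            using e CK(1) B(1) by (intro mult_left_mono) auto
          finally show ?thesis by (simp only: mult.assoc)
        qed
      qed
      then show ?thesis by (simp add: I_def mult_ac)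
    qed
    have i1: "integrable lborel (\<lambda>t. ?g t * d1 t)"
      by (rule decaying_integrable[OF decaying_mult_bounded[OF g decaying_imp_bounded[OF d1 \<epsilon>]] \<epsilon>])
    have i2: "integrable lborel (\<lambda>t. ?g t * d2 t)"
      by (rule decaying_integrable[OF decaying_mult_bounded[OF g d2] \<epsilon>])
    have "(\<integral>t. ?g t * d t \<partial>lborel) = (\<integral>t. ?g t * d1 t + ?g t * d2 t \<partial>lborel)"
      by (intro Bochner_Integration.integral_cong refl) (auto simp: d1_def d2_def indicator_def)
    also have "\<dots> = (\<integral>t. ?g t * d1 t \<partial>lborel) + (\<integral>t. ?g t * d2 t \<partial>lborel)"
      using i1 i2 by (rule Bochner_Integration.integral_add)
    finally show ?thesis using norm_triangle_le[OF add_mono[OF p1 p2]] by (simp only:)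
  qed
  have 1: "(\<lambda>i. 1 / real (Suc i)) \<longlonglongrightarrow> 0" using LIMSEQ_inverse_real_of_nat by (simp add: inverse_eq_divide)
  have 2: "(\<lambda>i. exp (- real (Suc i))) \<longlonglongrightarrow> 0"
  proof -
    have "(\<lambda>i. exp (- 1) ^ i :: real) \<longlonglongrightarrow> 0" by (rule LIMSEQ_power_zero) simp
    then have "(\<lambda>i. exp (- 1) ^ Suc i :: real) \<longlonglongrightarrow> 0" by (rule LIMSEQ_Suc)
    then show ?thesis by (simp add: exp_of_nat_mult[symmetric] del: power_Suc)
  qed
  have "(\<lambda>i. (E + 2 * \<rho> * B\<^sup>2) / 2 * (1 / real (Suc i)) + C * B * I * exp (- real (Suc i))) \<longlonglongrightarrow> (E + 2 * \<rho> * B\<^sup>2) / 2 * 0 + C * B * I * 0"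
    by (rule tendsto_add[OF tendsto_mult_left[OF 1] tendsto_mult_left[OF 2]])
  then have lim: "(\<lambda>i. (E + 2 * \<rho> * B\<^sup>2) / 2 * (1 / real (Suc i)) + C * B * I * exp (- real (Suc i))) \<longlonglongrightarrow> 0"
    by simp
  show ?thesis
  proof (rule Lim_null_comparison[OF always_eventually lim], rule allI)
    fix i
    have "(E / real (Suc i) + 2 * \<rho> * B\<^sup>2 / real (Suc i)) / 2 = (E + 2 * \<rho> * B\<^sup>2) / 2 * (1 / real (Suc i))"
    proof -
      have "(p / x + q / x) / 2 = (p + q) / 2 * (1 / x)" for p q x :: real
        by (simp add: add_divide_distrib)
      then show ?thesis .
    qed
    with bound[of i] show "norm (\<integral>t. differ n f 3 i t * d t \<partial>lborel) \<le> (E + 2 * \<rho> * B\<^sup>2) / 2 * (1 / real (Suc i)) + C * B * I * exp (- real (Suc i))"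
      by (simp only:)
  qed
qed

text \<open>
  A difference multiplies the limit of \<open>\<mu>\<^sup>i A i\<close> by \<open>1 - 1/\<mu> \<noteq> 0\<close>, and the third difference
  tends to zero.
\<close>

lemma pairing_evolve_remainder_0:
  assumes \<epsilon>: "\<epsilon> > 0" and f: "decaying \<epsilon> f" and d: "bounded_measurable d" and l: "\<mu> \<noteq> 1" "norm \<mu> = 1"
    and L: "(\<lambda>i. \<mu> ^ i * (\<integral>t. evolve n (2 * i) f t * d t \<partial>lborel)) \<longlonglongrightarrow> L"
  shows "L = 0"
proof -
  define A where "A = (\<lambda>p i. \<integral>t. differ n f p i t * d t \<partial>lborel)"
  have l0: "\<mu> \<noteq> 0" using l by auto
  have A_Suc: "A (Suc p) i = A p i - A p (Suc i)" for p i
    unfolding A_def by (rule pairing_differ_Suc[OF \<epsilon> f d])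
  have lim: "(\<lambda>i. \<mu> ^ i * A p i) \<longlonglongrightarrow> (1 - inverse \<mu>) ^ p * L" for p
  proof (induction p)
    case 0 show ?case using L by (simp add: A_def)
  next
    case (Suc p)
    have "(\<lambda>i. \<mu> ^ i * A p i - inverse \<mu> * (\<mu> ^ Suc i * A p (Suc i))) \<longlonglongrightarrow> (1 - inverse \<mu>) ^ p * L - inverse \<mu> * ((1 - inverse \<mu>) ^ p * L)"
      by (intro tendsto_intros Suc LIMSEQ_Suc[OF Suc])
    moreover have "(\<lambda>i. \<mu> ^ i * A p i - inverse \<mu> * (\<mu> ^ Suc i * A p (Suc i))) = (\<lambda>i. \<mu> ^ i * A (Suc p) i)"
    proof
      fix i
      have "inverse \<mu> * (\<mu> ^ Suc i * A p (Suc i)) = (inverse \<mu> * \<mu>) * (\<mu> ^ i * A p (Suc i))"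
        by (simp only: power_Suc mult.assoc)
      also have "inverse \<mu> * \<mu> = 1" using l0 by simp
      finally show "\<mu> ^ i * A p i - inverse \<mu> * (\<mu> ^ Suc i * A p (Suc i)) = \<mu> ^ i * A (Suc p) i"
        by (simp only: A_Suc right_diff_distrib mult_1)
    qed
    moreover have "(1 - inverse \<mu>) ^ p * L - inverse \<mu> * ((1 - inverse \<mu>) ^ p * L) = (1 - inverse \<mu>) ^ Suc p * L"
      by (simp only: power_Suc left_diff_distrib mult_1 mult.assoc)
    ultimately show ?case by metis
  qed
  have "(\<lambda>i. \<mu> ^ i * A 3 i) \<longlonglongrightarrow> 0"
  proof (rule Lim_null_comparison)
    show "(\<lambda>i. norm (A 3 i)) \<longlonglongrightarrow> 0"
      using pairing_differ3_bounded_tendsto_0[OF \<epsilon> f d] by (auto simp: A_def intro: tendsto_norm_zero)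
  qed (simp add: norm_mult norm_power l)
  then have "(1 - inverse \<mu>) ^ 3 * L = 0" using lim[of 3] LIMSEQ_unique by blast
  moreover have "1 - inverse \<mu> \<noteq> 0" using l by (simp add: l0 inverse_eq_1_iff)
  ultimately show ?thesis by simp
qed

lemma evolve_cong_AE:
  assumes [measurable]: "f \<in> borel_measurable borel" "g \<in> borel_measurable borel"
    and eq: "\<And>t. t \<noteq> 0 \<Longrightarrow> f t = g t" and "t \<noteq> 0"
  shows "evolve n j f t = evolve n j g t"
proof (cases j)
  case (Suc i)
  have "flip f = flip g"
  proof
    show "flip f x = flip g x" for x using eq[of x] by (cases "x = 0") (simp_all add: flip_def)
  qed
  then have "cross n f = cross n g" by (simp add: cross_def)
  then show ?thesis unfolding Suc evolve_Suc_shift by simp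
qed (use assms in auto)

text \<open>Reversing the order of the slabs: the grating is symmetric under reflection.\<close>

lemma evolve_transpose:
  assumes \<epsilon>: "\<epsilon> > 0" and f: "decaying \<epsilon> f" and z: "decaying \<epsilon> z"
  shows "(\<integral>t. z t * evolve n j f t \<partial>lborel) = (\<integral>t. flip f t * evolve (1 - n - int j) j (flip z) t \<partial>lborel)"
  using z
proof (induction j arbitrary: z)
  case 0
  note [measurable] = decaying_measurable[OF f] decaying_measurable[OF 0]
  show ?case by (simp, rule integral_cong_nonzero) (auto simp: flip_def sgn_real_def)
next
  case (Suc j)
  note z = Suc.prems
  define w where "w = width (n + int j)"
  define h where "h = heat k w z"
  have ev: "decaying \<epsilon> (evolve n j f)" by (rule decaying_evolve[OF \<epsilon> f])
  have h: "decaying \<epsilon> h" unfolding h_def w_def by (intro decaying_heat Im_k width_pos \<epsilon> z)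
  note [measurable] = decaying_measurable[OF f] decaying_measurable[OF z] decaying_measurable[OF h] decaying_measurable[OF ev]
  have m: "evolve n' j' g \<in> borel_measurable borel" if "decaying \<epsilon> g" for n' j' g
    by (rule decaying_measurable[OF decaying_evolve[OF \<epsilon> that]])
  have "(\<integral>t. z t * evolve n (Suc j) f t \<partial>lborel) = (\<integral>t. h t * flip (evolve n j f) t \<partial>lborel)"
    unfolding evolve.simps cross_def h_def w_def
    by (rule heat_transpose[OF Im_k width_pos \<epsilon> decaying_flip[OF ev] decaying_imp_bounded[OF z \<epsilon>]])
  also have "\<dots> = (\<integral>t. flip h t * evolve n j f t \<partial>lborel)" by (simp add: integral_flip_flip)
  also have "\<dots> = (\<integral>t. flip f t * evolve (1 - n - int j) j (flip (flip h)) t \<partial>lborel)"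
    by (rule Suc.IH[OF decaying_flip[OF h]])
  also have "\<dots> = (\<integral>t. flip f t * evolve (1 - n - int j) j (cross (n + int j) (flip z)) t \<partial>lborel)"
  proof (rule integral_cong_nonzero)
    have hh: "flip (flip h) t = cross (n + int j) (flip z) t" if "t \<noteq> 0" for t
    proof -
      have "cross (n + int j) (flip z) t = h t"
        unfolding cross_def h_def heat_def w_def
        by (rule integral_cong_nonzero) (measurable, auto simp: flip_def sgn_real_def)
      then show ?thesis using that by (simp add: flip_def sgn_real_def)
    qed
    note [measurable] = m[OF decaying_flip[OF decaying_flip[OF h]]] m[OF decaying_cross[OF \<epsilon> decaying_flip[OF z]]]
    show "(\<lambda>t. flip f t * evolve (1 - n - int j) j (flip (flip h)) t) \<in> borel_measurable borel" by measurable
    show "(\<lambda>t. flip f t * evolve (1 - n - int j) j (cross (n + int j) (flip z)) t) \<in> borel_measurable borel" by measurable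
    show "flip f t * evolve (1 - n - int j) j (flip (flip h)) t = flip f t * evolve (1 - n - int j) j (cross (n + int j) (flip z)) t"
      if "t \<noteq> 0" for t
      using evolve_cong_AE[OF _ _ hh that] by simp
  qed
  also have "cross (n + int j) = cross (1 - n - int (Suc j))" by (rule cross_cong) (simp, blast)
  also have "evolve (1 - n - int j) j (cross (1 - n - int (Suc j)) (flip z)) = evolve (1 - n - int (Suc j)) (Suc j) (flip z)"
    unfolding evolve_Suc_shift by (simp add: algebra_simps)
  finally show ?case .
qed

end

section \<open>Classical solutions in a slab\<close>

text \<open>
  The derivatives in \<open>y\<close> are parameters and the equation is solved for the derivative in \<open>x\<close>, which makes
  linear combinations and explicit solutions easy to handle.
\<close>

definition solves :: "complex \<Rightarrow> (real \<times> real) set \<Rightarrow> (real \<Rightarrow> real \<Rightarrow> complex) \<Rightarrow>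
    (real \<Rightarrow> real \<Rightarrow> complex) \<Rightarrow> (real \<Rightarrow> real \<Rightarrow> complex) \<Rightarrow> bool" where
  "solves k U f fy fyy \<longleftrightarrow>
     continuous_on U (\<lambda>(x, y). f x y) \<and> continuous_on U (\<lambda>(x, y). fy x y) \<and> continuous_on U (\<lambda>(x, y). fyy x y) \<and>
     (\<forall>(x, y)\<in>U. ((\<lambda>s. f s y) has_vector_derivative - inverse (2 * \<i> * k) * fyy x y) (at x) \<and>
        ((\<lambda>t. f x t) has_vector_derivative fy x y) (at y) \<and>
        ((\<lambda>t. fy x t) has_vector_derivative fyy x y) (at y))"

lemma classical_solution_solves:
  assumes "classical_solution k U f"
  shows "solves k U f (dy f) (dy (dy f))"
  unfolding solves_def
proof (intro conjI ballI, goal_cases)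
  case (4 z)
  obtain x y where z: "z = (x, y)" by force
  have d: "(\<lambda>s. f s y) differentiable (at x)" "(\<lambda>t. f x t) differentiable (at y)"
    "(\<lambda>t. dy f x t) differentiable (at y)" "parabolic k f x y = 0"
    using assms 4 unfolding classical_solution_def z by auto
  have "dx f x y = - inverse (2 * \<i> * k) * dy (dy f) x y"
    using d(4) unfolding parabolic_def by (simp add: eq_neg_iff_add_eq_0)
  with d(1-3) show ?case
    unfolding z vector_derivative_works dx_def[symmetric] dy_def[symmetric] by simp
qed (use assms in \<open>auto simp: classical_solution_def\<close>)

lemma solves_subset: "solves k U f fy fyy \<Longrightarrow> V \<subseteq> U \<Longrightarrow> solves k V f fy fyy"
  unfolding solves_def by (blast intro: continuous_on_subset)

lemma solvesD:
  assumes "solves k U f fy fyy" "(x, y) \<in> U"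
  shows "((\<lambda>s. f s y) has_vector_derivative - inverse (2 * \<i> * k) * fyy x y) (at x)"
    "((\<lambda>t. f x t) has_vector_derivative fy x y) (at y)"
    "((\<lambda>t. fy x t) has_vector_derivative fyy x y) (at y)"
  using assms unfolding solves_def by auto

lemma solves_continuous:
  assumes "solves k U f fy fyy"
  shows "continuous_on U (\<lambda>z. f (fst z) (snd z))" "continuous_on U (\<lambda>z. fy (fst z) (snd z))"
    "continuous_on U (\<lambda>z. fyy (fst z) (snd z))"
  using assms unfolding solves_def by (simp_all add: case_prod_beta')

lemma solvesI:
  assumes "continuous_on U (\<lambda>z. f (fst z) (snd z))" "continuous_on U (\<lambda>z. fy (fst z) (snd z))"
    "continuous_on U (\<lambda>z. fyy (fst z) (snd z))"
    "\<And>x y. (x, y) \<in> U \<Longrightarrow> ((\<lambda>s. f s y) has_vector_derivative - inverse (2 * \<i> * k) * fyy x y) (at x)"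
    "\<And>x y. (x, y) \<in> U \<Longrightarrow> ((\<lambda>t. f x t) has_vector_derivative fy x y) (at y)"
    "\<And>x y. (x, y) \<in> U \<Longrightarrow> ((\<lambda>t. fy x t) has_vector_derivative fyy x y) (at y)"
  shows "solves k U f fy fyy"
  using assms unfolding solves_def by (auto simp: case_prod_beta')

lemma solves_add:
  assumes f: "solves k U f fy fyy" and g: "solves k U g gy gyy"
  shows "solves k U (\<lambda>x y. f x y + g x y) (\<lambda>x y. fy x y + gy x y) (\<lambda>x y. fyy x y + gyy x y)"
proof (rule solvesI)
  fix x y assume U: "(x, y) \<in> U"
  note F = solvesD[OF f U] and G = solvesD[OF g U]
  show "((\<lambda>s. f s y + g s y) has_vector_derivative - inverse (2 * \<i> * k) * (fyy x y + gyy x y)) (at x)"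
    unfolding distrib_left by (intro has_vector_derivative_add F G)
  show "((\<lambda>t. f x t + g x t) has_vector_derivative fy x y + gy x y) (at y)"
    by (intro has_vector_derivative_add F G)
  show "((\<lambda>t. fy x t + gy x t) has_vector_derivative fyy x y + gyy x y) (at y)"
    by (intro has_vector_derivative_add F G)
qed (intro continuous_on_add solves_continuous[OF f] solves_continuous[OF g])+

lemma solves_cmult:
  assumes f: "solves k U f fy fyy"
  shows "solves k U (\<lambda>x y. c * f x y) (\<lambda>x y. c * fy x y) (\<lambda>x y. c * fyy x y)"
proof (rule solvesI)
  fix x y assume U: "(x, y) \<in> U"
  note F = solvesD[OF f U]
  show "((\<lambda>s. c * f s y) has_vector_derivative - inverse (2 * \<i> * k) * (c * fyy x y)) (at x)"
    unfolding mult.left_commute[of _ c] by (intro has_vector_derivative_mult_right F)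
  show "((\<lambda>t. c * f x t) has_vector_derivative c * fy x y) (at y)"
    by (intro has_vector_derivative_mult_right F)
  show "((\<lambda>t. c * fy x t) has_vector_derivative c * fyy x y) (at y)"
    by (intro has_vector_derivative_mult_right F)
qed (intro continuous_on_mult continuous_on_const solves_continuous[OF f])+

text \<open>
  Green's identity: \<open>\<Psi>\<close> solves the adjoint equation, so for \<open>\<eta> = 1\<close> only the boundary terms would remain. The
  cut-off \<open>\<eta>\<close> is needed because the line is not compact.
\<close>

lemma weighted_mass_derivative:
  fixes \<eta> \<eta>' \<eta>'' :: "real \<Rightarrow> complex"
  assumes f: "solves k U f fy fyy" and k: "k \<noteq> 0"
    and U: "{s1..s2} \<times> {c..d} \<subseteq> U" and s: "s \<in> {s1..s2}" and cd: "c \<le> d"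
    and \<Psi>c: "continuous_on U (\<lambda>(x, y). \<Psi> x y)" "continuous_on U (\<lambda>(x, y). \<Psi>y x y)" "continuous_on U (\<lambda>(x, y). \<Psi>yy x y)"
    and \<Psi>x: "\<And>x y. (x, y) \<in> U \<Longrightarrow> ((\<lambda>s. \<Psi> s y) has_vector_derivative inverse (2 * \<i> * k) * \<Psi>yy x y) (at x)"
    and \<Psi>y: "\<And>x y. (x, y) \<in> U \<Longrightarrow> ((\<lambda>t. \<Psi> x t) has_vector_derivative \<Psi>y x y) (at y)"
    and \<Psi>yy: "\<And>x y. (x, y) \<in> U \<Longrightarrow> ((\<lambda>t. \<Psi>y x t) has_vector_derivative \<Psi>yy x y) (at y)"
    and \<eta>: "\<And>y. (\<eta> has_vector_derivative \<eta>' y) (at y)" "\<And>y. (\<eta>' has_vector_derivative \<eta>'' y) (at y)"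
      "continuous_on UNIV \<eta>''"
  shows "((\<lambda>s. integral {c..d} (\<lambda>y. \<eta> y * (f s y * \<Psi> s y))) has_vector_derivative
     - inverse (2 * \<i> * k) *
       ((\<eta> d * (fy s d * \<Psi> s d - f s d * \<Psi>y s d) - \<eta>' d * (f s d * \<Psi> s d))
        - (\<eta> c * (fy s c * \<Psi> s c - f s c * \<Psi>y s c) - \<eta>' c * (f s c * \<Psi> s c))
        + integral {c..d} (\<lambda>y. f s y * (2 * \<eta>' y * \<Psi>y s y + \<eta>'' y * \<Psi> s y)))) (at s within {s1..s2})"
proof -
  define \<kappa> where "\<kappa> = inverse (2 * \<i> * k)"
  have fc: "continuous_on U (\<lambda>(x, y). f x y)" "continuous_on U (\<lambda>(x, y). fy x y)" "continuous_on U (\<lambda>(x, y). fyy x y)"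
    and fx: "\<And>x y. (x, y) \<in> U \<Longrightarrow> ((\<lambda>s. f s y) has_vector_derivative - \<kappa> * fyy x y) (at x)"
    and fy: "\<And>x y. (x, y) \<in> U \<Longrightarrow> ((\<lambda>t. f x t) has_vector_derivative fy x y) (at y)"
    and fyy: "\<And>x y. (x, y) \<in> U \<Longrightarrow> ((\<lambda>t. fy x t) has_vector_derivative fyy x y) (at y)"
    using f unfolding solves_def \<kappa>_def by auto
  note \<Psi>x = \<Psi>x[folded \<kappa>_def]
  have \<eta>c: "continuous_on UNIV \<eta>" "continuous_on UNIV \<eta>'"
    using \<eta>(1,2) by (auto intro!: continuous_at_imp_continuous_on has_vector_derivative_continuous)
  let ?W = "{s1..s2} \<times> {c..d}"
  have W: "continuous_on ?W (\<lambda>z. f (fst z) (snd z))" "continuous_on ?W (\<lambda>z. fy (fst z) (snd z))" "continuous_on ?W (\<lambda>z. fyy (fst z) (snd z))"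
      "continuous_on ?W (\<lambda>z. \<Psi> (fst z) (snd z))" "continuous_on ?W (\<lambda>z. \<Psi>y (fst z) (snd z))" "continuous_on ?W (\<lambda>z. \<Psi>yy (fst z) (snd z))"
    using continuous_on_subset[OF fc(1) U] continuous_on_subset[OF fc(2) U] continuous_on_subset[OF fc(3) U]
      continuous_on_subset[OF \<Psi>c(1) U] continuous_on_subset[OF \<Psi>c(2) U] continuous_on_subset[OF \<Psi>c(3) U]
    by (simp_all add: case_prod_beta')
  have X: "continuous_on ?W (\<lambda>z. \<eta> (snd z))"
    by (rule continuous_on_compose2[OF \<eta>c(1)]) (auto intro: continuous_intros)
  have line: "continuous_on {c..d} (\<lambda>y. g s' y)" if "continuous_on ?W (\<lambda>z. g (fst z) (snd z))" "s' \<in> {s1..s2}" for g :: "real \<Rightarrow> real \<Rightarrow> complex" and s'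
    by (rule continuous_on_compose2[OF that(1), of _ "\<lambda>y. (s', y)", simplified]) (use that(2) in \<open>auto intro!: continuous_intros\<close>)
  define h where "h = (\<lambda>s y. \<eta> y * ((- \<kappa> * fyy s y) * \<Psi> s y + f s y * (\<kappa> * \<Psi>yy s y)))"
  have "((\<lambda>s. integral (cbox c d) (\<lambda>y. \<eta> y * (f s y * \<Psi> s y))) has_vector_derivative integral (cbox c d) (h s)) (at s within {s1..s2})"
  proof (rule leibniz_rule_vector_derivative)
    fix x t assume x: "x \<in> {s1..s2}" and t: "t \<in> cbox c d"
    then have "(x, t) \<in> U" using U by auto
    note d = has_vector_derivative_mult_right[OF has_vector_derivative_mult[OF fx[OF this] \<Psi>x[OF this]], of "\<eta> t"]
    show "((\<lambda>x. \<eta> t * (f x t * \<Psi> x t)) has_vector_derivative h x t) (at x within {s1..s2})"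
      by (rule has_vector_derivative_at_within, rule has_vector_derivative_eq_rhs[OF d]) (simp add: h_def algebra_simps)
  next
    fix x assume x: "x \<in> {s1..s2}"
    show "(\<lambda>y. \<eta> y * (f x y * \<Psi> x y)) integrable_on cbox c d"
      using line[OF W(1) x] line[OF W(4) x] continuous_on_subset[OF \<eta>c(1)]
      by (intro integrable_continuous) (auto intro!: continuous_intros)
  next
    show "continuous_on ({s1..s2} \<times> cbox c d) (\<lambda>(x, t). h x t)"
      unfolding h_def case_prod_beta' using W X by (auto intro!: continuous_intros)
  qed (use s in auto)
  then have der: "((\<lambda>s. integral {c..d} (\<lambda>y. \<eta> y * (f s y * \<Psi> s y))) has_vector_derivative integral {c..d} (h s)) (at s within {s1..s2})"
    by simp
  define P where "P = (\<lambda>y. \<eta> y * (fy s y * \<Psi> s y - f s y * \<Psi>y s y) - \<eta>' y * (f s y * \<Psi> s y))"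
  define r where "r = (\<lambda>y. f s y * (2 * \<eta>' y * \<Psi>y s y + \<eta>'' y * \<Psi> s y))"
  have "((\<lambda>y. inverse (- \<kappa>) * h s y - r y) has_integral P d - P c) {c..d}"
  proof (rule fundamental_theorem_of_calculus[OF cd])
    fix y assume y: "y \<in> {c..d}"
    then have yU: "(s, y) \<in> U" using U s by auto
    have "(P has_vector_derivative
       (\<eta> y * ((fy s y * \<Psi>y s y + fyy s y * \<Psi> s y) - (f s y * \<Psi>yy s y + fy s y * \<Psi>y s y)) + \<eta>' y * (fy s y * \<Psi> s y - f s y * \<Psi>y s y))
         - (\<eta>' y * (f s y * \<Psi>y s y + fy s y * \<Psi> s y) + \<eta>'' y * (f s y * \<Psi> s y))) (at y)"
      unfolding P_def
      by (intro has_vector_derivative_diff has_vector_derivative_mult \<eta> fy[OF yU] fyy[OF yU] \<Psi>y[OF yU] \<Psi>yy[OF yU])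
    moreover have "(\<eta> y * ((fy s y * \<Psi>y s y + fyy s y * \<Psi> s y) - (f s y * \<Psi>yy s y + fy s y * \<Psi>y s y)) + \<eta>' y * (fy s y * \<Psi> s y - f s y * \<Psi>y s y))
         - (\<eta>' y * (f s y * \<Psi>y s y + fy s y * \<Psi> s y) + \<eta>'' y * (f s y * \<Psi> s y)) = inverse (- \<kappa>) * h s y - r y"
    proof -
      have \<kappa>: "\<kappa> \<noteq> 0" using k by (simp add: \<kappa>_def)
      have "h s y = (- \<kappa>) * (\<eta> y * (fyy s y * \<Psi> s y - f s y * \<Psi>yy s y))" by (simp add: h_def algebra_simps)
      then have "inverse (- \<kappa>) * h s y = \<eta> y * (fyy s y * \<Psi> s y - f s y * \<Psi>yy s y)" using \<kappa> by simp
      then show ?thesis unfolding r_def by (simp only:) (simp add: algebra_simps)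
    qed
    ultimately show "(P has_vector_derivative inverse (- \<kappa>) * h s y - r y) (at y within {c..d})"
      by (auto intro: has_vector_derivative_at_within)
  qed
  moreover
  have "h s integrable_on {c..d}" "r integrable_on {c..d}"
    unfolding h_def r_def
    using line[OF W(1) s] line[OF W(2) s] line[OF W(3) s] line[OF W(4) s] line[OF W(5) s] line[OF W(6) s]
      continuous_on_subset[OF \<eta>c(1)] continuous_on_subset[OF \<eta>c(2)] continuous_on_subset[OF \<eta>(3)]
    by (auto intro!: integrable_continuous_real continuous_intros)
  then have "((\<lambda>y. inverse (- \<kappa>) * h s y - r y) has_integral inverse (- \<kappa>) * integral {c..d} (h s) - integral {c..d} r) {c..d}"
    by (intro has_integral_diff has_integral_mult_right integrable_integral)
  ultimately have "inverse (- \<kappa>) * integral {c..d} (h s) - integral {c..d} r = P d - P c"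
    by (intro has_integral_unique)
  then have "integral {c..d} (h s) = - \<kappa> * (P d - P c + integral {c..d} r)"
    using k by (simp add: \<kappa>_def field_simps)
  with der show ?thesis unfolding P_def r_def \<kappa>_def by (simp only:)
qed

text \<open>
  The fundamental theorem of calculus for a limit of functions, when the errors of their derivatives tend to
  zero uniformly.
\<close>

lemma limit_of_derivatives:
  fixes J :: "nat \<Rightarrow> real \<Rightarrow> complex"
  assumes s: "s1 \<le> s2"
    and der: "\<And>n s. s \<in> {s1..s2} \<Longrightarrow> (J n has_vector_derivative g s + D n s) (at s within {s1..s2})"
    and D: "\<And>n s. s \<in> {s1..s2} \<Longrightarrow> norm (D n s) \<le> \<epsilon> n" and \<epsilon>: "\<epsilon> \<longlonglongrightarrow> 0"
    and g: "continuous_on {s1..s2} g"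
    and lim: "(\<lambda>n. J n s1) \<longlonglongrightarrow> A" "(\<lambda>n. J n s2) \<longlonglongrightarrow> B"
  shows "B - A = integral {s1..s2} g"
proof -
  define Q where "Q = (\<lambda>s. integral {s1..s} g)"
  have Q: "(Q has_vector_derivative g s) (at s within {s1..s2})" if "s \<in> {s1..s2}" for s
    unfolding Q_def by (rule integral_has_vector_derivative[OF g that])
  have bound: "norm ((J n s2 - Q s2) - (J n s1 - Q s1)) \<le> \<epsilon> n * norm (s2 - s1)" for n
  proof (rule differentiable_bound[where S = "{s1..s2}" and f' = "\<lambda>s h. h *\<^sub>R D n s"])
    show "((\<lambda>s. J n s - Q s) has_derivative (\<lambda>h. h *\<^sub>R D n s)) (at s within {s1..s2})" if "s \<in> {s1..s2}" for s
      using has_vector_derivative_diff[OF der[OF that, of n] Q[OF that]] by (simp add: has_vector_derivative_def)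
    show "onorm (\<lambda>h. h *\<^sub>R D n s) \<le> \<epsilon> n" if "s \<in> {s1..s2}" for s
      using D[OF that, of n] by (intro onorm_le) (auto simp: mult.commute intro: mult_left_mono)
  qed (use s in auto)
  have "(\<lambda>n. norm ((J n s2 - Q s2) - (J n s1 - Q s1))) \<longlonglongrightarrow> norm ((B - Q s2) - (A - Q s1))"
    by (intro tendsto_intros lim)
  moreover have "(\<lambda>n. norm ((J n s2 - Q s2) - (J n s1 - Q s1))) \<longlonglongrightarrow> 0"
  proof (rule Lim_null_comparison)
    have "(\<lambda>n. \<epsilon> n * norm (s2 - s1)) \<longlonglongrightarrow> 0 * norm (s2 - s1)" by (intro tendsto_intros \<epsilon>)
    then show "(\<lambda>n. \<epsilon> n * norm (s2 - s1)) \<longlonglongrightarrow> 0" by simp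
  qed (use bound in simp)
  ultimately have "(B - Q s2) - (A - Q s1) = 0" using LIMSEQ_unique by fastforce
  then have "B = A + integral {s1..s2} g" by (simp add: Q_def diff_eq_eq)
  then show ?thesis by simp
qed

lemma green_scale:
  assumes "Im k > 0" "x > 0"
  shows "green k x t = csqrt (k / (2 * of_real pi * \<i>)) / of_real (sqrt x) * exp (\<i> * k * (of_real t)\<^sup>2 / (2 * of_real x))"
proof -
  have "k / (2 * of_real pi * \<i>) = (- \<i> * k) / of_real (2 * pi)" by (simp add: field_simps)
  then have "Re (k / (2 * of_real pi * \<i>)) = Im k / (2 * pi)" by (simp only: Re_divide_of_real) simp
  then have "Re (k / (2 * of_real pi * \<i>)) > 0" using assms(1) by simp
  from csqrt_divide_of_real[OF assms(2) this]
  have "csqrt (k / (2 * of_real pi * \<i> * of_real x)) = csqrt (k / (2 * of_real pi * \<i>)) / of_real (sqrt x)"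
    by (simp add: divide_divide_eq_left)
  then show ?thesis using assms(2) by (simp add: green_def)
qed

text \<open>
  The second derivative of the kernel in \<open>y\<close>.
\<close>

definition green'' :: "complex \<Rightarrow> real \<Rightarrow> real \<Rightarrow> complex" where
  "green'' k x t = (\<i> * k / of_real x + (\<i> * k * of_real t / of_real x)\<^sup>2) * green k x t"

lemma green'_has_vector_derivative:
  assumes "x > 0" shows "((\<lambda>t. green' k x t) has_vector_derivative green'' k x t) (at t)"
proof -
  have "((\<lambda>t. \<i> * k / of_real x * of_real t) has_vector_derivative \<i> * k / of_real x) (at t)"
  proof -
    have "((\<lambda>z. \<i> * k / of_real x * z) has_field_derivative \<i> * k / of_real x) (at (of_real t))"
      by (rule DERIV_cmult_Id)
    from has_vector_derivative_real_field[OF this] show ?thesis .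
  qed
  from has_vector_derivative_mult[OF this green_has_vector_derivative[OF assms]]
  have "((\<lambda>t. (\<i> * k / of_real x * of_real t) * green k x t) has_vector_derivative
     (\<i> * k / of_real x * of_real t) * green' k x t + \<i> * k / of_real x * green k x t) (at t)" .
  then show ?thesis
    by (simp add: green'_def[abs_def] green''_def power2_eq_square algebra_simps)
qed

lemma decaying_green'':
  assumes "Im k > 0" "l > 0" shows "decaying \<epsilon> (green'' k l)"
proof -
  have [measurable]: "green'' k l \<in> borel_measurable borel" unfolding green''_def[abs_def] by measurable
  have eq: "green'' k l s = \<i> * k / of_real l * green k l s + \<i> * k / of_real l * (of_real s * green' k l s)" for s
    by (simp add: green''_def green'_def power2_eq_square algebra_simps)
  obtain C where C: "C \<ge> 0" "\<And>t. norm (green k l t) \<le> C * exp (- \<epsilon> * \<bar>t\<bar>)"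
    using decaying_green(1)[OF assms] by (rule decayingE) blast
  obtain D where D: "D \<ge> 0" "\<And>t. norm (green' k l t) \<le> D * exp (- (\<epsilon> + 1) * \<bar>t\<bar>)"
    using decaying_green(2)[OF assms] by (rule decayingE) blast
  define c where "c = norm (\<i> * k / of_real l)"
  have c: "c \<ge> 0" by (simp add: c_def)
  have "norm (green'' k l s) \<le> (c * C + c * D) * exp (- \<epsilon> * \<bar>s\<bar>)" for s
  proof -
    have "\<bar>s\<bar> \<le> exp \<bar>s\<bar>" using exp_ge_add_one_self[of "\<bar>s\<bar>"] by linarith
    then have "\<bar>s\<bar> * norm (green' k l s) \<le> exp \<bar>s\<bar> * (D * exp (- (\<epsilon> + 1) * \<bar>s\<bar>))"
      using D by (intro mult_mono) auto
    also have "\<dots> = D * (exp \<bar>s\<bar> * exp (- (\<epsilon> + 1) * \<bar>s\<bar>))" by simp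
    also have "exp \<bar>s\<bar> * exp (- (\<epsilon> + 1) * \<bar>s\<bar>) = exp (- \<epsilon> * \<bar>s\<bar>)"
      by (simp add: exp_add[symmetric] algebra_simps)
    finally have 1: "\<bar>s\<bar> * norm (green' k l s) \<le> D * exp (- \<epsilon> * \<bar>s\<bar>)" .
    have "norm (green'' k l s) \<le> norm (\<i> * k / of_real l * green k l s) + norm (\<i> * k / of_real l * (of_real s * green' k l s))"
      unfolding eq by (rule norm_triangle_ineq)
    also have "\<dots> = c * norm (green k l s) + c * (\<bar>s\<bar> * norm (green' k l s))"
      unfolding c_def norm_mult[of "\<i> * k / of_real l"] norm_mult[of "of_real s"] norm_of_real ..
    also have "\<dots> \<le> c * (C * exp (- \<epsilon> * \<bar>s\<bar>)) + c * (D * exp (- \<epsilon> * \<bar>s\<bar>))"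
      using 1 C c by (intro add_mono mult_left_mono)
    finally show ?thesis by (simp add: algebra_simps)
  qed
  then show ?thesis unfolding decaying_def by (intro conjI exI[of _ "c * C + c * D"] allI) measurable
qed

lemma green_time_derivative:
  assumes "Im k > 0" "x > 0"
  shows "((\<lambda>x. green k x t) has_vector_derivative - inverse (2 * \<i> * k) * green'' k x t) (at x)"
proof -
  have k0: "k \<noteq> 0" using assms by auto
  define c where "c = csqrt (k / (2 * of_real pi * \<i>))"
  have sx: "sqrt x > 0" "sqrt x * sqrt x = x" using assms by auto
  have d1: "((\<lambda>x. of_real (inverse (sqrt x))) has_vector_derivative complex_of_real (- (inverse (sqrt x) / 2) * inverse x)) (at x)"
  proof -
    have "((\<lambda>x. inverse (sqrt x)) has_real_derivative - (inverse (sqrt x) / 2) * inverse x) (at x)"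
      by (rule DERIV_cong[OF DERIV_inverse'[OF DERIV_real_sqrt]])
         (use assms sx in \<open>auto simp: field_simps\<close>)
    then show ?thesis
      unfolding has_real_derivative_iff_has_vector_derivative
      by (rule bounded_linear.has_vector_derivative[OF bounded_linear_of_real])
  qed
  have "((\<lambda>z. exp (\<i> * k * (of_real t)\<^sup>2 / (2 * z))) has_field_derivative
     exp (\<i> * k * (of_real t)\<^sup>2 / (2 * of_real x)) * (- (\<i> * k * (of_real t)\<^sup>2 / (2 * (of_real x)\<^sup>2)))) (at (of_real x))"
    using assms by (auto intro!: derivative_eq_intros simp: field_simps power2_eq_square)
  from has_vector_derivative_real_field[OF this]
  have d2: "((\<lambda>x. exp (\<i> * k * (of_real t)\<^sup>2 / (2 * of_real x))) has_vector_derivative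
     exp (\<i> * k * (of_real t)\<^sup>2 / (2 * of_real x)) * (- (\<i> * k * (of_real t)\<^sup>2 / (2 * (of_real x)\<^sup>2)))) (at x)" .
  let ?e = "exp (\<i> * k * (of_real t)\<^sup>2 / (2 * of_real x))"
  have "((\<lambda>x. c * (of_real (inverse (sqrt x)) * exp (\<i> * k * (of_real t)\<^sup>2 / (2 * of_real x)))) has_vector_derivative
     c * (of_real (inverse (sqrt x)) * (?e * (- (\<i> * k * (of_real t)\<^sup>2 / (2 * (of_real x)\<^sup>2))))
       + of_real (- (inverse (sqrt x) / 2) * inverse x) * ?e)) (at x)"
    by (intro has_vector_derivative_mult_right has_vector_derivative_mult d1 d2)
  moreover have "c * (of_real (inverse (sqrt x)) * (?e * (- (\<i> * k * (of_real t)\<^sup>2 / (2 * (of_real x)\<^sup>2))))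
       + of_real (- (inverse (sqrt x) / 2) * inverse x) * ?e) = - inverse (2 * \<i> * k) * green'' k x t"
  proof -
    have G: "green k x t = c * (of_real (inverse (sqrt x)) * ?e)"
      unfolding green_scale[OF assms] c_def by (simp only: divide_inverse of_real_inverse mult.assoc)
    have main: "- inverse (2 * \<i> * k) * green'' k x t = (- (1 / (2 * of_real x)) - \<i> * k * (of_real t)\<^sup>2 / (2 * (of_real x)\<^sup>2)) * green k x t"
    proof -
      have m: "- inverse (2 * \<i> * k) * (\<i> * k * z) = - (z / 2)" for z
      proof -
        have "\<i> * k * z = (2 * \<i> * k) * (z / 2)" by simp
        moreover have "- inverse c * (c * w) = - w" if "c \<noteq> 0" for c w :: complex using that by simp
        moreover have "2 * \<i> * k \<noteq> 0" using k0 by simp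
        ultimately show ?thesis by metis
      qed
      have "- inverse (2 * \<i> * k) * (\<i> * k / of_real x) = - (1 / (2 * of_real x))"
        using m[of "1 / of_real x"] by simp
      moreover have "- inverse (2 * \<i> * k) * (\<i> * k * of_real t / of_real x)\<^sup>2 = - (\<i> * k * (of_real t)\<^sup>2 / (2 * (of_real x)\<^sup>2))"
      proof -
        have "(\<i> * k * of_real t / of_real x)\<^sup>2 = \<i> * k * (\<i> * k * (of_real t)\<^sup>2 / (of_real x)\<^sup>2)"
          by (simp add: power2_eq_square)
        then show ?thesis using m[of "\<i> * k * (of_real t)\<^sup>2 / (of_real x)\<^sup>2"] by simp
      qed
      moreover have "- inverse (2 * \<i> * k) * green'' k x t = (- inverse (2 * \<i> * k) * (\<i> * k / of_real x)
          + - inverse (2 * \<i> * k) * (\<i> * k * of_real t / of_real x)\<^sup>2) * green k x t"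
        unfolding green''_def by (simp only: distrib_left distrib_right mult.assoc)
      ultimately show ?thesis by (simp only: diff_conv_add_uminus)
    qed
    have r: "of_real (- (inverse (sqrt x) / 2) * inverse x) = complex_of_real (inverse (sqrt x)) * (- (1 / (2 * of_real x)))"
    proof -
      have "- (s / 2) * inverse x = s * (- (1 / (2 * x)))" for s :: real
        by (simp add: inverse_eq_divide)
      then have "complex_of_real (- (inverse (sqrt x) / 2) * inverse x) = of_real (inverse (sqrt x)) * of_real (- (1 / (2 * x)))"
        by (simp only: of_real_mult)
      also have "complex_of_real (- (1 / (2 * x))) = - (1 / (2 * of_real x))" by simp
      finally show ?thesis .
    qed
    have gen: "c * (I * (e * (- B)) + I * (- A) * e) = (- A - B) * (c * (I * e))" for I e A B :: complex
      by (simp add: algebra_simps)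
    show ?thesis unfolding r gen main unfolding G ..
  qed
  ultimately have "((\<lambda>x. c * (of_real (inverse (sqrt x)) * exp (\<i> * k * (of_real t)\<^sup>2 / (2 * of_real x)))) has_vector_derivative
     - inverse (2 * \<i> * k) * green'' k x t) (at x)" by (simp only:)
  then show ?thesis
  proof (rule has_vector_derivative_transform_within_open[where S = "{0<..}"])
    show "c * (of_real (inverse (sqrt z)) * exp (\<i> * k * (of_real t)\<^sup>2 / (2 * of_real z))) = green k z t" if "z \<in> {0<..}" for z
      using that green_scale[OF assms(1), of z t] unfolding c_def
      by (simp only: greaterThan_iff divide_inverse of_real_inverse mult.assoc)
  qed (use assms in auto)
qed

lemma green_uniform_bound:
  assumes "Im k > 0" "0 < h1"
  obtains M where "M \<ge> 0" "\<And>h t. h1 \<le> h \<Longrightarrow> h \<le> h2 \<Longrightarrow> norm (green k h t) \<le> M * exp (- \<bar>t\<bar>)"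
    "\<And>h t. h1 \<le> h \<Longrightarrow> h \<le> h2 \<Longrightarrow> norm (green' k h t) \<le> M * exp (- \<bar>t\<bar>)"
proof (cases "h1 \<le> h2")
  case True
  define c where "c = norm (csqrt (k / (2 * of_real pi * \<i>))) / sqrt h1"
  define A where "A = Im k / (2 * h2)"
  have A: "A > 0" using assms True by (simp add: A_def)
  have c: "c \<ge> 0" using assms by (simp add: c_def)
  have g: "norm (green k h t) \<le> c * exp (- A * t\<^sup>2)" if "h1 \<le> h" "h \<le> h2" for h t
  proof -
    have h: "h > 0" using that assms by simp
    have "Re (\<i> * k * (of_real t)\<^sup>2 / (2 * of_real h)) = - (Im k / (2 * h)) * t\<^sup>2"
      using Re_divide_of_real[of "\<i> * k * (of_real t)\<^sup>2" "2 * h"] by (simp flip: of_real_power)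
    then have "norm (green k h t) = norm (csqrt (k / (2 * of_real pi * \<i>))) / sqrt h * exp (- (Im k / (2 * h)) * t\<^sup>2)"
      using h by (simp only: green_scale[OF assms(1) h] norm_mult norm_divide norm_exp_eq_Re norm_of_real) simp
    also have "\<dots> \<le> c * exp (- A * t\<^sup>2)"
      unfolding c_def A_def using that assms h
      by (intro mult_mono divide_left_mono) (auto intro!: mult_right_mono divide_left_mono)
    finally show ?thesis .
  qed
  define M where "M = c * (fact 0 * exp ((1 + 1)\<^sup>2 / (4 * A))) + norm k / h1 * (c * (fact 1 * exp ((1 + 1)\<^sup>2 / (4 * A))))"
  have M: "c * (fact 0 * exp ((1 + 1)\<^sup>2 / (4 * A))) \<le> M" "norm k / h1 * (c * (fact 1 * exp ((1 + 1)\<^sup>2 / (4 * A)))) \<le> M"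
    using c assms by (auto simp: M_def)
  show ?thesis
  proof (rule that[of M])
    show "M \<ge> 0" using c assms by (simp add: M_def)
    fix h t assume h: "h1 \<le> h" "h \<le> h2"
    have "norm (green k h t) \<le> c * (\<bar>t\<bar> ^ 0 * exp (- A * t\<^sup>2))" using g[OF h] by simp
    also have "\<dots> \<le> c * (fact 0 * exp ((1 + 1)\<^sup>2 / (4 * A)) * exp (- 1 * \<bar>t\<bar>))"
      by (intro mult_left_mono abs_mult_gaussian_le_exp_abs[OF A] c)
    also have "\<dots> = c * (fact 0 * exp ((1 + 1)\<^sup>2 / (4 * A))) * exp (- \<bar>t\<bar>)" by simp
    also have "\<dots> \<le> M * exp (- \<bar>t\<bar>)" by (intro mult_right_mono M) auto
    finally show "norm (green k h t) \<le> M * exp (- \<bar>t\<bar>)" .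
    have "norm (green' k h t) = norm k / h * \<bar>t\<bar> * norm (green k h t)"
      using h assms by (simp add: green'_def norm_mult norm_divide)
    also have "\<dots> \<le> norm k / h1 * \<bar>t\<bar> * (c * exp (- A * t\<^sup>2))"
      using h assms g[OF h] by (intro mult_mono divide_left_mono) auto
    also have "\<dots> = norm k / h1 * (c * (\<bar>t\<bar> ^ 1 * exp (- A * t\<^sup>2)))" by simp
    also have "\<dots> \<le> norm k / h1 * (c * (fact 1 * exp ((1 + 1)\<^sup>2 / (4 * A)) * exp (- 1 * \<bar>t\<bar>)))"
      using c assms by (intro mult_left_mono abs_mult_gaussian_le_exp_abs[OF A]) auto
    also have "\<dots> = norm k / h1 * (c * (fact 1 * exp ((1 + 1)\<^sup>2 / (4 * A)))) * exp (- \<bar>t\<bar>)" by simp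
    also have "\<dots> \<le> M * exp (- \<bar>t\<bar>)" by (intro mult_right_mono M) auto
    finally show "norm (green' k h t) \<le> M * exp (- \<bar>t\<bar>)" .
  qed
qed (use that[of 0] in auto)

section \<open>Bounded solutions in a slab\<close>

lemma norm_integral_Icc_le:
  fixes g :: "real \<Rightarrow> complex"
  assumes g: "continuous_on {c..d} g" and w: "integrable lborel w"
    and le: "\<And>t. t \<in> {c..d} \<Longrightarrow> norm (g t) \<le> w t" and w0: "\<And>t. w t \<ge> 0"
  shows "norm (integral {c..d} g) \<le> (\<integral>t. w t \<partial>lborel)"
proof -
  have "set_integrable lborel {c..d} g" by (rule borel_integrable_atLeastAtMost'[OF g])
  then have "integral {c..d} g = (\<integral>t. indicator {c..d} t *\<^sub>R g t \<partial>lborel)"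
    using set_borel_integral_eq_integral(2) unfolding set_lebesgue_integral_def by metis
  then show ?thesis using w0 le by (auto intro!: norm_integral_le[OF w] simp: indicator_def)
qed

lemma tendsto_integral_cutoff:
  fixes F :: "real \<Rightarrow> complex" and h :: "nat \<Rightarrow> real \<Rightarrow> complex"
  assumes F: "continuous_on UNIV F" and h: "\<And>n. continuous_on UNIV (h n)"
    and [measurable]: "S \<in> sets borel"
    and w: "integrable lborel w" and le: "\<And>n t. t \<in> {c n..d n} \<Longrightarrow> norm (F t) \<le> w t" and w0: "\<And>t. w t \<ge> 0"
    and h1: "\<And>n t. t \<in> {c n..d n} \<Longrightarrow> norm (h n t) \<le> 1"
    and lim: "\<And>t. (\<lambda>n. indicator {c n..d n} t *\<^sub>R h n t) \<longlonglongrightarrow> indicator S t"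
  shows "(\<lambda>n. integral {c n..d n} (\<lambda>t. h n t * F t)) \<longlonglongrightarrow> (LINT t:S|lborel. F t)"
proof -
  have [measurable]: "F \<in> borel_measurable borel" "\<And>n. h n \<in> borel_measurable borel"
    using F h by (auto intro: borel_measurable_continuous_onI)
  have eq: "integral {c n..d n} (\<lambda>t. h n t * F t) = (\<integral>t. (indicator {c n..d n} t *\<^sub>R h n t) * F t \<partial>lborel)" for n
  proof -
    have "set_integrable lborel {c n..d n} (\<lambda>t. h n t * F t)"
      using continuous_on_subset[OF F] continuous_on_subset[OF h]
      by (intro borel_integrable_atLeastAtMost' continuous_on_mult) auto
    then show ?thesis
      using set_borel_integral_eq_integral(2) unfolding set_lebesgue_integral_def by fastforce
  qed
  have "(\<lambda>n. \<integral>t. (indicator {c n..d n} t *\<^sub>R h n t) * F t \<partial>lborel) \<longlonglongrightarrow> (\<integral>t. indicator S t *\<^sub>R F t \<partial>lborel)"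
  proof (rule integral_dominated_convergence[where w = w])
    show "AE t in lborel. (\<lambda>n. (indicator {c n..d n} t *\<^sub>R h n t) * F t) \<longlonglongrightarrow> indicator S t *\<^sub>R F t"
    proof (rule AE_I2)
      fix t
      have "(\<lambda>n. (indicator {c n..d n} t *\<^sub>R h n t) * F t) \<longlonglongrightarrow> indicator S t * F t"
        by (intro tendsto_mult lim tendsto_const)
      then show "(\<lambda>n. (indicator {c n..d n} t *\<^sub>R h n t) * F t) \<longlonglongrightarrow> indicator S t *\<^sub>R F t"
        by (cases "t \<in> S") (simp_all only: indicator_simps mult_1 mult_zero_left scaleR_one scaleR_zero_left not_False_eq_True)
    qed
    show "AE t in lborel. norm ((indicator {c n..d n} t *\<^sub>R h n t) * F t) \<le> w t" for n
    proof (rule AE_I2)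
      fix t
      show "norm ((indicator {c n..d n} t *\<^sub>R h n t) * F t) \<le> w t"
      proof (cases "t \<in> {c n..d n}")
        case True
        then show ?thesis using mult_mono[OF h1[OF True] le[OF True]] w0[of t] by (simp add: norm_mult)
      next
        case False
        then have "indicator {c n..d n} t = (0::real)" by (rule indicator_simps)
        then show ?thesis using w0[of t] by simp
      qed
    qed
  qed (use w in auto)
  then show ?thesis unfolding eq set_lebesgue_integral_def .
qed

lemma continuous_green_pair:
  assumes "Im k > 0"
  shows "continuous_on ({0<..} \<times> UNIV) (\<lambda>z. green k (fst z) (snd z))"
    "continuous_on ({0<..} \<times> UNIV) (\<lambda>z. green' k (fst z) (snd z))"
    "continuous_on ({0<..} \<times> UNIV) (\<lambda>z. green'' k (fst z) (snd z))"
proof -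
  show g: "continuous_on ({0<..} \<times> UNIV) (\<lambda>z. green k (fst z) (snd z))"
  proof (rule continuous_on_eq)
    show "continuous_on ({0<..} \<times> UNIV) (\<lambda>z. csqrt (k / (2 * of_real pi * \<i>)) / of_real (sqrt (fst z))
        * exp (\<i> * k * (of_real (snd z))\<^sup>2 / (2 * of_real (fst z))))"
      by (intro continuous_intros) auto
  qed (use green_scale[OF assms] in auto)
  show "continuous_on ({0<..} \<times> UNIV) (\<lambda>z. green' k (fst z) (snd z))"
    "continuous_on ({0<..} \<times> UNIV) (\<lambda>z. green'' k (fst z) (snd z))"
    unfolding green'_def green''_def by (intro continuous_intros g; auto)+
qed

text \<open>
  The diffusive scaling \<open>y \<sim> x\<^bsup>1/2\<^esup>\<close>; it exhibits the kernel as an approximate identity.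
\<close>

lemma green_selfsimilar:
  assumes "Im k > 0" "h > 0"
  shows "of_real (sqrt h) * green k h (sqrt h * t) = green k 1 t"
proof -
  have "(complex_of_real (sqrt h * t))\<^sup>2 = of_real h * (of_real t)\<^sup>2"
    using assms(2) by (simp add: power_mult_distrib flip: of_real_power)
  then have e: "\<i> * k * (of_real (sqrt h * t))\<^sup>2 / (2 * of_real h) = \<i> * k * (of_real t)\<^sup>2 / (2 * of_real 1)"
    using assms(2) by (simp only:) simp
  have "complex_of_real (sqrt h) \<noteq> 0" using assms(2) by simp
  then show ?thesis
    unfolding green_scale[OF assms] green_scale[OF assms(1) zero_less_one] e by simp
qed

lemma solves_section_continuous:
  assumes "solves k ({p<..<q} \<times> UNIV) f fy fyy" "p < s" "s < q"
  shows "continuous_on UNIV (f s)"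
  by (rule continuous_on_compose2[OF solves_continuous(1)[OF assms(1)], of _ "\<lambda>y. (s, y)", simplified])
     (use assms in \<open>auto intro!: continuous_intros\<close>)

text \<open>
  As a function of \<open>(s, t)\<close>, the kernel \<open>G(x - s, y - t)\<close> solves the adjoint equation, so that its
  pairing with \<open>f s\<close> does not depend on \<open>s\<close>. The cut-off errors vanish because \<open>f\<close> is bounded.
\<close>

lemma heat_constant_in_slab:
  assumes k: "Im k > 0" and f: "solves k ({p<..<q} \<times> UNIV) f fy fyy"
    and B: "\<And>x y. p < x \<Longrightarrow> x < q \<Longrightarrow> norm (f x y) \<le> B"
    and s: "p < s1" "s1 \<le> s2" "s2 < x" "x < q"
  shows "heat k (x - s1) (f s1) y = heat k (x - s2) (f s2) y"
proof -
  have k0: "k \<noteq> 0" using k by auto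
  have B0: "B \<ge> 0" using B[of s1 0] s norm_ge_zero[of "f s1 0"] by linarith
  define \<kappa> where "\<kappa> = inverse (2 * \<i> * k)"
  define U where "U = {p<..<x} \<times> (UNIV :: real set)"
  have fU: "solves k U f fy fyy" unfolding U_def by (rule solves_subset[OF f]) (use s in auto)
  obtain M where M: "M \<ge> 0" "\<And>h t. x - s2 \<le> h \<Longrightarrow> h \<le> x - s1 \<Longrightarrow> norm (green k h t) \<le> M * exp (- \<bar>t\<bar>)"
    "\<And>h t. x - s2 \<le> h \<Longrightarrow> h \<le> x - s1 \<Longrightarrow> norm (green' k h t) \<le> M * exp (- \<bar>t\<bar>)"
    using green_uniform_bound[OF k, of "x - s2" "x - s1"] s by auto
  define R where "R = (\<lambda>n::nat. real n + 1)"
  have R: "R n \<ge> 1" for n by (simp add: R_def)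
  \<comment> \<open>A cut-off that vanishes together with its derivative at \<open>\<plusminus>R\<close>, so that no boundary terms arise.\<close>
  define e where "e = (\<lambda>n t. complex_of_real ((1 - (t / R n)\<^sup>2)\<^sup>2))"
  define e' where "e' = (\<lambda>n t. complex_of_real (- 4 * (t / R n) * (1 - (t / R n)\<^sup>2) / R n))"
  define e'' where "e'' = (\<lambda>n t. complex_of_real ((12 * (t / R n)\<^sup>2 - 4) / (R n)\<^sup>2))"
  have de: "(e n has_vector_derivative e' n t) (at t)" for n t
    unfolding e_def e'_def using R[of n]
    by (intro has_vector_derivative_of_real) (auto intro!: derivative_eq_intros simp: field_simps power2_eq_square)
  have de': "(e' n has_vector_derivative e'' n t) (at t)" for n t
    unfolding e'_def e''_def using R[of n]
    by (intro has_vector_derivative_of_real) (auto intro!: derivative_eq_intros simp: field_simps power2_eq_square)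
  have ce: "continuous_on UNIV (e n)" "continuous_on UNIV (e' n)" "continuous_on UNIV (e'' n)" for n
    unfolding e_def e'_def e''_def using R[of n] by (auto intro!: continuous_intros)
  have sq: "\<bar>t / R n\<bar> \<le> 1" "(t / R n)\<^sup>2 \<le> 1" if "t \<in> {- R n..R n}" for n t
  proof -
    show 1: "\<bar>t / R n\<bar> \<le> 1" using that R[of n] by (auto simp: abs_le_iff divide_le_eq le_divide_eq)
    show "(t / R n)\<^sup>2 \<le> 1" using 1 by (simp add: abs_square_le_1)
  qed
  have be: "norm (e n t) \<le> 1" "norm (e' n t) \<le> 4 / R n" "norm (e'' n t) \<le> 8 / R n" if "t \<in> {- R n..R n}" for n t
  proof -
    note u = sq[OF that]
    have v: "0 \<le> 1 - (t / R n)\<^sup>2" "1 - (t / R n)\<^sup>2 \<le> 1" using u by auto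
    show "norm (e n t) \<le> 1" unfolding e_def norm_of_real using v by (simp add: power_le_one)
    have "\<bar>t / R n\<bar> * (1 - (t / R n)\<^sup>2) \<le> 1 * 1" using u v by (intro mult_mono) auto
    moreover have "norm (e' n t) = 4 * (\<bar>t / R n\<bar> * (1 - (t / R n)\<^sup>2)) / R n"
      unfolding e'_def norm_of_real using v R[of n] by (simp only: abs_divide abs_mult abs_of_nonneg)
    ultimately show "norm (e' n t) \<le> 4 / R n" using R[of n] by (simp only:) (rule divide_right_mono, linarith, linarith)
    have "0 \<le> (t / R n)\<^sup>2" by simp
    then have "\<bar>12 * (t / R n)\<^sup>2 - 4\<bar> \<le> 8" using u(2) by (simp only: abs_le_iff) linarith
    then have "norm (e'' n t) \<le> 8 / (R n)\<^sup>2"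
      unfolding e''_def norm_of_real using R[of n] by (simp only: abs_divide) (simp add: divide_right_mono)
    also have "\<dots> \<le> 8 / R n" using R[of n] by (intro divide_left_mono) (auto simp: power2_eq_square)
    finally show "norm (e'' n t) \<le> 8 / R n" .
  qed
  have zero: "e n (R n) = 0" "e n (- R n) = 0" "e' n (R n) = 0" "e' n (- R n) = 0" for n
    unfolding e_def e'_def using R[of n] by auto
  define \<Psi> where "\<Psi> = (\<lambda>s t. green k (x - s) (y - t))"
  define \<Psi>y where "\<Psi>y = (\<lambda>s t. - green' k (x - s) (y - t))"
  define \<Psi>yy where "\<Psi>yy = (\<lambda>s t. green'' k (x - s) (y - t))"
  have cU: "continuous_on U (\<lambda>z. (x - fst z, y - snd z))" by (intro continuous_intros)
  have im: "(\<lambda>z. (x - fst z, y - snd z)) ` U \<subseteq> {0<..} \<times> UNIV" by (auto simp: U_def)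
  have \<Psi>c: "continuous_on U (\<lambda>(x, y). \<Psi> x y)" "continuous_on U (\<lambda>(x, y). \<Psi>y x y)" "continuous_on U (\<lambda>(x, y). \<Psi>yy x y)"
    unfolding \<Psi>_def \<Psi>y_def \<Psi>yy_def case_prod_beta'
    using continuous_on_compose2[OF continuous_green_pair(1)[OF k] cU im] continuous_on_minus[OF continuous_on_compose2[OF continuous_green_pair(2)[OF k] cU im]]
      continuous_on_compose2[OF continuous_green_pair(3)[OF k] cU im]
    by simp_all
  have shift: "((\<lambda>t. G (c - t)) has_vector_derivative - D) (at t)" if "(G has_vector_derivative D) (at (c - t))" for G :: "real \<Rightarrow> complex" and D c t
  proof -
    have "((G \<circ> (\<lambda>t. c - t)) has_vector_derivative (-1) *\<^sub>R D) (at t)"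
      by (rule vector_diff_chain_at) (auto intro!: that derivative_eq_intros simp: has_real_derivative_iff_has_vector_derivative[symmetric])
    then show ?thesis by (simp add: o_def)
  qed
  have \<Psi>x: "((\<lambda>s. \<Psi> s t) has_vector_derivative \<kappa> * \<Psi>yy s t) (at s)" if "(s, t) \<in> U" for s t
    using shift[OF green_time_derivative[OF k], of x s] that unfolding \<Psi>_def \<Psi>yy_def \<kappa>_def by (simp add: U_def)
  have \<Psi>y: "((\<lambda>t. \<Psi> s t) has_vector_derivative \<Psi>y s t) (at t)" if "(s, t) \<in> U" for s t
    using shift[OF green_has_vector_derivative, of "x - s" k y t] that unfolding \<Psi>_def \<Psi>y_def by (simp add: U_def)
  have \<Psi>yy: "((\<lambda>t. \<Psi>y s t) has_vector_derivative \<Psi>yy s t) (at t)" if "(s, t) \<in> U" for s t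
    using has_vector_derivative_minus[OF shift[OF green'_has_vector_derivative, of "x - s" k y t]] that unfolding \<Psi>y_def \<Psi>yy_def by (simp add: U_def)
  have sec: "continuous_on UNIV (f s)" "continuous_on UNIV (\<Psi> s)" "continuous_on UNIV (\<Psi>y s)" if "s \<in> {s1..s2}" for s
  proof -
    show "continuous_on UNIV (f s)" by (rule solves_section_continuous[OF f]) (use that s in auto)
    show "continuous_on UNIV (\<Psi> s)"
      by (rule continuous_on_compose2[OF \<Psi>c(1), of _ "\<lambda>t. (s, t)", simplified]) (use that s in \<open>auto simp: U_def intro!: continuous_intros\<close>)
    show "continuous_on UNIV (\<Psi>y s)"
      by (rule continuous_on_compose2[OF \<Psi>c(2), of _ "\<lambda>t. (s, t)", simplified]) (use that s in \<open>auto simp: U_def intro!: continuous_intros\<close>)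
  qed
  have bound\<Psi>: "norm (\<Psi> s t) \<le> M * exp (- 1 * \<bar>y - t\<bar>)" "norm (\<Psi>y s t) \<le> M * exp (- 1 * \<bar>y - t\<bar>)" if "s \<in> {s1..s2}" for s t
    using M(2,3)[of "x - s" "y - t"] that by (auto simp: \<Psi>_def \<Psi>y_def)
  have int: "integrable lborel (\<lambda>t. exp (- 1 * \<bar>y - t\<bar>))"
    using lborel_integrable_real_affine_iff[of "-1" "\<lambda>t. exp (- 1 * \<bar>t\<bar>)" y] integrable_exp_abs[of 1] by simp
  define I where "I = (\<integral>t. exp (- 1 * \<bar>y - t\<bar>) \<partial>lborel)"
  define J where "J = (\<lambda>n s. integral {- R n..R n} (\<lambda>t. e n t * (f s t * \<Psi> s t)))"
  define r where "r = (\<lambda>n s t. f s t * (2 * e' n t * \<Psi>y s t + e'' n t * \<Psi> s t))"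
  have der: "(J n has_vector_derivative 0 + - \<kappa> * integral {- R n..R n} (r n s)) (at s within {s1..s2})" if "s \<in> {s1..s2}" for n s
  proof -
    have sub: "{s1..s2} \<times> {- R n..R n} \<subseteq> U" using s by (auto simp: U_def)
    have "- R n \<le> R n" using R[of n] by simp
    from weighted_mass_derivative[OF fU k0 sub that this \<Psi>c \<Psi>x[unfolded \<kappa>_def] \<Psi>y \<Psi>yy de[of n] de'[of n] ce(3)[of n]]
    show ?thesis unfolding J_def r_def \<kappa>_def zero by simp
  qed
  have D: "norm (- \<kappa> * integral {- R n..R n} (r n s)) \<le> norm \<kappa> * (B * M * 16 * I) / R n" if "s \<in> {s1..s2}" for n s
  proof -
    have "norm (integral {- R n..R n} (r n s)) \<le> (\<integral>t. (B * M * 16 / R n) * exp (- 1 * \<bar>y - t\<bar>) \<partial>lborel)"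
    proof (rule norm_integral_Icc_le)
      show "continuous_on {- R n..R n} (r n s)"
        unfolding r_def using sec[OF that] ce[of n]
        by (intro continuous_intros) (auto intro: continuous_on_subset)
      show "integrable lborel (\<lambda>t. (B * M * 16 / R n) * exp (- 1 * \<bar>y - t\<bar>))" using int by (rule integrable_mult_right)
      show "0 \<le> (B * M * 16 / R n) * exp (- 1 * \<bar>y - t\<bar>)" for t using B0 M(1) R[of n] by simp
      fix t assume t: "t \<in> {- R n..R n}"
      let ?E = "exp (- 1 * \<bar>y - t\<bar>)"
      have 1: "norm (2 * e' n t * \<Psi>y s t) \<le> 2 * (4 / R n) * (M * ?E)"
        unfolding norm_mult using be(2)[OF t] bound\<Psi>(2)[OF that, of t] R[of n] by (intro mult_mono) auto
      have 2: "norm (e'' n t * \<Psi> s t) \<le> (8 / R n) * (M * ?E)"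
        unfolding norm_mult using be(3)[OF t] bound\<Psi>(1)[OF that, of t] R[of n] by (intro mult_mono) auto
      have 3: "norm (2 * e' n t * \<Psi>y s t + e'' n t * \<Psi> s t) \<le> 2 * (4 / R n) * (M * ?E) + (8 / R n) * (M * ?E)"
        using norm_triangle_le[OF add_mono[OF 1 2]] .
      have "norm (r n s t) \<le> B * (2 * (4 / R n) * (M * ?E) + (8 / R n) * (M * ?E))"
        unfolding r_def norm_mult[of "f s t"] using B[of s t] that s B0 by (intro mult_mono 3) auto
      also have "\<dots> = (B * M * 16 / R n) * ?E" using R[of n] by (simp add: field_simps)
      finally show "norm (r n s t) \<le> (B * M * 16 / R n) * ?E" .
    qed
    also have "\<dots> = (B * M * 16 / R n) * I" unfolding I_def by simp
    finally have "norm \<kappa> * norm (integral {- R n..R n} (r n s)) \<le> norm \<kappa> * ((B * M * 16 / R n) * I)"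
      by (rule mult_left_mono) simp
    then show ?thesis by (simp add: norm_mult mult_ac)
  qed
  have lim0: "(\<lambda>n. norm \<kappa> * (B * M * 16 * I) / R n) \<longlonglongrightarrow> 0"
    unfolding R_def by (rule tendsto_divide_0[OF tendsto_const]) (rule filterlim_at_top_imp_at_infinity, real_asymp)
  have limJ: "(\<lambda>n. J n s) \<longlonglongrightarrow> heat k (x - s) (f s) y" if "s \<in> {s1..s2}" for s
  proof -
    have "(\<lambda>n. integral {- R n..R n} (\<lambda>t. e n t * (f s t * \<Psi> s t))) \<longlonglongrightarrow> (LINT t:UNIV|lborel. f s t * \<Psi> s t)"
    proof (rule tendsto_integral_cutoff[where w = "\<lambda>t. B * M * exp (- 1 * \<bar>y - t\<bar>)"])
      show "continuous_on UNIV (\<lambda>t. f s t * \<Psi> s t)" by (intro continuous_on_mult sec that)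
      show "integrable lborel (\<lambda>t. B * M * exp (- 1 * \<bar>y - t\<bar>))" using int by (rule integrable_mult_right)
      show "norm (f s t * \<Psi> s t) \<le> B * M * exp (- 1 * \<bar>y - t\<bar>)" for t
        using mult_mono[OF B[of s t] bound\<Psi>(1)[OF that, of t]] that s B0 by (simp add: norm_mult mult.assoc)
      show "0 \<le> B * M * exp (- 1 * \<bar>y - t\<bar>)" for t using B0 M(1) by simp
      fix t :: real
      have ev: "\<forall>\<^sub>F n in sequentially. indicator {- R n..R n} t *\<^sub>R e n t = of_real ((1 - (t / (real n + 1))\<^sup>2)\<^sup>2)"
      proof (rule eventually_sequentiallyI)
        fix n assume "nat \<lceil>\<bar>t\<bar>\<rceil> \<le> n"
        then have "\<bar>t\<bar> \<le> R n" unfolding R_def by linarith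
        then have "t \<in> {- R n..R n}" by auto
        then show "indicator {- R n..R n} t *\<^sub>R e n t = of_real ((1 - (t / (real n + 1))\<^sup>2)\<^sup>2)" by (simp add: e_def R_def)
      qed
      have "(\<lambda>n. t * inverse (real (Suc n))) \<longlonglongrightarrow> t * 0"
        by (rule tendsto_mult_left[OF LIMSEQ_inverse_real_of_nat])
      then have "(\<lambda>n. (1 - (t * inverse (real (Suc n)))\<^sup>2)\<^sup>2) \<longlonglongrightarrow> (1 - (t * 0)\<^sup>2)\<^sup>2"
        by (rule tendsto_power[OF tendsto_diff[OF tendsto_const tendsto_power]])
      then have "(\<lambda>n. (1 - (t / (real n + 1))\<^sup>2)\<^sup>2) \<longlonglongrightarrow> 1" by (simp add: inverse_eq_divide add.commute)
      then have "(\<lambda>n. complex_of_real ((1 - (t / (real n + 1))\<^sup>2)\<^sup>2)) \<longlonglongrightarrow> of_real 1" by (rule tendsto_of_real)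
      then show "(\<lambda>n. indicator {- R n..R n} t *\<^sub>R e n t) \<longlonglongrightarrow> indicator UNIV t"
        using tendsto_cong[OF ev] by simp
    qed (use ce be in auto)
    then show ?thesis unfolding J_def heat_def \<Psi>_def by (simp add: set_lebesgue_integral_def mult.commute)
  qed
  have "heat k (x - s2) (f s2) y - heat k (x - s1) (f s1) y = integral {s1..s2} (\<lambda>_. 0)"
    by (rule limit_of_derivatives[OF s(2) der D lim0 _ limJ limJ]) (use s in auto)
  then show ?thesis by simp
qed

text \<open>
  By the previous lemma the initial line can be moved up to \<open>x\<close>, where the kernel becomes an approximate
  identity.
\<close>

lemma heat_representation_interior:
  assumes k: "Im k > 0" and f: "solves k ({p<..<q} \<times> UNIV) f fy fyy"
    and B: "\<And>x y. p < x \<Longrightarrow> x < q \<Longrightarrow> norm (f x y) \<le> B"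
    and s: "p < s" "s < x" "x < q"
  shows "f x y = heat k (x - s) (f s) y"
proof -
  define h where "h = (\<lambda>n::nat. (x - s) / (real n + 2))"
  have h: "h n > 0" "h n < x - s" for n
  proof -
    show "h n > 0" using s by (simp add: h_def)
    have "(x - s) / (real n + 2) < (x - s) / 1" using s by (intro divide_strict_left_mono) auto
    then show "h n < x - s" by (simp add: h_def)
  qed
  have xb: "p < x - h n" "x - h n < q" for n using h[of n] s by linarith+
  have h0: "h \<longlonglongrightarrow> 0" unfolding h_def by real_asymp
  have eq: "heat k (x - s) (f s) y = (\<integral>t. green k 1 t * f (x - h n) (y - sqrt (h n) * t) \<partial>lborel)" for n
  proof -
    have "heat k (x - s) (f s) y = heat k (x - (x - h n)) (f (x - h n)) y"
      using h[of n] s by (intro heat_constant_in_slab[OF k f B]) auto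
    also have "\<dots> = \<bar>- sqrt (h n)\<bar> *\<^sub>R (\<integral>t. green k (h n) (y - (y + (- sqrt (h n)) * t)) * f (x - h n) (y + (- sqrt (h n)) * t) \<partial>lborel)"
      unfolding heat_def using h[of n] by (subst lborel_integral_real_affine[of "- sqrt (h n)" _ y]) auto
    also have "\<dots> = (\<integral>t. (of_real (sqrt (h n)) * green k (h n) (sqrt (h n) * t)) * f (x - h n) (y - sqrt (h n) * t) \<partial>lborel)"
      using h[of n] by (simp add: scaleR_conv_of_real mult.assoc)
    also have "\<dots> = (\<integral>t. green k 1 t * f (x - h n) (y - sqrt (h n) * t) \<partial>lborel)"
      by (simp only: green_selfsimilar[OF k h(1)])
    finally show ?thesis .
  qed
  have B0: "B \<ge> 0" using B[of s 0] s norm_ge_zero[of "f s 0"] by linarith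
  have "(\<lambda>n. \<integral>t. green k 1 t * f (x - h n) (y - sqrt (h n) * t) \<partial>lborel) \<longlonglongrightarrow> (\<integral>t. green k 1 t * f x y \<partial>lborel)"
  proof (rule integral_dominated_convergence[where w = "\<lambda>t. norm (green k 1 t) * B"])
    show "integrable lborel (\<lambda>t. norm (green k 1 t) * B)"
      using decaying_integrable[OF decaying_green(1)[OF k, of 1 1]] by (intro integrable_mult_left integrable_norm) auto
    show "(\<lambda>t. green k 1 t * f (x - h n) (y - sqrt (h n) * t)) \<in> borel_measurable lborel" for n
    proof -
      have [measurable]: "f (x - h n) \<in> borel_measurable borel"
        using solves_section_continuous[OF f, of "x - h n"] h[of n] s by (intro borel_measurable_continuous_onI) auto
      show ?thesis by measurable
    qed
    show "AE t in lborel. norm (green k 1 t * f (x - h n) (y - sqrt (h n) * t)) \<le> norm (green k 1 t) * B" for n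
      using h[of n] s by (intro AE_I2) (auto simp: norm_mult intro!: mult_left_mono B)
    show "AE t in lborel. (\<lambda>n. green k 1 t * f (x - h n) (y - sqrt (h n) * t)) \<longlonglongrightarrow> green k 1 t * f x y"
    proof (intro AE_I2 tendsto_mult tendsto_const)
      fix t
      have "(\<lambda>n. (x - h n, y - sqrt (h n) * t)) \<longlonglongrightarrow> (x - 0, y - sqrt 0 * t)"
        by (intro tendsto_intros h0)
      then have "(\<lambda>n. (x - h n, y - sqrt (h n) * t)) \<longlonglongrightarrow> (x, y)" by simp
      then have "(\<lambda>n. (\<lambda>z. f (fst z) (snd z)) (x - h n, y - sqrt (h n) * t)) \<longlonglongrightarrow> (\<lambda>z. f (fst z) (snd z)) (x, y)"
        by (rule continuous_on_tendsto_compose[OF solves_continuous(1)[OF f]]) (use xb s in \<open>auto intro!: always_eventually\<close>)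
      then show "(\<lambda>n. f (x - h n) (y - sqrt (h n) * t)) \<longlonglongrightarrow> f x y" by simp
    qed
  qed simp
  then have "(\<lambda>n::nat. heat k (x - s) (f s) y) \<longlonglongrightarrow> (\<integral>t. green k 1 t * f x y \<partial>lborel)"
    unfolding eq[symmetric] .
  then have "heat k (x - s) (f s) y = (\<integral>t. green k 1 t * f x y \<partial>lborel)" by (simp add: LIMSEQ_const_iff)
  also have "\<dots> = f x y" using integral_green[OF k, of 1] by simp
  finally show ?thesis by simp
qed

lemma tendsto_heat:
  assumes k: "Im k > 0" and l: "0 < l"
    and f: "\<And>n. f n \<in> borel_measurable borel" "\<And>n t. norm (f n t) \<le> B"
    and f0: "f0 \<in> borel_measurable borel" and ls: "ls \<longlonglongrightarrow> l"
    and lim: "\<And>t. t \<noteq> 0 \<Longrightarrow> (\<lambda>n. f n t) \<longlonglongrightarrow> f0 t"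
  shows "(\<lambda>n. heat k (ls n) (f n) y) \<longlonglongrightarrow> heat k l f0 y"
proof -
  obtain M where M: "M \<ge> 0" "\<And>h t. l / 2 \<le> h \<Longrightarrow> h \<le> 2 * l \<Longrightarrow> norm (green k h t) \<le> M * exp (- \<bar>t\<bar>)"
  proof -
    have "0 < l / 2" using l by simp
    from green_uniform_bound[OF k this, of "2 * l"] show ?thesis using that by metis
  qed
  have B0: "B \<ge> 0" using f(2)[of 0 0] norm_ge_zero order_trans by blast
  have "\<forall>\<^sub>F n in sequentially. l / 2 < ls n \<and> ls n < 2 * l"
    using l by (intro eventually_conj order_tendstoD(1)[OF ls] order_tendstoD(2)[OF ls]) simp_all
  then obtain N where N: "\<And>n. n \<ge> N \<Longrightarrow> l / 2 < ls n \<and> ls n < 2 * l" by (auto simp: eventually_sequentially)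
  note [measurable] = f(1) f0
  have "(\<lambda>n. \<integral>t. green k (ls (n + N)) (y - t) * f (n + N) t \<partial>lborel) \<longlonglongrightarrow> (\<integral>t. green k l (y - t) * f0 t \<partial>lborel)"
  proof (rule integral_dominated_convergence[where w = "\<lambda>t. M * B * exp (- 1 * \<bar>y - t\<bar>)"])
    show "integrable lborel (\<lambda>t. M * B * exp (- 1 * \<bar>y - t\<bar>))"
      using lborel_integrable_real_affine_iff[of "-1" "\<lambda>t. exp (- 1 * \<bar>t\<bar>)" y] integrable_exp_abs[of 1] by simp
    show "AE t in lborel. norm (green k (ls (n + N)) (y - t) * f (n + N) t) \<le> M * B * exp (- 1 * \<bar>y - t\<bar>)" for n
    proof (rule AE_I2)
      fix t
      have "norm (green k (ls (n + N)) (y - t) * f (n + N) t) \<le> (M * exp (- \<bar>y - t\<bar>)) * B"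
        unfolding norm_mult using N[of "n + N"] f(2) M(1) by (intro mult_mono M(2)) auto
      then show "norm (green k (ls (n + N)) (y - t) * f (n + N) t) \<le> M * B * exp (- 1 * \<bar>y - t\<bar>)" by (simp add: mult_ac)
    qed
    show "AE t in lborel. (\<lambda>n. green k (ls (n + N)) (y - t) * f (n + N) t) \<longlonglongrightarrow> green k l (y - t) * f0 t"
      using AE_nonzero
    proof eventually_elim
      fix t :: real assume t: "t \<noteq> 0"
      have "(\<lambda>n. (ls (n + N), y - t)) \<longlonglongrightarrow> (l, y - t)"
        by (intro tendsto_Pair tendsto_const LIMSEQ_ignore_initial_segment ls)
      then have "(\<lambda>n. (\<lambda>z. green k (fst z) (snd z)) (ls (n + N), y - t)) \<longlonglongrightarrow> (\<lambda>z. green k (fst z) (snd z)) (l, y - t)"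
        by (rule continuous_on_tendsto_compose[OF continuous_green_pair(1)[OF k]])
           (use N l in \<open>auto intro!: always_eventually, smt (verit) le_add2 field_sum_of_halves\<close>)
      then show "(\<lambda>n. green k (ls (n + N)) (y - t) * f (n + N) t) \<longlonglongrightarrow> green k l (y - t) * f0 t"
        by (intro tendsto_mult LIMSEQ_ignore_initial_segment[OF lim[OF t]]) simp
    qed
  qed measurable
  then show ?thesis unfolding heat_def by (rule LIMSEQ_offset)
qed

text \<open>
  Uniqueness for the initial value problem: a bounded solution is determined by its values at the left end
  of the slab, even if these are attained only pointwise and away from the branch point \<open>y = 0\<close>.
\<close>

lemma slab_representation:
  assumes k: "Im k > 0" and pq: "p < q" and f: "solves k ({p<..<q} \<times> UNIV) f fy fyy"
    and B: "\<And>x y. p < x \<Longrightarrow> x < q \<Longrightarrow> norm (f x y) \<le> B"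
    and f0: "f0 \<in> borel_measurable borel" "\<And>y. y \<noteq> 0 \<Longrightarrow> ((\<lambda>x. f x y) \<longlongrightarrow> f0 y) (at_right p)"
    and f1: "((\<lambda>x. f x y) \<longlongrightarrow> L) (at_left q)"
  shows "L = heat k (q - p) f0 y"
proof -
  define s where "s = (\<lambda>n::nat. p + (q - p) / (real n + 3))"
  define r where "r = (\<lambda>n::nat. q - (q - p) / (real n + 3))"
  have s: "p < s n" "s n < r m" "r m < q" for n m
  proof -
    have 1: "(q - p) / (real n + 3) \<le> (q - p) / 3" for n using pq by (intro divide_left_mono) auto
    have 2: "(q - p) / (real n + 3) > 0" for n using pq by simp
    show "p < s n" "r m < q" using 2 by (auto simp: s_def r_def)
    show "s n < r m"
    proof -
      have "s n \<le> p + (q - p) / 3" "q - (q - p) / 3 \<le> r m" using 1 by (auto simp: s_def r_def)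
      moreover have "p + (q - p) / 3 < q - (q - p) / 3" using pq by (simp add: field_simps)
      ultimately show ?thesis by linarith
    qed
  qed
  have sl: "s \<longlonglongrightarrow> p" and rl: "r \<longlonglongrightarrow> q" unfolding s_def r_def by real_asymp+
  have Bs: "norm (f (s n) t) \<le> B" for n t using B s(1)[of n] less_trans[OF s(2)[of n 0] s(3)] by simp
  have meas: "f (s n) \<in> borel_measurable borel" for n
    using solves_section_continuous[OF f, of "s n"] s(1)[of n] less_trans[OF s(2)[of n 0] s(3)[of 0]] by (intro borel_measurable_continuous_onI) auto
  have sr: "filterlim s (at_right p) sequentially"
    using sl s(1) by (auto simp: filterlim_at intro!: always_eventually)
  have rr: "filterlim r (at_left q) sequentially"
    using rl s(3) by (auto simp: filterlim_at intro!: always_eventually)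
  have lim0: "(\<lambda>n. f (s n) t) \<longlonglongrightarrow> f0 t" if "t \<noteq> 0" for t
    using filterlim_compose[OF f0(2)[OF that] sr] .
  have rep: "f (r m) y = heat k (r m - p) f0 y" for m
  proof -
    have "(\<lambda>n. heat k (r m - s n) (f (s n)) y) \<longlonglongrightarrow> heat k (r m - p) f0 y"
      by (rule tendsto_heat[OF k _ meas Bs f0(1) _ lim0])
         (use less_trans[OF s(1)[of 0] s(2)[of 0 m]] in \<open>auto intro!: tendsto_intros sl\<close>)
    moreover have "heat k (r m - s n) (f (s n)) y = f (r m) y" for n
      using heat_representation_interior[OF k f B s(1)[of n] s(2)[of n m] s(3)[of m]] by simp
    ultimately show ?thesis by (simp add: LIMSEQ_const_iff)
  qed
  have f0b: "bounded_measurable (\<lambda>t. if t = 0 then 0 else f0 t)"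
  proof -
    have "norm (f0 t) \<le> B" if "t \<noteq> 0" for t
      by (rule Lim_bounded[OF tendsto_norm[OF lim0[OF that]], of 0]) (simp add: Bs)
    moreover have "B \<ge> 0" using Bs[of 0 0] norm_ge_zero order_trans by blast
    ultimately show ?thesis using f0(1) unfolding bounded_measurable_def by (auto intro!: exI[of _ B])
  qed
  have hz: "heat k l f0 y = heat k l (\<lambda>t. if t = 0 then 0 else f0 t) y" for l
    unfolding heat_def using f0(1) by (intro integral_cong_nonzero) auto
  obtain B' where B': "\<And>t. norm (if t = 0 then 0 else f0 t) \<le> B'" using f0b by (rule bounded_measurableE) blast
  have "(\<lambda>m. heat k (r m - p) (\<lambda>t. if t = 0 then 0 else f0 t) y) \<longlonglongrightarrow> heat k (q - p) (\<lambda>t. if t = 0 then 0 else f0 t) y"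
    by (rule tendsto_heat[where B = B' and f = "\<lambda>_ t. if t = 0 then 0 else f0 t"])
       (use k pq B' bounded_measurable_measurable[OF f0b] in \<open>auto intro!: tendsto_intros rl\<close>)
  then have "(\<lambda>m. f (r m) y) \<longlonglongrightarrow> heat k (q - p) f0 y" unfolding rep hz .
  moreover have "(\<lambda>m. f (r m) y) \<longlonglongrightarrow> L" using filterlim_compose[OF f1 rr] .
  ultimately show ?thesis using LIMSEQ_unique by blast
qed

section \<open>Flux through a slab\<close>

text \<open>
  A solution of the adjoint equation. If \<open>k \<psi>\<^sup>2\<close> is real and \<open>Im (k \<psi>) > 0\<close>, it decays for \<open>y \<rightarrow> -\<infinity>\<close>, and on a line \<open>y = const\<close> it is the
  complex conjugate, up to a constant factor, of the Floquet harmonic with angle \<open>\<psi>\<close>.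
\<close>

definition plane_wave :: "complex \<Rightarrow> complex \<Rightarrow> real \<Rightarrow> real \<Rightarrow> complex" where
  "plane_wave k \<psi> x y = exp (\<i> * k * of_real x * \<psi>\<^sup>2 / 2 - \<i> * k * \<psi> * of_real y)"

lemma plane_wave_derivatives:
  assumes "k \<noteq> 0"
  shows "((\<lambda>x. plane_wave k \<psi> x y) has_vector_derivative inverse (2 * \<i> * k) * (- (k\<^sup>2 * \<psi>\<^sup>2) * plane_wave k \<psi> x y)) (at x)"
    and "((\<lambda>y. plane_wave k \<psi> x y) has_vector_derivative - (\<i> * k * \<psi>) * plane_wave k \<psi> x y) (at y)"
    and "((\<lambda>y. - (\<i> * k * \<psi>) * plane_wave k \<psi> x y) has_vector_derivative - (k\<^sup>2 * \<psi>\<^sup>2) * plane_wave k \<psi> x y) (at y)"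
proof -
  have "((\<lambda>z. exp (\<i> * k * z * \<psi>\<^sup>2 / 2 - \<i> * k * \<psi> * of_real y)) has_field_derivative
      (\<i> * k * \<psi>\<^sup>2 / 2) * plane_wave k \<psi> x y) (at (of_real x))"
    unfolding plane_wave_def by (auto intro!: derivative_eq_intros)
  from has_vector_derivative_real_field[OF this]
  have "((\<lambda>x. plane_wave k \<psi> x y) has_vector_derivative (\<i> * k * \<psi>\<^sup>2 / 2) * plane_wave k \<psi> x y) (at x)"
    by (simp add: plane_wave_def)
  moreover have "inverse (2 * \<i> * k) * (- (k\<^sup>2 * \<psi>\<^sup>2) * w) = (\<i> * k * \<psi>\<^sup>2 / 2) * w" for w
  proof -
    have "- (k\<^sup>2 * \<psi>\<^sup>2) = (2 * \<i> * k) * (\<i> * k * \<psi>\<^sup>2 / 2)"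
      by (simp add: power2_eq_square) (metis (no_types, lifting) i_squared minus_mult_left mult.assoc mult.left_commute mult_1 power2_eq_square)
    moreover have "inverse c * ((c * d) * w) = d * w" if "c \<noteq> 0" for c d :: complex using that by simp
    moreover have "2 * \<i> * k \<noteq> 0" using assms by simp
    ultimately show ?thesis by metis
  qed
  ultimately show "((\<lambda>x. plane_wave k \<psi> x y) has_vector_derivative inverse (2 * \<i> * k) * (- (k\<^sup>2 * \<psi>\<^sup>2) * plane_wave k \<psi> x y)) (at x)"
    by (simp only:)
  have "((\<lambda>z. exp (\<i> * k * of_real x * \<psi>\<^sup>2 / 2 - \<i> * k * \<psi> * z)) has_field_derivative
      - (\<i> * k * \<psi>) * plane_wave k \<psi> x y) (at (of_real y))"
    unfolding plane_wave_def by (auto intro!: derivative_eq_intros)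
  from has_vector_derivative_real_field[OF this]
  show d: "((\<lambda>y. plane_wave k \<psi> x y) has_vector_derivative - (\<i> * k * \<psi>) * plane_wave k \<psi> x y) (at y)"
    by (simp add: plane_wave_def)
  have "- (\<i> * k * \<psi>) * (- (\<i> * k * \<psi>) * w) = - (k\<^sup>2 * \<psi>\<^sup>2) * w" for w
  proof -
    have "- (\<i> * k * \<psi>) * (- (\<i> * k * \<psi>)) = (\<i> * \<i>) * (k\<^sup>2 * \<psi>\<^sup>2)" by (simp only: power2_eq_square mult_ac minus_mult_minus)
    then show ?thesis by (simp add: mult.assoc[symmetric])
  qed
  then show "((\<lambda>y. - (\<i> * k * \<psi>) * plane_wave k \<psi> x y) has_vector_derivative - (k\<^sup>2 * \<psi>\<^sup>2) * plane_wave k \<psi> x y) (at y)"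
    using has_vector_derivative_mult_right[OF d, of "- (\<i> * k * \<psi>)"] by (simp only:)
qed

lemma continuous_plane_wave: "continuous_on S (\<lambda>z. plane_wave k \<psi> (f z) (g z))"
  if "continuous_on S f" "continuous_on S g"
  unfolding plane_wave_def by (intro continuous_intros that) auto

lemma norm_plane_wave:
  assumes "k * \<psi>\<^sup>2 \<in> \<real>"
  shows "norm (plane_wave k \<psi> x y) = exp (Im (k * \<psi>) * y)"
proof -
  from assms obtain r where r: "k * \<psi>\<^sup>2 = of_real r" by (auto elim: Reals_cases)
  have "\<i> * k * of_real x * \<psi>\<^sup>2 / 2 - \<i> * k * \<psi> * of_real y = \<i> * of_real x * (k * \<psi>\<^sup>2) / 2 - \<i> * (k * \<psi>) * of_real y"
    by (simp add: mult_ac)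
  also have "\<dots> = \<i> * of_real (x * r / 2) - \<i> * (k * \<psi>) * of_real y" unfolding r by simp
  finally have e: "\<i> * k * of_real x * \<psi>\<^sup>2 / 2 - \<i> * k * \<psi> * of_real y = \<i> * of_real (x * r / 2) - \<i> * (k * \<psi>) * of_real y" .
  have "Re (\<i> * of_real (x * r / 2) - \<i> * c * of_real y) = Im c * y" for c by simp
  then show ?thesis unfolding plane_wave_def e norm_exp_eq_Re by (simp only:)
qed

text \<open>
  Green's identity for a field and the adjoint plane wave on the part of a slab below height \<open>Y\<close>.
\<close>

lemma slab_flux:
  assumes k: "Im k > 0" and pq: "p < q" and f: "solves k ({p<..<q} \<times> UNIV) f fy fyy"
    and Y: "Y > 0" and B: "\<And>x y. p < x \<Longrightarrow> x < q \<Longrightarrow> y \<le> Y \<Longrightarrow> norm (f x y) \<le> B"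
    and \<psi>: "k * \<psi>\<^sup>2 \<in> \<real>" "Im (k * \<psi>) > 0"
    and f0: "f0 \<in> borel_measurable borel" "\<And>y. y \<noteq> 0 \<Longrightarrow> ((\<lambda>x. f x y) \<longlongrightarrow> f0 y) (at_right p)"
    and f1: "f1 \<in> borel_measurable borel" "\<And>y. y \<noteq> 0 \<Longrightarrow> ((\<lambda>x. f x y) \<longlongrightarrow> f1 y) (at_left q)"
    and g: "continuous_on {p..q} g" "\<And>x. p < x \<Longrightarrow> x < q \<Longrightarrow> g x = (fy x Y + \<i> * k * \<psi> * f x Y) * plane_wave k \<psi> x Y"
  shows "(LINT y:{..Y}|lborel. f1 y * plane_wave k \<psi> q y) - (LINT y:{..Y}|lborel. f0 y * plane_wave k \<psi> p y)
     = - inverse (2 * \<i> * k) * integral {p..q} g"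
proof -
  have k0: "k \<noteq> 0" using k by auto
  define \<nu> where "\<nu> = Im (k * \<psi>)"
  have \<nu>: "\<nu> > 0" using \<psi> by (simp add: \<nu>_def)
  define \<kappa> where "\<kappa> = inverse (2 * \<i> * k)"
  let ?P = "plane_wave k \<psi>"
  define W where "W = (\<lambda>y. exp (2 * \<nu> * Y) * exp (- \<nu> * \<bar>y\<bar>))"
  have W: "integrable lborel W" unfolding W_def by (intro integrable_mult_right integrable_exp_abs \<nu>)
  have W0: "W y \<ge> 0" for y by (simp add: W_def)
  have nP: "norm (?P x y) \<le> W y" if "y \<le> Y" for x y
  proof -
    have "\<nu> * (y + \<bar>y\<bar>) \<le> \<nu> * (2 * Y)" using that Y \<nu> by (intro mult_left_mono) auto
    then show ?thesis unfolding norm_plane_wave[OF \<psi>(1)] W_def \<nu>_def[symmetric] by (simp add: exp_add[symmetric] algebra_simps)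
  qed
  define m where "m = (p + q) / 2"
  have m: "p < m" "m < q" using pq by (auto simp: m_def field_simps)
  have B0: "B \<ge> 0" using B[of m 0] m Y norm_ge_zero[of "f m 0"] by linarith
  have interior: "(LINT y:{..Y}|lborel. f s2 y * ?P s2 y) - (LINT y:{..Y}|lborel. f s1 y * ?P s1 y) = - \<kappa> * integral {s1..s2} g"
    if s: "p < s1" "s1 \<le> s2" "s2 < q" for s1 s2
  proof -
    define U where "U = {p<..<q} \<times> (UNIV :: real set)"
    define R where "R = (\<lambda>n::nat. real n + 1)"
    have R: "R n \<ge> 1" for n by (simp add: R_def)
    have RY: "Y + R n \<ge> 1" "Y + R n \<ge> R n" for n using R[of n] Y by auto
    \<comment> \<open>Equal to \<open>1\<close> at \<open>Y\<close>, where the flux is to be kept, and vanishing together with its derivative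
      at \<open>-R\<close>.\<close>
    define e where "e = (\<lambda>n y. complex_of_real (((y + R n) / (Y + R n))\<^sup>2))"
    define e' where "e' = (\<lambda>n y. complex_of_real (2 * ((y + R n) / (Y + R n)) / (Y + R n)))"
    define e'' where "e'' = (\<lambda>n (y::real). complex_of_real (2 / (Y + R n)\<^sup>2))"
    have de: "(e n has_vector_derivative e' n y) (at y)" for n y
    proof -
      have "((\<lambda>y. (y + R n) / (Y + R n)) has_real_derivative 1 / (Y + R n)) (at y)"
        by (rule DERIV_cdivide) (auto intro!: derivative_eq_intros)
      from DERIV_power[OF this, of 2] show ?thesis
        unfolding e_def e'_def by (intro has_vector_derivative_of_real) (simp add: mult.commute)
    qed
    have de': "(e' n has_vector_derivative e'' n y) (at y)" for n y
    proof -
      have "((\<lambda>y. (y + R n) / (Y + R n)) has_real_derivative 1 / (Y + R n)) (at y)"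
        by (rule DERIV_cdivide) (auto intro!: derivative_eq_intros)
      from DERIV_cdivide[OF DERIV_cmult[OF this, of 2], of "Y + R n"] show ?thesis
        unfolding e'_def e''_def by (intro has_vector_derivative_of_real) (simp add: power2_eq_square)
    qed
    have ce: "continuous_on UNIV (e n)" "continuous_on UNIV (e' n)" "continuous_on UNIV (e'' n)" for n
      using has_vector_derivative_continuous[OF de[of n]] has_vector_derivative_continuous[OF de'[of n]]
      by (auto intro!: continuous_at_imp_continuous_on simp: e''_def)
    have be: "norm (e n y) \<le> 1" "norm (e' n y) \<le> 2 / R n" "norm (e'' n y) \<le> 2 / R n" if "y \<in> {- R n..Y}" for n y
    proof -
      have u: "0 \<le> (y + R n) / (Y + R n)" "(y + R n) / (Y + R n) \<le> 1" using that RY[of n] by (auto simp: divide_le_eq)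
      show "norm (e n y) \<le> 1" unfolding e_def norm_of_real using u by (simp add: power_le_one)
      have YR: "0 < Y + R n" using RY(1)[of n] by linarith
      have "0 \<le> 2 * ((y + R n) / (Y + R n)) / (Y + R n)"
        by (rule divide_nonneg_pos[OF mult_nonneg_nonneg[OF _ u(1)] YR]) simp
      then have "norm (e' n y) = 2 * ((y + R n) / (Y + R n)) / (Y + R n)"
        unfolding e'_def norm_of_real by (rule abs_of_nonneg)
      also have "\<dots> \<le> 2 * 1 / (Y + R n)" using u RY(1)[of n] by (intro divide_right_mono mult_left_mono) auto
      also have "\<dots> \<le> 2 / R n" using RY[of n] R[of n] by (simp add: frac_le)
      finally show "norm (e' n y) \<le> 2 / R n" .
      have "norm (e'' n y) = 2 / (Y + R n)\<^sup>2" unfolding e''_def norm_of_real by simp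
      also have "\<dots> \<le> 2 / R n"
      proof (rule divide_left_mono)
        have "R n * 1 \<le> (Y + R n) * (Y + R n)" using RY[of n] R[of n] by (intro mult_mono) auto
        then show "R n \<le> (Y + R n)\<^sup>2" by (simp add: power2_eq_square)
        show "0 < (Y + R n)\<^sup>2 * R n" using RY(1)[of n] R[of n] by simp
      qed simp
      finally show "norm (e'' n y) \<le> 2 / R n" .
    qed
    have ends: "e n (- R n) = 0" "e' n (- R n) = 0" "e n Y = 1" for n
    proof -
      have "(Y + R n) / (Y + R n) = 1" "(- R n + R n) / (Y + R n) = 0" using RY(1)[of n] by auto
      then show "e n (- R n) = 0" "e' n (- R n) = 0" "e n Y = 1" unfolding e_def e'_def by (simp_all only:) simp_all
    qed
    have Pc: "continuous_on U (\<lambda>(x, y). ?P x y)" "continuous_on U (\<lambda>(x, y). - (\<i> * k * \<psi>) * ?P x y)"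
        "continuous_on U (\<lambda>(x, y). - (k\<^sup>2 * \<psi>\<^sup>2) * ?P x y)"
      unfolding case_prod_beta' by (intro continuous_on_mult continuous_on_const continuous_plane_wave continuous_on_fst continuous_on_snd continuous_on_id)+
    define J where "J = (\<lambda>n s. integral {- R n..Y} (\<lambda>y. e n y * (f s y * ?P s y)))"
    define r where "r = (\<lambda>n s y. f s y * (2 * e' n y * (- (\<i> * k * \<psi>) * ?P s y) + e'' n y * ?P s y))"
    define D where "D = (\<lambda>n s. - \<kappa> * (- e' n Y * (f s Y * ?P s Y) + integral {- R n..Y} (r n s)))"
    have fU: "solves k U f fy fyy" using f by (simp add: U_def)
    have sec: "continuous_on UNIV (f x)" if "x \<in> {s1..s2}" for x
      by (rule solves_section_continuous[OF f]) (use that s in auto)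
    have secP: "continuous_on UNIV (?P x)" for x by (intro continuous_plane_wave continuous_intros)
    have der: "(J n has_vector_derivative - \<kappa> * g x + D n x) (at x within {s1..s2})" if x: "x \<in> {s1..s2}" for n x
    proof -
      have sub: "{s1..s2} \<times> {- R n..Y} \<subseteq> U" using s by (auto simp: U_def)
      have le: "- R n \<le> Y" using R[of n] Y by linarith
      note d = weighted_mass_derivative[OF fU k0 sub x le Pc plane_wave_derivatives[OF k0] de[of n] de'[of n] ce(3)[of n]]
      have gx: "g x = fy x Y * ?P x Y - f x Y * (- (\<i> * k * \<psi>) * ?P x Y)" using g(2)[of x] x s by (simp add: algebra_simps)
      show ?thesis unfolding J_def
        by (rule has_vector_derivative_eq_rhs[OF d]) (simp add: ends gx D_def r_def \<kappa>_def algebra_simps)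
    qed
    define c where "c = norm \<kappa> * (B * W Y * 2 + B * (4 * norm (k * \<psi>) + 2) * (\<integral>y. W y \<partial>lborel))"
    have bD: "norm (D n x) \<le> c / R n" if x: "x \<in> {s1..s2}" for n x
    proof -
      have xb: "norm (f x y) \<le> B" if "y \<le> Y" for y using B[of x y] x s that by auto
      have 1: "norm (- e' n Y * (f x Y * ?P x Y)) \<le> (2 / R n) * (B * W Y)"
        unfolding norm_mult norm_minus_cancel using be(2)[of Y n] RY(1)[of n] R[of n] nP[of Y x] xb[of Y] B0 W0[of Y] Y
        by (intro mult_mono) auto
      have 2: "norm (integral {- R n..Y} (r n x)) \<le> (\<integral>y. (B * (4 * norm (k * \<psi>) + 2) / R n) * W y \<partial>lborel)"
      proof (rule norm_integral_Icc_le)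
        show "continuous_on {- R n..Y} (r n x)"
          unfolding r_def using continuous_on_subset[OF sec[OF x]] continuous_on_subset[OF secP] continuous_on_subset[OF ce(2)] continuous_on_subset[OF ce(3)]
          by (intro continuous_intros) auto
        show "integrable lborel (\<lambda>y. (B * (4 * norm (k * \<psi>) + 2) / R n) * W y)" using W by (rule integrable_mult_right)
        show "0 \<le> (B * (4 * norm (k * \<psi>) + 2) / R n) * W y" for y using B0 W0 R[of n] by simp
        fix y assume y: "y \<in> {- R n..Y}"
        have a: "norm (2 * e' n y * (- (\<i> * k * \<psi>) * ?P x y)) \<le> 2 * (2 / R n) * (norm (k * \<psi>) * W y)"
        proof -
          have "norm (2 * e' n y) \<le> 2 * (2 / R n)" using be(2)[OF y] by (simp add: norm_mult)
          moreover have "norm (- (\<i> * k * \<psi>) * ?P x y) \<le> norm (k * \<psi>) * W y"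
            using nP[of y x] y by (simp add: norm_mult mult_left_mono mult.assoc)
          ultimately show ?thesis unfolding norm_mult[of "2 * e' n y"] using R[of n] by (intro mult_mono) auto
        qed
        have b: "norm (e'' n y * ?P x y) \<le> (2 / R n) * W y"
          unfolding norm_mult using be(3)[OF y] nP[of y x] y R[of n] by (intro mult_mono) auto
        have "norm (r n x y) \<le> B * (2 * (2 / R n) * (norm (k * \<psi>) * W y) + (2 / R n) * W y)"
          unfolding r_def norm_mult[of "f x y"] using xb[of y] y B0 norm_triangle_le[OF add_mono[OF a b]]
          by (intro mult_mono) auto
        also have "\<dots> = (B * (4 * norm (k * \<psi>) + 2) / R n) * W y" using R[of n] by (simp add: field_simps)
        finally show "norm (r n x y) \<le> (B * (4 * norm (k * \<psi>) + 2) / R n) * W y" .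
      qed
      have "norm (D n x) \<le> norm \<kappa> * ((2 / R n) * (B * W Y) + (B * (4 * norm (k * \<psi>) + 2) / R n) * (\<integral>y. W y \<partial>lborel))"
        unfolding D_def norm_mult[of "- \<kappa>"] norm_minus_cancel
        using norm_triangle_le[OF add_mono[OF 1 2]] by (intro mult_left_mono) auto
      also have "\<dots> = c / R n" using R[of n] by (simp add: c_def field_simps)
      finally show ?thesis .
    qed
    have lim0: "(\<lambda>n. c / R n) \<longlonglongrightarrow> 0" unfolding R_def
      by (rule tendsto_divide_0[OF tendsto_const]) (rule filterlim_at_top_imp_at_infinity, real_asymp)
    have limJ: "(\<lambda>n. J n x) \<longlonglongrightarrow> (LINT y:{..Y}|lborel. f x y * ?P x y)" if x: "x \<in> {s1..s2}" for x
      unfolding J_def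
    proof (rule tendsto_integral_cutoff[where w = "\<lambda>y. B * W y"])
      show "continuous_on UNIV (\<lambda>y. f x y * ?P x y)" by (intro continuous_on_mult sec[OF x] secP)
      show "integrable lborel (\<lambda>y. B * W y)" using W by (rule integrable_mult_right)
      show "0 \<le> B * W y" for y using B0 W0 by simp
      show "norm (f x y * ?P x y) \<le> B * W y" if "y \<in> {- R n..Y}" for n y
        unfolding norm_mult using B[of x y] x s nP[of y x] that B0 by (intro mult_mono) auto
      fix y :: real
      show "(\<lambda>n. indicator {- R n..Y} y *\<^sub>R e n y) \<longlonglongrightarrow> indicator {..Y} y"
      proof (cases "y \<le> Y")
        case True
        have ev: "\<forall>\<^sub>F n in sequentially. indicator {- R n..Y} y *\<^sub>R e n y = of_real ((1 + (y - Y) * inverse (Y + R n))\<^sup>2)"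
        proof (rule eventually_sequentiallyI)
          fix n assume "nat \<lceil>\<bar>y\<bar>\<rceil> \<le> n"
          then have "- R n \<le> y" unfolding R_def by linarith
          then have i: "y \<in> {- R n..Y}" using True by simp
          have "(y + R n) / (Y + R n) = 1 + (y - Y) * inverse (Y + R n)" using RY(1)[of n] by (simp add: field_simps)
          then show "indicator {- R n..Y} y *\<^sub>R e n y = of_real ((1 + (y - Y) * inverse (Y + R n))\<^sup>2)"
            using indicator_simps(1)[OF i, where 'b = real] by (simp only: e_def scaleR_one)
        qed
        have "(\<lambda>n. inverse (Y + R n)) \<longlonglongrightarrow> 0" unfolding R_def
          by (rule tendsto_inverse_0_at_top) real_asymp
        then have "(\<lambda>n. (1 + (y - Y) * inverse (Y + R n))\<^sup>2) \<longlonglongrightarrow> (1 + (y - Y) * 0)\<^sup>2"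
          by (intro tendsto_power tendsto_add tendsto_const tendsto_mult_left)
        then have "(\<lambda>n. complex_of_real ((1 + (y - Y) * inverse (Y + R n))\<^sup>2)) \<longlonglongrightarrow> of_real ((1 + (y - Y) * 0)\<^sup>2)" by (rule tendsto_of_real)
        then show ?thesis using tendsto_cong[OF ev] True by simp
      next
        case False
        then have "y \<notin> {- R n..Y}" for n by auto
        then show ?thesis using False by simp
      qed
    qed (use ce be in auto)
    have gc: "continuous_on {s1..s2} g" by (rule continuous_on_subset[OF g(1)]) (use s in auto)
    have "(LINT y:{..Y}|lborel. f s2 y * ?P s2 y) - (LINT y:{..Y}|lborel. f s1 y * ?P s1 y) = integral {s1..s2} (\<lambda>x. - \<kappa> * g x)"
      by (rule limit_of_derivatives[OF s(2) der bD lim0 _ limJ limJ]) (use s gc in \<open>auto intro!: continuous_intros\<close>)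
    then show ?thesis by simp
  qed
  define s where "s = (\<lambda>n::nat. p + (q - p) / (real n + 3))"
  define r where "r = (\<lambda>n::nat. q - (q - p) / (real n + 3))"
  have s: "p < s n" "s n < r n" "r n < q" for n
  proof -
    have 1: "(q - p) / (real n + 3) \<le> (q - p) / 3" for n using pq by (intro divide_left_mono) auto
    have 2: "(q - p) / (real n + 3) > 0" for n using pq by simp
    show "p < s n" "r n < q" using 2 by (auto simp: s_def r_def)
    show "s n < r n"
    proof -
      have "s n \<le> p + (q - p) / 3" "q - (q - p) / 3 \<le> r n" using 1 by (auto simp: s_def r_def)
      moreover have "p + (q - p) / 3 < q - (q - p) / 3" using pq by (simp add: field_simps)
      ultimately show ?thesis by linarith
    qed
  qed
  have sl: "s \<longlonglongrightarrow> p" and rl: "r \<longlonglongrightarrow> q" unfolding s_def r_def by real_asymp+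
  have sr: "filterlim s (at_right p) sequentially"
    using sl s(1) by (auto simp: filterlim_at intro!: always_eventually)
  have rr: "filterlim r (at_left q) sequentially"
    using rl s(3) by (auto simp: filterlim_at intro!: always_eventually)
  have mass: "(\<lambda>n. LINT y:{..Y}|lborel. f (x n) y * ?P (x n) y) \<longlonglongrightarrow> (LINT y:{..Y}|lborel. h y * ?P x0 y)"
    if x: "\<And>n. p < x n" "\<And>n. x n < q" "x \<longlonglongrightarrow> x0" and h: "h \<in> borel_measurable borel" "\<And>y. y \<noteq> 0 \<Longrightarrow> (\<lambda>n. f (x n) y) \<longlonglongrightarrow> h y" for x x0 h
    unfolding set_lebesgue_integral_def
  proof (rule integral_dominated_convergence[where w = "\<lambda>y. B * W y"])
    have [measurable]: "f (x n) \<in> borel_measurable borel" for n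
      using solves_section_continuous[OF f x(1) x(2)] by (rule borel_measurable_continuous_onI)
    have [measurable]: "?P c \<in> borel_measurable borel" for c
      by (rule borel_measurable_continuous_onI) (intro continuous_plane_wave continuous_intros)
    note [measurable] = h(1)
    show "(\<lambda>y. indicator {..Y} y *\<^sub>R (h y * ?P x0 y)) \<in> borel_measurable lborel" by measurable
    show "(\<lambda>y. indicator {..Y} y *\<^sub>R (f (x n) y * ?P (x n) y)) \<in> borel_measurable lborel" for n by measurable
    show "integrable lborel (\<lambda>y. B * W y)" using W by (rule integrable_mult_right)
    show "AE y in lborel. norm (indicator {..Y} y *\<^sub>R (f (x n) y * ?P (x n) y)) \<le> B * W y" for n
    proof (rule AE_I2)
      fix y
      show "norm (indicator {..Y} y *\<^sub>R (f (x n) y * ?P (x n) y)) \<le> B * W y"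
      proof (cases "y \<le> Y")
        case True
        then show ?thesis using mult_mono[OF B[OF x(1) x(2) True] nP[OF True] B0 norm_ge_zero] by (simp add: norm_mult)
      qed (use B0 W0 in auto)
    qed
    show "AE y in lborel. (\<lambda>n. indicator {..Y} y *\<^sub>R (f (x n) y * ?P (x n) y)) \<longlonglongrightarrow> indicator {..Y} y *\<^sub>R (h y * ?P x0 y)"
      using AE_nonzero
    proof eventually_elim
      fix y :: real assume y: "y \<noteq> 0"
      have "continuous_on UNIV (\<lambda>x. ?P x y)" by (intro continuous_plane_wave continuous_intros)
      then have "(\<lambda>n. ?P (x n) y) \<longlonglongrightarrow> ?P x0 y" using x(3) continuous_on_tendsto_compose by fastforce
      then show "(\<lambda>n. indicator {..Y} y *\<^sub>R (f (x n) y * ?P (x n) y)) \<longlonglongrightarrow> indicator {..Y} y *\<^sub>R (h y * ?P x0 y)"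
        by (intro tendsto_scaleR tendsto_const tendsto_mult h(2)[OF y])
    qed
  qed
  have sq: "s n < q" "p < r n" for n using s[of n] by linarith+
  have L1: "(\<lambda>n. LINT y:{..Y}|lborel. f (s n) y * ?P (s n) y) \<longlonglongrightarrow> (LINT y:{..Y}|lborel. f0 y * ?P p y)"
    by (rule mass[OF s(1) sq(1) sl f0(1) filterlim_compose[OF f0(2) sr]])
  have L2: "(\<lambda>n. LINT y:{..Y}|lborel. f (r n) y * ?P (r n) y) \<longlonglongrightarrow> (LINT y:{..Y}|lborel. f1 y * ?P q y)"
    by (rule mass[OF sq(2) s(3) rl f1(1) filterlim_compose[OF f1(2) rr]])
  have gi: "g integrable_on {p..q}" using g(1) by (rule integrable_continuous_real)
  define Q where "Q = (\<lambda>x. integral {p..x} g)"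
  have Qc: "continuous_on {p..q} Q" unfolding Q_def by (rule indefinite_integral_continuous_1[OF gi])
  have split: "integral {s n..r n} g = Q (r n) - Q (s n)" for n
  proof -
    have "g integrable_on {p..r n}" by (rule integrable_subinterval_real[OF gi]) (use s[of n] in auto)
    then have "integral {p..s n} g + integral {s n..r n} g = integral {p..r n} g"
      using s[of n] by (intro Henstock_Kurzweil_Integration.integral_combine) auto
    then show ?thesis by (simp add: Q_def algebra_simps)
  qed
  have "(\<lambda>n. Q (r n) - Q (s n)) \<longlonglongrightarrow> Q q - Q p"
    by (intro tendsto_diff continuous_on_tendsto_compose[OF Qc] sl rl)
       (use s sq pq in \<open>auto intro!: always_eventually simp: less_imp_le\<close>)
  then have L3: "(\<lambda>n. integral {s n..r n} g) \<longlonglongrightarrow> integral {p..q} g" unfolding split by (simp add: Q_def)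
  have "(\<lambda>n. (LINT y:{..Y}|lborel. f (r n) y * ?P (r n) y) - (LINT y:{..Y}|lborel. f (s n) y * ?P (s n) y))
     \<longlonglongrightarrow> (LINT y:{..Y}|lborel. f1 y * ?P q y) - (LINT y:{..Y}|lborel. f0 y * ?P p y)"
    by (intro tendsto_diff L1 L2)
  moreover have "(\<lambda>n. - \<kappa> * integral {s n..r n} g) \<longlonglongrightarrow> - \<kappa> * integral {p..q} g"
    by (intro tendsto_mult_left L3)
  moreover have "(LINT y:{..Y}|lborel. f (r n) y * ?P (r n) y) - (LINT y:{..Y}|lborel. f (s n) y * ?P (s n) y) = - \<kappa> * integral {s n..r n} g" for n
    using interior[OF s(1) less_imp_le[OF s(2)] s(3)] .
  ultimately show ?thesis unfolding \<kappa>_def by (simp only: LIMSEQ_unique)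
qed

section \<open>Edge waves and directivities\<close>

lemma summable_even_odd:
  fixes t :: "nat \<Rightarrow> complex"
  assumes "(\<lambda>i. t (2 * i)) sums x" "(\<lambda>i. t (2 * i + 1)) sums y"
  shows "t sums (x + y)"
proof -
  have real: "r sums (x + y)" if "(\<lambda>i. r (2 * i)) sums x" "(\<lambda>i. r (2 * i + 1)) sums y" for r :: "nat \<Rightarrow> real" and x y
  proof -
    have "(\<lambda>n. if even n then r (2 * (n div 2)) else r (2 * ((n - 1) div 2) + 1)) sums (y + x)"
      by (rule sums_if[OF that(2) that(1)])
    also have "(\<lambda>n. if even n then r (2 * (n div 2)) else r (2 * ((n - 1) div 2) + 1)) = r"
      by (auto simp: fun_eq_iff elim!: oddE)
    finally show ?thesis by (simp add: add.commute)
  qed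
  show ?thesis
    using assms unfolding sums_complex_iff plus_complex.sel by (intro conjI real) auto
qed

text \<open>
  The restriction to \<open>y < 0\<close> appears because the fields jump only across the lower half-lines.
\<close>

definition half_wave :: "complex \<Rightarrow> real \<Rightarrow> complex" where
  "half_wave \<beta> y = (if y < 0 then exp (- \<i> * \<beta> * of_real y) else 0)"

lemma measurable_half_wave [measurable]: "half_wave \<beta> \<in> borel_measurable borel"
  unfolding half_wave_def[abs_def] by measurable

lemma decaying_half_wave: "Im \<beta> > 0 \<Longrightarrow> decaying (Im \<beta>) (half_wave \<beta>)"
  unfolding decaying_def by (auto intro!: exI[of _ 1] simp: half_wave_def)

context grating
begin

definition node :: "int \<Rightarrow> real" where "node n = xn a b n"

lemma node_Suc: "node (n + 1) = node n + width n"
proof (cases "even n")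
  case True
  then have "(n + 1) div 2 = n div 2" by (auto elim!: evenE)
  then show ?thesis using True by (simp add: node_def xn_def width_def)
next
  case False
  then have "(n + 1) div 2 = n div 2 + 1" by (auto elim!: oddE)
  then show ?thesis using False by (simp add: node_def xn_def width_def algebra_simps)
qed

lemma node_add2: "node (n + 2) = node n + a"
proof -
  have "node (n + 2) = node (n + 1) + width (n + 1)"
    using node_Suc[of "n + 1"] unfolding add.assoc one_add_one .
  then show ?thesis using node_Suc[of n] by (simp add: width_def split: if_splits)
qed

lemma node_0 [simp]: "node 0 = 0" and node_1 [simp]: "node 1 = b"
  by (simp_all add: node_def xn_def)

text \<open>
  The reflection \<open>x \<rightarrow> b - x\<close> of the grating exchanges the edges \<open>n\<close> and \<open>1 - n\<close>.
\<close>

lemma node_reflect: "node (1 - n) = b - node n"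
proof (cases "even n")
  case True
  then have "(1 - n) div 2 = - (n div 2)" by (auto elim!: evenE)
  then show ?thesis using True by (simp add: node_def xn_def)
next
  case False
  then have "(1 - n) div 2 = - (n div 2)" by (auto elim!: oddE)
  then show ?thesis using False by (simp add: node_def xn_def)
qed

lemma node_add_even: "node (n + 2 * int i) = node n + a * real i"
proof (induction i)
  case (Suc i)
  have "n + 2 * int (Suc i) = (n + 2 * int i) + 2" by simp
  then have "node (n + 2 * int (Suc i)) = node (n + 2 * int i) + a" by (simp only: node_add2)
  then show ?case unfolding Suc by (simp add: algebra_simps)
qed simp

lemma node_less_Suc: "node n < node (n + 1)"
  using node_Suc width_pos by simp

lemma node_strict_mono: "m < n \<Longrightarrow> node m < node n"
proof (induction n rule: int_gr_induct)
  case base show ?case by (rule node_less_Suc)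
next
  case (step i) then show ?case using node_less_Suc[of i] by simp
qed

lemma node_mono: "m \<le> n \<Longrightarrow> node m \<le> node n"
  using node_strict_mono by (metis less_eq_real_def order.order_iff_strict)

text \<open>The field \<open>w\<^sub>n (x\<^sub>n\<^sub>+\<^sub>j\<^sub>+\<^sub>1 - 0, \<cdot>)\<close>.\<close>

definition edge_wave :: "int \<Rightarrow> nat \<Rightarrow> real \<Rightarrow> complex" where
  "edge_wave n j = evolve (n + 1) j (green k (width n))"

lemma edge_wave_Suc: "edge_wave n (Suc j) = cross (n + 1 + int j) (edge_wave n j)"
  by (simp add: edge_wave_def)

lemma decaying_edge_wave: "\<epsilon> > 0 \<Longrightarrow> decaying \<epsilon> (edge_wave n j)"
  unfolding edge_wave_def by (intro decaying_evolve decaying_green Im_k width_pos)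

lemma edge_wave_parity: "even n = even m \<Longrightarrow> edge_wave n j = edge_wave m j"
  unfolding edge_wave_def using width_cong[of n m] evolve_cong_start[of "n + 1" "m + 1"] by simp

lemma edge_slab_eq: "edge_slab a b k n j (node (n + 1 + int j)) y = edge_wave n j y"
proof (induction j arbitrary: y)
  case 0
  show ?case using node_Suc[of n] by (simp add: edge_wave_def node_def)
next
  case (Suc j)
  have p: "xn a b (n + int (Suc j)) = node (n + 1 + int j)" by (simp add: node_def algebra_simps)
  have "n + 1 + int (Suc j) = (n + 1 + int j) + 1" by simp
  then have w: "node (n + 1 + int (Suc j)) - node (n + 1 + int j) = width (n + 1 + int j)"
    using node_Suc[of "n + 1 + int j"] by (simp only:)
  show ?case
    unfolding edge_slab.simps(2) Let_def p Suc w edge_wave_Suc cross_def heat_def flip_def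
    by (simp only: mult.commute)
qed

lemma edge_green_eq:
  "edge_green a b k n (node (n + 1 + int j)) y 1 = of_real (sgn y) * edge_wave n j y"
proof -
  let ?m = "n + 1 + int j"
  have "(THE m. xn a b m \<le> node ?m \<and> node ?m < xn a b (m + 1)) = ?m"
  proof (rule the_equality)
    show "xn a b ?m \<le> node ?m \<and> node ?m < xn a b (?m + 1)"
      using node_less_Suc[of ?m] by (simp add: node_def)
    fix m assume "xn a b m \<le> node ?m \<and> node ?m < xn a b (m + 1)"
    then have h: "node m \<le> node ?m" "node ?m < node (m + 1)" by (auto simp: node_def)
    have "\<not> ?m < m" using node_strict_mono[of ?m m] h(1) by linarith
    moreover have "\<not> m + 1 \<le> ?m" using node_mono[of "m + 1" ?m] h(2) by linarith
    ultimately show "m = ?m" by linarith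
  qed
  moreover have "\<not> node ?m \<le> xn a b n" using node_strict_mono[of n ?m] by (simp add: node_def)
  moreover have "nat (?m - 1 - n) = j" by simp
  moreover have "node ?m = xn a b ?m" by (simp add: node_def)
  ultimately show ?thesis
    using edge_slab_eq[of n j y] unfolding edge_green_def Let_def by simp
qed

definition edge_term :: "complex \<Rightarrow> int \<Rightarrow> nat \<Rightarrow> complex" where
  "edge_term \<psi> n j = exp (\<i> * k * of_real (node (n + 1 + int j) - node n) * \<psi>\<^sup>2 / 2)
     * (\<integral>y. edge_wave n j y * half_wave (k * \<psi>) y \<partial>lborel)"

text \<open>
  On the half-line \<open>y < 0\<close> the value behind an edge is minus the value in front of it, which \<open>edge_wave\<close>
  records; hence the minus sign.
\<close>

lemma directivity_eq:
  assumes "summable (edge_term \<psi> n)"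
  shows "directivity a b k n \<psi> = 1 - 2 * (\<Sum>j. edge_term \<psi> n j)"
proof -
  have "(LINT y:{..0}|lborel. edge_green a b k n (node (n + 1 + int j)) y 1 * exp (- \<i> * k * \<psi> * of_real y))
      = - (\<integral>y. edge_wave n j y * half_wave (k * \<psi>) y \<partial>lborel)" for j
    unfolding set_lebesgue_integral_def edge_green_eq
    by (subst Bochner_Integration.integral_minus[symmetric], intro Bochner_Integration.integral_cong refl)
       (auto simp: half_wave_def indicator_def sgn_real_def mult.assoc)
  then have "directivity a b k n \<psi> = 1 + 2 * (\<Sum>j. - edge_term \<psi> n j)"
    unfolding directivity_def Let_def edge_term_def node_def[symmetric] by simp
  also have "(\<Sum>j. - edge_term \<psi> n j) = - (\<Sum>j. edge_term \<psi> n j)"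
    by (rule suminf_minus[OF assms])
  finally show ?thesis by simp
qed

text \<open>
  The factors \<open>\<mu>\<^sup>i\<close> have modulus one, so convergence is drawn from their oscillation. The edges of
  either parity form one series of the type treated above.
\<close>

lemma edge_term_sums:
  assumes \<psi>: "k * \<psi>\<^sup>2 \<in> \<real>" "Im (k * \<psi>) > 0" and \<mu>: "\<mu> = exp (\<i> * k * of_real a * \<psi>\<^sup>2 / 2)" "\<mu> \<noteq> 1"
  shows "summable (\<lambda>i. \<mu> ^ i * (\<integral>y. edge_wave n (2 * i) y * half_wave (k * \<psi>) y \<partial>lborel))"
    and "summable (\<lambda>i. \<mu> ^ i * (\<integral>y. edge_wave n (2 * i + 1) y * half_wave (k * \<psi>) y \<partial>lborel))"
    and "edge_term \<psi> n sums
      (exp (\<i> * k * of_real (width n) * \<psi>\<^sup>2 / 2) * (\<Sum>i. \<mu> ^ i * (\<integral>y. edge_wave n (2 * i) y * half_wave (k * \<psi>) y \<partial>lborel))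
       + \<mu> * (\<Sum>i. \<mu> ^ i * (\<integral>y. edge_wave n (2 * i + 1) y * half_wave (k * \<psi>) y \<partial>lborel)))"
proof -
  have n\<mu>: "norm \<mu> = 1"
  proof -
    from \<psi>(1) obtain r where "k * \<psi>\<^sup>2 = of_real r" by (auto elim: Reals_cases)
    then have r: "\<i> * k * of_real a * \<psi>\<^sup>2 / 2 = \<i> * of_real (a * r / 2)"
      using arg_cong[of "k * \<psi>\<^sup>2" "of_real r" "\<lambda>w. \<i> * of_real a * w / 2"] by (simp add: mult_ac)
    show ?thesis unfolding \<mu>(1) r by simp
  qed
  note h = decaying_half_wave[OF \<psi>(2)]
  have G: "decaying (Im (k * \<psi>)) (green k (width n))" by (intro decaying_green Im_k width_pos)
  show p: "summable (\<lambda>i. \<mu> ^ i * (\<integral>y. edge_wave n (2 * i) y * half_wave (k * \<psi>) y \<partial>lborel))"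
    unfolding edge_wave_def by (rule summable_pairing_evolve[OF \<psi>(2) G h \<mu>(2) n\<mu>])
  have odd: "edge_wave n (2 * i + 1) = evolve (n + 2) (2 * i) (cross (n + 1) (green k (width n)))" for i
    using evolve_Suc_shift[of "n + 1" "2 * i" "green k (width n)"] by (simp add: edge_wave_def add.assoc del: evolve.simps)
  show q: "summable (\<lambda>i. \<mu> ^ i * (\<integral>y. edge_wave n (2 * i + 1) y * half_wave (k * \<psi>) y \<partial>lborel))"
    unfolding odd by (rule summable_pairing_evolve[OF \<psi>(2) decaying_cross[OF \<psi>(2) G] h \<mu>(2) n\<mu>])
  have \<mu>i: "exp (\<i> * k * of_real (c + a * real i) * \<psi>\<^sup>2 / 2) = exp (\<i> * k * of_real c * \<psi>\<^sup>2 / 2) * \<mu> ^ i" for c i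
  proof -
    have "\<i> * k * of_real (c + a * real i) * \<psi>\<^sup>2 / 2 = \<i> * k * of_real c * \<psi>\<^sup>2 / 2 + of_nat i * (\<i> * k * of_real a * \<psi>\<^sup>2 / 2)"
      by (simp add: field_simps)
    then show ?thesis unfolding \<mu>(1) by (simp only: exp_add exp_of_nat_mult)
  qed
  have n1: "node (n + 1 + int (2 * i)) - node n = width n + a * real i" for i
    using node_add_even[of "n + 1" i] node_Suc[of n] by simp
  have n2: "node (n + 1 + int (2 * i + 1)) - node n = a + a * real i" for i
    using node_add_even[of "n + 2" i] node_add2[of n] by (simp add: algebra_simps)
  show "edge_term \<psi> n sums
      (exp (\<i> * k * of_real (width n) * \<psi>\<^sup>2 / 2) * (\<Sum>i. \<mu> ^ i * (\<integral>y. edge_wave n (2 * i) y * half_wave (k * \<psi>) y \<partial>lborel))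
       + \<mu> * (\<Sum>i. \<mu> ^ i * (\<integral>y. edge_wave n (2 * i + 1) y * half_wave (k * \<psi>) y \<partial>lborel)))"
  proof (rule summable_even_odd)
    have "edge_term \<psi> n (2 * i) = exp (\<i> * k * of_real (width n) * \<psi>\<^sup>2 / 2) * (\<mu> ^ i * (\<integral>y. edge_wave n (2 * i) y * half_wave (k * \<psi>) y \<partial>lborel))" for i
      unfolding edge_term_def n1 \<mu>i by (simp only: mult.assoc)
    then show "(\<lambda>i. edge_term \<psi> n (2 * i)) sums (exp (\<i> * k * of_real (width n) * \<psi>\<^sup>2 / 2) * (\<Sum>i. \<mu> ^ i * (\<integral>y. edge_wave n (2 * i) y * half_wave (k * \<psi>) y \<partial>lborel)))"
      using sums_mult[OF summable_sums[OF p]] by simp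
    have "edge_term \<psi> n (2 * i + 1) = \<mu> * (\<mu> ^ i * (\<integral>y. edge_wave n (2 * i + 1) y * half_wave (k * \<psi>) y \<partial>lborel))" for i
      unfolding edge_term_def n2 \<mu>i \<mu>(1)[symmetric] by (simp only: mult.assoc)
    then show "(\<lambda>i. edge_term \<psi> n (2 * i + 1)) sums (\<mu> * (\<Sum>i. \<mu> ^ i * (\<integral>y. edge_wave n (2 * i + 1) y * half_wave (k * \<psi>) y \<partial>lborel)))"
      using sums_mult[OF summable_sums[OF q], of \<mu>] by simp
  qed
qed

end

section \<open>The reduced problem\<close>

text \<open>
  Here \<open>d m\<close> stands for the left-hand value at the edge \<open>m\<close> of the difference of the two sheets, minus the
  incident wave. Passing the edge flips the sum of \<open>d m\<close> and the incident wave, so relative to the unflipped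
  incident wave the lower half-line becomes a source.
\<close>

locale reduced_problem = grating +
  fixes \<theta> :: complex and d :: "int \<Rightarrow> real \<Rightarrow> complex"
  assumes k\<theta>2: "k * \<theta>\<^sup>2 \<in> \<real>" and Im_k\<theta>: "Im (k * \<theta>) > 0"
    and nonresonant: "exp (\<i> * k * of_real a * \<theta>\<^sup>2 / 2) \<noteq> 1"
    and d_bounded: "\<And>m. bounded_measurable (d m)"
    and d_step: "\<And>m. d (m + 1) = heat k (width m) (\<lambda>y. flip (d m) y
        - 2 * (exp (- \<i> * k * of_real (node m) * \<theta>\<^sup>2 / 2) * half_wave (k * \<theta>) y))"
    and d_floquet: "\<And>m y. d (m + 2) y = exp (- \<i> * k * of_real a * \<theta>\<^sup>2 / 2) * d m y"
begin

definition phase :: "real \<Rightarrow> complex" where "phase x = exp (- \<i> * k * of_real x * \<theta>\<^sup>2 / 2)"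

definition \<mu> :: complex where "\<mu> = exp (\<i> * k * of_real a * \<theta>\<^sup>2 / 2)"

text \<open>
  The total difference field at the branch point itself, reached from the left.
\<close>

definition edge_value :: "int \<Rightarrow> complex" where "edge_value m = phase (node m) + d m 0"

definition source :: "int \<Rightarrow> real \<Rightarrow> complex" where
  "source m y = flip (d m) y - 2 * (phase (node m) * half_wave (k * \<theta>) y)"

lemma d_Suc: "d (m + 1) = heat k (width m) (source m)"
  unfolding d_step source_def[abs_def] phase_def ..

lemma norm_\<mu>: "norm \<mu> = 1"
proof -
  from k\<theta>2 obtain r where "k * \<theta>\<^sup>2 = of_real r" by (auto elim: Reals_cases)
  then have r: "\<i> * k * of_real a * \<theta>\<^sup>2 / 2 = \<i> * of_real (a * r / 2)"
    using arg_cong[of "k * \<theta>\<^sup>2" "of_real r" "\<lambda>w. \<i> * of_real a * w / 2"] by (simp add: mult_ac)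
  show ?thesis unfolding \<mu>_def r by simp
qed

lemma \<mu>_neq_1: "\<mu> \<noteq> 1" using nonresonant by (simp add: \<mu>_def)

lemma phase_add: "phase (x + y) = phase x * phase y"
  unfolding phase_def exp_add[symmetric] by (simp add: field_simps)

lemma phase_a: "\<mu> * phase a = 1"
  unfolding \<mu>_def phase_def exp_add[symmetric] by simp

lemma d_minus: "d (m - 2) y = \<mu> * d m y"
proof -
  have "d m y = phase a * d (m - 2) y" using d_floquet[of "m - 2" y] by (simp add: phase_def)
  then have "\<mu> * d m y = (\<mu> * phase a) * d (m - 2) y" by simp
  then show ?thesis by (simp add: phase_a)
qed

lemma d_minus_even: "d (m - 2 * int i) y = \<mu> ^ i * d m y"
proof (induction i)
  case (Suc i)
  have "d (m - 2 * int (Suc i)) y = d ((m - 2 * int i) - 2) y" by (simp add: algebra_simps)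
  then show ?case using Suc d_minus[of "m - 2 * int i" y] by simp
qed simp

lemma half_wave_bounded: "bounded_measurable (half_wave (k * \<theta>))"
  by (rule decaying_imp_bounded[OF decaying_half_wave[OF Im_k\<theta>] Im_k\<theta>])

lemma source_bounded: "bounded_measurable (source m)"
proof -
  have "bounded_measurable (\<lambda>y. flip (d m) y + (- 2 * phase (node m)) * half_wave (k * \<theta>) y)"
    by (intro bounded_measurable_add bounded_measurable_mult bounded_measurable_flip d_bounded half_wave_bounded)
       (auto simp: bounded_measurable_def)
  then show ?thesis by (simp add: source_def[abs_def] mult.assoc)
qed

text \<open>
  The value at an edge is found by tracing the field back through the slabs; the kernel of this
  backward evolution is the edge Green's function of the reflected grating.
\<close>

theorem edge_value_eq: "edge_value m = phase (node m) * directivity a b k (1 - m) \<theta>"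
proof -
  define n where "n = 1 - m"
  define T where "T = (\<lambda>j. \<integral>y. edge_wave n j y * flip (d (m - 1 - int j)) y \<partial>lborel)"
  define U where "U = (\<lambda>j. \<integral>y. edge_wave n j y * (phase (node (m - 1 - int j)) * half_wave (k * \<theta>) y) \<partial>lborel)"
  have W: "decaying 1 (edge_wave n j)" for j by (rule decaying_edge_wave) simp
  have split: "(\<integral>y. edge_wave n j y * source (m - 1 - int j) y \<partial>lborel) = T j - 2 * U j" for j
  proof -
    have i1: "integrable lborel (\<lambda>y. edge_wave n j y * flip (d (m - 1 - int j)) y)"
      by (rule decaying_integrable[OF decaying_mult_bounded[OF W bounded_measurable_flip[OF d_bounded]]]) simp
    have "bounded_measurable (\<lambda>y. phase (node (m - 1 - int j)) * half_wave (k * \<theta>) y)"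
      by (intro bounded_measurable_mult half_wave_bounded) (auto simp: bounded_measurable_def)
    then have i2: "integrable lborel (\<lambda>y. edge_wave n j y * (phase (node (m - 1 - int j)) * half_wave (k * \<theta>) y))"
      using decaying_integrable[OF decaying_mult_bounded[OF W]] zero_less_one by blast
    have "(\<integral>y. edge_wave n j y * source (m - 1 - int j) y \<partial>lborel)
        = (\<integral>y. edge_wave n j y * flip (d (m - 1 - int j)) y - 2 * (edge_wave n j y * (phase (node (m - 1 - int j)) * half_wave (k * \<theta>) y)) \<partial>lborel)"
      by (intro Bochner_Integration.integral_cong refl) (simp add: source_def right_diff_distrib mult_ac)
    also have "\<dots> = T j - 2 * U j" unfolding T_def U_def using i1 i2 by simp
    finally show ?thesis .
  qed
  have start: "d m 0 = T 0 - 2 * U 0"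
  proof -
    have "width (m - 1) = width n" by (rule width_cong) (simp add: n_def)
    then have "d m 0 = (\<integral>y. edge_wave n 0 y * source (m - 1 - int 0) y \<partial>lborel)"
      using d_Suc[of "m - 1"] by (simp add: heat_def edge_wave_def green_even)
    then show ?thesis by (simp only: split)
  qed
  \<comment> \<open>Transposing the propagation through one more slab turns one edge wave into the next.\<close>
  have step: "T j = T (Suc j) - 2 * U (Suc j)" for j
  proof -
    define i where "i = m - 1 - int (Suc j)"
    have w: "width i = width (n + 1 + int j)" by (rule width_cong) (simp add: i_def n_def)
    have ij: "m - 1 - int j = i + 1" by (simp add: i_def)
    have "T j = (\<integral>y. flip (edge_wave n j) y * heat k (width i) (source i) y \<partial>lborel)"
      unfolding T_def ij d_Suc flip_def by (simp add: mult_ac)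
    also have "\<dots> = (\<integral>y. source i y * heat k (width i) (flip (edge_wave n j)) y \<partial>lborel)"
      using heat_transpose[OF Im_k width_pos zero_less_one decaying_flip[OF W] source_bounded, of i i j] by (simp add: mult.commute)
    also have "heat k (width i) (flip (edge_wave n j)) = edge_wave n (Suc j)"
      by (simp add: edge_wave_Suc cross_def w)
    also have "(\<integral>y. source i y * edge_wave n (Suc j) y \<partial>lborel) = T (Suc j) - 2 * U (Suc j)"
      unfolding split[symmetric] i_def by (simp add: mult.commute)
    finally show ?thesis .
  qed
  have expand: "d m 0 = T N - 2 * (\<Sum>j\<le>N. U j)" for N
  proof (induction N)
    case 0
    show ?case unfolding start by simp
  next
    case (Suc N)
    have "T N - 2 * (\<Sum>j\<le>N. U j) = T (Suc N) - 2 * (\<Sum>j\<le>Suc N. U j)"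
      unfolding step[of N] by (simp add: algebra_simps)
    with Suc show ?case by (simp only:)
  qed
  have U: "U j = phase (node m) * edge_term \<theta> n j" for j
  proof -
    have x: "- node (m - 1 - int j) = (node (n + 1 + int j) - node n) - node m"
      using node_reflect[of "m - 1 - int j"] node_reflect[of m] by (simp add: n_def algebra_simps)
    have ph: "phase (node (m - 1 - int j)) = phase (node m) * exp (\<i> * k * of_real (node (n + 1 + int j) - node n) * \<theta>\<^sup>2 / 2)"
    proof -
      have "node (m - 1 - int j) = node m + - (node (n + 1 + int j) - node n)" using x by simp
      moreover have "phase (- z) = exp (\<i> * k * of_real z * \<theta>\<^sup>2 / 2)" for z by (simp add: phase_def)
      ultimately show ?thesis by (simp only: phase_add)
    qed
    have "U j = phase (node (m - 1 - int j)) * (\<integral>y. edge_wave n j y * half_wave (k * \<theta>) y \<partial>lborel)"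
      unfolding U_def by (subst integral_mult_right_zero[symmetric]) (simp add: mult_ac)
    then show ?thesis unfolding ph edge_term_def by (simp only: mult.assoc)
  qed
  note sums = edge_term_sums[OF k\<theta>2 Im_k\<theta> \<mu>_def \<mu>_neq_1]
  have s: "summable (edge_term \<theta> n)" by (rule sums_summable[OF sums(3)])
  then have "(\<lambda>N. \<Sum>j\<le>N. edge_term \<theta> n j) \<longlonglongrightarrow> (\<Sum>j. edge_term \<theta> n j)"
    using summable_LIMSEQ' by blast
  then have "(\<lambda>N. d m 0 + 2 * (phase (node m) * (\<Sum>j\<le>N. edge_term \<theta> n j))) \<longlonglongrightarrow> d m 0 + 2 * (phase (node m) * (\<Sum>j. edge_term \<theta> n j))"
    by (intro tendsto_add tendsto_const tendsto_mult_left)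
  moreover have "d m 0 + 2 * (phase (node m) * (\<Sum>j\<le>N. edge_term \<theta> n j)) = T N" for N
    using expand[of N] by (simp add: U sum_distrib_left)
  ultimately have T: "T \<longlonglongrightarrow> d m 0 + 2 * (phase (node m) * (\<Sum>j. edge_term \<theta> n j))" by simp
  have even: "strict_mono (\<lambda>i. 2 * i :: nat)" by (simp add: strict_mono_def)
  \<comment> \<open>By the Floquet property the remainder after \<open>2i\<close> slabs is a pairing with a fixed bounded function,
    times \<open>\<mu>\<^sup>i\<close>.\<close>
  have T_even: "T (2 * i) = \<mu> ^ i * (\<integral>y. evolve (n + 1) (2 * i) (green k (width n)) y * flip (d (m - 1)) y \<partial>lborel)" for i
  proof -
    have dm: "d (m - 1 - int (2 * i)) y = \<mu> ^ i * d (m - 1) y" for y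
      using d_minus_even[of "m - 1" i y] by simp
    show ?thesis
      unfolding T_def edge_wave_def flip_def dm integral_mult_right_zero[symmetric]
      by (simp only: mult_ac)
  qed
  have "(\<lambda>i. \<mu> ^ i * (\<integral>y. evolve (n + 1) (2 * i) (green k (width n)) y * flip (d (m - 1)) y \<partial>lborel))
      \<longlonglongrightarrow> d m 0 + 2 * (phase (node m) * (\<Sum>j. edge_term \<theta> n j))"
    using LIMSEQ_subseq_LIMSEQ[OF T even] by (simp add: o_def T_even)
  then have "d m 0 + 2 * (phase (node m) * (\<Sum>j. edge_term \<theta> n j)) = 0"
    by (rule pairing_evolve_remainder_0[OF zero_less_one decaying_green(1)[OF Im_k width_pos] bounded_measurable_flip[OF d_bounded] \<mu>_neq_1 norm_\<mu>])
  then have "edge_value m = phase (node m) * (1 - 2 * (\<Sum>j. edge_term \<theta> n j))"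
    by (simp add: edge_value_def algebra_simps add_eq_0_iff)
  then show ?thesis using directivity_eq[OF s] by (simp only: n_def)
qed

definition d' :: "int \<Rightarrow> real \<Rightarrow> complex" where
  "d' m y = (\<integral>t. green' k (width (m - 1)) (y - t) * source (m - 1) t \<partial>lborel)"

lemma d_derivative: "(d m has_vector_derivative d' m y) (at y)"
  using heat_has_vector_derivative[OF Im_k width_pos source_bounded, of "m - 1" "m - 1" y] d_Suc[of "m - 1"]
  by (simp add: d'_def)

lemma d'_bounded: "bounded_measurable (d' m)"
  unfolding d'_def[abs_def]
  by (rule bounded_measurable_convolution[OF decaying_green(2)[OF Im_k width_pos] source_bounded])

lemma d'_continuous: "isCont (d' m) y"
  unfolding d'_def[abs_def]
  by (rule has_vector_derivative_continuous[OF convolution_has_vector_derivative[OF decaying_green(2)[OF Im_k width_pos]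
        green'_has_vector_derivative[OF width_pos] decaying_green''[OF Im_k width_pos] source_bounded]])

lemma d_continuous: "isCont (d m) y"
  by (rule has_vector_derivative_continuous[OF d_derivative])

text \<open>The operator \<open>\<partial>\<^sub>y + i k \<theta>\<close> annihilates the incident wave.\<close>

definition g :: "int \<Rightarrow> real \<Rightarrow> complex" where "g m y = d' m y + \<i> * k * \<theta> * d m y"

lemma g_bounded: "bounded_measurable (g m)"
  unfolding g_def[abs_def]
  by (intro bounded_measurable_add bounded_measurable_mult d'_bounded d_bounded) (auto simp: bounded_measurable_def)

lemma source_minus: "source (m - 2) y = \<mu> * source m y"
proof -
  have "node m = node (m - 2) + a" using node_add2[of "m - 2"] by simp
  then have "phase (node m) = phase (node (m - 2)) * phase a" by (simp add: phase_add)
  then have "\<mu> * phase (node m) = phase (node (m - 2)) * (\<mu> * phase a)" by (simp add: mult_ac)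
  then have "phase (node (m - 2)) = \<mu> * phase (node m)" by (simp add: phase_a)
  then show ?thesis by (simp add: source_def flip_def d_minus algebra_simps)
qed

lemma g_minus: "g (m - 2) y = \<mu> * g m y"
proof -
  have w: "width (m - 2 - 1) = width (m - 1)" by (rule width_cong) simp
  have sm: "source (m - 2 - 1) t = \<mu> * source (m - 1) t" for t
    using source_minus[of "m - 1" t] by (simp add: algebra_simps)
  have "d' (m - 2) y = \<mu> * d' m y"
    unfolding d'_def w sm by (subst integral_mult_right_zero[symmetric]) (simp add: mult_ac)
  then show ?thesis by (simp add: g_def d_minus algebra_simps)
qed

lemma g_minus_even: "g (m - 2 * int i) y = \<mu> ^ i * g m y"
proof (induction i)
  case (Suc i)
  have "g (m - 2 * int (Suc i)) y = g ((m - 2 * int i) - 2) y" by (simp add: algebra_simps)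
  then show ?case using Suc g_minus[of "m - 2 * int i" y] by simp
qed simp

lemma edge_value_minus: "edge_value (m - 2) = \<mu> * edge_value m"
proof -
  have "node m = node (m - 2) + a" using node_add2[of "m - 2"] by simp
  then have "\<mu> * phase (node m) = phase (node (m - 2)) * (\<mu> * phase a)" by (simp add: phase_add mult_ac)
  then show ?thesis by (simp add: edge_value_def d_minus phase_a algebra_simps)
qed

lemma edge_value_minus_even: "edge_value (m - 2 * int i) = \<mu> ^ i * edge_value m"
proof (induction i)
  case (Suc i)
  have "edge_value (m - 2 * int (Suc i)) = edge_value ((m - 2 * int i) - 2)" by (simp add: algebra_simps)
  then show ?case using Suc edge_value_minus[of "m - 2 * int i"] by simp
qed simp

end

section \<open>Amplitudes of the diffracted waves\<close>

lemma decaying_tendsto_0: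
  assumes "decaying \<epsilon> f" "\<epsilon> > 0"
  shows "(f \<longlongrightarrow> 0) at_top" "(f \<longlongrightarrow> 0) at_bot"
proof -
  obtain C where C: "C \<ge> 0" "\<And>t. norm (f t) \<le> C * exp (- \<epsilon> * \<bar>t\<bar>)" using assms(1) by (rule decayingE) blast
  have "filterlim (\<lambda>t::real. - (\<epsilon> * t)) at_bot at_top"
    by (intro filterlim_compose[OF filterlim_uminus_at_bot_at_top] filterlim_tendsto_pos_mult_at_top[OF tendsto_const assms(2)] filterlim_ident)
  then have top: "((\<lambda>t. C * exp (- (\<epsilon> * t))) \<longlongrightarrow> 0) at_top"
    by (intro tendsto_mult_right_zero filterlim_compose[OF exp_at_bot])
  have bot: "((\<lambda>t. C * exp (\<epsilon> * t)) \<longlongrightarrow> 0) at_bot"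
    by (intro tendsto_mult_right_zero filterlim_compose[OF exp_at_bot] filterlim_tendsto_pos_mult_at_bot[OF tendsto_const assms(2)] filterlim_ident)
  show "(f \<longlongrightarrow> 0) at_top"
  proof (rule Lim_null_comparison[OF eventually_mono[OF eventually_ge_at_top[of 0]] top])
    show "norm (f t) \<le> C * exp (- (\<epsilon> * t))" if "0 \<le> t" for t using C(2)[of t] that by simp
  qed
  show "(f \<longlongrightarrow> 0) at_bot"
  proof (rule Lim_null_comparison[OF eventually_mono[OF eventually_le_at_bot[of 0]] bot])
    show "norm (f t) \<le> C * exp (\<epsilon> * t)" if "t \<le> 0" for t using C(2)[of t] that by simp
  qed
qed

lemma decaying_reflect:
  assumes "decaying \<epsilon> A" "\<epsilon> > 0" shows "decaying \<epsilon> (\<lambda>t. A (y - t))"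
proof -
  obtain C where C: "\<And>t. norm (A t) \<le> C * exp (- \<epsilon> * \<bar>t\<bar>)" using assms(1) by (rule decayingE) blast
  note [measurable] = decaying_measurable[OF assms(1)]
  have "norm (A (- t)) \<le> C * exp (- \<epsilon> * \<bar>t\<bar>)" for t using C[of "- t"] by simp
  then have "decaying \<epsilon> (\<lambda>t. A (- t))" unfolding decaying_def by (intro conjI exI[of _ C] allI) measurable
  from decaying_shift[OF this assms(2), of y] show ?thesis by simp
qed

lemma green_reflect_derivative:
  assumes "l > 0"
  shows "((\<lambda>t. green k l (y - t)) has_vector_derivative - green' k l (y - t)) (at t)"
proof -
  have "((green k l \<circ> (\<lambda>t. y - t)) has_vector_derivative (-1) *\<^sub>R green' k l (y - t)) (at t)"
    by (rule vector_diff_chain_at)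
       (auto intro!: derivative_eq_intros green_has_vector_derivative assms simp: has_real_derivative_iff_has_vector_derivative[symmetric])
  then show ?thesis by (simp add: o_def)
qed

lemma exp_wave_derivative:
  "((\<lambda>t. exp (- \<i> * \<beta> * of_real t)) has_vector_derivative - \<i> * \<beta> * exp (- \<i> * \<beta> * of_real t)) (at t)"
proof -
  have "((\<lambda>z. exp (- \<i> * \<beta> * z)) has_field_derivative - \<i> * \<beta> * exp (- \<i> * \<beta> * of_real t)) (at (of_real t))"
    by (auto intro!: derivative_eq_intros)
  from has_vector_derivative_real_field[OF this] show ?thesis .
qed

lemma isCont_green: "l > 0 \<Longrightarrow> isCont (green k l) t" "l > 0 \<Longrightarrow> isCont (green' k l) t"
  by (rule has_vector_derivative_continuous, erule green_has_vector_derivative)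
     (rule has_vector_derivative_continuous, erule green'_has_vector_derivative)

context reduced_problem
begin

text \<open>
  Away from the edge the differential operator commutes with the propagation. The source jumps at \<open>y = 0\<close> by
  twice the edge value, and this jump creates a point source.
\<close>

lemma g_step: "g (m + 1) y = heat k (width m) (flip (g m)) y + 2 * edge_value m * green k (width m) y"
proof -
  define w where "w = width m"
  define p where "p = phase (node m)"
  have w: "w > 0" by (simp add: w_def width_pos)
  let ?G = "green k w" and ?G' = "green' k w"
  note dec = decaying_green[OF Im_k w, of 1]
  define e where "e = (\<lambda>t::real. exp (- \<i> * (k * \<theta>) * of_real t))"
  define I where "I = (\<lambda>t. ?G' (y - t) * source m t + \<i> * k * \<theta> * (?G (y - t) * source m t) - ?G (y - t) * flip (g m) t)"
  define h where "h = (\<lambda>t. - d m t - 2 * p * e t)"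
  \<comment> \<open>The derivatives of \<open>G(y - t)\<close> times the source above and below the edge, in the form in which
    they are smooth up to \<open>t = 0\<close>.\<close>
  define f1 where "f1 = (\<lambda>t. ?G (y - t) * d' m t + - ?G' (y - t) * d m t)"
  define f2 where "f2 = (\<lambda>t. ?G (y - t) * (- d' m t + 2 * p * (\<i> * (k * \<theta>) * e t)) + - ?G' (y - t) * h t)"
  have i1: "integrable lborel (\<lambda>t. ?G' (y - t) * source m t)" by (rule integrable_convolution[OF zero_less_one dec(2) source_bounded])
  have i2: "integrable lborel (\<lambda>t. ?G (y - t) * source m t)" by (rule integrable_convolution[OF zero_less_one dec(1) source_bounded])
  have i3: "integrable lborel (\<lambda>t. ?G (y - t) * flip (g m) t)" by (rule integrable_convolution[OF zero_less_one dec(1) bounded_measurable_flip[OF g_bounded]])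
  have iI: "integrable lborel I" unfolding I_def using i1 i2 i3 by (intro Bochner_Integration.integrable_diff Bochner_Integration.integrable_add integrable_mult_right)
  have src_pos: "source m t = d m t" "flip (g m) t = g m t" if "t > 0" for t
    using that by (auto simp: source_def flip_def half_wave_def)
  have src_neg: "source m t = h t" "flip (g m) t = - g m t" if "t < 0" for t
    using that by (auto simp: source_def flip_def half_wave_def h_def p_def e_def mult.assoc)
  have I1: "I t = - f1 t" if "t > 0" for t
    unfolding I_def f1_def src_pos[OF that] g_def by (simp add: algebra_simps)
  have I2: "I t = - f2 t" if "t < 0" for t
    unfolding I_def f2_def src_neg[OF that] g_def h_def by (simp add: algebra_simps)
  have G: "((\<lambda>t. ?G (y - t)) has_vector_derivative - ?G' (y - t)) (at t)" for t by (rule green_reflect_derivative[OF w])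
  have contG: "isCont (\<lambda>t. ?G (y - t)) t" "isCont (\<lambda>t. ?G' (y - t)) t" for t
    by (rule continuous_at_compose[unfolded o_def, of t "\<lambda>t. y - t"], simp, rule isCont_green[OF w])+
  have conte: "isCont e t" for t unfolding e_def by (intro continuous_intros)
  have conth: "isCont h t" for t unfolding h_def by (intro continuous_intros d_continuous conte)
  have D1: "(LINT t:{0<..}|lborel. f1 t) = 0 - ?G y * d m 0"
  proof (rule integral_FTC_halfline[where F = "\<lambda>t. ?G (y - t) * d m t"])
    show "((\<lambda>t. ?G (y - t) * d m t) has_vector_derivative f1 t) (at t)" for t
      unfolding f1_def by (rule has_vector_derivative_mult[OF G d_derivative])
    show "isCont f1 t" for t unfolding f1_def by (intro continuous_intros contG d_continuous d'_continuous)
    have "set_integrable lborel {0<..} (\<lambda>t. - I t)" using iI by (auto simp: set_integrable_def intro!: integrable_mult_indicator)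
    then show "set_integrable lborel {0<..} f1"
      by (rule set_integrable_cong[THEN iffD1, rotated -1]) (auto simp: I1)
    have "isCont (\<lambda>t. ?G (y - t) * d m t) 0" by (intro continuous_intros contG d_continuous)
    then show "((\<lambda>t. ?G (y - t) * d m t) \<longlongrightarrow> ?G y * d m 0) (at_right 0)"
      using filterlim_at_split[of "\<lambda>t. ?G (y - t) * d m t" _ 0] by (simp add: isCont_def)
    show "((\<lambda>t. ?G (y - t) * d m t) \<longlongrightarrow> 0) at_top"
      by (rule decaying_tendsto_0[OF decaying_mult_bounded[OF decaying_reflect[OF dec(1)] d_bounded]]) simp_all
  qed
  have D2: "(LINT t:{..<0}|lborel. f2 t) = ?G y * h 0 - 0"
  proof (rule integral_FTC_negative_halfline[where F = "\<lambda>t. ?G (y - t) * h t"])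
    have dh: "(h has_vector_derivative - d' m t + 2 * p * (\<i> * (k * \<theta>) * e t)) (at t)" for t
    proof -
      have "(h has_vector_derivative - d' m t - 2 * p * (- \<i> * (k * \<theta>) * e t)) (at t)"
        unfolding h_def e_def
        by (intro has_vector_derivative_diff has_vector_derivative_minus has_vector_derivative_mult_right d_derivative exp_wave_derivative)
      then show ?thesis by (simp add: algebra_simps)
    qed
    show "((\<lambda>t. ?G (y - t) * h t) has_vector_derivative f2 t) (at t)" for t
      unfolding f2_def by (rule has_vector_derivative_mult[OF G dh])
    show "isCont f2 t" for t unfolding f2_def by (intro continuous_intros contG conth conte d'_continuous)
    have "set_integrable lborel {..<0} (\<lambda>t. - I t)" using iI by (auto simp: set_integrable_def intro!: integrable_mult_indicator)
    then show "set_integrable lborel {..<0} f2"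
      by (rule set_integrable_cong[THEN iffD1, rotated -1]) (auto simp: I2)
    have "isCont (\<lambda>t. ?G (y - t) * h t) 0" by (intro continuous_intros contG conth)
    then show "((\<lambda>t. ?G (y - t) * h t) \<longlongrightarrow> ?G y * h 0) (at_left 0)"
      using filterlim_at_split[of "\<lambda>t. ?G (y - t) * h t" _ 0] by (simp add: isCont_def)
    have "((\<lambda>t. ?G (y - t) * source m t) \<longlongrightarrow> 0) at_bot"
      by (rule decaying_tendsto_0[OF decaying_mult_bounded[OF decaying_reflect[OF dec(1)] source_bounded]]) simp_all
    moreover have "\<forall>\<^sub>F t in at_bot. ?G (y - t) * source m t = ?G (y - t) * h t"
      using eventually_gt_at_bot[of 0] by eventually_elim (simp add: src_neg)
    ultimately show "((\<lambda>t. ?G (y - t) * h t) \<longlongrightarrow> 0) at_bot" by (rule Lim_transform_eventually)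
  qed
  have [measurable]: "I \<in> borel_measurable borel" using iI by (auto dest: borel_measurable_integrable)
  have "g (m + 1) y - heat k w (flip (g m)) y = (\<integral>t. I t \<partial>lborel)"
    unfolding I_def g_def[of "m + 1"] d'_def d_Suc using i1 i2 i3 by (simp add: heat_def w_def)
  also have "\<dots> = (\<integral>t. indicator {0<..} t *\<^sub>R I t + indicator {..<0} t *\<^sub>R I t \<partial>lborel)"
    by (rule integral_cong_nonzero) (auto simp: indicator_def)
  also have "\<dots> = (LINT t:{0<..}|lborel. I t) + (LINT t:{..<0}|lborel. I t)"
    unfolding set_lebesgue_integral_def using iI
    by (intro Bochner_Integration.integral_add integrable_mult_indicator) auto
  also have "(LINT t:{0<..}|lborel. I t) = - (LINT t:{0<..}|lborel. f1 t)"
    unfolding set_lebesgue_integral_def integral_minus[symmetric]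
    by (intro Bochner_Integration.integral_cong refl) (auto simp: indicator_def I1)
  also have "(LINT t:{..<0}|lborel. I t) = - (LINT t:{..<0}|lborel. f2 t)"
    unfolding set_lebesgue_integral_def integral_minus[symmetric]
    by (intro Bochner_Integration.integral_cong refl) (auto simp: indicator_def I2)
  finally have "g (m + 1) y - heat k w (flip (g m)) y = 2 * edge_value m * ?G y"
    unfolding D1 D2 by (simp add: h_def e_def edge_value_def p_def algebra_simps)
  then show ?thesis by (simp add: w_def algebra_simps)
qed

context
  fixes \<psi> :: complex
  assumes k\<psi>2: "k * \<psi>\<^sup>2 \<in> \<real>" and Im_k\<psi>: "Im (k * \<psi>) > 0"
    and \<mu>_\<psi>: "exp (\<i> * k * of_real a * \<psi>\<^sup>2 / 2) = \<mu>"
begin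

definition even_sum :: "int \<Rightarrow> complex" where
  "even_sum n = (\<Sum>i. \<mu> ^ i * (\<integral>y. edge_wave n (2 * i) y * half_wave (k * \<psi>) y \<partial>lborel))"

definition odd_sum :: "int \<Rightarrow> complex" where
  "odd_sum n = (\<Sum>i. \<mu> ^ i * (\<integral>y. edge_wave n (2 * i + 1) y * half_wave (k * \<psi>) y \<partial>lborel))"

lemmas \<psi>_sums = edge_term_sums[OF k\<psi>2 Im_k\<psi> \<mu>_\<psi>[symmetric] \<mu>_neq_1, folded even_sum_def odd_sum_def]

lemma even_sum_parity: "even m = even n \<Longrightarrow> even_sum m = even_sum n"
  and odd_sum_parity: "even m = even n \<Longrightarrow> odd_sum m = odd_sum n"
  by (simp_all add: even_sum_def odd_sum_def edge_wave_parity[of m n])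

lemma directivity_\<psi>: "directivity a b k n \<psi> = 1 - 2 * (exp (\<i> * k * of_real (width n) * \<psi>\<^sup>2 / 2) * even_sum n + \<mu> * odd_sum n)"
  using directivity_eq[OF sums_summable[OF \<psi>_sums(3)]] sums_unique[OF \<psi>_sums(3)] by metis

text \<open>
  Unrolling \<open>g\<close> over its past produces one term for every edge upstream, weighted with the value at that edge;
  the contribution of the infinitely remote past vanishes.
\<close>

lemma pairing_g:
  "(\<integral>y. half_wave (k * \<psi>) y * g m y \<partial>lborel)
    = 2 * (edge_value (m - 1) * even_sum (m - 1) + edge_value (m - 2) * odd_sum (m - 2))"
proof -
  define z where "z = half_wave (k * \<psi>)"
  define \<nu> where "\<nu> = Im (k * \<psi>)"
  have \<nu>: "\<nu> > 0" using Im_k\<psi> by (simp add: \<nu>_def)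
  have z: "decaying \<nu> z" unfolding z_def \<nu>_def by (rule decaying_half_wave[OF Im_k\<psi>])
  define Z where "Z = (\<lambda>j. evolve (1 - m) j (flip z))"
  have Z: "decaying \<nu> (Z j)" for j unfolding Z_def by (rule decaying_evolve[OF \<nu> decaying_flip[OF z]])
  have W: "decaying \<nu> (edge_wave n j)" for n j by (rule decaying_edge_wave[OF \<nu>])
  define A where "A = (\<lambda>j. \<integral>y. flip (Z j) y * g (m - int j) y \<partial>lborel)"
  define w where "w = (\<lambda>j. \<integral>y. edge_wave (m - 1 - int j) j y * z y \<partial>lborel)"
  have start: "A 0 = (\<integral>y. z y * g m y \<partial>lborel)"
    unfolding A_def Z_def by (intro Bochner_Integration.integral_cong refl) (auto simp: flip_def z_def half_wave_def sgn_real_def)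
  have step: "A j = A (Suc j) + 2 * (edge_value (m - 1 - int j) * w j)" for j
  proof -
    define i where "i = m - int (Suc j)"
    have i1: "m - int j = i + 1" "m - 1 - int j = i" by (auto simp: i_def)
    have wd: "width i = width (1 - m + int j)" by (rule width_cong) (simp add: i_def, blast)
    note fZ = decaying_flip[OF Z[of j]]
    have G: "decaying \<nu> (green k (width i))" by (rule decaying_green(1)[OF Im_k width_pos])
    have I1: "integrable lborel (\<lambda>y. flip (Z j) y * heat k (width i) (flip (g i)) y)"
      by (rule decaying_integrable[OF decaying_mult_bounded[OF fZ bounded_measurable_heat[OF Im_k width_pos bounded_measurable_flip[OF g_bounded]]] \<nu>])
    have I2: "integrable lborel (\<lambda>y. flip (Z j) y * green k (width i) y)"
      by (rule decaying_integrable[OF decaying_mult_bounded[OF fZ decaying_imp_bounded[OF G \<nu>]] \<nu>])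
    have "A j = (\<integral>y. flip (Z j) y * heat k (width i) (flip (g i)) y + 2 * edge_value i * (flip (Z j) y * green k (width i) y) \<partial>lborel)"
      unfolding A_def i1 g_step by (intro Bochner_Integration.integral_cong refl) (simp add: algebra_simps)
    also have "\<dots> = (\<integral>y. flip (Z j) y * heat k (width i) (flip (g i)) y \<partial>lborel) + 2 * edge_value i * (\<integral>y. flip (Z j) y * green k (width i) y \<partial>lborel)"
      using I1 I2 by simp
    also have "(\<integral>y. flip (Z j) y * heat k (width i) (flip (g i)) y \<partial>lborel) = (\<integral>y. flip (g i) y * heat k (width i) (flip (Z j)) y \<partial>lborel)"
      using heat_transpose[OF Im_k width_pos \<nu> fZ bounded_measurable_flip[OF g_bounded], of i i] by (simp add: mult.commute)
    also have "heat k (width i) (flip (Z j)) = Z (Suc j)"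
      by (simp add: Z_def cross_def wd)
    also have "(\<integral>y. flip (g i) y * Z (Suc j) y \<partial>lborel) = A (Suc j)"
      unfolding A_def i_def flip_def by (simp add: mult_ac)
    also have "(\<integral>y. flip (Z j) y * green k (width i) y \<partial>lborel) = w j"
    proof -
      have "(\<integral>y. z y * evolve (i + 1) j (green k (width i)) y \<partial>lborel) = (\<integral>y. flip (green k (width i)) y * evolve (1 - (i + 1) - int j) j (flip z) y \<partial>lborel)"
        by (rule evolve_transpose[OF \<nu> G z])
      moreover have "1 - (i + 1) - int j = 1 - m" by (simp add: i_def)
      ultimately show ?thesis unfolding w_def i1 edge_wave_def Z_def flip_def by (simp add: mult_ac)
    qed
    finally show ?thesis by (simp add: i1 mult.assoc)
  qed
  have expand: "A 0 = A (2 * N) + 2 * (edge_value (m - 1) * (\<Sum>i<N. \<mu> ^ i * (\<integral>y. edge_wave (m - 1) (2 * i) y * z y \<partial>lborel))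
      + edge_value (m - 2) * (\<Sum>i<N. \<mu> ^ i * (\<integral>y. edge_wave (m - 2) (2 * i + 1) y * z y \<partial>lborel)))" for N
  proof (induction N)
    case (Suc N)
    have e1: "edge_value (m - 1 - int (2 * N)) * w (2 * N) = edge_value (m - 1) * (\<mu> ^ N * (\<integral>y. edge_wave (m - 1) (2 * N) y * z y \<partial>lborel))"
    proof -
      have "edge_wave (m - 1 - int (2 * N)) (2 * N) = edge_wave (m - 1) (2 * N)" by (rule edge_wave_parity) simp
      then show ?thesis using edge_value_minus_even[of "m - 1" N] unfolding w_def by (simp add: mult_ac)
    qed
    have e2: "edge_value (m - 1 - int (2 * N + 1)) * w (2 * N + 1) = edge_value (m - 2) * (\<mu> ^ N * (\<integral>y. edge_wave (m - 2) (2 * N + 1) y * z y \<partial>lborel))"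
    proof -
      have "m - 1 - int (2 * N + 1) = m - 2 - 2 * int N" by simp
      moreover have "edge_wave (m - 2 - 2 * int N) (2 * N + 1) = edge_wave (m - 2) (2 * N + 1)" by (rule edge_wave_parity) simp
      ultimately show ?thesis using edge_value_minus_even[of "m - 2" N] unfolding w_def by (simp only: mult_ac)
    qed
    have "A (2 * N) = A (2 * Suc N) + 2 * (edge_value (m - 1 - int (2 * N)) * w (2 * N)) + 2 * (edge_value (m - 1 - int (2 * N + 1)) * w (2 * N + 1))"
      using step[of "2 * N"] step[of "2 * N + 1"] by simp
    then show ?case unfolding Suc e1 e2 by (simp add: algebra_simps)
  qed simp
  define L where "L = A 0 - 2 * (edge_value (m - 1) * even_sum (m - 1) + edge_value (m - 2) * odd_sum (m - 2))"
  have "(\<lambda>N. A 0 - 2 * (edge_value (m - 1) * (\<Sum>i<N. \<mu> ^ i * (\<integral>y. edge_wave (m - 1) (2 * i) y * z y \<partial>lborel))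
      + edge_value (m - 2) * (\<Sum>i<N. \<mu> ^ i * (\<integral>y. edge_wave (m - 2) (2 * i + 1) y * z y \<partial>lborel)))) \<longlonglongrightarrow> L"
    unfolding L_def even_sum_def odd_sum_def z_def
    by (intro tendsto_diff tendsto_const tendsto_mult_left tendsto_add summable_LIMSEQ \<psi>_sums(1) \<psi>_sums(2))
  moreover have "A 0 - 2 * (edge_value (m - 1) * (\<Sum>i<N. \<mu> ^ i * (\<integral>y. edge_wave (m - 1) (2 * i) y * z y \<partial>lborel))
      + edge_value (m - 2) * (\<Sum>i<N. \<mu> ^ i * (\<integral>y. edge_wave (m - 2) (2 * i + 1) y * z y \<partial>lborel))) = A (2 * N)" for N
    using expand[of N] by simp
  ultimately have "(\<lambda>N. A (2 * N)) \<longlonglongrightarrow> L" by (simp only:)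
  moreover have "A (2 * N) = \<mu> ^ N * (\<integral>y. evolve (1 - m) (2 * N) (flip z) y * flip (g m) y \<partial>lborel)" for N
  proof -
    have gm: "g (m - int (2 * N)) y = \<mu> ^ N * g m y" for y using g_minus_even[of m N y] by simp
    show ?thesis unfolding A_def Z_def flip_def gm integral_mult_right_zero[symmetric] by (simp only: mult_ac)
  qed
  ultimately have "(\<lambda>N. \<mu> ^ N * (\<integral>y. evolve (1 - m) (2 * N) (flip z) y * flip (g m) y \<partial>lborel)) \<longlonglongrightarrow> L" by (simp only:)
  then have "L = 0"
    by (rule pairing_evolve_remainder_0[OF \<nu> decaying_flip[OF z] bounded_measurable_flip[OF g_bounded] \<mu>_neq_1 norm_\<mu>])
  then show ?thesis using start by (simp add: L_def z_def)
qed

text \<open>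
  The half-line Laplace transform of the total difference field in front of the edge \<open>m\<close>.
\<close>

definition shadow :: "int \<Rightarrow> complex" where
  "shadow m = (\<integral>y. half_wave (k * \<psi>) y * (phase (node m) * exp (- \<i> * (k * \<theta>) * of_real y) + d m y) \<partial>lborel)"

text \<open>
  Integration by parts: applied to the half wave, \<open>\<partial>\<^sub>y\<close> gives \<open>-i k \<psi>\<close>, which together with the \<open>i k \<theta>\<close> in \<open>g\<close>
  produces the factor \<open>\<psi> + \<theta>\<close>.
\<close>

lemma shadow_eq: "\<i> * k * (\<psi> + \<theta>) * shadow m = (\<integral>y. half_wave (k * \<psi>) y * g m y \<partial>lborel) - edge_value m"
proof -
  define p where "p = phase (node m)"
  define e where "e = (\<lambda>t::real. exp (- \<i> * (k * \<theta>) * of_real t))"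
  define E where "E = (\<lambda>t::real. exp (- \<i> * (k * \<psi>) * of_real t))"
  define F where "F = (\<lambda>t. E t * (p * e t + d m t))"
  define f where "f = (\<lambda>t. E t * (p * (- \<i> * (k * \<theta>) * e t) + d' m t) + - \<i> * (k * \<psi>) * E t * (p * e t + d m t))"
  define hw where "hw = (\<lambda>t. p * half_wave (k * \<theta>) t + d m t)"
  have hwb: "bounded_measurable hw" unfolding hw_def
    by (intro bounded_measurable_add bounded_measurable_mult half_wave_bounded d_bounded) (auto simp: bounded_measurable_def)
  note H = decaying_half_wave[OF Im_k\<psi>]
  have dF: "(F has_vector_derivative f t) (at t)" for t
    unfolding F_def f_def E_def e_def
    by (intro has_vector_derivative_mult has_vector_derivative_add has_vector_derivative_mult_right d_derivative exp_wave_derivative)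
  have conte: "isCont e t" "isCont E t" for t unfolding e_def E_def by (intro continuous_intros)+
  have sh: "shadow m = (\<integral>y. half_wave (k * \<psi>) y * hw y \<partial>lborel)"
    unfolding shadow_def hw_def p_def by (intro Bochner_Integration.integral_cong refl) (auto simp: half_wave_def)
  have i1: "integrable lborel (\<lambda>t. half_wave (k * \<psi>) t * hw t)"
    by (rule decaying_integrable[OF decaying_mult_bounded[OF H hwb] Im_k\<psi>])
  have i2: "integrable lborel (\<lambda>t. half_wave (k * \<psi>) t * g m t)"
    by (rule decaying_integrable[OF decaying_mult_bounded[OF H g_bounded] Im_k\<psi>])
  have fI: "f t = half_wave (k * \<psi>) t * g m t - \<i> * k * (\<psi> + \<theta>) * (half_wave (k * \<psi>) t * hw t)" if "t < 0" for t
    using that unfolding f_def g_def hw_def half_wave_def E_def e_def by (simp add: algebra_simps)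
  have iI: "integrable lborel (\<lambda>t. half_wave (k * \<psi>) t * g m t - \<i> * k * (\<psi> + \<theta>) * (half_wave (k * \<psi>) t * hw t))"
    using i1 i2 by simp
  have "(LINT t:{..<0}|lborel. f t) = F 0 - 0"
  proof (rule integral_FTC_negative_halfline)
    show "(F has_vector_derivative f t) (at t)" for t by (rule dF)
    show "isCont f t" for t unfolding f_def by (intro continuous_intros conte d_continuous d'_continuous)
    have "set_integrable lborel {..<0} (\<lambda>t. half_wave (k * \<psi>) t * g m t - \<i> * k * (\<psi> + \<theta>) * (half_wave (k * \<psi>) t * hw t))"
      unfolding set_integrable_def using iI by (intro integrable_mult_indicator) auto
    then show "set_integrable lborel {..<0} f"
      by (rule set_integrable_cong[THEN iffD1, rotated -1]) (auto simp: fI)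
    have "isCont F 0" using has_vector_derivative_continuous[OF dF] .
    then show "(F \<longlongrightarrow> F 0) (at_left 0)"
      using filterlim_at_split[of F _ 0] by (simp add: isCont_def)
    have "((\<lambda>t. half_wave (k * \<psi>) t * hw t) \<longlongrightarrow> 0) at_bot"
      by (rule decaying_tendsto_0[OF decaying_mult_bounded[OF H hwb] Im_k\<psi>])
    moreover have "\<forall>\<^sub>F t in at_bot. half_wave (k * \<psi>) t * hw t = F t"
      using eventually_gt_at_bot[of 0] by eventually_elim (simp add: half_wave_def hw_def F_def E_def e_def)
    ultimately show "(F \<longlongrightarrow> 0) at_bot" by (rule Lim_transform_eventually)
  qed
  moreover have "F 0 = edge_value m" by (simp add: F_def E_def e_def p_def edge_value_def)
  moreover have "(LINT t:{..<0}|lborel. f t) = (\<integral>t. half_wave (k * \<psi>) t * g m t - \<i> * k * (\<psi> + \<theta>) * (half_wave (k * \<psi>) t * hw t) \<partial>lborel)"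
    unfolding set_lebesgue_integral_def
  proof (intro Bochner_Integration.integral_cong refl)
    show "indicator {..<0} t *\<^sub>R f t = half_wave (k * \<psi>) t * g m t - \<i> * k * (\<psi> + \<theta>) * (half_wave (k * \<psi>) t * hw t)" for t
      by (cases "t < 0") (simp_all add: fI, simp add: half_wave_def)
  qed
  moreover have "\<dots> = (\<integral>t. half_wave (k * \<psi>) t * g m t \<partial>lborel) - \<i> * k * (\<psi> + \<theta>) * shadow m"
    unfolding sh using i1 i2 by simp
  ultimately show ?thesis by (simp add: algebra_simps)
qed

text \<open>
  By \<open>shadow_eq\<close> and \<open>pairing_g\<close> the left-hand side is a linear form in the two edge values, whose coefficients
  are the directivities at the angle \<open>\<psi>\<close>. The edge values in turn are directivities at the angle \<open>\<theta>\<close>, with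
  the edges \<open>0\<close> and \<open>1\<close> exchanged.
\<close>

theorem amplitude_formula:
  "- (\<i> * k * (\<psi> + \<theta>)) * (shadow 0 + exp (\<i> * k * of_real b * \<psi>\<^sup>2 / 2) * shadow 1)
    = directivity a b k 0 \<psi> * directivity a b k 1 \<theta>
      + directivity a b k 1 \<psi> * directivity a b k 0 \<theta> * exp (\<i> * k * of_real b * (\<psi>\<^sup>2 - \<theta>\<^sup>2) / 2)"
proof -
  define e where "e = exp (\<i> * k * of_real b * \<psi>\<^sup>2 / 2)"
  define e' where "e' = exp (\<i> * k * of_real (a - b) * \<psi>\<^sup>2 / 2)"
  define C0 where "C0 = edge_value 0"
  define C1 where "C1 = edge_value 1"
  have ee: "e * e' = \<mu>" unfolding \<mu>_\<psi>[symmetric] e_def e'_def exp_add[symmetric] by (simp add: field_simps)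
  have c: "edge_value (-1) = \<mu> * C1" "edge_value (-2) = \<mu> * C0"
    using edge_value_minus[of 1] edge_value_minus[of 0] by (simp_all add: C0_def C1_def)
  have p: "even_sum (-1) = even_sum 1" "odd_sum (-1) = odd_sum 1" "odd_sum (-2) = odd_sum 0"
    by (auto intro: even_sum_parity odd_sum_parity)
  have X0: "(\<integral>y. half_wave (k * \<psi>) y * g 0 y \<partial>lborel) = 2 * (\<mu> * C1 * even_sum 1 + \<mu> * C0 * odd_sum 0)"
    using pairing_g[of 0] by (simp add: c p)
  have X1: "(\<integral>y. half_wave (k * \<psi>) y * g 1 y \<partial>lborel) = 2 * (C0 * even_sum 0 + \<mu> * C1 * odd_sum 1)"
    using pairing_g[of 1] by (simp add: c p C0_def)
  have V0: "directivity a b k 0 \<psi> = 1 - 2 * (e * even_sum 0 + \<mu> * odd_sum 0)"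
    by (simp add: directivity_\<psi> width_def e_def)
  have V1: "directivity a b k 1 \<psi> = 1 - 2 * (e' * even_sum 1 + \<mu> * odd_sum 1)"
    by (simp add: directivity_\<psi> width_def e'_def)
  have "- (\<i> * k * (\<psi> + \<theta>)) * (shadow 0 + e * shadow 1)
      = - (\<i> * k * (\<psi> + \<theta>) * shadow 0) - e * (\<i> * k * (\<psi> + \<theta>) * shadow 1)"
    by (simp add: algebra_simps)
  also have "\<dots> = C0 * (1 - 2 * (e * even_sum 0 + \<mu> * odd_sum 0)) + C1 * (e - 2 * ((e * e') * even_sum 1 + e * \<mu> * odd_sum 1))"
    unfolding shadow_eq X0 X1 ee C0_def[symmetric] C1_def[symmetric] by (simp add: algebra_simps)
  also have "\<dots> = directivity a b k 0 \<psi> * C0 + directivity a b k 1 \<psi> * (e * C1)"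
    unfolding V0 V1 by (simp add: algebra_simps)
  also have "C0 = directivity a b k 1 \<theta>" using edge_value_eq[of 0] by (simp add: C0_def phase_def)
  also have "e * C1 = directivity a b k 0 \<theta> * exp (\<i> * k * of_real b * (\<psi>\<^sup>2 - \<theta>\<^sup>2) / 2)"
  proof -
    have "e * phase b = exp (\<i> * k * of_real b * (\<psi>\<^sup>2 - \<theta>\<^sup>2) / 2)"
      unfolding e_def phase_def exp_add[symmetric] by (simp add: field_simps)
    then show ?thesis using edge_value_eq[of 1] by (simp add: C1_def mult_ac)
  qed
  finally show ?thesis by (simp only: e_def mult.assoc)
qed

end

end

section \<open>Propagation angles of the Floquet harmonics\<close>

lemma psi_squared: "(psi a k \<theta> n)\<^sup>2 = \<theta>\<^sup>2 + 4 * of_real pi * of_int n / (k * of_real a)"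
  by (simp add: psi_def Let_def)

context grating
begin

lemma k_nonzero: "k \<noteq> 0" using Im_k by auto

lemma a_pos: "a > 0" using b_pos b_less by simp

lemma k_psi_squared: "k * (psi a k \<theta> n)\<^sup>2 = k * \<theta>\<^sup>2 + of_real (4 * pi * of_int n / a)"
  unfolding psi_squared using k_nonzero a_pos by (simp add: field_simps)

lemma k_psi_squared_real: "k * \<theta>\<^sup>2 \<in> \<real> \<Longrightarrow> k * (psi a k \<theta> n)\<^sup>2 \<in> \<real>"
  unfolding k_psi_squared by simp

lemma exp_psi: "exp (\<i> * k * of_real a * (psi a k \<theta> n)\<^sup>2 / 2) = exp (\<i> * k * of_real a * \<theta>\<^sup>2 / 2)"
proof -
  have "\<i> * k * of_real a * (psi a k \<theta> n)\<^sup>2 / 2 = \<i> * of_real a * (k * (psi a k \<theta> n)\<^sup>2) / 2" by simp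
  also have "\<dots> = \<i> * k * of_real a * \<theta>\<^sup>2 / 2 + 2 * of_int n * of_real pi * \<i>"
    unfolding k_psi_squared using a_pos by (simp add: field_simps)
  finally have e: "\<i> * k * of_real a * (psi a k \<theta> n)\<^sup>2 / 2 = \<i> * k * of_real a * \<theta>\<^sup>2 / 2 + 2 * of_int n * of_real pi * \<i>" .
  have "exp (2 * of_int n * of_real pi * \<i>) = 1" using exp_integer_2pi[of "of_int n"] by (simp add: mult_ac)
  then show ?thesis unfolding e exp_add by simp
qed

text \<open>
  If \<open>k \<psi>\<close> were real, so would be its square, which is the real number \<open>k \<psi>\<^sup>2\<close> times \<open>k\<close>; this forces
  \<open>\<psi> = 0\<close>. Hence exactly one of the two roots is admissible.
\<close>

lemma Im_k_psi:
  assumes "k * \<theta>\<^sup>2 \<in> \<real>" and nz: "psi a k \<theta> n \<noteq> 0"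
  shows "Im (k * psi a k \<theta> n) > 0"
proof -
  define r where "r = csqrt (\<theta>\<^sup>2 + 4 * of_real pi * of_int n / (k * of_real a))"
  have psi: "psi a k \<theta> n = (if Im (k * r) > 0 then r else - r)" unfolding psi_def r_def Let_def ..
  have r2: "r\<^sup>2 = (psi a k \<theta> n)\<^sup>2" by (simp add: psi)
  have "Im (k * r) \<noteq> 0"
  proof
    assume 0: "Im (k * r) = 0"
    obtain s where s: "k * r\<^sup>2 = of_real s" using k_psi_squared_real[OF assms(1), of n] unfolding r2 by (auto elim: Reals_cases)
    have "(k * r)\<^sup>2 = k * of_real s" unfolding s[symmetric] by (simp add: power2_eq_square)
    moreover have "Im ((k * r)\<^sup>2) = 0" using 0 by (simp add: power2_eq_square)
    ultimately have "Im (k * of_real s) = 0" by simp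
    then have "s = 0" using Im_k by simp
    then have "r = 0" using s k_nonzero by simp
    then show False using nz by (simp add: psi)
  qed
  then show ?thesis by (auto simp: psi)
qed

lemma psi_0:
  assumes "Re \<theta> > 0" "Im (k * \<theta>) > 0" shows "psi a k \<theta> 0 = \<theta>"
proof -
  have "csqrt (\<theta>\<^sup>2) = \<theta>" using assms(1) by (intro csqrt_square) auto
  then show ?thesis using assms(2) by (simp add: psi_def Let_def)
qed

text \<open>
  Since \<open>k \<theta>\<^sup>2 > 0\<close>, the argument of \<open>\<theta>\<close> is minus half the argument of \<open>k\<close>, and that of \<open>k \<theta>\<close> is half the
  argument of \<open>k\<close>.
\<close>

lemma Im_k\<theta>_pos:
  assumes "Re \<theta> > 0" "k * \<theta>\<^sup>2 \<in> \<real>" "Re (k * \<theta>\<^sup>2) > 0" shows "Im (k * \<theta>) > 0"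
proof -
  obtain r where r: "k * \<theta>\<^sup>2 = of_real r" using assms(2) by (auto elim: Reals_cases)
  have r0: "r > 0" using assms(3) unfolding r by simp
  have n0: "norm \<theta> > 0" "norm k > 0" using assms(1) k_nonzero by auto
  have "\<theta>\<^sup>2 * of_real ((norm k)\<^sup>2) = (k * \<theta>\<^sup>2) * cnj k"
    unfolding complex_norm_square by (simp add: mult_ac)
  then have "\<theta>\<^sup>2 * of_real ((norm k)\<^sup>2) = of_real r * cnj k" unfolding r .
  then have "Im (\<theta>\<^sup>2 * of_real ((norm k)\<^sup>2)) = Im (of_real r * cnj k)" by (rule arg_cong)
  then have "2 * Re \<theta> * Im \<theta> * (norm k)\<^sup>2 = - (r * Im k)" by (simp add: power2_eq_square[of \<theta>] algebra_simps)
  moreover have "r * Im k > 0" using r0 Im_k by simp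
  ultimately have "Re \<theta> * Im \<theta> * (2 * (norm k)\<^sup>2) < 0" by (simp add: algebra_simps)
  then have "Im \<theta> < 0" using assms(1) by (auto simp: mult_less_0_iff zero_less_mult_iff)
  have "(k * \<theta>) * of_real ((norm \<theta>)\<^sup>2) = (k * \<theta>\<^sup>2) * cnj \<theta>"
    unfolding complex_norm_square power2_eq_square[of \<theta>] by (simp add: mult_ac)
  then have "(k * \<theta>) * of_real ((norm \<theta>)\<^sup>2) = of_real r * cnj \<theta>" unfolding r .
  then have "Im ((k * \<theta>) * of_real ((norm \<theta>)\<^sup>2)) = Im (of_real r * cnj \<theta>)" by (rule arg_cong)
  then have "Im (k * \<theta>) * (norm \<theta>)\<^sup>2 = r * - Im \<theta>" by (simp add: algebra_simps)
  moreover have "r * - Im \<theta> > 0" using \<open>Im \<theta> < 0\<close> r0 by (simp add: mult_pos_neg)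
  ultimately show ?thesis using n0 by (metis zero_less_mult_pos2 zero_less_power)
qed

text \<open>
  At a resonance \<open>k a \<theta>\<^sup>2\<close> is a multiple of \<open>4\<pi>\<close>, and the corresponding \<open>\<psi>\<^sub>n\<close> vanishes.
\<close>

lemma nonresonant_if_psi_nonzero:
  assumes "k * \<theta>\<^sup>2 \<in> \<real>" and nz: "\<And>n. psi a k \<theta> n \<noteq> 0"
  shows "exp (\<i> * k * of_real a * \<theta>\<^sup>2 / 2) \<noteq> 1"
proof
  assume e: "exp (\<i> * k * of_real a * \<theta>\<^sup>2 / 2) = 1"
  obtain r where r: "k * \<theta>\<^sup>2 = of_real r" using assms(1) by (auto elim: Reals_cases)
  have "\<i> * k * of_real a * \<theta>\<^sup>2 / 2 = \<i> * of_real a * (k * \<theta>\<^sup>2) / 2" by simp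
  also have "\<dots> = \<i> * of_real (a * r / 2)" unfolding r by simp
  finally have "exp (\<i> * of_real (a * r / 2)) = 1" using e by (simp only:)
  then obtain N :: int where "a * r / 2 = of_int (2 * N) * pi" unfolding exp_eq_1 by auto
  then have "r + 4 * pi * of_int (- N) / a = 0" using a_pos by (simp add: field_simps)
  moreover have "k * (psi a k \<theta> (- N))\<^sup>2 = of_real (r + 4 * pi * of_int (- N) / a)" unfolding k_psi_squared r by simp
  ultimately have "k * (psi a k \<theta> (- N))\<^sup>2 = 0" by (simp only: of_real_0)
  then show False using nz[of "- N"] k_nonzero by simp
qed

section \<open>The field near the cuts\<close>

lemma slab_exists: obtains m where "node m \<le> x" "x < node (m + 1)"
proof -
  define j where "j = \<lfloor>x / a\<rfloor>"
  have "of_int j \<le> x / a" "x / a < of_int j + 1" unfolding j_def by linarith+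
  then have j: "a * of_int j \<le> x" "x < a * (of_int j + 1)" using a_pos by (simp_all add: field_simps)
  have n: "node (2 * j) = a * of_int j" "node (2 * j + 1) = a * of_int j + b" by (simp_all add: node_def xn_def)
  have n2: "node (2 * j + 1 + 1) = a * (of_int j + 1)" using node_add2[of "2 * j"] n by (simp add: algebra_simps)
  show thesis
  proof (cases "x < node (2 * j + 1)")
    case True then show thesis using that[of "2 * j"] j n by simp
  next
    case False then show thesis using that[of "2 * j + 1"] j n2 by simp
  qed
qed

lemma slab_not_node: "node m < x \<Longrightarrow> x < node (m + 1) \<Longrightarrow> x \<noteq> node n"
proof
  assume x: "node m < x" "x < node (m + 1)" "x = node n"
  show False
  proof (cases "n \<le> m")
    case True then show False using node_mono[OF True] x by simp
  next
    case False
    then have "m + 1 \<le> n" by simp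
    from node_mono[OF this] show False using x by simp
  qed
qed

lemma slab_subset: "{node m<..<node (m + 1)} \<times> UNIV \<subseteq> sheet_interior a b"
proof
  fix z assume "z \<in> {node m<..<node (m + 1)} \<times> (UNIV :: real set)"
  then have "fst z \<noteq> node n" for n using slab_not_node[of m "fst z" n] by auto
  then show "z \<in> sheet_interior a b" by (simp add: sheet_interior_def node_def case_prod_beta)
qed

lemma cut_nbhd_eq: "cut_nbhd a b m = {node (m - 1)<..<node (m + 1)} \<times> {..<0}"
  by (auto simp: cut_nbhd_def node_def)

lemma node_bracket: "node (m - 1) < node m" "node m < node (m + 1)"
  using node_less_Suc[of "m - 1"] node_less_Suc[of m] by simp_all

end

lemma compact_locally_bounded:
  fixes f :: "'a::topological_space \<Rightarrow> real"
  assumes S: "compact S" and loc: "\<And>p. p \<in> S \<Longrightarrow> \<exists>M. \<forall>\<^sub>F q in nhds p. f q \<le> M"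
  shows "\<exists>M. \<forall>q\<in>S. f q \<le> M"
proof -
  have "\<forall>p\<in>S. \<exists>W M. open W \<and> p \<in> W \<and> (\<forall>q\<in>W. f q \<le> M)" using loc unfolding eventually_nhds by meson
  then obtain W M where W: "\<And>p. p \<in> S \<Longrightarrow> open (W p) \<and> p \<in> W p \<and> (\<forall>q\<in>W p. f q \<le> M p)" by metis
  obtain D where D: "D \<subseteq> S" "finite D" "S \<subseteq> (\<Union>p\<in>D. W p)"
    by (rule compactE_image[OF S, of S W]) (use W in auto)
  have "f q \<le> (\<Sum>p\<in>D. \<bar>M p\<bar>)" if q: "q \<in> S" for q
  proof -
    obtain p where p: "p \<in> D" "q \<in> W p" using D(3) q by blast
    have "f q \<le> \<bar>M p\<bar>" using W[of p] p D(1) by force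
    also have "\<dots> \<le> (\<Sum>p\<in>D. \<bar>M p\<bar>)" by (rule member_le_sum) (use p D in auto)
    finally show ?thesis .
  qed
  then show ?thesis by blast
qed

lemma eventually_norm_le_nhds:
  fixes f :: "'a::t2_space \<Rightarrow> 'b::real_normed_vector"
  assumes "isCont f p"
  shows "\<forall>\<^sub>F q in nhds p. norm (f q) \<le> norm (f p) + 1"
proof -
  have "((\<lambda>q. norm (f q)) \<longlongrightarrow> norm (f p)) (nhds p)"
    using assms unfolding isCont_def tendsto_at_iff_tendsto_nhds by (rule tendsto_norm)
  then have "\<forall>\<^sub>F q in nhds p. norm (f q) < norm (f p) + 1" by (rule order_tendstoD) simp
  then show ?thesis by (rule eventually_mono) simp
qed

locale diffraction = grating +
  fixes \<theta> :: complex and u :: field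
  assumes Re_\<theta>: "Re \<theta> > 0" and k\<theta>2: "k * \<theta>\<^sup>2 \<in> \<real>" and k\<theta>2_pos: "Re (k * \<theta>\<^sup>2) > 0"
    and psi_nonzero: "\<And>n. psi a k \<theta> n \<noteq> 0"
    and diffraction: "diffraction_solution a b k \<theta> u"
begin

lemma Im_k\<theta>: "Im (k * \<theta>) > 0" by (rule Im_k\<theta>_pos[OF Re_\<theta> k\<theta>2 k\<theta>2_pos])

definition branch :: "real \<Rightarrow> real \<Rightarrow> bool" where "branch x y \<longleftrightarrow> (\<exists>n. (x, y) = (node n, 0))"

lemma solves_interior:
  assumes "\<nu> \<in> {1, 2}"
  shows "solves k (sheet_interior a b) (\<lambda>x y. u x y \<nu>) (dy (\<lambda>x y. u x y \<nu>)) (dy (dy (\<lambda>x y. u x y \<nu>)))"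
  using diffraction assms unfolding diffraction_solution_def solution_on_surface_def
  by (intro classical_solution_solves) blast

lemma isCont_interior:
  assumes "\<nu> \<in> {1, 2}" "open W" "p \<in> W" "W \<subseteq> sheet_interior a b"
  shows "isCont (\<lambda>z. u (fst z) (snd z) \<nu>) p"
  using continuous_on_subset[OF solves_continuous(1)[OF solves_interior[OF assms(1)]] assms(4)] assms(2,3)
  by (simp add: continuous_on_eq_continuous_at)

lemma isCont_upper:
  assumes "\<nu> \<in> {1, 2}" "y > 0" shows "isCont (\<lambda>z. u (fst z) (snd z) \<nu>) (x, y)"
  by (rule isCont_interior[OF assms(1), of "UNIV \<times> {0<..}"])
     (use assms(2) in \<open>auto simp: sheet_interior_def intro: open_Times\<close>)

lemma isCont_slab:
  assumes "\<nu> \<in> {1, 2}" "node m < x" "x < node (m + 1)" shows "isCont (\<lambda>z. u (fst z) (snd z) \<nu>) (x, y)"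
  by (rule isCont_interior[OF assms(1) _ _ slab_subset[of m]]) (use assms in \<open>auto intro: open_Times\<close>)

lemma isCont_cut:
  assumes "\<nu> \<in> {1, 2}" "y < 0" shows "isCont (\<lambda>z. glue_cut a b m u \<nu> (fst z) (snd z)) (node m, y)"
proof -
  have "classical_solution k (cut_nbhd a b m) (glue_cut a b m u \<nu>)"
    using diffraction assms unfolding diffraction_solution_def solution_on_surface_def by blast
  then have "continuous_on (cut_nbhd a b m) (\<lambda>z. glue_cut a b m u \<nu> (fst z) (snd z))"
    unfolding classical_solution_def by (simp add: case_prod_beta')
  then show ?thesis
    using assms(2) node_bracket[of m] unfolding cut_nbhd_eq
    by (subst (asm) continuous_on_eq_continuous_at) (auto intro: open_Times)
qed

lemma isCont_horizontal:
  fixes f :: "real \<times> real \<Rightarrow> complex"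
  assumes "isCont f (x, y)" shows "((\<lambda>s. f (s, y)) \<longlongrightarrow> f (x, y)) (at x within S)"
  by (rule tendsto_within_subset[of _ _ _ UNIV], rule isCont_tendsto_compose[OF assms]) (auto intro!: tendsto_intros)

lemma isCont_vertical:
  fixes f :: "real \<times> real \<Rightarrow> complex"
  assumes "isCont f (x, y)" shows "isCont (\<lambda>t. f (x, t)) y"
  unfolding isCont_def by (rule isCont_tendsto_compose[OF assms]) (auto intro!: tendsto_intros)

lemma right_limit:
  assumes "\<nu> \<in> {1, 2}" "y \<noteq> 0"
  shows "((\<lambda>x. u x y \<nu>) \<longlongrightarrow> u (node m) y \<nu>) (at_right (node m))"
proof (cases "y > 0")
  case True
  from isCont_horizontal[OF isCont_upper[OF assms(1) True]] show ?thesis by simp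
next
  case False
  then have y: "y < 0" using assms(2) by simp
  have "((\<lambda>x. glue_cut a b m u \<nu> x y) \<longlongrightarrow> glue_cut a b m u \<nu> (node m) y) (at_right (node m))"
    using isCont_horizontal[OF isCont_cut[OF assms(1) y]] by simp
  then show ?thesis
    by (rule Lim_transform_eventually[OF tendsto_eq_rhs])
       (auto simp: glue_cut_def node_def eventually_at_filter)
qed

text \<open>
  Passing a cut exchanges the sheets; the value on the cut itself is the one from the right.
\<close>

lemma left_limit:
  assumes "\<nu> \<in> {1, 2}" "y \<noteq> 0"
  shows "((\<lambda>x. u x y \<nu>) \<longlongrightarrow> u (node m) y (if y < 0 then 3 - \<nu> else \<nu>)) (at_left (node m))"
proof (cases "y > 0")
  case True
  from isCont_horizontal[OF isCont_upper[OF assms(1) True]] True show ?thesis by simp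
next
  case False
  then have y: "y < 0" using assms(2) by simp
  have \<nu>: "3 - \<nu> \<in> {1, 2}" "3 - (3 - \<nu>) = \<nu>" using assms(1) by auto
  have "((\<lambda>x. glue_cut a b m u (3 - \<nu>) x y) \<longlongrightarrow> glue_cut a b m u (3 - \<nu>) (node m) y) (at_left (node m))"
    using isCont_horizontal[OF isCont_cut[OF \<nu>(1) y]] by simp
  then show ?thesis
    by (rule Lim_transform_eventually[OF tendsto_eq_rhs])
       (use y \<nu> in \<open>auto simp: glue_cut_def node_def eventually_at_filter\<close>)
qed

lemma measurable_node:
  assumes "\<nu> \<in> {1, 2}" shows "(\<lambda>y. u (node m) y \<nu>) \<in> borel_measurable borel"
proof (rule borel_measurable_continuous_countable_exceptions[of "{0}"])
  show "continuous_on (- {0}) (\<lambda>y. u (node m) y \<nu>)"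
  proof (rule continuous_at_imp_continuous_on, rule ballI)
    fix y :: real assume "y \<in> - {0}"
    then consider "y > 0" | "y < 0" by fastforce
    then show "isCont (\<lambda>y. u (node m) y \<nu>) y"
    proof cases
      case 1 from isCont_vertical[OF isCont_upper[OF assms 1]] show ?thesis by simp
    next
      case 2 from isCont_vertical[OF isCont_cut[OF assms 2, of m]] show ?thesis by (simp add: glue_cut_def node_def)
    qed
  qed
qed simp

text \<open>
  In the unstarred notation this is the assumed Floquet property. The set where the two notations
  exchange the sheets is periodic.
\<close>

lemma floquet:
  assumes "\<nu> \<in> {1, 2}" "\<not> branch x y"
  shows "u (x + a) y \<nu> = exp (- \<i> * k * of_real a * \<theta>\<^sup>2 / 2) * u x y \<nu>"
proof -
  have nb: "\<forall>n. (x, y) \<noteq> (xn a b n, 0)" using assms(2) by (auto simp: branch_def node_def)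
  have U: "unstarred a b u (x + a) y \<nu>' = exp (- \<i> * k * of_real a * \<theta>\<^sup>2 / 2) * unstarred a b u x y \<nu>'" if "\<nu>' \<in> {1, 2}" for \<nu>'
    using diffraction nb that unfolding diffraction_solution_def by blast
  have shift: "(\<exists>m. xn a b (2 * m) \<le> x + a \<and> x + a < xn a b (2 * m + 1)) \<longleftrightarrow>
      (\<exists>m. xn a b (2 * m) \<le> x \<and> x < xn a b (2 * m + 1))"
  proof -
    have e: "xn a b (2 * (m + 1)) = xn a b (2 * m) + a" "xn a b (2 * (m + 1) + 1) = xn a b (2 * m + 1) + a" for m
      by (simp_all add: xn_def algebra_simps)
    show ?thesis
    proof
      assume "\<exists>m. xn a b (2 * m) \<le> x + a \<and> x + a < xn a b (2 * m + 1)"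
      then obtain m where "xn a b (2 * m) \<le> x + a" "x + a < xn a b (2 * m + 1)" by blast
      then show "\<exists>m. xn a b (2 * m) \<le> x \<and> x < xn a b (2 * m + 1)"
        using e[of "m - 1"] by (intro exI[of _ "m - 1"]) simp
    next
      assume "\<exists>m. xn a b (2 * m) \<le> x \<and> x < xn a b (2 * m + 1)"
      then obtain m where "xn a b (2 * m) \<le> x" "x < xn a b (2 * m + 1)" by blast
      then show "\<exists>m. xn a b (2 * m) \<le> x + a \<and> x + a < xn a b (2 * m + 1)"
        using e[of m] by (intro exI[of _ "m + 1"]) simp
    qed
  qed
  have \<nu>: "3 - \<nu> \<in> {1, 2}" "3 - (3 - \<nu>) = \<nu>" using assms(1) by auto
  define cut where "cut \<longleftrightarrow> (\<exists>m. xn a b (2 * m) \<le> x \<and> x < xn a b (2 * m + 1))"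
  show ?thesis using U[OF assms(1)] U[OF \<nu>(1)] unfolding unstarred_def shift \<nu>(2) cut_def[symmetric] by (auto split: if_splits)
qed

lemma norm_u_in: "norm (u_in k \<theta> x y) = exp (Im (k * \<theta>) * y)"
proof -
  have "u_in k \<theta> x y = plane_wave k \<theta> (- x) y" by (simp add: u_in_def plane_wave_def)
  then show ?thesis by (simp only: norm_plane_wave[OF k\<theta>2])
qed

lemma norm_shift: "norm (exp (- \<i> * k * of_real a * \<theta>\<^sup>2 / 2)) = 1"
  using norm_u_in[of a 0] by (simp only: u_in_def of_real_0 mult_zero_right diff_zero exp_zero)

lemma norm_floquet: "\<nu> \<in> {1, 2} \<Longrightarrow> \<not> branch x y \<Longrightarrow> norm (u (x + a) y \<nu>) = norm (u x y \<nu>)"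
  by (subst floquet, assumption, assumption, unfold norm_mult norm_shift mult_1, rule refl)

lemma branch_shift: "branch (x + a) y \<longleftrightarrow> branch x y"
proof -
  have "(\<exists>n. x + a = node n) \<longleftrightarrow> (\<exists>n. x = node n)"
  proof
    assume "\<exists>n. x + a = node n"
    then obtain n where "x + a = node n" by blast
    then have "x = node (n - 2)" using node_add2[of "n - 2"] by simp
    then show "\<exists>n. x = node n" ..
  next
    assume "\<exists>n. x = node n"
    then obtain n where "x + a = node (n + 2)" using node_add2 by metis
    then show "\<exists>n. x + a = node n" ..
  qed
  then show ?thesis by (auto simp: branch_def)
qed

lemma norm_floquet_int:
  assumes "\<nu> \<in> {1, 2}" "\<not> branch x y"
  shows "norm (u (x + of_int j * a) y \<nu>) = norm (u x y \<nu>) \<and> \<not> branch (x + of_int j * a) y"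
proof (induction j rule: int_induct[where k = 0])
  case base then show ?case using assms by simp
next
  case (step1 i)
  have e: "x + of_int (i + 1) * a = (x + of_int i * a) + a" by (simp add: algebra_simps)
  show ?case unfolding e using step1 norm_floquet[OF assms(1), of "x + of_int i * a" y]
    by (simp add: branch_shift)
next
  case (step2 i)
  define z where "z = x + of_int (i - 1) * a"
  have e: "x + of_int i * a = z + a" by (simp add: z_def algebra_simps)
  show ?case using step2 norm_floquet[OF assms(1), of z y] unfolding e z_def[symmetric]
    by (simp add: branch_shift)
qed

text \<open>
  Unlike \<^const>\<open>u_sc\<close> this uses the starred sheets. The two differ at most by an exchange of the sheets
  in \<open>y < 0\<close>, where nothing is subtracted.
\<close>

definition scattered :: "real \<Rightarrow> real \<Rightarrow> nat \<Rightarrow> complex" where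
  "scattered x y \<nu> = u x y \<nu> - (if y > 0 \<and> \<nu> = 1 then u_in k \<theta> x y else 0)"

lemma scattered_far: obtains Y where "\<And>x y \<nu>. \<bar>y\<bar> \<ge> Y \<Longrightarrow> \<nu> \<in> {1, 2} \<Longrightarrow> norm (scattered x y \<nu>) \<le> 1"
proof -
  have ev: "\<forall>\<^sub>F y in at_infinity. \<forall>x. norm (u_sc a b k \<theta> u x y \<nu>) < 1" if "\<nu> \<in> {1, 2}" for \<nu>
  proof -
    have "uniform_limit UNIV (\<lambda>y x. u_sc a b k \<theta> u x y \<nu>) (\<lambda>_. 0) at_infinity"
      using diffraction that unfolding diffraction_solution_def by blast
    from uniform_limitD[OF this zero_less_one] show ?thesis by simp
  qed
  have "\<forall>\<^sub>F y in at_infinity. \<forall>\<nu>\<in>{1,2}. \<forall>x. norm (u_sc a b k \<theta> u x y \<nu>) < 1"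
    using ev[of 1] ev[of 2] by simp (rule eventually_conj; simp)
  then obtain Y where Y: "\<And>y. norm y \<ge> Y \<Longrightarrow> \<forall>\<nu>\<in>{1,2}. \<forall>x. norm (u_sc a b k \<theta> u x y \<nu>) < 1"
    unfolding eventually_at_infinity by blast
  have "norm (scattered x y \<nu>) \<le> 1" if y: "\<bar>y\<bar> \<ge> Y" and \<nu>: "\<nu> \<in> {1, 2}" for x y \<nu>
  proof -
    have Y': "\<forall>\<nu>\<in>{1,2}. \<forall>x. norm (u_sc a b k \<theta> u x y \<nu>) < 1" by (rule Y) (use y in simp)
    have "3 - \<nu> \<in> {1, 2}" using \<nu> by auto
    with Y' \<nu> have 1: "norm (u_sc a b k \<theta> u x y \<nu>) < 1" and 2: "norm (u_sc a b k \<theta> u x y (3 - \<nu>)) < 1" by blast+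
    have \<nu>': "3 - (3 - \<nu>) = \<nu>" using \<nu> by auto
    show ?thesis
    proof (cases "y < 0 \<and> (\<exists>m. xn a b (2 * m) \<le> x \<and> x < xn a b (2 * m + 1))")
      case True
      then have "scattered x y \<nu> = u_sc a b k \<theta> u x y (3 - \<nu>)"
        using \<nu>' by (simp add: scattered_def u_sc_def unstarred_def)
      then show ?thesis using 2 by simp
    next
      case False
      then have "unstarred a b u x y \<nu> = u x y \<nu>" unfolding unstarred_def by (rule if_not_P)
      then have "scattered x y \<nu> = u_sc a b k \<theta> u x y \<nu>" by (cases "y > 0 \<and> \<nu> = 1") (auto simp: scattered_def u_sc_def)
      then show ?thesis using 1 by simp
    qed
  qed
  then show thesis by (rule that)
qed

text \<open>
  Every point other than a branch point has a neighbourhood on which the pair of sheets is described by two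
  continuous functions, possibly after gluing along a cut.
\<close>

lemma locally_bounded:
  "\<exists>M. \<forall>\<^sub>F z in nhds (x, y). (if branch (fst z) (snd z) then 0 else norm (u (fst z) (snd z) 1) + norm (u (fst z) (snd z) 2)) \<le> M"
    (is "\<exists>M. eventually (\<lambda>z. ?f z \<le> M) _")
proof -
  have from_two: "\<exists>M. \<forall>\<^sub>F z in nhds (x, y). ?f z \<le> M"
    if ev: "\<forall>\<^sub>F z in nhds (x, y). norm (g1 z) \<le> M1" "\<forall>\<^sub>F z in nhds (x, y). norm (g2 z) \<le> M2"
      and eq: "\<And>z. norm (u (fst z) (snd z) 1) + norm (u (fst z) (snd z) 2) = norm (g1 z) + norm (g2 z)"
    for g1 g2 :: "real \<times> real \<Rightarrow> complex" and M1 M2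
  proof (rule exI[of _ "M1 + M2"], rule eventually_mono[OF eventually_conj[OF ev]])
    fix z assume z: "norm (g1 z) \<le> M1 \<and> norm (g2 z) \<le> M2"
    then have "0 \<le> M1" "0 \<le> M2" using norm_ge_zero order_trans by blast+
    then show "?f z \<le> M1 + M2" using z eq[of z] by simp
  qed
  have cont: "\<exists>M. \<forall>\<^sub>F z in nhds (x, y). ?f z \<le> M" if "\<And>\<nu>. \<nu> \<in> {1, 2} \<Longrightarrow> isCont (\<lambda>z. u (fst z) (snd z) \<nu>) (x, y)"
    by (rule from_two[OF eventually_norm_le_nhds eventually_norm_le_nhds refl]) (rule that; simp)+
  obtain m where m: "node m \<le> x" "x < node (m + 1)" by (rule slab_exists)
  consider "y > 0" | "node m < x" | "x = node m" "y < 0" | "x = node m" "y = 0" using m(1) by fastforce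
  then show ?thesis
  proof cases
    case 1 show ?thesis by (rule cont) (rule isCont_upper[OF _ 1])
  next
    case 2 show ?thesis by (rule cont) (rule isCont_slab[OF _ 2 m(2)])
  next
    case 3
    have c: "isCont (\<lambda>z. glue_cut a b m u \<nu> (fst z) (snd z)) (x, y)" if "\<nu> \<in> {1, 2}" for \<nu>
      unfolding 3(1) by (rule isCont_cut[OF that 3(2)])
    show ?thesis
      by (rule from_two[OF eventually_norm_le_nhds[OF c[of 1]] eventually_norm_le_nhds[OF c[of 2]]])
         (auto simp: glue_cut_def)
  next
    case 4
    have "bounded_near_branch_points a b u" using diffraction unfolding diffraction_solution_def by blast
    then obtain \<epsilon> M where \<epsilon>: "\<epsilon> > 0"
      and M: "\<And>\<nu> x' y'. \<nu> \<in> {1, 2} \<Longrightarrow> (x', y') \<in> ball (node m, 0) \<epsilon> - {(node m, 0)} \<Longrightarrow> norm (u x' y' \<nu>) \<le> M"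
      unfolding bounded_near_branch_points_def node_def by blast
    have "\<forall>\<^sub>F z in nhds (x, y). z \<in> ball (node m, 0) \<epsilon>"
      unfolding 4 using \<epsilon> by (intro eventually_nhds_in_open) auto
    then have "\<forall>\<^sub>F z in nhds (x, y). ?f z \<le> 2 * \<bar>M\<bar>"
    proof (rule eventually_mono)
      fix z :: "real \<times> real" assume z: "z \<in> ball (node m, 0) \<epsilon>"
      show "?f z \<le> 2 * \<bar>M\<bar>"
      proof (cases "branch (fst z) (snd z)")
        case False
        then have "z \<noteq> (node m, 0)" by (auto simp: branch_def)
        then have "norm (u (fst z) (snd z) \<nu>) \<le> \<bar>M\<bar>" if "\<nu> \<in> {1, 2}" for \<nu>
        proof -
          have "norm (u (fst z) (snd z) \<nu>) \<le> M" by (rule M[OF that]) (use z \<open>z \<noteq> _\<close> in simp)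
          then show ?thesis by simp
        qed
        from this[of 1] this[of 2] show ?thesis by simp
      qed simp
    qed
    then show ?thesis ..
  qed
qed

text \<open>
  Far away the scattered field is small; on one period of the remaining strip compactness applies, and the
  Floquet factor has modulus one.
\<close>

lemma scattered_bounded:
  obtains B where "B \<ge> 0" "\<And>x y \<nu>. \<nu> \<in> {1, 2} \<Longrightarrow> \<not> branch x y \<Longrightarrow> norm (scattered x y \<nu>) \<le> B"
proof -
  obtain Y where Y: "\<And>x y \<nu>. \<bar>y\<bar> \<ge> Y \<Longrightarrow> \<nu> \<in> {1, 2} \<Longrightarrow> norm (scattered x y \<nu>) \<le> 1" using scattered_far by blast
  have ex: "\<exists>M. \<forall>z\<in>{0..a} \<times> {- Y..Y}. (if branch (fst z) (snd z) then 0 else norm (u (fst z) (snd z) 1) + norm (u (fst z) (snd z) 2)) \<le> M"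
  proof (rule compact_locally_bounded)
    show "compact ({0..a} \<times> {- Y..Y})" by (intro compact_Times) auto
    fix p :: "real \<times> real"
    show "\<exists>M. \<forall>\<^sub>F z in nhds p. (if branch (fst z) (snd z) then 0 else norm (u (fst z) (snd z) 1) + norm (u (fst z) (snd z) 2)) \<le> M"
      using locally_bounded[of "fst p" "snd p"] unfolding prod.collapse .
  qed
  then obtain M where M: "\<And>x y. x \<in> {0..a} \<Longrightarrow> y \<in> {- Y..Y} \<Longrightarrow> \<not> branch x y \<Longrightarrow> norm (u x y 1) + norm (u x y 2) \<le> M"
  proof -
    assume *: "\<And>M. (\<And>x y. x \<in> {0..a} \<Longrightarrow> y \<in> {- Y..Y} \<Longrightarrow> \<not> branch x y \<Longrightarrow> norm (u x y 1) + norm (u x y 2) \<le> M) \<Longrightarrow> thesis"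
    from ex obtain M where M: "\<forall>z\<in>{0..a} \<times> {- Y..Y}. (if branch (fst z) (snd z) then 0 else norm (u (fst z) (snd z) 1) + norm (u (fst z) (snd z) 2)) \<le> M" by blast
    show thesis
    proof (rule *[of M])
      fix x y assume "x \<in> {0..a}" "y \<in> {- Y..Y}" "\<not> branch x y"
      then show "norm (u x y 1) + norm (u x y 2) \<le> M" using bspec[OF M, of "(x, y)"] by simp
    qed
  qed
  define B where "B = \<bar>M\<bar> + exp (Im (k * \<theta>) * Y) + 1"
  have "norm (scattered x y \<nu>) \<le> B" if \<nu>: "\<nu> \<in> {1, 2}" and nb: "\<not> branch x y" for x y \<nu>
  proof (cases "\<bar>y\<bar> \<ge> Y")
    case True from Y[OF this \<nu>, of x] show ?thesis by (simp add: B_def add_nonneg_nonneg order_trans)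
  next
    case False
    then have y: "y \<in> {- Y..Y}" by auto
    define j where "j = - \<lfloor>x / a\<rfloor>"
    have "of_int (- j) \<le> x / a" "x / a < of_int (- j) + 1" unfolding j_def by linarith+
    then have x: "x + of_int j * a \<in> {0..a}" using a_pos by (simp add: field_simps)
    note fl = norm_floquet_int[OF \<nu> nb, of j]
    have "norm (u (x + of_int j * a) y 1) + norm (u (x + of_int j * a) y 2) \<le> M" by (rule M[OF x y]) (use fl in simp)
    then have "norm (u (x + of_int j * a) y 1) \<le> \<bar>M\<bar>" "norm (u (x + of_int j * a) y 2) \<le> \<bar>M\<bar>"
      using norm_ge_zero[of "u (x + of_int j * a) y 1"] norm_ge_zero[of "u (x + of_int j * a) y 2"] by linarith+
    then have "norm (u (x + of_int j * a) y \<nu>) \<le> \<bar>M\<bar>" using \<nu> by auto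
    then have un: "norm (u x y \<nu>) \<le> \<bar>M\<bar>" using fl by simp
    have "norm (if y > 0 \<and> \<nu> = 1 then u_in k \<theta> x y else 0) \<le> exp (Im (k * \<theta>) * Y)"
      using y Im_k\<theta> by (simp add: norm_u_in mult_left_mono)
    then show ?thesis using un unfolding scattered_def B_def by (intro order_trans[OF norm_triangle_ineq4]) linarith
  qed
  moreover have "B \<ge> 0" by (simp add: B_def add_nonneg_nonneg)
  ultimately show thesis using that by blast
qed

end

section \<open>Fourier coefficients of the field above the grating\<close>

definition harmonic :: "real \<Rightarrow> int \<Rightarrow> real \<Rightarrow> complex" where
  "harmonic a j x = exp (\<i> * of_real (2 * pi * of_int j * x / a))"

lemma continuous_harmonic: "continuous_on S (harmonic a j)"
  unfolding harmonic_def[abs_def] divide_inverse by (intro continuous_intros)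

lemma norm_harmonic [simp]: "norm (harmonic a j x) = 1"
  unfolding harmonic_def by (rule norm_exp_i_times)

lemma has_integral_harmonic:
  assumes "a > 0"
  shows "(harmonic a j has_integral (if j = 0 then of_real a else 0)) {0..a}"
proof (cases "j = 0")
  case True
  then have "harmonic a j = (\<lambda>_. 1)" by (simp add: harmonic_def fun_eq_iff)
  then show ?thesis using has_integral_const_real[of "1::complex" 0 a] assms True by (simp add: scaleR_conv_of_real)
next
  case False
  define c where "c = \<i> * of_real (2 * pi * of_int j / a)"
  have c: "c \<noteq> 0" using False assms by (simp add: c_def)
  have h: "harmonic a j x = exp (c * of_real x)" for x by (simp add: harmonic_def c_def mult.assoc)
  have "(harmonic a j has_integral exp (c * of_real a) / c - exp (c * of_real 0) / c) {0..a}"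
  proof (rule fundamental_theorem_of_calculus)
    fix x :: real
    have "((\<lambda>z. exp (c * z) / c) has_field_derivative exp (c * of_real x)) (at (of_real x))"
      using c by (auto intro!: derivative_eq_intros)
    from has_vector_derivative_real_field[OF this]
    show "((\<lambda>x. exp (c * of_real x) / c) has_vector_derivative harmonic a j x) (at x within {0..a})"
      unfolding h by (rule has_vector_derivative_at_within)
  qed (use assms in simp)
  moreover have "exp (c * of_real a) = 1"
  proof -
    have "c * of_real a = 2 * of_int j * of_real pi * \<i>" using assms by (simp add: c_def)
    then show ?thesis using exp_integer_2pi[of "of_int j"] by (simp add: mult_ac)
  qed
  ultimately show ?thesis using False by simp
qed

context grating
begin

text \<open>
  The phases in \<open>x\<close> of two Floquet harmonics differ by a multiple of \<open>2\<pi>x/a\<close>.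
\<close>

lemma mode_product:
  "exp (- \<i> * k * of_real x * (psi a k \<theta> m)\<^sup>2 / 2 + w) * plane_wave k (psi a k \<theta> n) x y
     = harmonic a (n - m) x * exp (w - \<i> * k * psi a k \<theta> n * of_real y)"
proof -
  let ?m = "psi a k \<theta> m" and ?n = "psi a k \<theta> n"
  have "k * ?n\<^sup>2 - k * ?m\<^sup>2 = of_real (4 * pi * of_int (n - m) / a)"
    unfolding k_psi_squared by (simp add: diff_divide_distrib algebra_simps)
  moreover have "\<i> * of_real x / 2 * of_real r = \<i> * of_real (x / 2 * r)" for r by simp
  moreover have "x / 2 * (4 * pi * of_int (n - m) / a) = 2 * pi * of_int (n - m) * x / a" by (simp add: mult.commute)
  ultimately have "\<i> * of_real x / 2 * (k * ?n\<^sup>2 - k * ?m\<^sup>2) = \<i> * of_real (2 * pi * of_int (n - m) * x / a)"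
    by (simp only:)
  moreover have "(- \<i> * k * of_real x * ?m\<^sup>2 / 2 + w) + (\<i> * k * of_real x * ?n\<^sup>2 / 2 - \<i> * k * ?n * of_real y)
      = \<i> * of_real x / 2 * (k * ?n\<^sup>2 - k * ?m\<^sup>2) + (w - \<i> * k * ?n * of_real y)"
    by (simp add: algebra_simps)
  ultimately show ?thesis unfolding plane_wave_def harmonic_def exp_add[symmetric] by (simp only:)
qed

end

locale diffraction_coefficients = diffraction +
  fixes R :: "nat \<Rightarrow> int \<Rightarrow> complex"
  assumes coefficients: "floquet_coefficients a b k \<theta> u R"
begin

text \<open>
  For \<open>\<sigma> = 1\<close> the combination is continuous across the cuts, for \<open>\<sigma> = -1\<close> it changes sign.
\<close>

definition comb :: "complex \<Rightarrow> real \<Rightarrow> real \<Rightarrow> complex" where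
  "comb \<sigma> x y = u x y 1 + \<sigma> * u x y 2"

lemma Im_k\<psi>: "Im (k * psi a k \<theta> n) > 0" by (rule Im_k_psi[OF k\<theta>2 psi_nonzero])

lemma k\<psi>2: "k * (psi a k \<theta> n)\<^sup>2 \<in> \<real>" by (rule k_psi_squared_real[OF k\<theta>2])

lemma psi_zero: "psi a k \<theta> 0 = \<theta>" by (rule psi_0[OF Re_\<theta> Im_k\<theta>])

text \<open>
  The Floquet expansion converges absolutely at \<open>x = 0\<close> and the moduli of its terms do not depend on \<open>x\<close>, so it
  may be integrated term by term. The incident wave meets only the harmonic with the same angle.
\<close>

lemma comb_fourier:
  assumes y: "y > 0"
  shows "((\<lambda>x. comb \<sigma> x y * plane_wave k (psi a k \<theta> n) x y) has_integral
    of_real a * (R 1 n + \<sigma> * R 2 n + (if n = 0 then exp (- (2 * \<i> * k * \<theta>) * of_real y) else 0))) {0..a}"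
proof -
  let ?P = "plane_wave k (psi a k \<theta> n)"
  define c where "c = (\<lambda>m. (R 1 m + \<sigma> * R 2 m) * exp (\<i> * k * psi a k \<theta> m * of_real y - \<i> * k * psi a k \<theta> n * of_real y))"
  define S where "S = (\<lambda>x. (comb \<sigma> x y - u_in k \<theta> x y) * ?P x y)"
  define T where "T = (\<lambda>m x. c m * harmonic a (n - m) x)"
  have sum: "((\<lambda>m. T m x) has_sum S x) UNIV" for x
  proof -
    define e where "e = (\<lambda>m. exp (- \<i> * k * of_real x * (psi a k \<theta> m)\<^sup>2 / 2 + \<i> * k * psi a k \<theta> m * of_real y))"
    have h: "((\<lambda>m. R \<nu> m * e m) has_sum u_sc a b k \<theta> u x y \<nu>) UNIV" if "\<nu> \<in> {1, 2}" for \<nu>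
      using coefficients that y unfolding floquet_coefficients_def e_def by blast
    have "((\<lambda>m. R 1 m * e m + \<sigma> * (R 2 m * e m)) has_sum u_sc a b k \<theta> u x y 1 + \<sigma> * u_sc a b k \<theta> u x y 2) UNIV"
      by (intro has_sum_add has_sum_cmult_right h) auto
    then have "((\<lambda>m. (R 1 m * e m + \<sigma> * (R 2 m * e m)) * ?P x y) has_sum
        (u_sc a b k \<theta> u x y 1 + \<sigma> * u_sc a b k \<theta> u x y 2) * ?P x y) UNIV"
      by (rule has_sum_cmult_left)
    moreover have "(R 1 m * e m + \<sigma> * (R 2 m * e m)) * ?P x y = T m x" for m
    proof -
      have "(R 1 m * e m + \<sigma> * (R 2 m * e m)) * ?P x y = (R 1 m + \<sigma> * R 2 m) * (e m * ?P x y)" by (simp add: algebra_simps)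
      then show ?thesis unfolding e_def mode_product T_def c_def by (simp add: mult_ac)
    qed
    moreover have "(u_sc a b k \<theta> u x y 1 + \<sigma> * u_sc a b k \<theta> u x y 2) * ?P x y = S x"
      using y by (simp add: S_def u_sc_def unstarred_def comb_def)
    ultimately show ?thesis by simp
  qed
  have "c summable_on UNIV" using has_sum_imp_summable[OF sum[of 0]] by (simp add: T_def harmonic_def)
  then have M: "(\<lambda>m. norm (c m)) summable_on UNIV" by (simp add: summable_on_iff_abs_summable_on_complex)
  have "uniform_limit {0..a} (\<lambda>X x. \<Sum>m\<in>X. T m x) S (finite_subsets_at_top UNIV)"
    by (rule Weierstrass_m_test_general'[OF _ sum M]) (simp add: T_def norm_mult)
  moreover have "continuous_on {0..a} (\<lambda>x. \<Sum>m\<in>X. T m x)" for X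
    unfolding T_def by (intro continuous_on_sum continuous_on_mult continuous_on_const continuous_harmonic)
  ultimately obtain I J where I: "\<And>X. ((\<lambda>x. \<Sum>m\<in>X. T m x) has_integral I X) {0..a}"
    and J: "(S has_integral J) {0..a}" and lim: "(I \<longlongrightarrow> J) (finite_subsets_at_top UNIV)"
    by (rule uniform_limit_integral) (simp, blast)
  have "I X = c n * of_real a" if X: "finite X" "n \<in> X" for X
  proof -
    have "((\<lambda>x. \<Sum>m\<in>X. T m x) has_integral (\<Sum>m\<in>X. c m * (if n - m = 0 then of_real a else 0))) {0..a}"
      unfolding T_def by (intro has_integral_sum X has_integral_mult_right has_integral_harmonic a_pos)
    from has_integral_unique[OF I this] have "I X = (\<Sum>m\<in>X. c m * (if n - m = 0 then of_real a else 0))" .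
    also have "\<dots> = (\<Sum>m\<in>X. if m = n then c n * of_real a else 0)" by (intro sum.cong) auto
    finally show ?thesis using X by simp
  qed
  then have "\<forall>\<^sub>F X in finite_subsets_at_top UNIV. I X = c n * of_real a"
    unfolding eventually_finite_subsets_at_top by (intro exI[of _ "{n}"]) auto
  then have "(I \<longlongrightarrow> c n * of_real a) (finite_subsets_at_top UNIV)" by (rule tendsto_eventually)
  from tendsto_unique[OF _ lim this] have "J = c n * of_real a" by simp
  also have "\<dots> = of_real a * (R 1 n + \<sigma> * R 2 n)" by (simp add: c_def)
  finally have S: "(S has_integral of_real a * (R 1 n + \<sigma> * R 2 n)) {0..a}" using J by simp
  have "u_in k \<theta> x y * ?P x y = exp (- \<i> * k * \<theta> * of_real y - \<i> * k * psi a k \<theta> n * of_real y) * harmonic a n x" for x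
    using mode_product[of x \<theta> 0 "- \<i> * k * \<theta> * of_real y" n y] unfolding psi_zero u_in_def by (simp add: mult_ac)
  then have "((\<lambda>x. u_in k \<theta> x y * ?P x y) has_integral
      exp (- \<i> * k * \<theta> * of_real y - \<i> * k * psi a k \<theta> n * of_real y) * (if n = 0 then of_real a else 0)) {0..a}"
    by (simp only:) (intro has_integral_mult_right has_integral_harmonic a_pos)
  also have "exp (- \<i> * k * \<theta> * of_real y - \<i> * k * psi a k \<theta> n * of_real y) * (if n = 0 then of_real a else 0)
      = of_real a * (if n = 0 then exp (- (2 * \<i> * k * \<theta>) * of_real y) else 0)"
    by (simp add: psi_zero algebra_simps)
  finally have "((\<lambda>x. S x + u_in k \<theta> x y * ?P x y) has_integral of_real a * (R 1 n + \<sigma> * R 2 n)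
      + of_real a * (if n = 0 then exp (- (2 * \<i> * k * \<theta>) * of_real y) else 0)) {0..a}"
    by (rule has_integral_add[OF S])
  moreover have "S x + u_in k \<theta> x y * ?P x y = comb \<sigma> x y * ?P x y" for x
    by (simp add: S_def algebra_simps)
  ultimately show ?thesis by (simp add: distrib_left)
qed

section \<open>The flux identity for the Floquet coefficients\<close>

definition comb_y :: "complex \<Rightarrow> real \<Rightarrow> real \<Rightarrow> complex" where
  "comb_y \<sigma> x y = dy (\<lambda>x y. u x y 1) x y + \<sigma> * dy (\<lambda>x y. u x y 2) x y"

definition comb_yy :: "complex \<Rightarrow> real \<Rightarrow> real \<Rightarrow> complex" where
  "comb_yy \<sigma> x y = dy (dy (\<lambda>x y. u x y 1)) x y + \<sigma> * dy (dy (\<lambda>x y. u x y 2)) x y"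

lemma comb_solves: "solves k (sheet_interior a b) (comb \<sigma>) (comb_y \<sigma>) (comb_yy \<sigma>)"
  unfolding comb_def[abs_def] comb_y_def[abs_def] comb_yy_def[abs_def]
  by (intro solves_add solves_cmult solves_interior) auto

text \<open>
  The integrand is \<open>\<partial>\<^sub>y (f P) + 2 i k \<psi> f P\<close> with the plane wave \<open>P\<close>, and the integral of \<open>f P\<close> over a period is
  known for every \<open>y > 0\<close>. For \<open>n = 0\<close> the downgoing incident wave drops out: its share of the two terms cancels.
\<close>

lemma flux_through_line:
  fixes \<sigma> :: complex and n :: int and Y :: real
  defines "f \<equiv> \<lambda>x y. (comb_y \<sigma> x y + \<i> * k * psi a k \<theta> n * comb \<sigma> x y) * plane_wave k (psi a k \<theta> n) x y"
  assumes Y: "Y > 0"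
  shows "continuous_on S (\<lambda>x. f x Y)"
    and "integral {0..a} (\<lambda>x. f x Y) = 2 * \<i> * k * psi a k \<theta> n * of_real a * (R 1 n + \<sigma> * R 2 n)"
proof -
  let ?\<psi> = "psi a k \<theta> n"
  let ?P = "plane_wave k ?\<psi>"
  define \<rho> where "\<rho> = R 1 n + \<sigma> * R 2 n"
  define G where "G = (\<lambda>y x. comb \<sigma> x y * ?P x y)"
  define Gy where "Gy = (\<lambda>y x. comb \<sigma> x y * (- (\<i> * k * ?\<psi>) * ?P x y) + comb_y \<sigma> x y * ?P x y)"
  have sub: "S \<times> {0<..} \<subseteq> sheet_interior a b" for S by (auto simp: sheet_interior_def)
  note cont = solves_continuous[OF solves_subset[OF comb_solves sub]]
  have swap: "continuous_on ({0<..} \<times> S) (\<lambda>z. g (snd z) (fst z))"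
    if "continuous_on (S \<times> {0<..}) (\<lambda>z. g (fst z) (snd z))" for g :: "real \<Rightarrow> real \<Rightarrow> complex" and S
    by (rule continuous_on_compose2[OF that, of _ "\<lambda>z. (snd z, fst z)", simplified]) (auto intro!: continuous_intros)
  have line: "continuous_on S (\<lambda>x. g x y)" if "continuous_on (S \<times> {0<..}) (\<lambda>z. g (fst z) (snd z))" "y > 0"
    for g :: "real \<Rightarrow> real \<Rightarrow> complex" and S y
    by (rule continuous_on_compose2[OF that(1), of _ "\<lambda>x. (x, y)", simplified]) (use that(2) in \<open>auto intro!: continuous_intros\<close>)
  have Gc: "continuous_on S (G y)" "continuous_on S (Gy y)" if "y > 0" for y S
    unfolding G_def Gy_def
    by (intro continuous_intros line[OF cont(1) that] line[OF cont(2) that] continuous_plane_wave)+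
  have f_eq: "f x y = Gy y x + 2 * \<i> * k * ?\<psi> * G y x" for x y
    by (simp add: f_def G_def Gy_def algebra_simps)
  show "continuous_on S (\<lambda>x. f x Y)"
    unfolding f_eq by (intro continuous_intros Gc Y)
  define \<delta> where "\<delta> = (\<lambda>y::real. if n = 0 then exp (- (2 * \<i> * k * \<theta>) * of_real y) else 0)"
  have GI: "integral {0..a} (G y) = of_real a * (\<rho> + \<delta> y)" if "y > 0" for y
    unfolding G_def \<rho>_def \<delta>_def using comb_fourier[OF that, of \<sigma> n] by (rule integral_unique)
  have "((\<lambda>y. integral (cbox 0 a) (G y)) has_vector_derivative integral (cbox 0 a) (Gy Y)) (at Y within {0<..})"
  proof (rule leibniz_rule_vector_derivative)
    fix y x :: real assume y: "y \<in> {0<..}"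
    have "((\<lambda>y. comb \<sigma> x y) has_vector_derivative comb_y \<sigma> x y) (at y)"
      by (rule solvesD(2)[OF comb_solves]) (use y in \<open>simp add: sheet_interior_def\<close>)
    from has_vector_derivative_mult[OF this plane_wave_derivatives(2)[OF k_nonzero]]
    show "((\<lambda>y. G y x) has_vector_derivative Gy y x) (at y within {0<..})"
      unfolding G_def Gy_def by (rule has_vector_derivative_at_within)
  next
    fix y :: real assume "y \<in> {0<..}"
    then show "G y integrable_on cbox 0 a" using Gc(1) by (intro integrable_continuous) simp
  next
    show "continuous_on ({0<..} \<times> cbox 0 a) (\<lambda>(y, x). Gy y x)"
      unfolding Gy_def case_prod_beta'
      by (intro continuous_intros swap[OF cont(1)] swap[OF cont(2)] continuous_plane_wave)
  qed (use Y in auto)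
  then have "((\<lambda>y. integral {0..a} (G y)) has_vector_derivative integral {0..a} (Gy Y)) (at Y)"
    using Y by (simp add: at_within_open[of Y "{0<..}"])
  then have "((\<lambda>y. of_real a * (\<rho> + \<delta> y)) has_vector_derivative integral {0..a} (Gy Y)) (at Y)"
    by (rule has_vector_derivative_transform_within_open[of _ _ _ "{0<..}"]) (use Y GI in auto)
  moreover have "((\<lambda>y. of_real a * (\<rho> + \<delta> y)) has_vector_derivative of_real a * (0 + - (2 * \<i> * k * \<theta>) * \<delta> Y)) (at Y)"
  proof (intro has_vector_derivative_mult_right has_vector_derivative_add has_vector_derivative_const)
    have "((\<lambda>z. exp (- (2 * \<i> * k * \<theta>) * z)) has_field_derivative - (2 * \<i> * k * \<theta>) * exp (- (2 * \<i> * k * \<theta>) * of_real Y)) (at (of_real Y))"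
      by (auto intro!: derivative_eq_intros)
    from has_vector_derivative_real_field[OF this]
    show "(\<delta> has_vector_derivative - (2 * \<i> * k * \<theta>) * \<delta> Y) (at Y)"
      by (cases "n = 0") (simp_all add: \<delta>_def[abs_def])
  qed
  ultimately have "integral {0..a} (Gy Y) = of_real a * (0 + - (2 * \<i> * k * \<theta>) * \<delta> Y)"
    by (rule vector_derivative_unique_at)
  moreover have "integral {0..a} (\<lambda>x. f x Y) = integral {0..a} (Gy Y) + 2 * \<i> * k * ?\<psi> * integral {0..a} (G Y)"
    unfolding f_eq
    by (subst integral_add) (auto intro!: integrable_continuous_real continuous_intros Gc Y)
  moreover have "?\<psi> * \<delta> Y = \<theta> * \<delta> Y" by (simp add: \<delta>_def psi_zero)
  ultimately have "integral {0..a} (\<lambda>x. f x Y)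
      = of_real a * (0 + - (2 * \<i> * k * \<theta>) * \<delta> Y) + 2 * \<i> * k * ?\<psi> * (of_real a * (\<rho> + \<delta> Y))" and e: "?\<psi> * \<delta> Y = \<theta> * \<delta> Y"
    unfolding GI[OF Y] by (simp_all only:)
  then have "integral {0..a} (\<lambda>x. f x Y)
      = of_real a * (0 + - (2 * \<i> * k * \<theta>) * \<delta> Y) + 2 * \<i> * k * ?\<psi> * (of_real a * (\<rho> + \<delta> Y))" by (simp only:)
  also have "\<dots> = 2 * \<i> * k * ?\<psi> * of_real a * \<rho> + 2 * \<i> * k * of_real a * (?\<psi> * \<delta> Y - \<theta> * \<delta> Y)"
    by (simp add: algebra_simps)
  also have "?\<psi> * \<delta> Y - \<theta> * \<delta> Y = 0" by (simp only: e diff_self)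
  finally show "integral {0..a} (\<lambda>x. f x Y) = 2 * \<i> * k * ?\<psi> * of_real a * (R 1 n + \<sigma> * R 2 n)"
    by (simp add: \<rho>_def)
qed

lemma not_branch: "y \<noteq> 0 \<Longrightarrow> \<not> branch x y" "node m < x \<Longrightarrow> x < node (m + 1) \<Longrightarrow> \<not> branch x y"
  using slab_not_node[of m x] by (auto simp: branch_def)

lemma comb_bounded:
  assumes "norm \<sigma> = 1"
  obtains C where "C \<ge> 0" "\<And>x y. y \<le> 1 \<Longrightarrow> \<not> branch x y \<Longrightarrow> norm (comb \<sigma> x y) \<le> C"
proof -
  obtain B where B: "B \<ge> 0" "\<And>x y \<nu>. \<nu> \<in> {1, 2} \<Longrightarrow> \<not> branch x y \<Longrightarrow> norm (scattered x y \<nu>) \<le> B"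
    by (rule scattered_bounded) (rule that; blast)
  define C where "C = B + exp (Im (k * \<theta>))"
  have "norm (u x y \<nu>) \<le> C" if "\<nu> \<in> {1, 2}" "\<not> branch x y" "y \<le> 1" for x y \<nu>
  proof -
    have "norm (if y > 0 \<and> \<nu> = 1 then u_in k \<theta> x y else 0) \<le> exp (Im (k * \<theta>))"
      using that(3) Im_k\<theta> by (simp add: norm_u_in)
    moreover have "u x y \<nu> = scattered x y \<nu> + (if y > 0 \<and> \<nu> = 1 then u_in k \<theta> x y else 0)" by (simp add: scattered_def)
    ultimately show ?thesis using norm_triangle_ineq B(2)[OF that(1,2)] unfolding C_def by (metis add_mono order_trans)
  qed
  then have "norm (comb \<sigma> x y) \<le> C + C" if "y \<le> 1" "\<not> branch x y" for x y
    unfolding comb_def using that assms by (intro norm_triangle_le add_mono) (auto simp: norm_mult)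
  moreover have "C + C \<ge> 0" using B(1) by (simp add: C_def add_nonneg_nonneg)
  ultimately show thesis using that by blast
qed

lemma comb_measurable: "comb \<sigma> (node m) \<in> borel_measurable borel"
proof -
  have [measurable]: "(\<lambda>y. u (node m) y 1) \<in> borel_measurable borel" "(\<lambda>y. u (node m) y 2) \<in> borel_measurable borel"
    by (rule measurable_node; simp)+
  show ?thesis unfolding comb_def[abs_def] by measurable
qed

lemma comb_right_limit: "y \<noteq> 0 \<Longrightarrow> ((\<lambda>x. comb \<sigma> x y) \<longlongrightarrow> comb \<sigma> (node m) y) (at_right (node m))"
  unfolding comb_def by (intro tendsto_add tendsto_mult_left right_limit) auto

lemma comb_left_limit:
  assumes "y \<noteq> 0" "\<sigma> * \<sigma> = 1"
  shows "((\<lambda>x. comb \<sigma> x y) \<longlongrightarrow> (if y < 0 then \<sigma> else 1) * comb \<sigma> (node m) y) (at_left (node m))"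
proof -
  have "((\<lambda>x. comb \<sigma> x y) \<longlongrightarrow> u (node m) y (if y < 0 then 3 - 1 else 1) + \<sigma> * u (node m) y (if y < 0 then 3 - 2 else 2)) (at_left (node m))"
    unfolding comb_def by (intro tendsto_add tendsto_mult_left left_limit assms) auto
  moreover have "\<sigma> * comb \<sigma> (node m) y = \<sigma> * u (node m) y 1 + (\<sigma> * \<sigma>) * u (node m) y 2"
    by (simp add: comb_def algebra_simps)
  ultimately show ?thesis by (cases "y < 0") (simp_all add: assms(2) comb_def add.commute)
qed

lemma comb_floquet: "\<not> branch x y \<Longrightarrow> comb \<sigma> (x + a) y = exp (- \<i> * k * of_real a * \<theta>\<^sup>2 / 2) * comb \<sigma> x y"
  unfolding comb_def using floquet[of 1 x y] floquet[of 2 x y] by (simp add: algebra_simps)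

text \<open>
  The moment of the values just behind the edge \<open>m\<close>.
\<close>

definition lower_moment :: "complex \<Rightarrow> int \<Rightarrow> int \<Rightarrow> complex" where
  "lower_moment \<sigma> n m = (LINT y:{..<0}|lborel. comb \<sigma> (node m) y * plane_wave k (psi a k \<theta> n) (node m) y)"

lemma integrable_below:
  assumes [measurable]: "f0 \<in> borel_measurable borel" and C: "\<And>y. y \<le> 1 \<Longrightarrow> norm (f0 y) \<le> C"
  shows "set_integrable lborel {..1} (\<lambda>y. f0 y * plane_wave k (psi a k \<theta> n) x y)"
proof -
  define \<nu> where "\<nu> = Im (k * psi a k \<theta> n)"
  have \<nu>: "\<nu> > 0" unfolding \<nu>_def by (rule Im_k\<psi>)
  have C0: "C \<ge> 0" using C[of 0] norm_ge_zero[of "f0 0"] by linarith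
  have [measurable]: "plane_wave k (psi a k \<theta> n) x \<in> borel_measurable borel"
    by (intro borel_measurable_continuous_onI continuous_plane_wave continuous_intros)
  show ?thesis unfolding set_integrable_def
  proof (rule Bochner_Integration.integrable_bound)
    show "integrable lborel (\<lambda>y. C * (exp (2 * \<nu>) * exp (- \<nu> * \<bar>y\<bar>)))" by (intro integrable_mult_right integrable_exp_abs \<nu>)
    show "AE y in lborel. norm (indicator {..1} y *\<^sub>R (f0 y * plane_wave k (psi a k \<theta> n) x y)) \<le> norm (C * (exp (2 * \<nu>) * exp (- \<nu> * \<bar>y\<bar>)))"
    proof (rule AE_I2)
      fix y :: real
      have "norm (f0 y * plane_wave k (psi a k \<theta> n) x y) \<le> C * (exp (2 * \<nu>) * exp (- \<nu> * \<bar>y\<bar>))" if "y \<le> 1"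
        unfolding norm_mult
      proof (rule mult_mono)
        have "\<nu> * (y + \<bar>y\<bar>) \<le> \<nu> * 2" using that \<nu> by (intro mult_left_mono) auto
        then show "norm (plane_wave k (psi a k \<theta> n) x y) \<le> exp (2 * \<nu>) * exp (- \<nu> * \<bar>y\<bar>)"
          unfolding norm_plane_wave[OF k\<psi>2] \<nu>_def[symmetric] by (simp add: exp_add[symmetric] algebra_simps)
      qed (use C[OF that] C0 in auto)
      then show "norm (indicator {..1} y *\<^sub>R (f0 y * plane_wave k (psi a k \<theta> n) x y)) \<le> norm (C * (exp (2 * \<nu>) * exp (- \<nu> * \<bar>y\<bar>)))"
        using C0 by (auto simp: indicator_def)
    qed
  qed measurable
qed

lemma set_integral_cong_nonzero:
  fixes f g :: "real \<Rightarrow> complex"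
  assumes "f \<in> borel_measurable borel" "g \<in> borel_measurable borel" "A \<in> sets borel"
    and "\<And>y. y \<noteq> 0 \<Longrightarrow> y \<in> A \<Longrightarrow> f y = g y"
  shows "(LINT y:A|lborel. f y) = (LINT y:A|lborel. g y)"
  unfolding set_lebesgue_integral_def
proof (rule integral_cong_nonzero)
  note [measurable] = assms(1-3)
  show "(\<lambda>y. indicator A y *\<^sub>R f y) \<in> borel_measurable borel" "(\<lambda>y. indicator A y *\<^sub>R g y) \<in> borel_measurable borel"
    by measurable
qed (use assms(4) in \<open>auto simp: indicator_def\<close>)

text \<open>
  The contributions of the slabs of one period telescope by the Floquet property, except for the lower
  half-lines, where the combination is multiplied by \<open>\<sigma>\<close>.
\<close>

theorem flux_identity:
  assumes \<sigma>: "\<sigma> \<in> {1, - 1}"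
  shows "(\<sigma> - 1) * (lower_moment \<sigma> n 0 + lower_moment \<sigma> n 1) = - (psi a k \<theta> n * of_real a * (R 1 n + \<sigma> * R 2 n))"
proof -
  have \<sigma>2: "\<sigma> * \<sigma> = 1" and n\<sigma>: "norm \<sigma> = 1" using \<sigma> by auto
  let ?\<psi> = "psi a k \<theta> n"
  let ?P = "plane_wave k ?\<psi>"
  have [measurable]: "?P x \<in> borel_measurable borel" for x
    by (intro borel_measurable_continuous_onI continuous_plane_wave continuous_intros)
  note [measurable] = comb_measurable
  obtain C where C: "C \<ge> 0" "\<And>x y. y \<le> 1 \<Longrightarrow> \<not> branch x y \<Longrightarrow> norm (comb \<sigma> x y) \<le> C"
    using comb_bounded[OF n\<sigma>] by blast
  define L where "L = (\<lambda>m y. (if y < 0 then \<sigma> else 1) * comb \<sigma> (node m) y)"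
  have [measurable]: "L m \<in> borel_measurable borel" for m unfolding L_def by measurable
  define I where "I = lower_moment \<sigma> n"
  define J where "J = (\<lambda>m. LINT y:{0..1}|lborel. comb \<sigma> (node m) y * ?P (node m) y)"
  have nc: "norm (comb \<sigma> (node m) y) \<le> C + norm (comb \<sigma> (node m) 0)" if "y \<le> 1" for m y
  proof (cases "y = 0")
    case False
    then show ?thesis using C(2)[OF that not_branch(1)[OF False], of "node m"] by (simp add: add_increasing2)
  qed (use C(1) in simp)
  have nL: "norm (L m y) \<le> C + norm (comb \<sigma> (node m) 0)" if "y \<le> 1" for m y
    using nc[OF that, of m] n\<sigma> by (simp add: L_def norm_mult)
  have split: "(LINT y:{..1}|lborel. f y) = (LINT y:{..<0}|lborel. f y) + (LINT y:{0..1}|lborel. f y)"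
    if "set_integrable lborel {..1} f" for f :: "real \<Rightarrow> complex"
  proof -
    have e: "{..1} = {..<0} \<union> {0..(1::real)}" by auto
    show ?thesis unfolding e
      by (rule set_integral_Un) (auto intro: set_integrable_subset[OF that])
  qed
  have I1: "(LINT y:{..1}|lborel. comb \<sigma> (node m) y * ?P (node m) y) = I m + J m" for m
    using split[OF integrable_below[OF comb_measurable nc, where n = n and x = "node m"]] by (simp add: I_def J_def lower_moment_def)
  have I2: "(LINT y:{..1}|lborel. L m y * ?P (node m) y) = \<sigma> * I m + J m" for m
  proof -
    have Lm: "L m \<in> borel_measurable borel" by measurable
    have "(LINT y:{..<0}|lborel. L m y * ?P (node m) y) = (LINT y:{..<0}|lborel. \<sigma> * (comb \<sigma> (node m) y * ?P (node m) y))"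
      by (rule set_lebesgue_integral_cong) (auto simp: L_def)
    also have "\<dots> = \<sigma> * I m" by (simp add: I_def lower_moment_def)
    moreover have "(LINT y:{0..1}|lborel. L m y * ?P (node m) y) = J m"
      unfolding J_def by (rule set_lebesgue_integral_cong) (auto simp: L_def)
    ultimately show ?thesis using split[OF integrable_below[OF Lm nL, where n = n and x = "node m"]] by simp
  qed
  define g where "g = (\<lambda>x. (comb_y \<sigma> x 1 + \<i> * k * ?\<psi> * comb \<sigma> x 1) * ?P x 1)"
  have gc: "continuous_on S g" for S unfolding g_def by (rule flux_through_line(1)) simp
  have slab: "(\<sigma> * I (m + 1) + J (m + 1)) - (I m + J m) = - inverse (2 * \<i> * k) * integral {node m..node (m + 1)} g" for m
    unfolding I1[symmetric] I2[symmetric]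
  proof (rule slab_flux[OF Im_k node_less_Suc solves_subset[OF comb_solves slab_subset] zero_less_one _ k\<psi>2 Im_k\<psi> _ _ _ _ gc])
    show "norm (comb \<sigma> x y) \<le> C" if "node m < x" "x < node (m + 1)" "y \<le> 1" for x y
      using C(2) that not_branch(2) by blast
    show "((\<lambda>x. comb \<sigma> x y) \<longlongrightarrow> L (m + 1) y) (at_left (node (m + 1)))" if "y \<noteq> 0" for y
      unfolding L_def by (rule comb_left_limit[OF that \<sigma>2])
  qed (simp_all add: comb_right_limit g_def)
  have node2: "node 2 = node 0 + a" using node_add2[of 0] by simp
  have per: "comb \<sigma> (node 2) y * ?P (node 2) y = comb \<sigma> (node 0) y * ?P (node 0) y" if "y \<noteq> 0" for y
  proof -
    have "?P (node 2) y = exp (\<i> * k * of_real a * ?\<psi>\<^sup>2 / 2) * ?P (node 0) y"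
      unfolding plane_wave_def node2 by (simp add: exp_add[symmetric] algebra_simps add_divide_distrib)
    then have P: "?P (node 2) y = exp (\<i> * k * of_real a * \<theta>\<^sup>2 / 2) * ?P (node 0) y" unfolding exp_psi .
    have Q: "comb \<sigma> (node 2) y = exp (- \<i> * k * of_real a * \<theta>\<^sup>2 / 2) * comb \<sigma> (node 0) y"
      unfolding node2 by (rule comb_floquet[OF not_branch(1)[OF that]])
    have E: "exp (- \<i> * k * of_real a * \<theta>\<^sup>2 / 2) * exp (\<i> * k * of_real a * \<theta>\<^sup>2 / 2) = 1"
      by (simp add: exp_add[symmetric])
    have "comb \<sigma> (node 2) y * ?P (node 2) y
      = (exp (- \<i> * k * of_real a * \<theta>\<^sup>2 / 2) * exp (\<i> * k * of_real a * \<theta>\<^sup>2 / 2)) * (comb \<sigma> (node 0) y * ?P (node 0) y)"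
      unfolding P Q by (simp only: mult_ac)
    then show ?thesis unfolding E by simp
  qed
  have cm: "(\<lambda>y. comb \<sigma> (node m) y * ?P x y) \<in> borel_measurable borel" for m x by measurable
  have I20: "I 2 = I 0" "J 2 = J 0"
    unfolding I_def lower_moment_def J_def by (intro set_integral_cong_nonzero cm per; simp)+
  have b: "0 \<le> b" "b \<le> a" using b_pos b_less by simp_all
  have "integral {0..b} g + integral {b..a} g = integral {0..a} g"
    by (rule Henstock_Kurzweil_Integration.integral_combine[OF b integrable_continuous_real[OF gc]])
  moreover define \<kappa> where "\<kappa> = - inverse (2 * \<i> * k)"
  have "(\<sigma> - 1) * (I 0 + I 1) = ((\<sigma> * I 1 + J 1) - (I 0 + J 0)) + ((\<sigma> * I 0 + J 0) - (I 1 + J 1))"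
    by (simp add: algebra_simps)
  then have "(\<sigma> - 1) * (I 0 + I 1) = \<kappa> * (integral {0..b} g + integral {b..a} g)"
  proof -
    have "(\<sigma> * I 1 + J 1) - (I 0 + J 0) = \<kappa> * integral {0..b} g"
      using slab[of 0, folded \<kappa>_def] by simp
    moreover have "(\<sigma> * I 0 + J 0) - (I 1 + J 1) = \<kappa> * integral {b..a} g"
      using slab[of 1, folded \<kappa>_def] I20 node2 by simp
    ultimately show ?thesis
      using \<open>(\<sigma> - 1) * (I 0 + I 1) = _\<close> by (simp only: distrib_left)
  qed
  ultimately have "(\<sigma> - 1) * (I 0 + I 1) = - inverse (2 * \<i> * k) * integral {0..a} g"
    by (simp only: \<kappa>_def)
  also have "integral {0..a} g = 2 * \<i> * k * ?\<psi> * of_real a * (R 1 n + \<sigma> * R 2 n)"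
    unfolding g_def by (rule flux_through_line(2)) simp
  finally have "(\<sigma> - 1) * (I 0 + I 1) = - inverse (2 * \<i> * k) * ((2 * \<i> * k) * (?\<psi> * of_real a * (R 1 n + \<sigma> * R 2 n)))"
    by (simp only: mult.assoc)
  moreover have "- inverse c * (c * z) = - z" if "c \<noteq> 0" for c z :: complex using that by simp
  moreover have "2 * \<i> * k \<noteq> 0" using k_nonzero by simp
  ultimately show ?thesis unfolding I_def by (simp only:)
qed

end

section \<open>The antisymmetric part of the field\<close>

context diffraction_coefficients
begin

text \<open>
  Values just behind the edge \<open>m\<close>. At \<open>y = 0\<close> the field is arbitrary; the value \<open>0\<close> agrees there with that of a
  flipped function.
\<close>

definition deviation :: "int \<Rightarrow> real \<Rightarrow> complex" where
  "deviation m y = (if y = 0 then 0 else comb (- 1) (node m) y - u_in k \<theta> (node m) y)"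

text \<open>
  The values in front of the edge \<open>m\<close>, obtained by propagation from the preceding edge.
\<close>

definition reduced :: "int \<Rightarrow> real \<Rightarrow> complex" where
  "reduced m = heat k (width (m - 1)) (deviation (m - 1))"

lemma u_in_solves:
  "solves k UNIV (u_in k \<theta>) (\<lambda>x y. - (\<i> * k * \<theta>) * u_in k \<theta> x y) (\<lambda>x y. - (k\<^sup>2 * \<theta>\<^sup>2) * u_in k \<theta> x y)"
proof -
  have e: "u_in k \<theta> x y = plane_wave k \<theta> (- x) y" for x y by (simp add: u_in_def plane_wave_def)
  show ?thesis unfolding e
  proof (rule solvesI)
    fix x y :: real
    have "((\<lambda>x. plane_wave k \<theta> x y) \<circ> uminus has_vector_derivative (- 1) *\<^sub>R (inverse (2 * \<i> * k) * (- (k\<^sup>2 * \<theta>\<^sup>2) * plane_wave k \<theta> (- x) y))) (at x)"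
    proof (rule vector_diff_chain_at)
      show "(uminus has_vector_derivative (- 1 :: real)) (at x)"
        by (auto intro!: derivative_eq_intros simp: has_real_derivative_iff_has_vector_derivative[symmetric])
    qed (rule plane_wave_derivatives(1)[OF k_nonzero])
    then show "((\<lambda>s. plane_wave k \<theta> (- s) y) has_vector_derivative - inverse (2 * \<i> * k) * (- (k\<^sup>2 * \<theta>\<^sup>2) * plane_wave k \<theta> (- x) y)) (at x)"
      by (simp add: o_def)
    show "((\<lambda>t. plane_wave k \<theta> (- x) t) has_vector_derivative - (\<i> * k * \<theta>) * plane_wave k \<theta> (- x) y) (at y)"
      by (rule plane_wave_derivatives(2)[OF k_nonzero])
    show "((\<lambda>t. - (\<i> * k * \<theta>) * plane_wave k \<theta> (- x) t) has_vector_derivative - (k\<^sup>2 * \<theta>\<^sup>2) * plane_wave k \<theta> (- x) y) (at y)"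
      by (rule plane_wave_derivatives(3)[OF k_nonzero])
  qed (intro continuous_intros continuous_plane_wave)+
qed

lemma continuous_u_in: "continuous_on S (\<lambda>x. u_in k \<theta> x y)" "continuous_on S (\<lambda>y. u_in k \<theta> x y)"
  unfolding u_in_def divide_inverse by (intro continuous_intros)+

text \<open>
  For \<open>y > 0\<close> subtracting the incident wave removes its exponential growth, for \<open>y \<le> 0\<close> it is bounded by one.
\<close>

lemma antisymmetric_bounded:
  obtains B where "B \<ge> 0" "\<And>x y. \<not> branch x y \<Longrightarrow> norm (comb (- 1) x y - u_in k \<theta> x y) \<le> B"
proof -
  obtain B where B: "B \<ge> 0" "\<And>x y \<nu>. \<nu> \<in> {1, 2} \<Longrightarrow> \<not> branch x y \<Longrightarrow> norm (scattered x y \<nu>) \<le> B"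
    by (rule scattered_bounded) (rule that; blast)
  have "norm (comb (- 1) x y - u_in k \<theta> x y) \<le> B + B + 1" if nb: "\<not> branch x y" for x y
  proof -
    define r where "r = (if y > 0 then 0 else u_in k \<theta> x y)"
    have r: "norm r \<le> 1" using Im_k\<theta> by (simp add: r_def norm_u_in mult_nonneg_nonpos)
    have "comb (- 1) x y - u_in k \<theta> x y = (scattered x y 1 - scattered x y 2) - r"
      by (simp add: comb_def scattered_def r_def)
    also have "norm \<dots> \<le> (B + B) + 1"
      by (intro order_trans[OF norm_triangle_ineq4] add_mono B nb r) auto
    finally show ?thesis .
  qed
  moreover have "B + B + 1 \<ge> 0" using B(1) by simp
  ultimately show thesis using that by blast
qed

lemma deviation_measurable: "deviation m \<in> borel_measurable borel"
proof -
  have [measurable]: "(\<lambda>y. u_in k \<theta> (node m) y) \<in> borel_measurable borel"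
    by (intro borel_measurable_continuous_onI continuous_u_in)
  note [measurable] = comb_measurable
  show ?thesis unfolding deviation_def[abs_def] by measurable
qed

lemma deviation_bounded: "bounded_measurable (deviation m)"
proof -
  obtain B where B: "B \<ge> 0" "\<And>x y. \<not> branch x y \<Longrightarrow> norm (comb (- 1) x y - u_in k \<theta> x y) \<le> B"
    by (rule antisymmetric_bounded) (rule that; blast)
  have "norm (deviation m y) \<le> B" for y using B(1) B(2)[OF not_branch(1)] by (simp add: deviation_def)
  then show ?thesis unfolding bounded_measurable_def using deviation_measurable by blast
qed

text \<open>
  The incident wave is smooth across the cuts while the difference of the sheets changes sign below the
  branch point, so the value in front of the edge is the flipped value behind it, minus the incident wave.
\<close>

lemma comb_node:
  assumes y: "y \<noteq> 0"
  shows "(if y < 0 then - 1 else 1) * comb (- 1) (node m) y - u_in k \<theta> (node m) y = reduced m y"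
proof -
  obtain B where B: "B \<ge> 0" "\<And>x y. \<not> branch x y \<Longrightarrow> norm (comb (- 1) x y - u_in k \<theta> x y) \<le> B"
    by (rule antisymmetric_bounded) (rule that; blast)
  define p where "p = node (m - 1)"
  have pq: "p < node m" unfolding p_def by (rule node_bracket)
  have sub: "{p<..<node m} \<times> UNIV \<subseteq> sheet_interior a b" using slab_subset[of "m - 1"] by (simp add: p_def)
  note sol = solves_add[OF solves_subset[OF comb_solves[of "- 1"] sub] solves_cmult[OF solves_subset[OF u_in_solves, of "{p<..<node m} \<times> UNIV"], of "- 1"], OF subset_UNIV]
  have uc: "((\<lambda>x. u_in k \<theta> x t) \<longlongrightarrow> u_in k \<theta> x t) (at x within S)" for x t S
    using continuous_u_in(1)[of UNIV t] by (auto simp: continuous_on_eq_continuous_at isCont_def intro: tendsto_within_subset)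
  have "(if y < 0 then - 1 else 1) * comb (- 1) (node m) y + - 1 * u_in k \<theta> (node m) y = heat k (node m - p) (deviation (m - 1)) y"
  proof (rule slab_representation[OF Im_k pq sol])
    show "norm (comb (- 1) x y + - 1 * u_in k \<theta> x y) \<le> B" if "p < x" "x < node m" for x y
      using B(2)[OF not_branch(2)[of "m - 1" x y]] that by (simp add: p_def)
    show "((\<lambda>x. comb (- 1) x t + - 1 * u_in k \<theta> x t) \<longlongrightarrow> deviation (m - 1) t) (at_right p)" if "t \<noteq> 0" for t
    proof -
      have "((\<lambda>x. comb (- 1) x t + - 1 * u_in k \<theta> x t) \<longlongrightarrow> comb (- 1) p t + - 1 * u_in k \<theta> p t) (at_right p)"
        unfolding p_def by (intro tendsto_add tendsto_mult_left uc comb_right_limit that)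
      then show ?thesis using that by (simp add: deviation_def p_def)
    qed
    show "((\<lambda>x. comb (- 1) x y + - 1 * u_in k \<theta> x y) \<longlongrightarrow>
        (if y < 0 then - 1 else 1) * comb (- 1) (node m) y + - 1 * u_in k \<theta> (node m) y) (at_left (node m))"
      by (intro tendsto_add tendsto_mult_left uc comb_left_limit y) simp
  qed (rule deviation_measurable)
  moreover have "node m - p = width (m - 1)" using node_Suc[of "m - 1"] by (simp add: p_def)
  ultimately show ?thesis by (simp add: reduced_def)
qed

lemma u_in_phase: "u_in k \<theta> x y = exp (- \<i> * k * of_real x * \<theta>\<^sup>2 / 2) * exp (- \<i> * (k * \<theta>) * of_real y)"
  unfolding u_in_def by (simp add: exp_add[symmetric] mult.assoc)

lemma deviation_eq:
  "deviation m y = flip (reduced m) y - 2 * (exp (- \<i> * k * of_real (node m) * \<theta>\<^sup>2 / 2) * half_wave (k * \<theta>) y)"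
proof (cases "y = 0")
  case True then show ?thesis by (simp add: deviation_def flip_def half_wave_def)
next
  case False
  define e where "e = u_in k \<theta> (node m) y"
  have "exp (- \<i> * k * of_real (node m) * \<theta>\<^sup>2 / 2) * half_wave (k * \<theta>) y = (if y < 0 then e else 0)"
    by (simp add: e_def u_in_phase half_wave_def)
  moreover have "flip (reduced m) y = of_real (sgn y) * ((if y < 0 then - 1 else 1) * comb (- 1) (node m) y - e)"
    unfolding flip_def comb_node[OF False, symmetric] e_def ..
  ultimately show ?thesis using False unfolding deviation_def e_def[symmetric]
    by (cases "y < 0") (simp_all add: algebra_simps)
qed

lemma deviation_floquet: "deviation (m + 2) y = exp (- \<i> * k * of_real a * \<theta>\<^sup>2 / 2) * deviation m y"
proof (cases "y = 0")
  case False
  have "u_in k \<theta> (node m + a) y = exp (- \<i> * k * of_real a * \<theta>\<^sup>2 / 2) * u_in k \<theta> (node m) y"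
    unfolding u_in_def exp_add[symmetric] by (simp add: algebra_simps add_divide_distrib diff_divide_distrib)
  then show ?thesis
    using False comb_floquet[OF not_branch(1)[OF False], of "- 1" "node m"]
    by (simp add: deviation_def node_add2 algebra_simps)
qed (simp add: deviation_def)

sublocale reduced_problem a b k \<theta> reduced
proof
  show "exp (\<i> * k * of_real a * \<theta>\<^sup>2 / 2) \<noteq> 1" by (rule nonresonant_if_psi_nonzero[OF k\<theta>2 psi_nonzero])
  show "bounded_measurable (reduced m)" for m
    unfolding reduced_def by (rule bounded_measurable_heat[OF Im_k width_pos deviation_bounded])
  show "reduced (m + 1) = heat k (width m) (\<lambda>y. flip (reduced m) y - 2 * (exp (- \<i> * k * of_real (node m) * \<theta>\<^sup>2 / 2) * half_wave (k * \<theta>) y))" for m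
    unfolding deviation_eq[symmetric] by (simp add: reduced_def)
  show "reduced (m + 2) y = exp (- \<i> * k * of_real a * \<theta>\<^sup>2 / 2) * reduced m y" for m y
  proof -
    have e: "m + 2 - 1 = (m - 1) + 2" by simp
    have w: "width (m - 1 + 2) = width (m - 1)" by (rule width_cong) simp
    have d: "deviation (m - 1 + 2) = (\<lambda>y. exp (- \<i> * k * of_real a * \<theta>\<^sup>2 / 2) * deviation (m - 1) y)" by (rule ext, rule deviation_floquet)
    show ?thesis unfolding reduced_def e w d by (rule heat_cmult)
  qed
qed (rule k\<theta>2, rule Im_k\<theta>)

lemma lower_moment_shadow:
  "lower_moment (- 1) n m = - (exp (\<i> * k * of_real (node m) * (psi a k \<theta> n)\<^sup>2 / 2) * shadow (psi a k \<theta> n) m)"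
proof -
  let ?\<psi> = "psi a k \<theta> n"
  define E where "E = exp (\<i> * k * of_real (node m) * ?\<psi>\<^sup>2 / 2)"
  have "indicator {..<0} y *\<^sub>R (comb (- 1) (node m) y * plane_wave k ?\<psi> (node m) y)
     = - E * (half_wave (k * ?\<psi>) y * (phase (node m) * exp (- \<i> * (k * \<theta>) * of_real y) + reduced m y))" for y
  proof (cases "y < 0")
    case True
    have "plane_wave k ?\<psi> (node m) y = E * half_wave (k * ?\<psi>) y"
      unfolding plane_wave_def E_def half_wave_def using True by (simp add: exp_add[symmetric] mult.assoc)
    moreover have "comb (- 1) (node m) y = - (phase (node m) * exp (- \<i> * (k * \<theta>) * of_real y) + reduced m y)"
    proof -
      have "- comb (- 1) (node m) y - phase (node m) * exp (- \<i> * (k * \<theta>) * of_real y) = reduced m y"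
        using comb_node[of y m] True unfolding u_in_phase phase_def[symmetric] by simp
      moreover have "c = - (U + r)" if "- c - U = r" for c U r :: complex unfolding that[symmetric] by simp
      ultimately show ?thesis by blast
    qed
    ultimately have "comb (- 1) (node m) y * plane_wave k ?\<psi> (node m) y
        = - E * (half_wave (k * ?\<psi>) y * (phase (node m) * exp (- \<i> * (k * \<theta>) * of_real y) + reduced m y))"
      by (simp only: mult_minus_left mult_minus_right mult_ac)
    then show ?thesis using True by simp
  qed (simp add: half_wave_def)
  then show ?thesis
    unfolding lower_moment_def set_lebesgue_integral_def E_def[symmetric]
      shadow_def[OF k\<psi>2[of n] Im_k\<psi>[of n] exp_psi[of \<theta> n, folded \<mu>_def]] by simp
qed

text \<open>
  The sum of the two sheets does not see the cuts: a plane wave passes without reflection.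
\<close>

lemma symmetric_part_trivial: "R 2 n = - R 1 n"
proof -
  have "psi a k \<theta> n * of_real a * (R 1 n + R 2 n) = 0" using flux_identity[of 1 n] by simp
  then have "R 1 n + R 2 n = 0" using psi_nonzero[of n] a_pos by simp
  then show ?thesis by (simp add: add_eq_0_iff)
qed

text \<open>
  For \<open>\<sigma> = -1\<close> the flux identity expresses the coefficient by the two shadows of a period.
\<close>

theorem reflection_coefficient:
  "R 1 n = (directivity a b k 0 (psi a k \<theta> n) * directivity a b k 1 \<theta>
       + directivity a b k 1 (psi a k \<theta> n) * directivity a b k 0 \<theta>
         * exp (\<i> * k * of_real b * ((psi a k \<theta> n)\<^sup>2 - \<theta>\<^sup>2) / 2))
      / (\<i> * k * of_real a * psi a k \<theta> n * (psi a k \<theta> n + \<theta>))"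
proof -
  let ?\<psi> = "psi a k \<theta> n"
  define S where "S = shadow ?\<psi> 0 + exp (\<i> * k * of_real b * ?\<psi>\<^sup>2 / 2) * shadow ?\<psi> 1"
  have "lower_moment (- 1) n 0 + lower_moment (- 1) n 1 = - S"
    by (simp add: lower_moment_shadow S_def)
  moreover have "(- 1 - 1) * (lower_moment (- 1) n 0 + lower_moment (- 1) n 1) = - (?\<psi> * of_real a * (R 1 n + - 1 * R 2 n))"
    by (rule flux_identity) simp
  ultimately have "(- 1 - 1) * (- S) = - (?\<psi> * of_real a * (R 1 n + - 1 * R 2 n))" by (simp only:)
  moreover have "(- 1 - 1) * (- S) = 2 * S" "R 1 n + - 1 * R 2 n = 2 * R 1 n"
    unfolding symmetric_part_trivial by simp_all
  moreover have "- s = p * r" if "2 * s = - (p * (2 * r))" for s p r :: complex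
  proof -
    have "2 * s = 2 * (- (p * r))" using that by simp
    then have "s = - (p * r)" by (subst (asm) mult_cancel_left) simp
    then show ?thesis by simp
  qed
  ultimately have S: "- S = ?\<psi> * of_real a * R 1 n" by (simp only:)
  have "\<i> * k * (?\<psi> + \<theta>) * (- S) = directivity a b k 0 ?\<psi> * directivity a b k 1 \<theta>
       + directivity a b k 1 ?\<psi> * directivity a b k 0 \<theta> * exp (\<i> * k * of_real b * (?\<psi>\<^sup>2 - \<theta>\<^sup>2) / 2)"
    using amplitude_formula[OF k\<psi>2[of n] Im_k\<psi>[of n] exp_psi[of \<theta> n, folded \<mu>_def]]
    unfolding S_def by (simp only: mult_minus_left mult_minus_right)
  then have "R 1 n * (\<i> * k * of_real a * ?\<psi> * (?\<psi> + \<theta>)) = directivity a b k 0 ?\<psi> * directivity a b k 1 \<theta>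
       + directivity a b k 1 ?\<psi> * directivity a b k 0 \<theta> * exp (\<i> * k * of_real b * (?\<psi>\<^sup>2 - \<theta>\<^sup>2) / 2)"
    unfolding S by (simp only: mult_ac)
  moreover have "Im (k * (?\<psi> + \<theta>)) > 0"
    unfolding distrib_left plus_complex.sel using Im_k\<psi>[of n] Im_k\<theta> by (rule add_pos_pos)
  then have "?\<psi> + \<theta> \<noteq> 0" by (metis mult_zero_right order_less_irrefl zero_complex.sel(2))
  then have "\<i> * k * of_real a * ?\<psi> * (?\<psi> + \<theta>) \<noteq> 0" using k_nonzero a_pos psi_nonzero[of n] by simp
  ultimately show ?thesis by (simp add: eq_divide_eq)
qed

end

theorem proposition4:
  fixes a b :: real and k \<theta> :: complex
    and u :: field and R :: "nat \<Rightarrow> int \<Rightarrow> complex"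
  assumes "0 < b" and "b < a"
    and "Re k > 0" and "Im k > 0"
    and "Re \<theta> > 0" and "k * \<theta>\<^sup>2 \<in> \<real>" and "Re (k * \<theta>\<^sup>2) > 0"
    and "\<forall>n. psi a k \<theta> n \<noteq> 0"
    and "diffraction_solution a b k \<theta> u"
    and "floquet_coefficients a b k \<theta> u R"
  shows "\<forall>n. R 1 n =
      (directivity a b k 0 (psi a k \<theta> n) * directivity a b k 1 \<theta>
       + directivity a b k 1 (psi a k \<theta> n) * directivity a b k 0 \<theta>
         * exp (\<i> * k * of_real b * ((psi a k \<theta> n)\<^sup>2 - \<theta>\<^sup>2) / 2))
      / (\<i> * k * of_real a * psi a k \<theta> n * (psi a k \<theta> n + \<theta>))
    \<and> R 2 n = - R 1 n"
proof -
  interpret diffraction_coefficients a b k \<theta> u R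
    using assms by unfold_locales auto
  show ?thesis using reflection_coefficient symmetric_part_trivial by blast
qed

end
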